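(* Let $h:\mathbb{R}^{k-1}\to\mathbb{R}^{k}$ be a standard map defining a wave-front singularity of type $A_k$ ($k\ge2$), $D_k$ ($k\ge 4$, either sign), or $E_k$ ($k=6,7,8$). Then there exist explicit polynomials $A^{\mathbf{x}}(v)$ and $B^{\mathbf{x}}(v)$ in one variable $v$, depending polynomially on $\mathbf{x}\in\mathbb{R}^k$, and a polynomial $r(\mathbf{x})\in\mathbb{R}[\mathbf{x}]$ (namely those listed in the context), such that $$\Theta(\mathbf{x})=\frac{\operatorname{Res}_v\bigl(A^{\mathbf{x}}(v),B^{\mathbf{x}}(v)\bigr)}{r(\mathbf{x})^2}$$ is a polynomial in $\mathbb{R}[\mathbf{x}]$ and is a main-analytic function of $h(\mathbb{R}^{k-1})$ in $\mathbb{R}^k$. Moreover, $\Theta$ agrees with the discriminant polynomial $\Delta_S$ up to a nonzero scalar.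
   Context: A subset $S\subset\mathbb{R}^n$ is a global main-analytic set if there is a real-analytic function $\Theta:\mathbb{R}^n\to\mathbb{R}$ with real zero set $\mathcal{Z}(\Theta)\supset S$, $\dim_H\mathcal{Z}(\Theta)=\dim_H S$ and $\dim_H(\mathcal{Z}(\Theta)\setminus S)<\dim_H S$ ($\dim_H$ = Hausdorff dimension); such $\Theta$ is called a main-analytic function of $S$. The discriminant polynomial $\Delta_S$ is the squarefree polynomial (unique up to a nonzero scalar) whose complex zero set is $h^{\mathbb{C}}(\mathbb{C}^{k-1})\subset\mathbb{C}^k$, where $h^{\mathbb{C}}$ is the complexification of $h$. Coordinates on the target are $\mathbf{x}=(x_0,\dots,x_{k-1})$. $\operatorname{Res}_v$ is the resultant of two elements of $\mathbb{R}[\mathbf{x}][v]$ (determinant of the Sylvester matrix), and a prime denotes $d/dv$. Standard maps: - $A_k$: $h(v,x_2,\dots,x_{k-1})=\bigl(kv^{k+1}+\sum_{i=2}^{k-1}(i-1)x_iv^i,\ -(k+1)v^k-\sum_{i=2}^{k-1}ix_iv^{i-1},\ x_2,\dots,x_{k-1}\bigr)$. - $D_k$: $h(u,v,x_3,\dots,x_{k-1})=(h_0,h_1,h_2,x_3,\dots,x_{k-1})$, where, for a fixed choice of sign, $h_0=\pm2u^2v+(k-2)v^{k-1}+\sum_{i=3}^{k-1}(i-2)x_iv^{i-1}$, $h_1=\mp2uv$, $h_2=\mp u^2-(k-1)v^{k-2}-\sum_{i=3}^{k-1}(i-1)x_iv^{i-2}$. - $E_6$: $h(u,v,x_3,x_4,x_5)=(2u^3+3v^4+x_3v^2+uv\delta,\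 -3u^2-x_4v-x_5v^2,\ -4v^3-2x_3v-u\delta,\ x_3,x_4,x_5)$ with $\delta=2x_5v+x_4$. - $E_7$: $h(u,v,x_3,\dots,x_6)=(2u^3+x_3v^2+2x_4v^3+uv\delta,\ -3u^2-v^3-x_5v-x_6v^2,\ -2x_3v-3x_4v^2-u\delta,\ x_3,\dots,x_6)$ with $\delta=3v^2+2x_6v+x_5$. - $E_8$: $h(u,v,x_3,\dots,x_7)=(2u^3+4v^5+x_3v^2+2x_4v^3+uv\delta,\ -3u^2-x_5v-x_6v^2-x_7v^3,\ -5v^4-2x_3v-3x_4v^2-u\delta,\ x_3,\dots,x_7)$ with $\delta=3x_7v^2+2x_6v+x_5$. Polynomials $A^{\mathbf{x}},B^{\mathbf{x}},r$: - $A_k$: $A^{\mathbf{x}}(v)=v^{k+1}+x_{k-1}v^{k-1}+\cdots+x_1v+x_0$, $B^{\mathbf{x}}=(A^{\mathbf{x}})'$, $r=1$. - $D_k$: $A^{\mathbf{x}}(v)=v^k+x_{k-1}v^{k-1}+\cdots+x_2v^2+x_0v\mp\frac14x_1^2$ (sign matching that of $h$), $B^{\mathbf{x}}=(A^{\mathbf{x}})'$, $r=1$. - $E_6,E_7,E_8$: $A^{\mathbf{x}}=3(Q')^2+(P')^2P$ and $B^{\mathbf{x}}=2Q'P-3P'Q$ (polynomials in $v$), where $E_6$: $P=x_5v^2+x_4v+x_1$, $Q=v^4+x_3v^2+x_2v+x_0$, $r=x_4^3+2x_3x_4x_5^2-2x_2x_5^3$; $E_7$: $P=v^3+x_6v^2+x_5v+x_1$,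 $Q=x_4v^3+x_3v^2+x_2v+x_0$, $r=3x_2^2+(-6x_4x_5-4x_3x_6+4x_4x_6^2)x_2+x_5(4x_3^2+3x_4^2x_5-4x_3x_4x_6)$; $E_8$: $P=x_7v^3+x_6v^2+x_5v+x_1$, $Q=v^5+x_4v^3+x_3v^2+x_2v+x_0$, $r=\operatorname{Res}_v(5v^4+3x_4v^2+2x_3v+x_2,\ 3x_7v^2+2x_6v+x_5)$. *)

theory Defs
  imports
    "HOL-Analysis.Analysis"
    "HOL-Library.Poly_Mapping"
    "HOL-Computational_Algebra.Squarefree"
    "Subresultants.Resultant_Prelim"
begin

section \<open>Coordinate spaces and multivariate polynomials\<close>

text \<open>
  The dimension varies inside the statements below, so points of \<open>K\<^sup>n\<close> are functions on the
  natural numbers vanishing from index \<open>n\<close> on, as in \<^const>\<open>Euclidean_space\<close>.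
\<close>

definition coord_space :: "nat \<Rightarrow> (nat \<Rightarrow> 'a::zero) set" where
  "coord_space n = {x. \<forall>i\<ge>n. x i = 0}"

text \<open>
  Polynomials in the countably many variables \<open>x\<^sub>0, x\<^sub>1, \<dots>\<close>, as finitely supported maps from
  exponent vectors to coefficients; \<open>mpolys n\<close> is the subring \<open>K[x\<^sub>0, \<dots>, x\<^sub>n\<^sub>-\<^sub>1]\<close>. Every divisor of
  a nonzero element of this subring lies in it, so \<^const>\<open>squarefree\<close> has the same meaning in
  the big ring and in the subring.
\<close>

type_synonym 'a mpol = "(nat \<Rightarrow>\<^sub>0 nat) \<Rightarrow>\<^sub>0 'a"

definition mpolys :: "nat \<Rightarrow> 'a::zero mpol set" where
  "mpolys n = {p. \<forall>\<alpha>\<in>Poly_Mapping.keys p. Poly_Mapping.keys \<alpha> \<subseteq> {..<n}}"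

definition Const :: "'a::zero \<Rightarrow> 'a mpol" where
  "Const c = Poly_Mapping.single 0 c"

definition X :: "nat \<Rightarrow> 'a::zero_neq_one mpol" where
  "X i = Poly_Mapping.single (Poly_Mapping.single i 1) 1"

definition meval :: "(nat \<Rightarrow> 'a) \<Rightarrow> 'a mpol \<Rightarrow> 'a::comm_semiring_1" where
  "meval x p = (\<Sum>\<alpha>\<in>Poly_Mapping.keys p.
     Poly_Mapping.lookup p \<alpha> * (\<Prod>i\<in>Poly_Mapping.keys \<alpha>. x i ^ Poly_Mapping.lookup \<alpha> i))"

definition complexify :: "real mpol \<Rightarrow> complex mpol" where
  "complexify p = Poly_Mapping.map complex_of_real p"


section \<open>Hausdorff dimension in Euclidean n-space\<close>

definition edist :: "nat \<Rightarrow> (nat \<Rightarrow> real) \<Rightarrow> (nat \<Rightarrow> real) \<Rightarrow> real" where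
  "edist n x y = L2_set (\<lambda>i. x i - y i) {..<n}"

definition ediam :: "nat \<Rightarrow> (nat \<Rightarrow> real) set \<Rightarrow> real" where
  "ediam n U = (if U = {} then 0 else SUP (x, y)\<in>U \<times> U. edist n x y)"

definition delta_cover ::
  "nat \<Rightarrow> real \<Rightarrow> (nat \<Rightarrow> real) set \<Rightarrow> (nat \<Rightarrow> (nat \<Rightarrow> real) set) \<Rightarrow> bool" where
  "delta_cover n \<delta> S U \<longleftrightarrow>
     S \<subseteq> (\<Union>j. U j) \<and>
     (\<forall>j. U j \<subseteq> coord_space n \<and> (\<forall>x\<in>U j. \<forall>y\<in>U j. edist n x y \<le> \<delta>))"

definition hausdorff_measure :: "nat \<Rightarrow> real \<Rightarrow> (nat \<Rightarrow> real) set \<Rightarrow> ennreal" where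
  "hausdorff_measure n d S =
     (SUP \<delta>\<in>{0<..}. INF U\<in>{U. delta_cover n \<delta> S U}. suminf (\<lambda>j. ennreal (ediam n (U j) powr d)))"

text \<open>
  Only exponents \<open>d > 0\<close> are used, because \<open>0 powr 0 = 0\<close>. The infimum is the same as over
  \<open>d \<ge> 0\<close>, since a set of zero counting measure is empty. The empty set has dimension 0.
\<close>

definition hausdorff_dim :: "nat \<Rightarrow> (nat \<Rightarrow> real) set \<Rightarrow> ereal" where
  "hausdorff_dim n S = Inf (ereal ` {d. 0 < d \<and> hausdorff_measure n d S = 0})"


section \<open>Real-analytic functions and main-analytic functions\<close>

definition real_analytic :: "nat \<Rightarrow> ((nat \<Rightarrow> real) \<Rightarrow> real) \<Rightarrow> bool" where
  "real_analytic n f \<longleftrightarrow>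
     (\<forall>a\<in>coord_space n. \<exists>\<rho>>0. \<exists>c :: (nat \<Rightarrow>\<^sub>0 nat) \<Rightarrow> real.
        \<forall>x\<in>coord_space n. (\<forall>i<n. \<bar>x i - a i\<bar> < \<rho>) \<longrightarrow>
          ((\<lambda>\<alpha>. c \<alpha> * (\<Prod>i<n. (x i - a i) ^ Poly_Mapping.lookup \<alpha> i)) has_sum f x)
            {\<alpha>. Poly_Mapping.keys \<alpha> \<subseteq> {..<n}})"

definition zero_set :: "nat \<Rightarrow> ((nat \<Rightarrow> 'a) \<Rightarrow> 'a) \<Rightarrow> (nat \<Rightarrow> 'a::zero) set" where
  "zero_set n f = {x\<in>coord_space n. f x = 0}"

definition main_analytic_function ::
  "nat \<Rightarrow> ((nat \<Rightarrow> real) \<Rightarrow> real) \<Rightarrow> (nat \<Rightarrow> real) set \<Rightarrow> bool" where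
  "main_analytic_function n f S \<longleftrightarrow>
     S \<subseteq> coord_space n \<and> real_analytic n f \<and> S \<subseteq> zero_set n f \<and>
     hausdorff_dim n (zero_set n f) = hausdorff_dim n S \<and>
     hausdorff_dim n (zero_set n f - S) < hausdorff_dim n S"


section \<open>Standard maps of wave-front singularities\<close>

text \<open>The integer argument of \<open>WF_D\<close> is the upper sign (\<open>1\<close>) or the lower sign (\<open>-1\<close>).\<close>

datatype wf_type = WF_A nat | WF_D int nat | WF_E6 | WF_E7 | WF_E8

fun valid_wf :: "wf_type \<Rightarrow> bool" where
  "valid_wf (WF_A k) \<longleftrightarrow> k \<ge> 2"
| "valid_wf (WF_D s k) \<longleftrightarrow> k \<ge> 4 \<and> (s = 1 \<or> s = -1)"
| "valid_wf WF_E6 \<longleftrightarrow> True"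
| "valid_wf WF_E7 \<longleftrightarrow> True"
| "valid_wf WF_E8 \<longleftrightarrow> True"

fun wf_dim :: "wf_type \<Rightarrow> nat" where
  "wf_dim (WF_A k) = k"
| "wf_dim (WF_D s k) = k"
| "wf_dim WF_E6 = 6"
| "wf_dim WF_E7 = 7"
| "wf_dim WF_E8 = 8"

text \<open>
  A parameter point \<open>(v, x\<^sub>2, \<dots>, x\<^sub>k\<^sub>-\<^sub>1)\<close> or \<open>(u, v, x\<^sub>3, \<dots>, x\<^sub>k\<^sub>-\<^sub>1)\<close> of \<open>K\<^sup>k\<^sup>-\<^sup>1\<close> is given by its
  coordinates \<open>y 0, y 1, \<dots>, y (k - 2)\<close>; in both cases \<open>x\<^sub>i\<close> is \<open>y (i - 1)\<close>. The maps are
  polynomial with integer coefficients and are defined over any commutative ring: the instance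
  at \<open>complex\<close> is the complexification of the instance at \<open>real\<close>.
\<close>

definition target :: "nat \<Rightarrow> 'a \<Rightarrow> 'a \<Rightarrow> 'a \<Rightarrow> (nat \<Rightarrow> 'a) \<Rightarrow> nat \<Rightarrow> 'a::zero" where
  "target k h0 h1 h2 x = (\<lambda>i. if i = 0 then h0 else if i = 1 then h1 else if i \<ge> k then 0
     else if i = 2 then h2 else x i)"

definition map_A :: "nat \<Rightarrow> (nat \<Rightarrow> 'a) \<Rightarrow> nat \<Rightarrow> 'a::comm_ring_1" where
  "map_A k y = (let v = y 0; x = (\<lambda>i. y (i - 1)) in
     target k
       (of_nat k * v ^ (k + 1) + (\<Sum>i=2..<k. of_nat (i - 1) * x i * v ^ i))
       (- of_nat (k + 1) * v ^ k - (\<Sum>i=2..<k. of_nat i * x i * v ^ (i - 1)))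
       (x 2) x)"

definition map_D :: "int \<Rightarrow> nat \<Rightarrow> (nat \<Rightarrow> 'a) \<Rightarrow> nat \<Rightarrow> 'a::comm_ring_1" where
  "map_D s k y = (let u = y 0; v = y 1; x = (\<lambda>i. y (i - 1)) in
     target k
       (of_int s * 2 * u\<^sup>2 * v + of_nat (k - 2) * v ^ (k - 1)
          + (\<Sum>i=3..<k. of_nat (i - 2) * x i * v ^ (i - 1)))
       (- of_int s * 2 * u * v)
       (- of_int s * u\<^sup>2 - of_nat (k - 1) * v ^ (k - 2)
          - (\<Sum>i=3..<k. of_nat (i - 1) * x i * v ^ (i - 2)))
       x)"

definition map_E6 :: "(nat \<Rightarrow> 'a) \<Rightarrow> nat \<Rightarrow> 'a::comm_ring_1" where
  "map_E6 y = (let u = y 0; v = y 1; x = (\<lambda>i. y (i - 1)); \<delta> = 2 * x 5 * v + x 4 in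
     target 6
       (2 * u ^ 3 + 3 * v ^ 4 + x 3 * v\<^sup>2 + u * v * \<delta>)
       (- 3 * u\<^sup>2 - x 4 * v - x 5 * v\<^sup>2)
       (- 4 * v ^ 3 - 2 * x 3 * v - u * \<delta>)
       x)"

definition map_E7 :: "(nat \<Rightarrow> 'a) \<Rightarrow> nat \<Rightarrow> 'a::comm_ring_1" where
  "map_E7 y = (let u = y 0; v = y 1; x = (\<lambda>i. y (i - 1)); \<delta> = 3 * v\<^sup>2 + 2 * x 6 * v + x 5 in
     target 7
       (2 * u ^ 3 + x 3 * v\<^sup>2 + 2 * x 4 * v ^ 3 + u * v * \<delta>)
       (- 3 * u\<^sup>2 - v ^ 3 - x 5 * v - x 6 * v\<^sup>2)
       (- 2 * x 3 * v - 3 * x 4 * v\<^sup>2 - u * \<delta>)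
       x)"

definition map_E8 :: "(nat \<Rightarrow> 'a) \<Rightarrow> nat \<Rightarrow> 'a::comm_ring_1" where
  "map_E8 y = (let u = y 0; v = y 1; x = (\<lambda>i. y (i - 1));
                   \<delta> = 3 * x 7 * v\<^sup>2 + 2 * x 6 * v + x 5 in
     target 8
       (2 * u ^ 3 + 4 * v ^ 5 + x 3 * v\<^sup>2 + 2 * x 4 * v ^ 3 + u * v * \<delta>)
       (- 3 * u\<^sup>2 - x 5 * v - x 6 * v\<^sup>2 - x 7 * v ^ 3)
       (- 5 * v ^ 4 - 2 * x 3 * v - 3 * x 4 * v\<^sup>2 - u * \<delta>)
       x)"

fun std_map :: "wf_type \<Rightarrow> (nat \<Rightarrow> 'a) \<Rightarrow> nat \<Rightarrow> 'a::comm_ring_1" where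
  "std_map (WF_A k) = map_A k"
| "std_map (WF_D s k) = map_D s k"
| "std_map WF_E6 = map_E6"
| "std_map WF_E7 = map_E7"
| "std_map WF_E8 = map_E8"


section \<open>The polynomials A, B and r\<close>

fun poly_P :: "wf_type \<Rightarrow> real mpol poly" where
  "poly_P WF_E6 = [: X 1, X 4, X 5 :]"
| "poly_P WF_E7 = [: X 1, X 5, X 6, 1 :]"
| "poly_P WF_E8 = [: X 1, X 5, X 6, X 7 :]"
| "poly_P _ = 0"

fun poly_Q :: "wf_type \<Rightarrow> real mpol poly" where
  "poly_Q WF_E6 = [: X 0, X 2, X 3, 0, 1 :]"
| "poly_Q WF_E7 = [: X 0, X 2, X 3, X 4 :]"
| "poly_Q WF_E8 = [: X 0, X 2, X 3, X 4, 0, 1 :]"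
| "poly_Q _ = 0"

fun poly_A :: "wf_type \<Rightarrow> real mpol poly" where
  "poly_A (WF_A k) = monom 1 (k + 1) + (\<Sum>i<k. monom (X i) i)"
| "poly_A (WF_D s k) = monom 1 k + (\<Sum>i=2..<k. monom (X i) i) + monom (X 0) 1
     - [: Const (of_int s / 4) * (X 1)\<^sup>2 :]"
| "poly_A \<tau> = 3 * (pderiv (poly_Q \<tau>))\<^sup>2 + (pderiv (poly_P \<tau>))\<^sup>2 * poly_P \<tau>"

fun poly_B :: "wf_type \<Rightarrow> real mpol poly" where
  "poly_B (WF_A k) = pderiv (poly_A (WF_A k))"
| "poly_B (WF_D s k) = pderiv (poly_A (WF_D s k))"
| "poly_B \<tau> = 2 * pderiv (poly_Q \<tau>) * poly_P \<tau> - 3 * pderiv (poly_P \<tau>) * poly_Q \<tau>"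

fun poly_r :: "wf_type \<Rightarrow> real mpol" where
  "poly_r (WF_A k) = 1"
| "poly_r (WF_D s k) = 1"
| "poly_r WF_E6 = X 4 ^ 3 + 2 * X 3 * X 4 * X 5 ^ 2 - 2 * X 2 * X 5 ^ 3"
| "poly_r WF_E7 = 3 * X 2 ^ 2 + (- 6 * X 4 * X 5 - 4 * X 3 * X 6 + 4 * X 4 * X 6 ^ 2) * X 2
     + X 5 * (4 * X 3 ^ 2 + 3 * X 4 ^ 2 * X 5 - 4 * X 3 * X 4 * X 6)"
| "poly_r WF_E8 = resultant [: X 2, 2 * X 3, 3 * X 4, 0, 5 :] [: X 5, 2 * X 6, 3 * X 7 :]"


section \<open>Discriminant polynomials\<close>

definition discriminant_polynomial ::
  "nat \<Rightarrow> ((nat \<Rightarrow> complex) \<Rightarrow> nat \<Rightarrow> complex) \<Rightarrow> complex mpol \<Rightarrow> bool" where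
  "discriminant_polynomial k hC p \<longleftrightarrow>
     p \<in> mpolys k \<and> squarefree p \<and>
     zero_set k (\<lambda>x. meval x p) = hC ` coord_space (k - 1)"

end

theory Submission
  imports Defs "Subresultants.Subresultant" "Jordan_Normal_Form.Char_Poly"
begin

text \<open>
  The image \<open>S\<close> of \<open>h\<close> is the set of unfolding parameters with a degenerate critical point on the
  zero level. For fixed \<open>x\<^sub>1, \<dots>, x\<^sub>k\<^sub>-\<^sub>1\<close> the critical points satisfy monic equations, so \<open>S\<close> is the zero
  set of a polynomial monic in \<open>x\<^sub>0\<close>, parametrized by an irreducible variety; it is squarefree because it has
  as many roots as its degree at one parameter point. For the types E, a root \<open>a\<close> of \<open>A\<close> belongs to the critical
  point \<open>v = a\<close>, \<open>u = - Q'(a) / P'(a)\<close>, and \<open>B(a) = - 3 P'(a) (x\<^sub>0 - \<xi>(a))\<close> where \<open>\<xi>(a)\<close> is the critical level;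
  the product of the \<open>P'(a)\<close> over all roots is a scalar multiple of \<open>r\<^sup>2\<close>, which is the factor to be removed.
  Real zeros of \<open>\<Theta>\<close> outside \<open>S\<close> come from pairs of complex conjugate critical points, and these are
  parametrized polynomially by \<open>k - 2\<close> real numbers, whereas \<open>S\<close> projects onto a cube of dimension \<open>k - 1\<close>.
\<close>

text \<open>For the types E the resultant says nothing about singular points where \<open>r\<close>
  vanishes: a common zero of \<open>P'\<close> and \<open>Q'\<close> is a common zero of
  \<open>A\<close> and \<open>B\<close> without any critical point having to lie on the zero level.
  The candidate for \<open>\<Theta>\<close> is therefore built without the resultant, as the
  characteristic polynomial \<open>T\<close> of multiplication by the critical level on the finite
  module of functions on the critical locus. For generic parameters the resultant has
  \<open>k\<close> distinct roots in \<open>x 0\<close>, all of them roots of \<open>T\<close>, and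
  this forces \<open>R = \<Theta> r^2\<close>. Over \<open>r = 0\<close> the zeros of
  \<open>\<Theta>\<close> are reached as limits: \<open>A\<close> has a constant leading coefficient
  and \<open>3 u^2 = - P\<close>, so critical points stay bounded. Uniqueness of the discriminant
  polynomial is a statement about an ideal. The Nullstellensatz is replaced by pseudo-division by a
  polynomial with constant leading coefficient, whose remainder needs to be examined only where a
  nonzero discriminant does not vanish. For type D the main variable is \<open>x 1\<close> and not
  \<open>x 0\<close>, because \<open>A'\<close> contains \<open>x 0\<close> but not
  \<open>x 1\<close>.\<close>

definition mhom :: "('a::comm_semiring_1 \<Rightarrow> 'b::comm_semiring_1) \<Rightarrow> (nat \<Rightarrow> 'b) \<Rightarrow> 'a mpol \<Rightarrow> 'b" where
  "mhom \<phi> x p = (\<Sum>\<alpha>\<in>Poly_Mapping.keys p.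
     \<phi> (Poly_Mapping.lookup p \<alpha>) * (\<Prod>i\<in>Poly_Mapping.keys \<alpha>. x i ^ Poly_Mapping.lookup \<alpha> i))"

lemma meval_eq_mhom: "meval x = mhom (\<lambda>c. c) x"
  by (simp add: fun_eq_iff meval_def mhom_def)

lemma mpol_sum_induct [case_names single add]:
  assumes "\<And>\<alpha> c. P (Poly_Mapping.single \<alpha> c)" and "\<And>p q. P p \<Longrightarrow> P q \<Longrightarrow> P (p + q)"
  shows "P (p :: 'a::comm_monoid_add mpol)"
proof (induction p rule: update_induct)
  case const
  show ?case using assms(1)[of 0 0] by simp
next
  case (update f a b)
  have "Poly_Mapping.update a b f = f + Poly_Mapping.single a b"
    by (rule poly_mapping_eqI)
      (use update(1) in \<open>auto simp: lookup_update lookup_add lookup_single in_keys_iff when_def\<close>)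
  with update assms show ?case by metis
qed

lemma monomial_prod_superset:
  fixes x :: "nat \<Rightarrow> 'b::comm_semiring_1"
  assumes "finite A" "Poly_Mapping.keys \<alpha> \<subseteq> A"
  shows "(\<Prod>i\<in>Poly_Mapping.keys \<alpha>. x i ^ Poly_Mapping.lookup \<alpha> i) = (\<Prod>i\<in>A. x i ^ Poly_Mapping.lookup \<alpha> i)"
  by (rule prod.mono_neutral_left) (use assms in \<open>auto simp: in_keys_iff\<close>)

lemma monomial_prod_add:
  fixes x :: "nat \<Rightarrow> 'b::comm_semiring_1" and \<alpha> \<beta> :: "nat \<Rightarrow>\<^sub>0 nat"
  shows "(\<Prod>i\<in>Poly_Mapping.keys (\<alpha> + \<beta>). x i ^ Poly_Mapping.lookup (\<alpha> + \<beta>) i) =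
    (\<Prod>i\<in>Poly_Mapping.keys \<alpha>. x i ^ Poly_Mapping.lookup \<alpha> i) *
    (\<Prod>i\<in>Poly_Mapping.keys \<beta>. x i ^ Poly_Mapping.lookup \<beta> i)"
proof -
  let ?A = "Poly_Mapping.keys \<alpha> \<union> Poly_Mapping.keys \<beta>"
  have "Poly_Mapping.keys (\<alpha> + \<beta>) \<subseteq> ?A" by (rule Poly_Mapping.keys_add)
  then show ?thesis
    using monomial_prod_superset[of ?A "\<alpha> + \<beta>" x] monomial_prod_superset[of ?A \<alpha> x]
      monomial_prod_superset[of ?A \<beta> x]
    by (simp add: lookup_add power_add prod.distrib)
qed

text \<open>All substitutions below are instances of \<open>mhom\<close>: \<open>meval\<close> with
  the identity on coefficients, \<open>ev\<close> with \<open>complex_of_real\<close>, composition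
  with \<open>Const\<close>, separation of a variable with \<open>[:Const c:]\<close>, and
  restriction to a line with constant one-variable polynomials. An arbitrary coefficient
  homomorphism serves them all.\<close>

locale mpol_hom = comm_semiring_hom \<phi> for \<phi> :: "'a::comm_semiring_1 \<Rightarrow> 'b::comm_semiring_1"
begin

lemma mhom_single: "mhom \<phi> x (Poly_Mapping.single \<alpha> c) =
    \<phi> c * (\<Prod>i\<in>Poly_Mapping.keys \<alpha>. x i ^ Poly_Mapping.lookup \<alpha> i)"
  by (simp add: mhom_def hom_distribs)

lemma mhom_superset:
  assumes "finite A" "Poly_Mapping.keys p \<subseteq> A"
  shows "mhom \<phi> x p = (\<Sum>\<alpha>\<in>A.
     \<phi> (Poly_Mapping.lookup p \<alpha>) * (\<Prod>i\<in>Poly_Mapping.keys \<alpha>. x i ^ Poly_Mapping.lookup \<alpha> i))"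
  unfolding mhom_def
  by (rule sum.mono_neutral_left) (use assms in \<open>auto simp: in_keys_iff\<close>)

lemma mhom_add: "mhom \<phi> x (p + q) = mhom \<phi> x p + mhom \<phi> x q"
proof -
  let ?A = "Poly_Mapping.keys p \<union> Poly_Mapping.keys q"
  have "Poly_Mapping.keys (p + q) \<subseteq> ?A" by (rule Poly_Mapping.keys_add)
  then show ?thesis
    using mhom_superset[of ?A "p + q" x] mhom_superset[of ?A p x] mhom_superset[of ?A q x]
    by (simp add: lookup_add hom_add distrib_right sum.distrib)
qed

lemma mhom_mult: "mhom \<phi> x (p * q) = mhom \<phi> x p * mhom \<phi> x q"
proof (induction p rule: mpol_sum_induct)
  case (single \<alpha> c)
  show ?case
    by (induction q rule: mpol_sum_induct)
      (auto simp: mult_single mhom_single monomial_prod_add hom_mult algebra_simps mhom_add)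
qed (simp add: distrib_right mhom_add)

lemma mhom_Const [simp]: "mhom \<phi> x (Const c) = \<phi> c"
  by (simp add: Const_def mhom_single)

lemma mhom_X [simp]: "mhom \<phi> x (X i) = x i"
  by (simp add: X_def mhom_single)

lemma mhom_0 [simp]: "mhom \<phi> x 0 = 0"
  by (simp add: mhom_def)

lemma mhom_1 [simp]: "mhom \<phi> x 1 = 1"
  using mhom_Const[of x 1] unfolding Const_def single_one by simp

end

lemma Const_0 [simp]: "Const 0 = 0" by (simp add: Const_def)
lemma Const_1 [simp]: "Const 1 = 1" by (simp add: Const_def)
lemma Const_add: "Const (a + b) = Const a + Const b" by (simp add: Const_def single_add)
lemma Const_mult: "Const (a * b) = Const a * (Const b :: 'a::comm_semiring_1 mpol)"
  by (simp add: Const_def mult_single)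
lemma Const_power: "Const (a ^ n) = (Const a :: 'a::comm_semiring_1 mpol) ^ n"
  by (induction n) (simp_all add: Const_mult)
lemma Const_eq_0_iff [simp]: "Const a = 0 \<longleftrightarrow> a = 0"
  by (metis Const_0 Const_def lookup_single_eq)

lemma X_power_eq_single: "X i ^ n = (Poly_Mapping.single (Poly_Mapping.single i n) 1 :: 'a::comm_semiring_1 mpol)"
proof (induction n)
  case (Suc n)
  then show ?case
    by (simp add: X_def mult_single flip: single_add)
qed (simp flip: single_one)

text \<open>Constants and variables generate the ring, so identities between homomorphisms out of it
  (\<open>complexify\<close>, \<open>uni\<close>, compositions) reduce to two trivial cases.\<close>

lemma mpol_induct [case_names Const X add mult]:
  fixes p :: "'a::comm_semiring_1 mpol"
  assumes c: "\<And>c. P (Const c)" and x: "\<And>i. P (X i)"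
    and a: "\<And>p q. P p \<Longrightarrow> P q \<Longrightarrow> P (p + q)" and m: "\<And>p q. P p \<Longrightarrow> P q \<Longrightarrow> P (p * q)"
  shows "P p"
proof (induction p rule: mpol_sum_induct)
  case (single \<alpha> c)
  have "P (Poly_Mapping.single \<alpha> 1 :: 'a mpol)"
  proof (induction \<alpha> rule: update_induct)
    case const
    then show ?case using c[of 1] by (simp add: Const_def)
  next
    case (update f i n)
    have *: "Poly_Mapping.update i n f = f + Poly_Mapping.single i n"
      by (rule poly_mapping_eqI)
        (use update(1) in \<open>auto simp: lookup_update lookup_add lookup_single in_keys_iff when_def\<close>)
    have "P (X i ^ n :: 'a mpol)"
      by (induction n) (use c[of 1] x m in auto)
    then have "P (Poly_Mapping.single f 1 * X i ^ n :: 'a mpol)"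
      using update m by blast
    then show ?case
      by (simp add: X_power_eq_single mult_single *)
  qed
  then have "P (Const c * Poly_Mapping.single \<alpha> 1)"
    using c m by blast
  then show ?case by (simp add: Const_def mult_single)
qed (use a in blast)

lemma mpol_hom_id: "mpol_hom (\<lambda>c::'a::comm_semiring_1. c)"
  by unfold_locales auto

lemmas mhom_id = mpol_hom.mhom_add[OF mpol_hom_id] mpol_hom.mhom_mult[OF mpol_hom_id]
  mpol_hom.mhom_0[OF mpol_hom_id] mpol_hom.mhom_1[OF mpol_hom_id]
  mpol_hom.mhom_Const[OF mpol_hom_id] mpol_hom.mhom_X[OF mpol_hom_id]

lemma mpol_hom_of_real: "mpol_hom complex_of_real"
  by unfold_locales simp_all

lemmas mhom_of_real = mpol_hom.mhom_add[OF mpol_hom_of_real] mpol_hom.mhom_mult[OF mpol_hom_of_real]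
  mpol_hom.mhom_0[OF mpol_hom_of_real] mpol_hom.mhom_1[OF mpol_hom_of_real]
  mpol_hom.mhom_Const[OF mpol_hom_of_real] mpol_hom.mhom_X[OF mpol_hom_of_real]

interpretation mev: comm_ring_hom "meval x" for x :: "nat \<Rightarrow> 'a::comm_ring_1"
  unfolding meval_eq_mhom by unfold_locales (simp_all add: mhom_id)

text \<open>Real polynomials are evaluated at complex points directly. By
  \<open>meval_complexify\<close> this is evaluation of the complexification, so the algebra can
  stay over the reals until \<open>discriminant_polynomial\<close> asks for complex
  coefficients.\<close>

definition ev :: "(nat \<Rightarrow> complex) \<Rightarrow> real mpol \<Rightarrow> complex" where
  "ev = mhom complex_of_real"

interpretation evh: comm_ring_hom "ev x" for x
  unfolding ev_def by unfold_locales (simp_all add: mhom_of_real)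

lemma meval_Const [simp]: "meval x (Const c) = c"
  and meval_X [simp]: "meval x (X i) = x i"
  unfolding meval_eq_mhom by (simp_all add: mhom_id)

lemma ev_Const [simp]: "ev x (Const c) = of_real c"
  and ev_X [simp]: "ev x (X i) = x i"
  unfolding ev_def by (simp_all add: mhom_of_real)

lemma lookup_complexify: "Poly_Mapping.lookup (complexify p) \<alpha> = of_real (Poly_Mapping.lookup p \<alpha>)"
  by (simp add: complexify_def map.rep_eq when_def)

lemma complexify_single: "complexify (Poly_Mapping.single \<alpha> c) = Poly_Mapping.single \<alpha> (of_real c)"
  by (rule poly_mapping_eqI) (simp add: lookup_complexify lookup_single when_def)

lemma complexify_add: "complexify (p + q) = complexify p + complexify q"
  by (rule poly_mapping_eqI) (simp add: lookup_complexify lookup_add)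

lemma complexify_mult: "complexify (p * q) = complexify p * complexify q"
proof (induction p rule: mpol_sum_induct)
  case (single \<alpha> c)
  show ?case
    by (induction q rule: mpol_sum_induct)
      (auto simp: mult_single complexify_single complexify_add algebra_simps)
qed (simp add: distrib_right complexify_add)

lemma complexify_Const [simp]: "complexify (Const c) = Const (of_real c)"
  by (simp add: Const_def complexify_single)

lemma complexify_X [simp]: "complexify (X i) = X i"
  by (simp add: X_def complexify_single)

interpretation cx: comm_ring_hom complexify
  by unfold_locales (use complexify_Const[of 0] complexify_Const[of 1] in \<open>auto simp: complexify_add complexify_mult\<close>)

lemma meval_complexify: "meval x (complexify p) = ev x p"
  by (induction p rule: mpol_induct) (auto simp: cx.hom_add cx.hom_mult mev.hom_add mev.hom_mult evh.hom_add evh.hom_mult)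

lemma ev_of_real: "ev (\<lambda>i. of_real (x i)) p = of_real (meval x p)"
  by (induction p rule: mpol_induct) (auto simp: mev.hom_add mev.hom_mult evh.hom_add evh.hom_mult)

subsection \<open>Polynomials in finitely many variables\<close>

lemma mpolys_Const [simp]: "Const c \<in> mpolys n"
  by (auto simp: mpolys_def Const_def)

lemma mpolys_X [simp]: "i < n \<Longrightarrow> (X i :: 'a::comm_semiring_1 mpol) \<in> mpolys n"
  by (auto simp: mpolys_def X_def)

lemma mpolys_0 [simp]: "0 \<in> mpolys n"
  by (auto simp: mpolys_def)

lemma mpolys_1 [simp]: "(1 :: 'a::comm_semiring_1 mpol) \<in> mpolys n"
  by (metis Const_1 mpolys_Const)

lemma mpolys_add: "p \<in> mpolys n \<Longrightarrow> q \<in> mpolys n \<Longrightarrow> p + q \<in> mpolys n"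
  unfolding mpolys_def using Poly_Mapping.keys_add by fastforce

lemma mpolys_mult: "p \<in> mpolys n \<Longrightarrow> q \<in> mpolys n \<Longrightarrow> p * q \<in> mpolys n"
  for p q :: "'a::comm_semiring_1 mpol"
proof -
  assume pq: "p \<in> mpolys n" "q \<in> mpolys n"
  show "p * q \<in> mpolys n"
    unfolding mpolys_def
  proof safe
    fix \<alpha> i assume "\<alpha> \<in> Poly_Mapping.keys (p * q)" and i: "i \<in> Poly_Mapping.keys \<alpha>"
    then obtain a b where "\<alpha> = a + b" "a \<in> Poly_Mapping.keys p" "b \<in> Poly_Mapping.keys q"
      using keys_mult[of p q] by auto
    then show "i < n"
      using pq i Poly_Mapping.keys_add[of a b] unfolding mpolys_def by fastforce
  qed
qed

lemma mpolys_uminus: "p \<in> mpolys n \<Longrightarrow> - p \<in> mpolys n" for p :: "'a::comm_ring_1 mpol"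
  by (simp add: mpolys_def)

lemma mpolys_diff: "p \<in> mpolys n \<Longrightarrow> q \<in> mpolys n \<Longrightarrow> p - q \<in> mpolys n" for p q :: "'a::comm_ring_1 mpol"
  using mpolys_add[of p n "- q"] mpolys_uminus[of q n] by simp

lemma mpolys_power: "p \<in> mpolys n \<Longrightarrow> p ^ m \<in> mpolys n" for p :: "'a::comm_semiring_1 mpol"
  by (induction m) (auto intro: mpolys_mult)

lemma mpolys_sum: "(\<And>i. i \<in> A \<Longrightarrow> f i \<in> mpolys n) \<Longrightarrow> sum f A \<in> mpolys n"
  by (induction A rule: infinite_finite_induct) (auto intro: mpolys_add)

lemma mpolys_prod: "(\<And>i. i \<in> A \<Longrightarrow> f i \<in> mpolys n) \<Longrightarrow> prod f A \<in> mpolys n"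
  for f :: "_ \<Rightarrow> 'a::comm_semiring_1 mpol"
  by (induction A rule: infinite_finite_induct) (auto intro: mpolys_mult)

lemma mpolys_of_nat: "(of_nat m :: 'a::comm_semiring_1 mpol) \<in> mpolys n"
  by (induction m) (auto intro: mpolys_add)

lemma mpolys_numeral: "(numeral m :: 'a::comm_semiring_1 mpol) \<in> mpolys n"
  using mpolys_of_nat[of "numeral m" n] by simp

lemmas mpolys_intros = mpolys_add mpolys_mult mpolys_uminus mpolys_diff mpolys_power mpolys_sum
  mpolys_prod mpolys_of_nat mpolys_numeral mpolys_Const mpolys_X mpolys_0 mpolys_1

lemma mpolys_det:
  fixes M :: "'a::comm_ring_1 mpol mat"
  assumes "M \<in> carrier_mat m m" "\<And>i j. i < m \<Longrightarrow> j < m \<Longrightarrow> M $$ (i, j) \<in> mpolys n"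
  shows "det M \<in> mpolys n"
proof -
  have "signof p \<in> (mpolys n :: 'a mpol set)" for p
    by (auto simp: sign_def intro: mpolys_intros)
  moreover have "p i < m" if "p permutes {0..<m}" "i < m" for p i
    using that permutes_in_image[of p "{0..<m}" i] by simp
  ultimately show ?thesis
    unfolding det_def'[OF assms(1)] by (intro mpolys_sum mpolys_mult mpolys_prod) (auto intro: assms)
qed

lemma mpolys_resultant:
  fixes f g :: "'a::comm_ring_1 mpol poly"
  assumes "\<And>i. coeff f i \<in> mpolys n" "\<And>i. coeff g i \<in> mpolys n"
  shows "resultant f g \<in> mpolys n"
  unfolding resultant_def
  by (rule mpolys_det[where m = "degree f + degree g"]) (auto simp: sylvester_index_mat assms)

lemma meval_cong_mpolys:
  assumes "p \<in> mpolys n" "\<And>i. i < n \<Longrightarrow> x i = y i"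
  shows "meval x p = meval y p"
proof -
  have "x i = y i" if "\<alpha> \<in> Poly_Mapping.keys p" "i \<in> Poly_Mapping.keys \<alpha>" for \<alpha> i
    using assms that unfolding mpolys_def by blast
  then show ?thesis
    unfolding meval_def by (intro sum.cong prod.cong arg_cong2[of _ _ _ _ "(*)"]) auto
qed

lemma mpolys_complexify: "p \<in> mpolys n \<Longrightarrow> complexify p \<in> mpolys n"
  by (auto simp: mpolys_def in_keys_iff lookup_complexify)

lemma ev_cong_mpolys:
  assumes "p \<in> mpolys n" "\<And>i. i < n \<Longrightarrow> x i = y i"
  shows "ev x p = ev y p"
  using meval_cong_mpolys[OF mpolys_complexify[OF assms(1)], of x y] assms(2) by (simp add: meval_complexify)

lemma ex_mpolys: "\<exists>n. p \<in> mpolys n"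
proof -
  have "finite (\<Union>(Poly_Mapping.keys ` Poly_Mapping.keys p))" by auto
  then obtain n where "\<forall>i\<in>\<Union>(Poly_Mapping.keys ` Poly_Mapping.keys p). i < n"
    using finite_nat_set_iff_bounded by blast
  then show ?thesis by (intro exI[of _ n]) (auto simp: mpolys_def)
qed

lemma mhom_mpolys:
  fixes H :: "nat \<Rightarrow> 'a::comm_ring_1 mpol"
  assumes "\<And>i. H i \<in> mpolys n"
  shows "mhom Const H p \<in> mpolys n"
proof -
  interpret C: mpol_hom "Const :: 'a \<Rightarrow> 'a mpol"
    by unfold_locales (simp_all add: Const_add Const_mult)
  show ?thesis
    by (induction p rule: mpol_induct) (auto simp: C.mhom_add C.mhom_mult assms intro: mpolys_intros)
qed

subsection \<open>Composition of polynomials\<close>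

interpretation mconst: mpol_hom "Const :: 'a::comm_ring_1 \<Rightarrow> 'a mpol"
  by unfold_locales (simp_all add: Const_add Const_mult)

interpretation msubst: comm_ring_hom "mhom Const H" for H :: "nat \<Rightarrow> 'a::comm_ring_1 mpol"
  by unfold_locales (auto simp: mconst.mhom_add mconst.mhom_mult)

lemma meval_subst: "meval y (mhom Const H p) = meval (\<lambda>i. meval y (H i)) p"
  for H :: "nat \<Rightarrow> 'a::comm_ring_1 mpol"
  by (induction p rule: mpol_induct)
    (auto simp: mconst.mhom_add mconst.mhom_mult mev.hom_add mev.hom_mult)

lemma ev_subst: "ev y (mhom Const H p) = ev (\<lambda>i. ev y (H i)) p"
  by (induction p rule: mpol_induct)
    (auto simp: mconst.mhom_add mconst.mhom_mult evh.hom_add evh.hom_mult)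

subsection \<open>Separating one variable\<close>

text \<open>The variable \<open>X e\<close> becomes the polynomial variable while the coefficient
  ring is still the full ring. The coefficients no longer contain \<open>X e\<close>, but
  \<open>pev x\<close> formally keeps a value at \<open>e\<close>, the dummy coordinate of
  \<open>discriminant_from_data\<close>.\<close>

definition uni :: "nat \<Rightarrow> 'a::comm_ring_1 mpol \<Rightarrow> 'a mpol poly" where
  "uni e = mhom (\<lambda>c. [:Const c:]) (\<lambda>i. if i = e then [:0, 1:] else [:X i:])"

interpretation muni: mpol_hom "\<lambda>c::'a::comm_ring_1. [:Const c:]"
  by unfold_locales (simp_all add: Const_add Const_mult)

interpretation unih: comm_ring_hom "uni e" for e
  unfolding uni_def by unfold_locales (auto simp: muni.mhom_add muni.mhom_mult)

lemma uni_Const [simp]: "uni e (Const c) = [:Const c:]"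
  and uni_X: "uni e (X i) = (if i = e then [:0, 1:] else [:X i:])"
  unfolding uni_def by simp_all

lemma poly_uni: "poly (uni e p) (X e) = p"
  by (induction p rule: mpol_induct) (auto simp: unih.hom_add unih.hom_mult uni_X)

definition pev :: "(nat \<Rightarrow> 'a::comm_ring_1) \<Rightarrow> 'a mpol poly \<Rightarrow> 'a poly" where
  "pev x f = map_poly (meval x) f"

interpretation mapev: map_poly_comm_ring_hom "meval x" for x :: "nat \<Rightarrow> 'a::comm_ring_1" ..

interpretation pevh: comm_ring_hom "pev x" for x :: "nat \<Rightarrow> 'a::comm_ring_1"
  unfolding pev_def[abs_def] by unfold_locales (auto simp: mapev.hom_add mapev.hom_mult)

lemma coeff_pev [simp]: "coeff (pev x f) i = meval x (coeff f i)"
  by (simp add: pev_def)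

lemma pev_pCons [simp]: "pev x (pCons a f) = pCons (meval x a) (pev x f)"
  by (rule poly_eqI) (simp add: coeff_pCons split: nat.split)

lemma poly_pev_uni: "poly (pev x (uni e p)) z = meval (x(e := z)) p"
proof (induction p rule: mpol_induct)
  case (X i)
  then show ?case by (auto simp: uni_X)
qed (auto simp: unih.hom_add unih.hom_mult pevh.hom_add pevh.hom_mult mev.hom_add mev.hom_mult)

subsection \<open>Polynomials as functions\<close>

text \<open>Membership in \<open>mpolys n\<close> is turned into invariance under the substitution
  that kills the variables from \<open>n\<close> on. Being a homomorphism, this substitution can be
  compared with \<open>uni\<close>, which is how \<open>coeff_uni_mpolys\<close> locates the
  coefficients.\<close>

lemma mpolys_trunc:
  fixes p :: "'a::comm_ring_1 mpol"
  assumes "p \<in> mpolys n"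
  shows "mhom Const (\<lambda>i. if i < n then X i else 0) p = p"
proof -
  have mono: "(\<Prod>i\<in>Poly_Mapping.keys \<alpha>. X i ^ Poly_Mapping.lookup \<alpha> i) = (Poly_Mapping.single \<alpha> 1 :: 'a mpol)" for \<alpha>
  proof (induction \<alpha> rule: update_induct)
    case const
    then show ?case by simp
  next
    case (update f i m)
    have *: "Poly_Mapping.update i m f = f + Poly_Mapping.single i m"
      by (rule poly_mapping_eqI)
        (use update(1) in \<open>auto simp: lookup_update lookup_add lookup_single in_keys_iff when_def\<close>)
    show ?case
      unfolding * monomial_prod_add update by (simp add: X_power_eq_single mult_single)
  qed
  have less: "i < n" if "\<alpha> \<in> Poly_Mapping.keys p" "i \<in> Poly_Mapping.keys \<alpha>" for \<alpha> i
    using assms that unfolding mpolys_def by blast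
  have "mhom Const (\<lambda>i. if i < n then X i else 0) p =
    (\<Sum>\<alpha>\<in>Poly_Mapping.keys p. Const (Poly_Mapping.lookup p \<alpha>) * (\<Prod>i\<in>Poly_Mapping.keys \<alpha>. X i ^ Poly_Mapping.lookup \<alpha> i))"
    unfolding mhom_def using less
    by (intro sum.cong prod.cong arg_cong2[of _ _ _ _ "(*)"]) auto
  also have "\<dots> = (\<Sum>\<alpha>\<in>Poly_Mapping.keys p. Poly_Mapping.single \<alpha> (Poly_Mapping.lookup p \<alpha>))"
    by (intro sum.cong) (auto simp: mono Const_def mult_single)
  also have "\<dots> = p"
    by (rule poly_mapping_eqI) (auto simp: lookup_sum lookup_single when_def in_keys_iff)
  finally show ?thesis .
qed

lemma uni_trunc_Suc:
  fixes p :: "'a::comm_ring_1 mpol"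
  shows "uni n (mhom Const (\<lambda>i. if i < Suc n then X i else 0) p) =
    map_poly (mhom Const (\<lambda>i. if i < n then X i else 0)) (uni n p)"
proof -
  let ?h = "mhom Const (\<lambda>i. if i < n then X i else 0) :: 'a mpol \<Rightarrow> 'a mpol"
  interpret m: map_poly_comm_ring_hom ?h ..
  have [simp]: "map_poly ?h [:c:] = [:?h c:]" for c
    by (rule poly_eqI) (simp add: coeff_pCons split: nat.split)
  show ?thesis
  proof (induction p rule: mpol_induct)
    case (X i)
    then show ?case by (cases "i = n") (auto simp: uni_X)
  qed (auto simp: unih.hom_add unih.hom_mult mconst.mhom_add mconst.mhom_mult m.hom_add m.hom_mult)
qed

lemma coeff_uni_mpolys:
  fixes p :: "'a::comm_ring_1 mpol"
  assumes "p \<in> mpolys (Suc n)"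
  shows "coeff (uni n p) i \<in> mpolys n"
proof -
  have eq: "coeff (uni n p) i = mhom Const (\<lambda>i. if i < n then X i else 0) (coeff (uni n p) i)"
    using arg_cong[OF uni_trunc_Suc[of n p], of "\<lambda>f. coeff f i"] mpolys_trunc[OF assms] by simp
  have "mhom Const (\<lambda>i. if i < n then X i else 0) (coeff (uni n p) i) \<in> mpolys n"
    by (rule mhom_mpolys) simp
  then show ?thesis by (simp only: eq[symmetric])
qed

text \<open>Induction on the number of variables: with the other coordinates fixed, the polynomial
  in the last variable vanishes identically on an infinite field, so each coefficient vanishes at
  every point.\<close>

lemma meval_mpolys_zero:
  fixes p :: "'a::{field_char_0} mpol"
  assumes "p \<in> mpolys n" "\<And>x. meval x p = 0"
  shows "p = 0"
  using assms
proof (induction n arbitrary: p)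
  case 0
  then have "Poly_Mapping.keys p \<subseteq> {0}" by (auto simp: mpolys_def)
  then have p: "p = Const (Poly_Mapping.lookup p 0)"
    by (intro poly_mapping_eqI) (auto simp: Const_def lookup_single when_def in_keys_iff)
  then have "Poly_Mapping.lookup p 0 = 0"
    by (metis "0.prems"(2) meval_Const)
  with p show ?case by simp
next
  case (Suc n)
  have "coeff (uni n p) i = 0" for i
  proof (rule Suc.IH)
    fix x
    have "poly (pev x (uni n p)) z = 0" for z
      by (simp add: poly_pev_uni Suc.prems)
    then have "pev x (uni n p) = 0"
      using poly_all_0_iff_0 by blast
    then show "meval x (coeff (uni n p) i) = 0"
      by (metis coeff_0 coeff_pev)
  qed (use Suc.prems coeff_uni_mpolys in blast)
  then have "uni n p = 0" by (intro poly_eqI) simp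
  then show ?case using poly_uni[of n p] by simp
qed

lemma meval_zero: "(\<And>x. meval x p = 0) \<Longrightarrow> p = 0" for p :: "'a::{field_char_0} mpol"
  using ex_mpolys meval_mpolys_zero by blast

lemma meval_eqI: "(\<And>x. meval x p = meval x q) \<Longrightarrow> p = q" for p q :: "'a::{field_char_0} mpol"
  using meval_zero[of "p - q"] by (simp add: mev.hom_minus)

lemma ev_zero: "(\<And>x. ev x p = 0) \<Longrightarrow> p = 0"
  using meval_zero[of p] ev_of_real by (metis of_real_eq_0_iff)

lemma ev_eqI: "(\<And>x. ev x p = ev x q) \<Longrightarrow> p = q"
  using ev_zero[of "p - q"] by (simp add: evh.hom_minus)

text \<open>\<open>w * p\<close> vanishes everywhere and the ring has no zero divisors. Thus
  coefficient identities may be checked only where a discriminant or the like is nonzero.\<close>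

lemma meval_generic_zero:
  fixes p w :: "'a::{field_char_0} mpol"
  assumes "w \<noteq> 0" "\<And>x. meval x w \<noteq> 0 \<Longrightarrow> meval x p = 0"
  shows "p = 0"
proof -
  have "w * p = 0"
    by (rule meval_zero) (use assms(2) in \<open>auto simp: mev.hom_mult\<close>)
  then show ?thesis using assms(1) by simp
qed

text \<open>On the line through the origin and \<open>y\<close> the polynomial becomes a
  one-variable polynomial without complex zeros, hence constant by the fundamental theorem of
  algebra; so its value at \<open>y\<close> is its value at the origin.\<close>

lemma nowhere_zero_Const:
  fixes g :: "complex mpol"
  assumes "\<And>x. meval x g \<noteq> 0"
  shows "\<exists>c. c \<noteq> 0 \<and> g = Const c"
proof -
  interpret L: mpol_hom "\<lambda>c::complex. [:c:]"
    by unfold_locales auto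
  have "meval y g = meval (\<lambda>_. 0) g" for y
  proof -
    define q where "q = mhom (\<lambda>c. [:c:]) (\<lambda>i. [:0, y i:]) g"
    have ev: "poly q t = meval (\<lambda>i. t * y i) g" for t
      unfolding q_def
      by (induction g rule: mpol_induct) (auto simp: L.mhom_add L.mhom_mult mev.hom_add mev.hom_mult)
    have "constant (poly q)"
      using fundamental_theorem_of_algebra[of q] assms ev by auto
    then have "poly q 1 = poly q 0"
      by (auto simp: constant_def)
    then show ?thesis by (simp add: ev)
  qed
  then have "g = Const (meval (\<lambda>_. 0) g)"
    by (intro meval_eqI) simp
  then show ?thesis using assms by blast
qed

section \<open>Resultants as products over roots\<close>

lemma sylvester_mat_sub_index':
  fixes p q :: "'a::comm_ring_1 poly"
  assumes "degree p \<le> m" "degree q \<le> n" "i < m + n" "j < m + n"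
  shows "sylvester_mat_sub m n p q $$ (i, j) =
    (if i < n then coeff (monom 1 (n - 1 - i) * p) (m + n - 1 - j)
     else coeff (monom 1 (m + n - 1 - i) * q) (m + n - 1 - j))"
  using assms
  by (auto simp: sylvester_mat_sub_index coeff_monom_mult coeff_eq_0 intro!: arg_cong[of _ _ "coeff p"] arg_cong[of _ _ "coeff q"])

text \<open>
  With \<open>L\<close> subtracting \<open>a\<close> times the next row from all \<open>q\<close>-rows but the last, every row of
  \<open>L * Syl((v - a) p, q)\<close> except the last is \<open>v - a\<close> times a row of \<open>Syl(p, q)\<close>; the matrix \<open>F\<close>
  is multiplication by \<open>v - a\<close>, extended by the constant 1.
\<close>

lemma resultant_sub_linear_factor:
  fixes p q :: "'a::idom poly"
  assumes p: "degree p \<le> m" and q: "degree q \<le> n"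
  shows "resultant_sub (Suc m) n ([:-a, 1:] * p) q = poly q a * resultant_sub m n p q"
proof -
  define N where "N = m + n"
  define f where "f = [:-a, 1:] * p"
  have f: "degree f \<le> Suc m"
    unfolding f_def using degree_mult_le[of "[:-a, 1:]" p] p by simp
  define S where "S = sylvester_mat_sub (Suc m) n f q"
  define S' where "S' = sylvester_mat_sub m n p q"
  define L :: "'a mat" where "L = mat (Suc N) (Suc N) (\<lambda>(i, j). if i = j then 1 else if n \<le> i \<and> j = Suc i then - a else 0)"
  define F :: "'a mat" where "F = mat (Suc N) (Suc N) (\<lambda>(i, j). if i = j then 1 else if j = Suc i then - a else 0)"
  define s where "s = synthetic_div q a"
  \<comment> \<open>\<open>S'\<close> bordered by a row and a column. The last row of
    \<open>S\<close> is \<open>q\<close> itself, and \<open>q = (v - a) s + q(a)\<close>. So the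
    last row of \<open>W\<close> holds the coefficients of \<open>s\<close> and the remainder
    \<open>q(a)\<close>, which becomes the extra factor of the determinant.\<close>
  define W where "W = four_block_mat S' (0\<^sub>m N 1) (mat 1 N (\<lambda>(i, j). coeff s (N - 1 - j))) (mat 1 1 (\<lambda>_. poly q a))"
  have carrS: "S \<in> carrier_mat (Suc N) (Suc N)"
    by (rule carrier_matI) (simp_all add: S_def N_def)
  have carrS': "S' \<in> carrier_mat N N"
    by (rule carrier_matI) (simp_all add: S'_def N_def)
  have carrL: "L \<in> carrier_mat (Suc N) (Suc N)" and carrF: "F \<in> carrier_mat (Suc N) (Suc N)"
    unfolding L_def F_def by simp_all
  have carrW: "W \<in> carrier_mat (Suc N) (Suc N)"
    using carrS' by (intro carrier_matI) (simp_all add: W_def)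
  note carr = carrS carrL carrF carrS' carrW
  have detL: "det L = 1"
    using carr(2) by (subst det_upper_triangular[where n = "Suc N"])
      (auto simp: upper_triangular_def L_def diag_mat_def intro!: prod_list_neutral)
  have detF: "det F = 1"
    using carr(3) by (subst det_upper_triangular[where n = "Suc N"])
      (auto simp: upper_triangular_def F_def diag_mat_def intro!: prod_list_neutral)
  have detW: "det W = det S' * poly q a"
    unfolding W_def using carr(4)
    by (subst det_four_block_mat_upper_right_zero_col[where n = N]) (auto simp: det_single)
  have LS: "(L * S) $$ (i, j) = S $$ (i, j) - (if n \<le> i \<and> i < N then a * S $$ (Suc i, j) else 0)"
    if "i < Suc N" "j < Suc N" for i j
  proof -
    have "(L * S) $$ (i, j) = (\<Sum>l<Suc N. L $$ (i, l) * S $$ (l, j))"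
      using carr that by (auto simp: scalar_prod_def atLeast0LessThan)
    also have "\<dots> = (\<Sum>l<Suc N. (if l = i then S $$ (l, j) else 0) + (if n \<le> i \<and> l = Suc i then - a * S $$ (l, j) else 0))"
      using that by (intro sum.cong) (auto simp: L_def)
    also have "\<dots> = S $$ (i, j) - (if n \<le> i \<and> i < N then a * S $$ (Suc i, j) else 0)"
      using that by (auto simp: sum.distrib sum.delta)
    finally show ?thesis .
  qed
  have WF: "(W * F) $$ (i, j) = W $$ (i, j) - (if 0 < j then a * W $$ (i, j - 1) else 0)"
    if "i < Suc N" "j < Suc N" for i j
  proof -
    have "(W * F) $$ (i, j) = (\<Sum>l<Suc N. W $$ (i, l) * F $$ (l, j))"
      using carr that by (auto simp: scalar_prod_def atLeast0LessThan)
    also have "\<dots> = (\<Sum>l<Suc N. (if l = j then W $$ (i, l) else 0) + (if l = j - 1 then (if 0 < j then - a * W $$ (i, l) else 0) else 0))"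
      using that by (intro sum.cong) (auto simp: F_def)
    also have "\<dots> = W $$ (i, j) - (if 0 < j then a * W $$ (i, j - 1) else 0)"
      using that by (auto simp: sum.distrib sum.delta)
    finally show ?thesis .
  qed
  have lin: "coeff ([:-a, 1:] * t) d = (if d = 0 then 0 else coeff t (d - 1)) - a * coeff t d" for t d
    by (cases d) (auto simp: algebra_simps)
  have Wi: "W $$ (i, j) = (if i < N then (if j < N then
        coeff (if i < n then monom 1 (n - 1 - i) * p else monom 1 (N - 1 - i) * q) (N - 1 - j) else 0)
      else if j < N then coeff s (N - 1 - j) else poly q a)" if "i < Suc N" "j < Suc N" for i j
    using that carr(4) p q
    by (auto simp: W_def S'_def sylvester_mat_sub_index' N_def)
  have Si: "S $$ (i, j) = coeff (if i < n then monom 1 (n - 1 - i) * f else monom 1 (N - i) * q) (N - j)"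
    if "i < Suc N" "j < Suc N" for i j
    using that f q unfolding S_def by (subst sylvester_mat_sub_index') (auto simp: N_def)
  \<comment> \<open>Multiplication of a row by \<open>F\<close> multiplies the polynomial stored in
    it by \<open>v - a\<close>. The bound \<open>degree t < N\<close> matters at
    \<open>j = 0\<close>, where the coefficient of \<open>t\<close> in degree \<open>N\<close> has
    to be 0.\<close>
  have row: "(if j < N then coeff t (N - 1 - j) else 0) - (if 0 < j then a * (if j - 1 < N then coeff t (N - 1 - (j - 1)) else 0) else 0)
      = coeff ([:-a, 1:] * t) (N - j)" if "j < Suc N" and t: "degree t < N" for t j
  proof -
    have "N - 1 - (j - 1) = N - j" if "0 < j" using that by simp
    moreover have "coeff t (N - j) = 0" if "j = 0" using that t by (simp add: coeff_eq_0)
    ultimately show ?thesis using that(1) by (subst lin) (auto simp: Suc_diff_Suc)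
  qed
  have qs: "q = [:-a, 1:] * s + [:poly q a:]"
    unfolding s_def using synthetic_div_correct'[of a q] by simp
  have "L * S = W * F"
  proof (rule eq_matI)
    fix i j assume "i < dim_row (W * F)" "j < dim_col (W * F)"
    then have ij: "i < Suc N" "j < Suc N" using carr by auto
    consider "i < n" "i < N" | "n \<le> i" "i < N" | "i = N" using ij by linarith
    then show "(L * S) $$ (i, j) = (W * F) $$ (i, j)"
    proof cases
      case 1
      let ?t = "monom 1 (n - 1 - i) * p"
      have deg: "degree ?t < N"
      proof -
        have "degree ?t \<le> (n - 1 - i) + m"
          using degree_mult_le[of "monom (1::'a) (n - 1 - i)" p] degree_monom_le[of "1::'a" "n - 1 - i"] p
          by linarith
        also have "\<dots> < N" using 1 by (simp add: N_def)
        finally show ?thesis .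
      qed
      have "(W * F) $$ (i, j) = coeff ([:-a, 1:] * ?t) (N - j)"
        using ij 1 by (subst row[OF ij(2) deg, symmetric]) (auto simp: WF Wi)
      also have "[:-a, 1:] * ?t = monom 1 (n - 1 - i) * f"
        by (simp only: f_def mult_ac)
      also have "coeff \<dots> (N - j) = (L * S) $$ (i, j)"
        using ij 1 by (simp add: LS Si)
      finally show ?thesis by simp
    next
      case 2
      let ?t = "monom 1 (N - 1 - i) * q"
      have deg: "degree ?t < N"
      proof -
        have "degree ?t \<le> (N - 1 - i) + n"
          using degree_mult_le[of "monom (1::'a) (N - 1 - i)" q] degree_monom_le[of "1::'a" "N - 1 - i"] q
          by linarith
        also have "\<dots> < N" using 2 by linarith
        finally show ?thesis .
      qed
      have "(W * F) $$ (i, j) = coeff ([:-a, 1:] * ?t) (N - j)"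
        using ij 2 by (subst row[OF ij(2) deg, symmetric]) (auto simp: WF Wi)
      also have "[:-a, 1:] * ?t = monom 1 (N - i) * q - Polynomial.smult a (monom 1 (N - 1 - i) * q)"
      proof -
        have "monom 1 (N - i) = [:0, 1:] * (monom 1 (N - 1 - i) :: 'a poly)"
          using 2 by (simp add: monom_Suc[symmetric] Suc_diff_Suc)
        then show ?thesis by (simp add: algebra_simps)
      qed
      also have "coeff \<dots> (N - j) = (L * S) $$ (i, j)"
        using ij 2 by (simp add: LS Si)
      finally show ?thesis by simp
    next
      case 3
      have "coeff s d = 0" if "N \<le> d" for d
      proof (cases "N = 0")
        case True
        then have "degree q = 0" using q N_def by simp
        then obtain b where "q = [:b:]" using degree_eq_zeroE by blast
        then show ?thesis by (simp add: s_def)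
      next
        case False
        have "degree s < N"
          unfolding s_def degree_synthetic_div using q False N_def by linarith
        then show ?thesis using that by (simp add: coeff_eq_0)
      qed
      then have s0: "coeff s N = 0" by simp
      have "coeff q (N - j) = coeff ([:-a, 1:] * s) (N - j) + coeff [:poly q a:] (N - j)"
        using arg_cong[OF qs, of "\<lambda>f. coeff f (N - j)"] by (simp only: coeff_add)
      also have "\<dots> = (if j < N then coeff s (N - 1 - j) else poly q a) - (if 0 < j then a * coeff s (N - j) else 0)"
      proof (cases "j < N")
        case True
        then have "N - j = Suc (N - Suc j)" by simp
        then show ?thesis using True s0 by (cases "j = 0") (auto simp: lin coeff_pCons split: nat.split)
      next
        case False
        then have "j = N" using ij by simp
        then show ?thesis using s0 by (cases N) (auto simp: lin)
      qed
      finally have "coeff q (N - j) = (if j < N then coeff s (N - 1 - j) else poly q a) - (if 0 < j then a * coeff s (N - j) else 0)" .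
      moreover have "N - 1 - (j - 1) = N - j" if "0 < j" using that by simp
      ultimately show ?thesis
        using ij 3 by (cases "N = 0") (auto simp: LS WF Si Wi N_def)
    qed
  qed (use carr in auto)
  then have "det (L * S) = det (W * F)" by simp
  then have "det S = poly q a * det S'"
    using carr by (simp add: det_mult detL detF detW mult.commute)
  then show ?thesis
    unfolding resultant_sub_def S_def S'_def f_def .
qed

lemma resultant_sub_const:
  fixes q :: "'a::comm_ring_1 poly"
  shows "resultant_sub 0 n [:c:] q = c ^ n"
proof -
  have "sylvester_mat_sub 0 n [:c:] q = c \<cdot>\<^sub>m 1\<^sub>m n"
    by (rule eq_matI) (auto simp: sylvester_mat_sub_index)
  then show ?thesis unfolding resultant_sub_def by simp
qed

text \<open>Linear factors are split off one at a time. The formal degree \<open>n\<close> may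
  exceed the degree of \<open>q\<close>, as happens after evaluating coefficients at a point where
  the leading one vanishes; this only affects the power of \<open>c\<close>.\<close>

lemma resultant_sub_prod:
  fixes q :: "'a::idom poly"
  assumes "degree q \<le> n"
  shows "resultant_sub (length as) n (Polynomial.smult c (\<Prod>a\<leftarrow>as. [:-a, 1:])) q = c ^ n * (\<Prod>a\<leftarrow>as. poly q a)"
proof (induction as)
  case Nil
  show ?case using resultant_sub_const[of n c q] by simp
next
  case (Cons b as)
  have "degree (Polynomial.smult c (\<Prod>a\<leftarrow>as. [:-a, 1:])) \<le> length as"
    using degree_linear_factors[of uminus as] by (auto intro: order.trans[OF degree_smult_le])
  from resultant_sub_linear_factor[OF this assms, of b] Cons
  show ?case by (simp add: mult_ac)
qed

lemma complex_poly_roots: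
  fixes p :: "complex poly"
  shows "\<exists>as. length as = degree p \<and> p = Polynomial.smult (lead_coeff p) (\<Prod>a\<leftarrow>as. [:-a, 1:])"
  using fundamental_theorem_algebra_factorized[of p] by (metis (full_types))

lemma resultant_sub_eq_0_iff:
  fixes p q :: "complex poly"
  assumes "p \<noteq> 0" "degree q \<le> n"
  shows "resultant_sub (degree p) n p q = 0 \<longleftrightarrow> (\<exists>v. poly p v = 0 \<and> poly q v = 0)"
proof -
  obtain as where as: "length as = degree p" "p = Polynomial.smult (lead_coeff p) (\<Prod>a\<leftarrow>as. [:-a, 1:])"
    using complex_poly_roots by blast
  have "poly p v = 0 \<longleftrightarrow> v \<in> set as" for v
  proof -
    have "poly (\<Prod>a\<leftarrow>as. [:-a, 1:]) v = 0 \<longleftrightarrow> v \<in> set as"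
      by (auto simp: poly_prod_list prod_list_zero_iff)
    then show ?thesis using assms(1) by (subst as(2)) simp
  qed
  moreover have "resultant_sub (degree p) n p q = lead_coeff p ^ n * (\<Prod>a\<leftarrow>as. poly q a)"
    using resultant_sub_prod[OF assms(2), of as "lead_coeff p"] as by simp
  ultimately show ?thesis
    using assms(1) by (auto simp: prod_list_zero_iff)
qed

section \<open>Specialization of resultants; polynomials monic in a main variable\<close>

lemma pev_smult [simp]: "pev x (Polynomial.smult a f) = Polynomial.smult (meval x a) (pev x f)"
  by (rule poly_eqI) (simp add: mev.hom_mult)

lemma pev_pderiv: "pev x (pderiv f) = pderiv (pev x f)" for f :: "complex mpol poly"
  by (rule poly_eqI) (simp add: coeff_pderiv mev.hom_mult mev.hom_add mev.hom_of_nat)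

lemma meval_resultant:
  "meval x (resultant f g) = resultant_sub (degree f) (degree g) (pev x f) (pev x g)"
  unfolding resultant_def sylvester_mat_def resultant_sub_def mev.hom_det[symmetric] pev_def
  by (subst sylvester_mat_sub_map) simp_all

lemma smult_Const_cancel:
  fixes c :: complex
  assumes "Polynomial.smult (Const (c ^ k)) f = g" "c \<noteq> 0"
  shows "f = Polynomial.smult (Const (1 / c ^ k)) g"
proof -
  have "Const (1 / c ^ k) * Const (c ^ k) = (1 :: complex mpol)"
    using assms(2) by (simp flip: Const_mult)
  then show ?thesis unfolding assms(1)[symmetric] by simp
qed

text \<open>The constant leading coefficient keeps the degree in every fibre. One fibre with
  \<open>N\<close> distinct roots makes the discriminant a nonzero polynomial, and then every fibre
  off its zero set has \<open>N\<close> distinct roots.\<close>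

locale monic_separable =
  fixes T :: "complex mpol poly" and N :: nat and c :: complex
  assumes deg: "degree T = N" and lead: "coeff T N = Const c" and c: "c \<noteq> 0" and N: "N > 0"
    and sep: "\<exists>x. card {z. poly (pev x T) z = 0} = N"
begin

lemma degree_pev: "degree (pev x T) = N"
proof (rule antisym)
  show "degree (pev x T) \<le> N"
    by (rule degree_le) (metis coeff_eq_0 coeff_pev deg mev.hom_zero)
  show "N \<le> degree (pev x T)"
    by (rule le_degree) (simp add: lead c)
qed

lemma pev_nz: "pev x T \<noteq> 0"
  using degree_pev[of x] N by auto

lemma T_nz: "T \<noteq> 0"
  using pev_nz by (metis pevh.hom_zero)

definition disc :: "complex mpol" where
  "disc = resultant T (pderiv T)"

lemma meval_disc: "meval x disc = 0 \<longleftrightarrow> (\<exists>z. poly (pev x T) z = 0 \<and> poly (pderiv (pev x T)) z = 0)"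
proof -
  have "degree (pderiv (pev x T)) \<le> degree (pderiv T)"
    by (simp add: degree_pderiv deg degree_pev)
  then show ?thesis
    unfolding disc_def meval_resultant pev_pderiv
    using resultant_sub_eq_0_iff[OF pev_nz[of x], of "pderiv (pev x T)" "degree (pderiv T)"]
    by (simp add: deg degree_pev)
qed

lemma card_roots: "meval x disc \<noteq> 0 \<longleftrightarrow> card {z. poly (pev x T) z = 0} = N"
  using rsquarefree_card_degree[OF pev_nz[of x]] rsquarefree_roots[of "pev x T"]
  by (auto simp: meval_disc degree_pev)

lemma disc_nz: "disc \<noteq> 0"
proof -
  obtain x where "card {z. poly (pev x T) z = 0} = N" using sep by blast
  then have "meval x disc \<noteq> 0" by (simp only: card_roots)
  then show ?thesis by auto
qed

text \<open>The Nullstellensatz for the hypersurface \<open>T = 0\<close>. Pseudo-division by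
  \<open>T\<close> multiplies \<open>f\<close> only by a power of the constant \<open>c\<close>. In
  a fibre with \<open>N\<close> distinct roots the remainder has \<open>N\<close> zeros but degree
  below \<open>N\<close>; so its coefficients vanish where \<open>disc\<close> does not, hence
  identically.\<close>

lemma vanishing_dvd:
  assumes "\<And>x z. poly (pev x T) z = 0 \<Longrightarrow> poly (pev x f) z = 0"
  shows "T dvd f"
proof -
  obtain q r where qr: "pseudo_divmod f T = (q, r)" by fastforce
  obtain k where k: "Polynomial.smult (Const c ^ k) f = T * q + r" and r: "r = 0 \<or> degree r < N"
    using pseudo_divmod[OF T_nz qr] by (auto simp: deg lead)
  have "r = 0"
  proof (intro poly_eqI)
    fix i
    have "coeff r i = 0"
    proof (rule meval_generic_zero[OF disc_nz])
      fix x assume "meval x disc \<noteq> 0"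
      then have card: "card {z. poly (pev x T) z = 0} = N" by (simp add: card_roots)
      have "poly (pev x r) z = 0" if "poly (pev x T) z = 0" for z
        using arg_cong[OF k, of "\<lambda>f. poly (pev x f) z"] that assms[OF that]
        by (simp add: pevh.hom_add pevh.hom_mult)
      then have sub: "{z. poly (pev x T) z = 0} \<subseteq> {z. poly (pev x r) z = 0}" by auto
      have "pev x r = 0"
      proof (rule ccontr)
        assume nz: "pev x r \<noteq> 0"
        then have "N \<le> card {z. poly (pev x r) z = 0}"
          using card card_mono[OF poly_roots_finite[OF nz] sub] by simp
        also have "\<dots> \<le> degree (pev x r)" using nz by (rule card_poly_roots_bound)
        also have "\<dots> \<le> degree r" unfolding pev_def by (rule degree_map_poly_le)
        finally show False using r nz by auto
      qed
      then show "meval x (coeff r i) = 0" by (metis coeff_0 coeff_pev)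
    qed
    then show "coeff r i = coeff 0 i" by simp
  qed
  then have "f = Polynomial.smult (Const (1 / c ^ k)) (T * q)"
    using k c by (intro smult_Const_cancel) (simp_all add: Const_power)
  then show ?thesis by (metis dvd_smult dvd_triv_left)
qed

end

text \<open>
  The polynomial parametrization makes the ideal of the zero set prime, and by
  \<open>vanishing_dvd\<close> this ideal is generated by \<open>T\<close>.
\<close>

locale parametrized_hypersurface = monic_separable +
  fixes G :: "nat \<Rightarrow> complex mpol" and Gz :: "complex mpol"
  assumes param: "poly (pev x T) z = 0 \<longleftrightarrow> (\<exists>y. x = (\<lambda>i. meval y (G i)) \<and> z = meval y Gz)"
begin

lemma prime: assumes "T dvd f * g" shows "T dvd f \<or> T dvd g"
proof -
  define \<phi> where "\<phi> f = poly (map_poly (mhom Const G) f) Gz" for f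
  interpret m: map_poly_comm_ring_hom "mhom Const G" ..
  have ev: "meval y (\<phi> f) = poly (pev (\<lambda>i. meval y (G i)) f) (meval y Gz)" for y f
    unfolding \<phi>_def
    by (induction f) (auto simp: mev.hom_add mev.hom_mult meval_subst)
  have dvd: "T dvd f \<longleftrightarrow> \<phi> f = 0" for f
  proof
    assume 0: "\<phi> f = 0"
    show "T dvd f"
    proof (rule vanishing_dvd)
      fix x z assume "poly (pev x T) z = 0"
      then obtain y where "x = (\<lambda>i. meval y (G i))" "z = meval y Gz" using param by blast
      then show "poly (pev x f) z = 0" using ev[of y f] 0 by simp
    qed
  next
    assume "T dvd f"
    then obtain g where "f = T * g" by auto
    then have "meval y (\<phi> f) = 0" for y
      using param[of "\<lambda>i. meval y (G i)" "meval y Gz"] by (auto simp: ev pevh.hom_mult)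
    then show "\<phi> f = 0" by (rule meval_zero)
  qed
  have "\<phi> (f * g) = \<phi> f * \<phi> g"
    unfolding \<phi>_def by (simp add: m.hom_mult)
  then show ?thesis using assms by (auto simp: dvd)
qed

text \<open>This replaces the Euclidean algorithm over the fraction field of the coefficients. An
  element \<open>\<rho>\<close> of least degree in the ideal of \<open>T\<close> and
  \<open>g\<close> divides a multiple of \<open>T\<close> by a power of its leading coefficient; as
  \<open>T\<close> is prime, a positive degree of \<open>\<rho>\<close> would make \<open>T\<close>
  divide \<open>\<rho>\<close> or the cofactor.\<close>

lemma bezout:
  assumes "\<not> T dvd g"
  shows "\<exists>a b R. R \<noteq> 0 \<and> a * T + b * g = [:R:]"
proof -
  define J where "J = {f. f \<noteq> 0 \<and> (\<exists>a b. f = a * T + b * g)}"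
  have lin: "h - u * f \<in> J \<or> h - u * f = 0" if hf: "h \<in> J" "f \<in> J" for h f u
  proof -
    obtain a b a' b' where "h = a * T + b * g" "f = a' * T + b' * g"
      using hf unfolding J_def by auto
    then have "h - u * f = (a - u * a') * T + (b - u * b') * g" by (simp add: algebra_simps)
    then show ?thesis unfolding J_def by blast
  qed
  have TJ: "T \<in> J" unfolding J_def using T_nz by (auto intro: exI[of _ 1] exI[of _ 0])
  have gJ: "g \<in> J" unfolding J_def using assms by (auto intro: exI[of _ 1] exI[of _ 0])
  have smJ: "Polynomial.smult s f \<in> J" if "f \<in> J" "s \<noteq> 0" for s f
  proof -
    obtain a b where "f = a * T + b * g" "f \<noteq> 0" using \<open>f \<in> J\<close> unfolding J_def by auto
    then have "Polynomial.smult s f = Polynomial.smult s a * T + Polynomial.smult s b * g"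
      by (simp add: smult_add_right)
    then have "\<exists>a b. Polynomial.smult s f = a * T + b * g" by blast
    then show ?thesis using \<open>f \<noteq> 0\<close> \<open>s \<noteq> 0\<close> by (simp add: J_def)
  qed
  have red: "\<exists>q r k. Polynomial.smult (lead_coeff f ^ k) h = f * q + r \<and> (r = 0 \<or> r \<in> J \<and> degree r < degree f)"
    if "f \<in> J" "h \<in> J" for f h
  proof -
    have fnz: "f \<noteq> 0" using that unfolding J_def by auto
    obtain q r where qr: "pseudo_divmod h f = (q, r)" by fastforce
    obtain k where k: "Polynomial.smult (lead_coeff f ^ k) h = f * q + r" and r: "r = 0 \<or> degree r < degree f"
      using pseudo_divmod[OF fnz qr] by auto
    have "r = Polynomial.smult (lead_coeff f ^ k) h - q * f" using k by (simp add: algebra_simps)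
    then have "r \<in> J \<or> r = 0"
      using lin[OF smJ[OF that(2), of "lead_coeff f ^ k"] that(1), of q] fnz by auto
    with k r show ?thesis by blast
  qed
  obtain \<rho> where \<rho>: "\<rho> \<in> J" and min: "\<And>f. f \<in> J \<Longrightarrow> degree \<rho> \<le> degree f"
    using ex_has_least_nat[of "\<lambda>f. f \<in> J" T degree] TJ by auto
  have "degree \<rho> = 0"
  proof (rule ccontr)
    assume pos: "degree \<rho> \<noteq> 0"
    have \<rho>nz: "\<rho> \<noteq> 0" using \<rho> unfolding J_def by auto
    obtain q r k where q: "Polynomial.smult (lead_coeff \<rho> ^ k) T = \<rho> * q + r"
      and r: "r = 0 \<or> r \<in> J \<and> degree r < degree \<rho>"
      using red[OF \<rho> TJ] by blast
    have "r = 0" using r min[of r] by auto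
    with q have eq: "Polynomial.smult (lead_coeff \<rho> ^ k) T = \<rho> * q" by simp
    have "T dvd \<rho> * q" by (metis eq dvd_refl dvd_smult)
    then consider "T dvd \<rho>" | "T dvd q" using prime by blast
    then show False
    proof cases
      \<comment> \<open>Now the least degree is at least \<open>N\<close>. But the pseudo-remainder
        of \<open>g\<close> modulo \<open>T\<close> lies in the ideal, has degree below
        \<open>N\<close>, and is nonzero because the multiplier is a nonzero constant and
        \<open>T\<close> does not divide \<open>g\<close>.\<close>
      case 1
      then have "N \<le> degree \<rho>" using \<rho>nz dvd_imp_degree_le[of T \<rho>] deg by simp
      moreover obtain q' r' k' where q': "Polynomial.smult (lead_coeff T ^ k') g = T * q' + r'"
        and r': "r' = 0 \<or> r' \<in> J \<and> degree r' < degree T"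
        using red[OF TJ gJ] by blast
      moreover have "r' \<noteq> 0"
      proof
        assume "r' = 0"
        with q' have "Polynomial.smult (Const (c ^ k')) g = T * q'" by (simp add: deg lead Const_power)
        then have "g = Polynomial.smult (Const (1 / c ^ k')) (T * q')"
          using c by (rule smult_Const_cancel)
        then show False using assms by (metis dvd_smult dvd_triv_left)
      qed
      ultimately show False using min[of r'] deg by simp
    next
      \<comment> \<open>Cancelling \<open>T\<close> makes \<open>\<rho>\<close> a divisor of a power
        of its own leading coefficient, which has degree 0.\<close>
      case 2
      then obtain q2 where "q = T * q2" by auto
      with eq have "T * [:lead_coeff \<rho> ^ k:] = T * (\<rho> * q2)" by (simp add: mult_ac)
      then have "[:lead_coeff \<rho> ^ k:] = \<rho> * q2" using mult_left_cancel[OF T_nz] by blast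
      moreover have "lead_coeff \<rho> ^ k \<noteq> 0" using \<rho>nz by simp
      ultimately have "degree \<rho> + degree q2 = 0"
        by (metis degree_mult_eq degree_pCons_0 mult_eq_0_iff pCons_eq_0_iff)
      with pos show False by simp
    qed
  qed
  then obtain R where "\<rho> = [:R:]" using degree_eq_zeroE by blast
  with \<rho> have "[:R:] \<noteq> 0" "\<exists>a b. [:R:] = a * T + b * g" unfolding J_def by simp_all
  then obtain a b where "[:R:] \<noteq> 0" "[:R:] = a * T + b * g" by blast
  then have "R \<noteq> 0 \<and> a * T + b * g = [:R:]" by (metis pCons_0_0)
  then show ?thesis by blast
qed

text \<open>In a fibre without multiple roots a square factor \<open>y\<close> can have no root, so
  \<open>y\<close> has degree 0 in the main variable. Then it divides the constant leading
  coefficient \<open>c\<close> and is a unit.\<close>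

lemma squarefree_uni:
  assumes T: "T = uni e T0"
  shows "squarefree T0"
  unfolding squarefree_def
proof (intro allI impI)
  fix y assume "y\<^sup>2 dvd T0"
  then obtain z where "T0 = y\<^sup>2 * z" by auto
  then have eq: "T = uni e y * uni e y * uni e z"
    by (simp add: T unih.hom_mult power2_eq_square)
  have "coeff (uni e y) i = 0" if "i > 0" for i
  proof (rule meval_generic_zero[OF disc_nz])
    fix x assume disc: "meval x disc \<noteq> 0"
    let ?y = "pev x (uni e y)"
    have "poly ?y t \<noteq> 0" for t
    proof
      assume "poly ?y t = 0"
      moreover have "pev x T = ?y * ?y * pev x (uni e z)" by (simp add: eq pevh.hom_mult)
      ultimately have "poly (pev x T) t = 0" "poly (pderiv (pev x T)) t = 0"
        by (simp_all add: pderiv_mult)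
      with disc show False by (auto simp: meval_disc)
    qed
    then have "constant (poly ?y)" using fundamental_theorem_of_algebra[of ?y] by blast
    then have "degree ?y = 0" by (simp add: constant_degree)
    then show "meval x (coeff (uni e y) i) = 0"
      using that by (metis coeff_eq_0 coeff_pev)
  qed
  then have "degree (uni e y) = 0"
    by (metis gr0I leading_coeff_0_iff degree_0)
  then obtain y0 where y0: "uni e y = [:y0:]" using degree_eq_zeroE by blast
  then have "y = y0" using poly_uni[of e y] by simp
  have "Const c = y0 * (y0 * coeff (uni e z) N)"
    using arg_cong[OF eq, of "\<lambda>f. coeff f N"] by (simp add: lead y0 mult_ac)
  then have "1 = y0 * (y0 * coeff (uni e z) N * Const (1 / c))"
    using c by (metis (no_types, opaque_lifting) Const_1 Const_mult mult.assoc nonzero_eq_divide_eq mult.commute)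
  then show "y dvd 1" unfolding \<open>y = y0\<close> by (rule dvdI)
qed

text \<open>\<open>D = T0 * g\<close>, and \<open>g\<close> must be constant. Squarefreeness keeps
  \<open>T\<close> from dividing \<open>g\<close>, so \<open>bezout\<close> yields a nonzero
  \<open>R\<close> free of the main variable; a root of \<open>g\<close> in a fibre with
  \<open>R\<close> nonzero would be a zero of \<open>D\<close> but not of \<open>T\<close>. Hence
  \<open>g\<close> is free of the main variable too, and it vanishes nowhere, since a zero would
  fill a whole fibre with zeros of \<open>T\<close>.\<close>

lemma unique_uni:
  assumes T: "T = uni e T0" and sq: "squarefree D"
    and zeros: "\<And>x. meval x D = 0 \<longleftrightarrow> meval x T0 = 0"
  shows "\<exists>a. a \<noteq> 0 \<and> T0 = Const a * D"
proof -
  have zeros': "poly (pev x (uni e D)) z = 0 \<longleftrightarrow> poly (pev x T) z = 0" for x z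
    unfolding T poly_pev_uni by (rule zeros)
  then have "T dvd uni e D" by (intro vanishing_dvd) simp
  then obtain g' where g': "uni e D = T * g'" by auto
  define g where "g = poly g' (X e)"
  have D: "D = T0 * g"
    using arg_cong[OF g', of "\<lambda>f. poly f (X e)"] by (simp add: poly_uni T g_def)
  have UD: "uni e D = T * uni e g"
    by (simp add: D T unih.hom_mult)
  have nd: "\<not> T dvd uni e g"
  proof
    assume "T dvd uni e g"
    then obtain h where "uni e g = T * h" by auto
    then have "g = T0 * poly h (X e)"
      using arg_cong[of _ _ "\<lambda>f. poly f (X e)"] by (metis T poly_mult poly_uni)
    with D have "T0\<^sup>2 dvd D" by (simp add: power2_eq_square mult.assoc[symmetric])
    with sq have "T0 dvd 1" by (auto simp: squarefree_def)
    then have "T dvd 1" unfolding T by (metis dvdE dvdI unih.hom_mult unih.hom_one)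
    then show False using N deg by (metis degree_1 dvd_imp_degree_le not_gr_zero le_zero_eq one_neq_zero)
  qed
  have "degree (uni e g) = 0"
  proof (rule ccontr)
    assume pos: "degree (uni e g) \<noteq> 0"
    obtain a b R where R: "R \<noteq> 0" "a * T + b * uni e g = [:R:]" using bezout[OF nd] by blast
    \<comment> \<open>The product provides one point at which \<open>R\<close> is nonzero and the
      fibre of \<open>g\<close> keeps its positive degree, hence has a root.\<close>
    have "R * lead_coeff (uni e g) \<noteq> 0" using R pos by auto
    then obtain x where x: "meval x (R * lead_coeff (uni e g)) \<noteq> 0" using meval_zero by blast
    then have xR: "meval x R \<noteq> 0" and xl: "coeff (pev x (uni e g)) (degree (uni e g)) \<noteq> 0"
      by (auto simp: mev.hom_mult)
    have "degree (pev x (uni e g)) \<noteq> 0" using le_degree[OF xl] pos by simp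
    then have "\<not> constant (poly (pev x (uni e g)))" by (simp add: constant_degree)
    then obtain z where z: "poly (pev x (uni e g)) z = 0"
      using fundamental_theorem_of_algebra by blast
    then have "poly (pev x T) z = 0"
      using zeros'[of x z] by (simp add: UD pevh.hom_mult)
    then have "poly (pev x [:R:]) z = 0"
      unfolding R(2)[symmetric] using z by (simp add: pevh.hom_add pevh.hom_mult)
    then show False using xR by simp
  qed
  then obtain \<gamma> where \<gamma>: "uni e g = [:\<gamma>:]" using degree_eq_zeroE by blast
  then have "g = \<gamma>" using poly_uni[of e g] by simp
  have "meval x \<gamma> \<noteq> 0" for x
  proof
    assume "meval x \<gamma> = 0"
    then have "poly (pev x T) z = 0" for z
      using zeros'[of x z] by (simp add: UD pevh.hom_mult \<gamma>)
    then show False using pev_nz[of x] poly_all_0_iff_0 by blast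
  qed
  then obtain d where d: "d \<noteq> 0" "\<gamma> = Const d" using nowhere_zero_Const by blast
  then have "T0 = Const (1 / d) * D"
    by (simp add: D \<open>g = \<gamma>\<close> mult.left_commute[of "Const _" T0] flip: Const_mult)
  then show ?thesis using d by (intro exI[of _ "1 / d"]) simp
qed

end

subsection \<open>Hausdorff dimension of polynomial images\<close>

text \<open>Hausdorff measure zero without the mesh size, since a small total of
  \<open>\<rho> j powr d\<close> already makes every piece small. Upper bounds \<open>\<rho>\<close>
  stand in for exact diameters so that estimates can be inserted directly.\<close>

definition hnull :: "nat \<Rightarrow> real \<Rightarrow> (nat \<Rightarrow> real) set \<Rightarrow> bool" where
  "hnull n d S \<longleftrightarrow> (\<forall>\<epsilon>>0. \<exists>U \<rho>. S \<subseteq> (\<Union>j::nat. U j) \<and>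
     (\<forall>j. U j \<subseteq> coord_space n \<and> 0 \<le> \<rho> j \<and> (\<forall>x\<in>U j. \<forall>y\<in>U j. edist n x y \<le> \<rho> j)) \<and>
     (suminf (\<lambda>j. ennreal (\<rho> j powr d))) \<le> ennreal \<epsilon>)"

lemma ennreal_le_suminf: "f j \<le> suminf f" for f :: "nat \<Rightarrow> ennreal"
proof -
  have "sum f {j} \<le> suminf f" by (rule sum_le_suminf) auto
  then show ?thesis by simp
qed

lemma ediam_le:
  assumes "0 \<le> \<rho>" "\<And>x y. x \<in> U \<Longrightarrow> y \<in> U \<Longrightarrow> edist n x y \<le> \<rho>"
  shows "ediam n U \<le> \<rho>"
  unfolding ediam_def using assms by (auto intro!: cSUP_least)

lemma edist_le_ediam:
  assumes "\<And>x y. x \<in> U \<Longrightarrow> y \<in> U \<Longrightarrow> edist n x y \<le> \<delta>" and xy: "x \<in> U" "y \<in> U"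
  shows "edist n x y \<le> ediam n U"
proof -
  have "bdd_above ((\<lambda>(x, y). edist n x y) ` (U \<times> U))"
    using assms(1) by (intro bdd_aboveI[of _ \<delta>]) auto
  then have "(\<lambda>(x, y). edist n x y) (x, y) \<le> (SUP (x, y)\<in>U \<times> U. edist n x y)"
    using xy by (intro cSUP_upper) auto
  then show ?thesis using xy by (auto simp: ediam_def)
qed

lemma edist_nonneg: "0 \<le> edist n x y"
  by (simp add: edist_def)

lemma ediam_nonneg:
  assumes "\<And>x y. x \<in> U \<Longrightarrow> y \<in> U \<Longrightarrow> edist n x y \<le> \<delta>"
  shows "0 \<le> ediam n U"
proof (cases "U = {}")
  case False
  then obtain x where "x \<in> U" by auto
  have "edist n x x \<le> ediam n U" using assms \<open>x \<in> U\<close> \<open>x \<in> U\<close> by (rule edist_le_ediam)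
  then show ?thesis using edist_nonneg[of n x x] by simp
qed (simp add: ediam_def)

lemma hausdorff_measure_0_iff:
  assumes d: "d > 0"
  shows "hausdorff_measure n d S = 0 \<longleftrightarrow> hnull n d S"
proof
  assume H: "hausdorff_measure n d S = 0"
  show "hnull n d S"
    unfolding hnull_def
  proof (intro allI impI)
    fix \<epsilon> :: real assume \<epsilon>: "\<epsilon> > 0"
    have "(INF U\<in>{U. delta_cover n 1 S U}. suminf (\<lambda>j. ennreal (ediam n (U j) powr d))) \<le> hausdorff_measure n d S"
      unfolding hausdorff_measure_def by (rule SUP_upper2[where i = 1]) auto
    also have "\<dots> < ennreal \<epsilon>" using H \<epsilon> by simp
    finally obtain U where U: "delta_cover n 1 S U" "suminf (\<lambda>j. ennreal (ediam n (U j) powr d)) < ennreal \<epsilon>"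
      unfolding INF_less_iff by auto
    then show "\<exists>U \<rho>. S \<subseteq> (\<Union>j::nat. U j) \<and>
     (\<forall>j. U j \<subseteq> coord_space n \<and> 0 \<le> \<rho> j \<and> (\<forall>x\<in>U j. \<forall>y\<in>U j. edist n x y \<le> \<rho> j)) \<and>
     (suminf (\<lambda>j. ennreal (\<rho> j powr d))) \<le> ennreal \<epsilon>"
      unfolding delta_cover_def
      by (intro exI[of _ U] exI[of _ "\<lambda>j. ediam n (U j)"])
        (auto intro!: ediam_nonneg[where \<delta> = 1] edist_le_ediam[where \<delta> = 1])
  qed
next
  assume H: "hnull n d S"
  have "(INF U\<in>{U. delta_cover n \<delta> S U}. suminf (\<lambda>j. ennreal (ediam n (U j) powr d))) = 0"
    if \<delta>: "\<delta> > 0" for \<delta>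
  proof -
    have "(INF U\<in>{U. delta_cover n \<delta> S U}. suminf (\<lambda>j. ennreal (ediam n (U j) powr d))) \<le> 0 + ennreal \<epsilon>"
      if \<epsilon>: "\<epsilon> > 0" for \<epsilon>
    proof -
      \<comment> \<open>A total of at most \<open>\<delta> powr d\<close> forces each single
        \<open>\<rho> j\<close> to be at most \<open>\<delta>\<close>.\<close>
      have "min \<epsilon> (\<delta> powr d) > 0" using \<delta> \<epsilon> by simp
      then obtain U \<rho> where U: "S \<subseteq> (\<Union>j::nat. U j)"
         "\<And>j. U j \<subseteq> coord_space n" "\<And>j. 0 \<le> \<rho> j" "\<And>j x y. x \<in> U j \<Longrightarrow> y \<in> U j \<Longrightarrow> edist n x y \<le> \<rho> j"
         and sum: "(suminf (\<lambda>j. ennreal (\<rho> j powr d))) \<le> ennreal (min \<epsilon> (\<delta> powr d))"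
        using H unfolding hnull_def by meson
      have "\<rho> j \<le> \<delta>" for j
      proof -
        have "ennreal (\<rho> j powr d) \<le> (suminf (\<lambda>j. ennreal (\<rho> j powr d)))"
          by (rule ennreal_le_suminf)
        also have "\<dots> \<le> ennreal (\<delta> powr d)" using sum by (rule order_trans) (auto intro: ennreal_leI)
        finally have "\<rho> j powr d \<le> \<delta> powr d" by (simp add: ennreal_le_iff)
        then show ?thesis using d \<delta> U(3)[of j] by (metis less_le_not_le linorder_not_less powr_less_mono2)
      qed
      then have "delta_cover n \<delta> S U"
        unfolding delta_cover_def using U(1,2,4) by (meson order_trans)
      moreover have "suminf (\<lambda>j. ennreal (ediam n (U j) powr d)) \<le> (suminf (\<lambda>j. ennreal (\<rho> j powr d)))"
        using d U(3,4) by (intro suminf_le ennreal_leI powr_mono2 ediam_le ediam_nonneg) auto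
      ultimately show ?thesis
        using sum by (intro INF_lower2[of U]) (auto intro!: order_trans[OF _ order_trans[OF sum]] ennreal_leI)
    qed
    then show ?thesis
      using ennreal_le_epsilon[of 0] by (metis le_zero_eq)
  qed
  then show "hausdorff_measure n d S = 0"
    unfolding hausdorff_measure_def by (simp add: SUP_eq_const)
qed

lemma hausdorff_dim_le:
  assumes "0 \<le> m" "\<And>d. d > m \<Longrightarrow> hnull n d S"
  shows "hausdorff_dim n S \<le> ereal m"
proof (rule ereal_le_epsilon2)
  fix e :: real assume "e > 0"
  then show "hausdorff_dim n S \<le> ereal m + ereal e"
    unfolding hausdorff_dim_def using assms
    by (intro Inf_lower) (auto simp: hausdorff_measure_0_iff)
qed

lemma hausdorff_dim_ge:
  assumes "\<And>d. 0 < d \<Longrightarrow> d < m \<Longrightarrow> \<not> hnull n d S"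
  shows "ereal m \<le> hausdorff_dim n S"
  unfolding hausdorff_dim_def
proof (rule Inf_greatest)
  fix z assume "z \<in> ereal ` {d. 0 < d \<and> hausdorff_measure n d S = 0}"
  then obtain d where "z = ereal d" "0 < d" "hnull n d S" by (auto simp: hausdorff_measure_0_iff)
  then show "ereal m \<le> z" using assms[of d] by (cases "d < m") auto
qed

lemma hnull_subset: "hnull n d T \<Longrightarrow> S \<subseteq> T \<Longrightarrow> hnull n d S"
  unfolding hnull_def by (meson subset_trans)

lemma hnull_UN:
  fixes S :: "nat \<Rightarrow> (nat \<Rightarrow> real) set"
  assumes "\<And>i. hnull n d (S i)"
  shows "hnull n d (\<Union>i. S i)"
  unfolding hnull_def
proof (intro allI impI)
  fix \<epsilon> :: real assume \<epsilon>: "\<epsilon> > 0"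
  have "\<forall>i. \<exists>U \<rho>. S i \<subseteq> (\<Union>j::nat. U j) \<and>
     (\<forall>j. U j \<subseteq> coord_space n \<and> 0 \<le> \<rho> j \<and> (\<forall>x\<in>U j. \<forall>y\<in>U j. edist n x y \<le> \<rho> j)) \<and>
     (suminf (\<lambda>j. ennreal (\<rho> j powr d))) \<le> ennreal (\<epsilon> * (1/2) ^ Suc i)"
    using assms \<epsilon> unfolding hnull_def by simp
  then obtain U \<rho> where U: "\<And>i. S i \<subseteq> (\<Union>j::nat. U i j)"
     "\<And>i j. U i j \<subseteq> coord_space n" "\<And>i j. 0 \<le> (\<rho> i j :: real)"
     "\<And>i j x y. x \<in> U i j \<Longrightarrow> y \<in> U i j \<Longrightarrow> edist n x y \<le> \<rho> i j"
     and sum: "\<And>i. (suminf (\<lambda>j. ennreal (\<rho> i j powr d))) \<le> ennreal (\<epsilon> * (1/2) ^ Suc i)"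
    by metis
  let ?U = "\<lambda>l. case prod_decode l of (i, j) \<Rightarrow> U i j"
  let ?\<rho> = "\<lambda>l. case prod_decode l of (i, j) \<Rightarrow> \<rho> i j"
  have "(\<Union>i. S i) \<subseteq> (\<Union>l. ?U l)"
  proof
    fix x assume "x \<in> (\<Union>i. S i)"
    then obtain i j where "x \<in> U i j" using U(1) by blast
    then have "x \<in> ?U (prod_encode (i, j))" by simp
    then show "x \<in> (\<Union>l. ?U l)" by (rule UN_I[OF UNIV_I])
  qed
  moreover have "(suminf (\<lambda>l. ennreal (?\<rho> l powr d))) \<le> ennreal \<epsilon>"
  proof -
    have "(suminf (\<lambda>l. ennreal (?\<rho> l powr d))) = (suminf (\<lambda>l. (\<lambda>(i, j). ennreal (\<rho> i j powr d)) (prod_decode l)))"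
      by (intro suminf_cong) (auto split: prod.split)
    also have "\<dots> = (suminf (\<lambda>i. (suminf (\<lambda>j. ennreal (\<rho> i j powr d)))))"
      by (subst suminf_ennreal_2dimen[where g = "\<lambda>i. (suminf (\<lambda>j. ennreal (\<rho> i j powr d)))"]) (auto simp: o_def)
    also have "\<dots> \<le> (suminf (\<lambda>i. ennreal (\<epsilon> * (1/2) ^ Suc i)))"
      by (intro suminf_le sum) auto
    also have "\<dots> = ennreal (suminf (\<lambda>i. \<epsilon> * (1/2) ^ Suc i))"
      using \<epsilon> by (intro suminf_ennreal2) (auto intro: summable_mult power_half_series[THEN sums_summable])
    also have "(suminf (\<lambda>i. \<epsilon> * (1/2) ^ Suc i)) = \<epsilon>"
      using sums_unique[OF sums_mult[OF power_half_series, of \<epsilon>]] by simp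
    finally show ?thesis .
  qed
  ultimately show "\<exists>U \<rho>. (\<Union>i. S i) \<subseteq> (\<Union>j::nat. U j) \<and>
     (\<forall>j. U j \<subseteq> coord_space n \<and> 0 \<le> \<rho> j \<and> (\<forall>x\<in>U j. \<forall>y\<in>U j. edist n x y \<le> \<rho> j)) \<and>
     (suminf (\<lambda>j. ennreal (\<rho> j powr d))) \<le> ennreal \<epsilon>"
    using U(2-4) by (intro exI[of _ ?U] exI[of _ ?\<rho>]) (auto split: prod.split)
qed

lemma hnull_Un: "hnull n d S \<Longrightarrow> hnull n d T \<Longrightarrow> hnull n d (S \<union> T)"
  using hnull_UN[of n d "\<lambda>i. if i = 0 then S else T"]
  by (rule hnull_subset) (auto split: if_splits)

lemma hnull_empty: "hnull n d {}"
  unfolding hnull_def by (intro allI impI exI[of _ "\<lambda>_. {}"] exI[of _ "\<lambda>_. 0"]) auto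

lemma hnull_finite_UN:
  assumes "finite I" "\<And>i. i \<in> I \<Longrightarrow> hnull n d (S i)"
  shows "hnull n d (\<Union>i\<in>I. S i)"
  using assms by (induction I rule: finite_induct) (auto intro: hnull_Un hnull_empty)

text \<open>The bound \<open>B\<close> on the values is carried through the induction because the
  Lipschitz constant of a product depends on it.\<close>

lemma meval_lipschitz:
  fixes p :: "real mpol"
  assumes R: "R \<ge> 0"
  shows "\<exists>B L. B \<ge> 0 \<and> L \<ge> 0 \<and> (\<forall>x. (\<forall>i. \<bar>x i\<bar> \<le> R) \<longrightarrow> \<bar>meval x p\<bar> \<le> B) \<and>
    (\<forall>x y \<delta>. (\<forall>i. \<bar>x i\<bar> \<le> R) \<longrightarrow> (\<forall>i. \<bar>y i\<bar> \<le> R) \<longrightarrow> (\<forall>i. \<bar>x i - y i\<bar> \<le> \<delta>) \<longrightarrow>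
       \<bar>meval x p - meval y p\<bar> \<le> L * \<delta>)"
proof (induction p rule: mpol_induct)
  case (Const c)
  then show ?case by (intro exI[of _ "\<bar>c\<bar>"] exI[of _ 0]) auto
next
  case (X i)
  then show ?case using R by (intro exI[of _ R] exI[of _ 1]) auto
next
  case (add p q)
  then obtain B L B' L' where p: "B \<ge> 0" "L \<ge> 0" "\<And>x. (\<forall>i. \<bar>x i\<bar> \<le> R) \<Longrightarrow> \<bar>meval x p\<bar> \<le> B"
     "\<And>x y \<delta>. (\<forall>i. \<bar>x i\<bar> \<le> R) \<Longrightarrow> (\<forall>i. \<bar>y i\<bar> \<le> R) \<Longrightarrow> (\<forall>i. \<bar>x i - y i\<bar> \<le> \<delta>) \<Longrightarrow>
       \<bar>meval x p - meval y p\<bar> \<le> L * \<delta>"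
    and q: "B' \<ge> 0" "L' \<ge> 0" "\<And>x. (\<forall>i. \<bar>x i\<bar> \<le> R) \<Longrightarrow> \<bar>meval x q\<bar> \<le> B'"
     "\<And>x y \<delta>. (\<forall>i. \<bar>x i\<bar> \<le> R) \<Longrightarrow> (\<forall>i. \<bar>y i\<bar> \<le> R) \<Longrightarrow> (\<forall>i. \<bar>x i - y i\<bar> \<le> \<delta>) \<Longrightarrow>
       \<bar>meval x q - meval y q\<bar> \<le> L' * \<delta>"
    by blast
  show ?case
  proof (rule exI[of _ "B + B'"], rule exI[of _ "L + L'"], intro conjI allI impI)
    fix x :: "nat \<Rightarrow> real" assume "\<forall>i. \<bar>x i\<bar> \<le> R"
    then show "\<bar>meval x (p + q)\<bar> \<le> B + B'" using p(3)[of x] q(3)[of x] by (simp add: mev.hom_add)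
  next
    fix x y :: "nat \<Rightarrow> real" and \<delta> assume "\<forall>i. \<bar>x i\<bar> \<le> R" "\<forall>i. \<bar>y i\<bar> \<le> R" "\<forall>i. \<bar>x i - y i\<bar> \<le> \<delta>"
    then show "\<bar>meval x (p + q) - meval y (p + q)\<bar> \<le> (L + L') * \<delta>"
      using p(4)[of x y \<delta>] q(4)[of x y \<delta>] by (simp add: mev.hom_add distrib_right)
  qed (use p q in auto)
next
  case (mult p q)
  then obtain B L B' L' where p: "B \<ge> 0" "L \<ge> 0" "\<And>x. (\<forall>i. \<bar>x i\<bar> \<le> R) \<Longrightarrow> \<bar>meval x p\<bar> \<le> B"
     "\<And>x y \<delta>. (\<forall>i. \<bar>x i\<bar> \<le> R) \<Longrightarrow> (\<forall>i. \<bar>y i\<bar> \<le> R) \<Longrightarrow> (\<forall>i. \<bar>x i - y i\<bar> \<le> \<delta>) \<Longrightarrow>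
       \<bar>meval x p - meval y p\<bar> \<le> L * \<delta>"
    and q: "B' \<ge> 0" "L' \<ge> 0" "\<And>x. (\<forall>i. \<bar>x i\<bar> \<le> R) \<Longrightarrow> \<bar>meval x q\<bar> \<le> B'"
     "\<And>x y \<delta>. (\<forall>i. \<bar>x i\<bar> \<le> R) \<Longrightarrow> (\<forall>i. \<bar>y i\<bar> \<le> R) \<Longrightarrow> (\<forall>i. \<bar>x i - y i\<bar> \<le> \<delta>) \<Longrightarrow>
       \<bar>meval x q - meval y q\<bar> \<le> L' * \<delta>"
    by blast
  show ?case
  proof (rule exI[of _ "B * B'"], rule exI[of _ "B * L' + B' * L"], intro conjI allI impI)
    fix x :: "nat \<Rightarrow> real" assume "\<forall>i. \<bar>x i\<bar> \<le> R"
    then show "\<bar>meval x (p * q)\<bar> \<le> B * B'"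
      using p(1) p(3)[of x] q(3)[of x] by (simp add: mev.hom_mult abs_mult mult_mono)
  next
    fix x y :: "nat \<Rightarrow> real" and \<delta> assume xy: "\<forall>i. \<bar>x i\<bar> \<le> R" "\<forall>i. \<bar>y i\<bar> \<le> R" "\<forall>i. \<bar>x i - y i\<bar> \<le> \<delta>"
    have "\<delta> \<ge> 0" using xy(3) abs_ge_zero order_trans by blast
    have "meval x (p * q) - meval y (p * q) =
      meval x p * (meval x q - meval y q) + meval y q * (meval x p - meval y p)"
      by (simp add: mev.hom_mult algebra_simps)
    also have "\<bar>\<dots>\<bar> \<le> \<bar>meval x p\<bar> * \<bar>meval x q - meval y q\<bar> + \<bar>meval y q\<bar> * \<bar>meval x p - meval y p\<bar>"
      by (metis abs_mult abs_triangle_ineq)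
    also have "\<dots> \<le> B * (L' * \<delta>) + B' * (L * \<delta>)"
      using p q xy \<open>\<delta> \<ge> 0\<close> by (intro add_mono mult_mono) auto
    finally show "\<bar>meval x (p * q) - meval y (p * q)\<bar> \<le> (B * L' + B' * L) * \<delta>"
      by (simp add: algebra_simps)
  qed (use p q in auto)
qed

text \<open>The parameter space is a countable union of cubes, on each of which the map is
  Lipschitz. A grid of mesh \<open>1 / M\<close> has of the order of \<open>M^m\<close> cells, with
  images of diameter at most \<open>K / M\<close>; the sum is of order \<open>M^(m - d)\<close> and
  tends to 0.\<close>

lemma hnull_polynomial_image:
  fixes H :: "nat \<Rightarrow> real mpol"
  assumes d: "d > real m" and S: "S \<subseteq> coord_space n"
    and img: "\<And>x. x \<in> S \<Longrightarrow> \<exists>y\<in>coord_space m. \<forall>i<n. x i = meval y (H i)"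
  shows "hnull n d S"
proof -
  have d0: "d > 0" using d by (meson le_less_trans of_nat_0_le_iff)
  define C where "C N = {x\<in>S. \<exists>y\<in>coord_space m. (\<forall>i. \<bar>y i\<bar> \<le> real N) \<and> (\<forall>i<n. x i = meval y (H i))}" for N
  have "S \<subseteq> (\<Union>N. C N)"
  proof
    fix x assume x: "x \<in> S"
    then obtain y where y: "y \<in> coord_space m" "\<forall>i<n. x i = meval y (H i)" using img by blast
    obtain N where N: "(\<Sum>i<m. \<bar>y i\<bar>) \<le> real N" using real_arch_simple by blast
    have "\<bar>y i\<bar> \<le> real N" for i
    proof (cases "i < m")
      case True
      then have "\<bar>y i\<bar> \<le> (\<Sum>i<m. \<bar>y i\<bar>)" by (intro member_le_sum) auto
      with N show ?thesis by simp
    qed (use y(1) in \<open>auto simp: coord_space_def\<close>)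
    with x y show "x \<in> (\<Union>N. C N)" unfolding C_def by blast
  qed
  moreover have "hnull n d (C N)" for N
    unfolding hnull_def
  proof (intro allI impI)
    fix \<epsilon> :: real assume \<epsilon>: "\<epsilon> > 0"
    have "\<forall>i. \<exists>L\<ge>0. \<forall>x y \<delta>. (\<forall>i. \<bar>x i\<bar> \<le> real N) \<longrightarrow> (\<forall>i. \<bar>y i\<bar> \<le> real N) \<longrightarrow> (\<forall>i. \<bar>x i - y i\<bar> \<le> \<delta>) \<longrightarrow>
       \<bar>meval x (H i) - meval y (H i)\<bar> \<le> L * \<delta>"
      using meval_lipschitz[of "real N"] by (meson of_nat_0_le_iff)
    then obtain L where L: "\<And>i. L i \<ge> 0"
      "\<And>i x y \<delta>. (\<forall>i. \<bar>x i\<bar> \<le> real N) \<Longrightarrow> (\<forall>i. \<bar>y i\<bar> \<le> real N) \<Longrightarrow> (\<forall>i. \<bar>x i - y i\<bar> \<le> \<delta>) \<Longrightarrow>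
       \<bar>meval x (H i) - meval y (H i)\<bar> \<le> L i * \<delta>"
      by metis
    define K where "K = (\<Sum>i<n. L i)"
    have K: "K \<ge> 0" unfolding K_def using L(1) by (simp add: sum_nonneg)
    have "(\<lambda>M. real (2 * N * M + 1) ^ m * (K / real M) powr d) \<longlonglongrightarrow> 0"
    proof (rule Lim_null_comparison)
      have "(\<lambda>M. real M powr (real m - d)) \<longlonglongrightarrow> 0"
        using d by (intro tendsto_neg_powr filterlim_real_sequentially) auto
      then have "(\<lambda>M. real (2 * N + 1) ^ m * K powr d * real M powr (real m - d)) \<longlonglongrightarrow> real (2 * N + 1) ^ m * K powr d * 0"
        by (intro tendsto_mult tendsto_const)
      then show "(\<lambda>M. real (2 * N + 1) ^ m * K powr d * real M powr (real m - d)) \<longlonglongrightarrow> 0" by simp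
      show "\<forall>\<^sub>F M in sequentially. norm (real (2 * N * M + 1) ^ m * (K / real M) powr d) \<le> real (2 * N + 1) ^ m * K powr d * real M powr (real m - d)"
        using eventually_gt_at_top[of 0]
      proof eventually_elim
        case (elim M)
        have "real (2 * N * M + 1) ^ m \<le> (real (2 * N + 1) * real M) ^ m"
        proof (rule power_mono)
          have "2 * N * M + 1 \<le> (2 * N + 1) * M" using elim by simp
          then show "real (2 * N * M + 1) \<le> real (2 * N + 1) * real M" by (metis of_nat_le_iff of_nat_mult)
        qed simp
        then have "real (2 * N * M + 1) ^ m * (K / real M) powr d \<le> (real (2 * N + 1) * real M) ^ m * (K / real M) powr d"
          by (intro mult_right_mono) auto
        also have "\<dots> = real (2 * N + 1) ^ m * K powr d * real M powr (real m - d)"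
          using elim K by (simp add: power_mult_distrib powr_divide powr_diff powr_realpow)
        finally show ?case by simp
      qed
    qed
    then have "\<forall>\<^sub>F M in sequentially. real (2 * N * M + 1) ^ m * (K / real M) powr d < \<epsilon>"
      using \<epsilon> by (rule order_tendstoD)
    then have "\<forall>\<^sub>F M in sequentially. real (2 * N * M + 1) ^ m * (K / real M) powr d < \<epsilon> \<and> M > 0"
      using eventually_gt_at_top[of 0] by (rule eventually_conj)
    then obtain M :: nat where M: "real (2 * N * M + 1) ^ m * (K / real M) powr d < \<epsilon>" "M > 0"
      using eventually_happens' sequentially_bot by blast
    define I where "I = {..<m} \<rightarrow>\<^sub>E {..2 * N * M}"
    have finI: "finite I" unfolding I_def by (intro finite_PiE) auto
    have cardI: "card I = (2 * N * M + 1) ^ m" unfolding I_def by (simp add: card_funcsetE)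
    \<comment> \<open>The image of the grid cell with index \<open>g\<close>. Indices run from 0 to
      \<open>2 * N * M\<close> inclusive because \<open>y i = N\<close> can occur.\<close>
    define V where "V g = {x\<in>C N. \<exists>y\<in>coord_space m. (\<forall>i. \<bar>y i\<bar> \<le> real N) \<and> (\<forall>i<n. x i = meval y (H i)) \<and>
        (\<forall>i<m. nat \<lfloor>(y i + real N) * real M\<rfloor> = g i)}" for g
    obtain e where e: "bij_betw e {..<card I} I" using ex_bij_betw_nat_finite[OF finI] by (auto simp: atLeast0LessThan)
    define U where "U j = (if j < card I then V (e j) else {})" for j
    define \<rho> where "\<rho> j = (if j < card I then K / real M else 0)" for j
    have cover: "C N \<subseteq> (\<Union>j. U j)"
    proof
      fix x assume x: "x \<in> C N"
      then obtain y where y: "y \<in> coord_space m" "\<forall>i. \<bar>y i\<bar> \<le> real N" "\<forall>i<n. x i = meval y (H i)"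
        unfolding C_def by auto
      define g where "g = restrict (\<lambda>i. nat \<lfloor>(y i + real N) * real M\<rfloor>) {..<m}"
      have "nat \<lfloor>(y i + real N) * real M\<rfloor> \<le> 2 * N * M" for i
      proof -
        have "(y i + real N) * real M \<le> (2 * real N) * real M"
          using y(2) by (intro mult_right_mono) (auto simp: abs_le_iff)
        then have "\<lfloor>(y i + real N) * real M\<rfloor> \<le> int (2 * N * M)" by (simp add: floor_le_iff)
        then show ?thesis by (simp only: nat_le_iff)
      qed
      then have "g \<in> I" unfolding g_def I_def by (auto simp: PiE_iff)
      then have "g \<in> e ` {..<card I}" using e unfolding bij_betw_def by simp
      then obtain j where "j < card I" "e j = g" by blast
      moreover have "x \<in> V g" unfolding V_def using x y by (auto simp: g_def)
      ultimately show "x \<in> (\<Union>j. U j)" unfolding U_def by force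
    qed
    have diam: "edist n x x' \<le> \<rho> j" if "x \<in> U j" "x' \<in> U j" for x x' j
    proof -
      have j: "j < card I" and "x \<in> V (e j)" "x' \<in> V (e j)" using that by (auto simp: U_def split: if_splits)
      then obtain y y' where
        y: "y \<in> coord_space m" "\<forall>i. \<bar>y i\<bar> \<le> real N" "\<forall>i<n. x i = meval y (H i)" "\<forall>i<m. nat \<lfloor>(y i + real N) * real M\<rfloor> = e j i"
        and y': "y' \<in> coord_space m" "\<forall>i. \<bar>y' i\<bar> \<le> real N" "\<forall>i<n. x' i = meval y' (H i)" "\<forall>i<m. nat \<lfloor>(y' i + real N) * real M\<rfloor> = e j i"
        unfolding V_def by blast
      have "\<bar>y i - y' i\<bar> \<le> 1 / real M" for i
      proof (cases "i < m")
        case True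
        have "0 \<le> (y i + real N) * real M" "0 \<le> (y' i + real N) * real M"
          using spec[OF y(2), of i] spec[OF y'(2), of i] by (auto simp: abs_le_iff)
        moreover have "nat \<lfloor>(y i + real N) * real M\<rfloor> = nat \<lfloor>(y' i + real N) * real M\<rfloor>"
          using y(4) y'(4) True by simp
        ultimately have "\<lfloor>(y i + real N) * real M\<rfloor> = \<lfloor>(y' i + real N) * real M\<rfloor>"
          by (metis nat_0_le zero_le_floor)
        then have "\<bar>(y i + real N) * real M - (y' i + real N) * real M\<bar> \<le> 1" by linarith
        then have "\<bar>y i - y' i\<bar> * real M \<le> 1"
          by (simp add: abs_mult[symmetric] algebra_simps abs_if split: if_splits)
        then show ?thesis using M(2) by (simp add: field_simps)
      next
        case False
        then show ?thesis using y(1) y'(1) by (simp add: coord_space_def)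
      qed
      then have "\<bar>x i - x' i\<bar> \<le> L i * (1 / real M)" if "i < n" for i
        using L(2)[of y y' "1 / real M" i] y y' that by simp
      then have "edist n x x' \<le> (\<Sum>i<n. L i * (1 / real M))"
        unfolding edist_def by (intro order_trans[OF L2_set_le_sum_abs] sum_mono) auto
      also have "\<dots> = \<rho> j" using j by (simp add: \<rho>_def K_def sum_distrib_right[symmetric] sum_divide_distrib)
      finally show ?thesis .
    qed
    have "(suminf (\<lambda>j. ennreal (\<rho> j powr d))) = (\<Sum>j<card I. ennreal (\<rho> j powr d))"
      by (intro suminf_finite) (auto simp: \<rho>_def)
    also have "\<dots> = ennreal (\<Sum>j<card I. \<rho> j powr d)" by (intro sum_ennreal) auto
    also have "(\<Sum>j<card I. \<rho> j powr d) = real (card I) * (K / real M) powr d"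
      by (simp add: \<rho>_def)
    also have "\<dots> = real (2 * N * M + 1) ^ m * (K / real M) powr d"
      by (simp add: cardI)
    also have "ennreal \<dots> \<le> ennreal \<epsilon>" using M(1) by (intro ennreal_leI) simp
    finally have sum: "(suminf (\<lambda>j. ennreal (\<rho> j powr d))) \<le> ennreal \<epsilon>" .
    have US: "U j \<subseteq> coord_space n" and \<rho>0: "0 \<le> \<rho> j" for j
      using S K unfolding U_def V_def C_def \<rho>_def by auto
    show "\<exists>U \<rho>. C N \<subseteq> (\<Union>j::nat. U j) \<and>
       (\<forall>j. U j \<subseteq> coord_space n \<and> 0 \<le> \<rho> j \<and> (\<forall>x\<in>U j. \<forall>y\<in>U j. edist n x y \<le> \<rho> j)) \<and>
       (suminf (\<lambda>j. ennreal (\<rho> j powr d))) \<le> ennreal \<epsilon>"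
      by (rule exI[of _ U], rule exI[of _ \<rho>]) (intro conjI allI ballI cover US \<rho>0 diam sum; assumption)
  qed
  ultimately show ?thesis using hnull_UN hnull_subset by blast
qed

lemma abs_le_edist: "i < n \<Longrightarrow> \<bar>x i - y i\<bar> \<le> edist n x y"
  using member_le_L2_set[of "{..<n}" i "\<lambda>i. \<bar>x i - y i\<bar>"] by (simp add: edist_def L2_set_def)

text \<open>Projected to the coordinates in \<open>J\<close>, a covering of \<open>S\<close> by sets
  of diameter at most \<open>\<rho> j\<close> becomes a covering of the box by cubes of side
  \<open>2 * \<rho> j\<close>. Their volumes add up to at most \<open>2^k\<close> times the sum of
  the \<open>\<rho> j powr d\<close>, which would be less than the volume of the box.\<close>

lemma not_hnull_of_projection:
  assumes J: "J \<subseteq> {..<n}" and d: "0 < d" "d \<le> real (card J)"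
    and ab: "\<And>i. i \<in> J \<Longrightarrow> a i < b i"
    and proj: "\<And>z. (\<And>i. i \<in> J \<Longrightarrow> a i \<le> z i \<and> z i \<le> b i) \<Longrightarrow> \<exists>x\<in>S. \<forall>i\<in>J. x i = z i"
  shows "\<not> hnull n d S"
proof
  assume null: "hnull n d S"
  interpret product_sigma_finite "\<lambda>_::nat. lborel :: real measure" ..
  have finJ: "finite J" using J finite_subset by blast
  define k where "k = card J"
  define P where "P = PiM J (\<lambda>_. lborel :: real measure)"
  define box where "box = PiE J (\<lambda>i. {a i..b i})"
  have vol: "emeasure P (PiE J (\<lambda>i. {f i..g i})) = ennreal (\<Prod>i\<in>J. g i - f i)"
    if "\<And>i. i \<in> J \<Longrightarrow> f i \<le> g i" for f g :: "nat \<Rightarrow> real"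
    using that finJ unfolding P_def by (subst emeasure_PiM) (auto simp: prod_ennreal)
  have meas: "PiE J (\<lambda>i. {f i..g i}) \<in> sets P" for f g :: "nat \<Rightarrow> real"
    unfolding P_def using finJ by (intro sets_PiM_I_finite) auto
  define v where "v = (\<Prod>i\<in>J. b i - a i)"
  have v: "v > 0" unfolding v_def using ab by (intro prod_pos) auto
  \<comment> \<open>The bound 1 gives \<open>\<rho> j \<le> 1\<close>, hence
    \<open>\<rho> j ^ k \<le> \<rho> j powr d\<close>; the other bound leaves at most half of the
    volume \<open>v\<close> after the factor \<open>2^k\<close>.\<close>
  define \<epsilon> where "\<epsilon> = min 1 (v / 2 ^ (k + 1))"
  have \<epsilon>: "\<epsilon> > 0" using v by (simp add: \<epsilon>_def)
  obtain U \<rho> where U: "S \<subseteq> (\<Union>j::nat. U j)"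
     "\<And>j. U j \<subseteq> coord_space n" "\<And>j. 0 \<le> \<rho> j" "\<And>j x y. x \<in> U j \<Longrightarrow> y \<in> U j \<Longrightarrow> edist n x y \<le> \<rho> j"
     and sum: "(suminf (\<lambda>j. ennreal (\<rho> j powr d))) \<le> ennreal \<epsilon>"
    using null \<epsilon> unfolding hnull_def by meson
  have \<rho>1: "\<rho> j \<le> 1" for j
  proof -
    have "ennreal (\<rho> j powr d) \<le> (suminf (\<lambda>j. ennreal (\<rho> j powr d)))"
      by (rule ennreal_le_suminf)
    also have "\<dots> \<le> ennreal 1" using sum by (rule order_trans) (auto simp: \<epsilon>_def intro: ennreal_leI)
    finally have "\<rho> j powr d \<le> 1 powr d" by (simp add: ennreal_le_iff del: ennreal_1)
    then show ?thesis using d U(3)[of j] by (metis less_le_not_le linorder_not_less powr_less_mono2 zero_le_one)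
  qed
  define c where "c j = (SOME x. x \<in> U j)" for j
  define B where "B j = (if U j = {} then {} else PiE J (\<lambda>i. {c j i - \<rho> j..c j i + \<rho> j}))" for j
  have "box \<subseteq> (\<Union>j. B j)"
  proof
    fix z assume z: "z \<in> box"
    then obtain x where x: "x \<in> S" "\<forall>i\<in>J. x i = z i"
      using proj[of z] unfolding box_def by (auto simp: PiE_iff)
    then obtain j where j: "x \<in> U j" using U(1) by blast
    then have c: "c j \<in> U j" unfolding c_def by (metis someI)
    have "\<bar>z i - c j i\<bar> \<le> \<rho> j" if "i \<in> J" for i
      using abs_le_edist[of i n x "c j"] U(4)[OF j c] x that J by auto
    then have "z \<in> PiE J (\<lambda>i. {c j i - \<rho> j..c j i + \<rho> j})"
      using z unfolding box_def by (auto simp: PiE_iff abs_le_iff algebra_simps)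
    then show "z \<in> (\<Union>j. B j)" using j unfolding B_def by auto
  qed
  then have "emeasure P box \<le> emeasure P (\<Union>j. B j)"
    by (intro emeasure_mono sets.countable_UN) (auto simp: B_def meas)
  also have "\<dots> \<le> (suminf (\<lambda>j. emeasure P (B j)))"
    by (intro emeasure_subadditive_countably) (auto simp: B_def meas)
  also have "\<dots> \<le> (suminf (\<lambda>j. ennreal (2 ^ k) * ennreal (\<rho> j powr d)))"
  proof (intro suminf_le)
    fix j
    have "(2 * \<rho> j) ^ k \<le> 2 ^ k * \<rho> j powr d"
    proof (cases "\<rho> j = 0")
      case True
      then show ?thesis using d by (cases k) (auto simp: k_def)
    next
      case False
      then have pos: "\<rho> j > 0" using U(3)[of j] by simp
      then have "\<rho> j ^ k = \<rho> j powr real k" by (simp add: powr_realpow)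
      also have "\<dots> \<le> \<rho> j powr d" using pos \<rho>1[of j] d by (intro powr_mono') (auto simp: k_def)
      finally show ?thesis by (simp add: power_mult_distrib)
    qed
    moreover have "emeasure P (B j) \<le> ennreal ((2 * \<rho> j) ^ k)"
      unfolding B_def using U(3)[of j] by (auto simp: vol k_def)
    ultimately have "emeasure P (B j) \<le> ennreal (2 ^ k * \<rho> j powr d)"
      using ennreal_leI order_trans by blast
    then show "emeasure P (B j) \<le> ennreal (2 ^ k) * ennreal (\<rho> j powr d)"
      by (simp add: ennreal_mult)
  qed auto
  also have "\<dots> = ennreal (2 ^ k) * (suminf (\<lambda>j. ennreal (\<rho> j powr d)))"
    by (rule ennreal_suminf_cmult)
  also have "\<dots> \<le> ennreal (2 ^ k) * ennreal \<epsilon>" using sum by (intro mult_left_mono) auto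
  also have "\<dots> = ennreal (2 ^ k * \<epsilon>)" using \<epsilon> by (simp add: ennreal_mult)
  also have "\<dots> \<le> ennreal (v / 2)"
  proof (rule ennreal_leI)
    have "2 ^ k * \<epsilon> \<le> 2 ^ k * (v / 2 ^ (k + 1))" by (intro mult_left_mono) (auto simp: \<epsilon>_def)
    then show "2 ^ k * \<epsilon> \<le> v / 2" by simp
  qed
  finally have "emeasure P box \<le> ennreal (v / 2)" .
  moreover have "emeasure P box = ennreal v" unfolding box_def v_def using ab by (intro vol) (auto intro: less_imp_le)
  ultimately show False using v by (simp add: ennreal_le_iff)
qed

subsection \<open>Main-analytic polynomials\<close>

text \<open>The substitution of \<open>X i + a i\<close> is the Taylor expansion at
  \<open>a\<close>; it is finite, so radius 1 serves as well as any other.\<close>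

lemma real_analytic_meval:
  assumes p: "p \<in> mpolys n"
  shows "real_analytic n (\<lambda>x. meval x p)"
  unfolding real_analytic_def
proof
  fix a :: "nat \<Rightarrow> real"
  define H where "H i = (if i < n then X i + Const (a i) else 0)" for i
  define q where "q = mhom Const H p"
  have q: "q \<in> mpolys n" unfolding q_def
    by (rule mhom_mpolys) (auto simp: H_def intro: mpolys_intros)
  have eq: "meval x p = (\<Sum>\<alpha>\<in>Poly_Mapping.keys q. Poly_Mapping.lookup q \<alpha> * (\<Prod>i<n. (x i - a i) ^ Poly_Mapping.lookup \<alpha> i))" for x
  proof -
    have "meval x p = meval (\<lambda>i. meval (\<lambda>i. x i - a i) (H i)) p"
      by (rule meval_cong_mpolys[OF p]) (simp add: H_def mev.hom_add)
    also have "\<dots> = meval (\<lambda>i. x i - a i) q" by (simp add: q_def meval_subst)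
    also have "\<dots> = (\<Sum>\<alpha>\<in>Poly_Mapping.keys q. Poly_Mapping.lookup q \<alpha> * (\<Prod>i<n. (x i - a i) ^ Poly_Mapping.lookup \<alpha> i))"
      unfolding meval_def using q
      by (intro sum.cong arg_cong2[of _ _ _ _ "(*)"] monomial_prod_superset) (auto simp: mpolys_def)
    finally show ?thesis .
  qed
  have sum: "((\<lambda>\<alpha>. Poly_Mapping.lookup q \<alpha> * (\<Prod>i<n. (x i - a i) ^ Poly_Mapping.lookup \<alpha> i)) has_sum meval x p)
          {\<alpha>. Poly_Mapping.keys \<alpha> \<subseteq> {..<n}}" for x
    unfolding eq
    by (subst has_sum_cong_neutral[where T = "Poly_Mapping.keys q"
        and g = "\<lambda>\<alpha>. Poly_Mapping.lookup q \<alpha> * (\<Prod>i<n. (x i - a i) ^ Poly_Mapping.lookup \<alpha> i)"])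
      (use q in \<open>auto simp: mpolys_def in_keys_iff\<close>)
  show "\<exists>\<rho>>0. \<exists>c. \<forall>x\<in>coord_space n. (\<forall>i<n. \<bar>x i - a i\<bar> < \<rho>) \<longrightarrow>
      ((\<lambda>\<alpha>. c \<alpha> * (\<Prod>i<n. (x i - a i) ^ Poly_Mapping.lookup \<alpha> i)) has_sum meval x p)
        {\<alpha>. Poly_Mapping.keys \<alpha> \<subseteq> {..<n}}"
  proof (rule exI[of _ "1::real"], rule conjI)
    show "\<exists>c. \<forall>x\<in>coord_space n. (\<forall>i<n. \<bar>x i - a i\<bar> < 1) \<longrightarrow>
      ((\<lambda>\<alpha>. c \<alpha> * (\<Prod>i<n. (x i - a i) ^ Poly_Mapping.lookup \<alpha> i)) has_sum meval x p)
        {\<alpha>. Poly_Mapping.keys \<alpha> \<subseteq> {..<n}}"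
      using sum by blast
  qed simp
qed

text \<open>Upper bounds come from counting parameters, \<open>n - 1\<close> for \<open>S\<close>
  and \<open>n - 2\<close> for the remaining zeros; the lower bound \<open>n - 1\<close> for
  \<open>S\<close> comes from the box. The zero set is the union of both parts and contains
  \<open>S\<close>, so its dimension is \<open>n - 1\<close> as well.\<close>

lemma main_analytic_functionI:
  fixes p :: "real mpol" and H :: "nat \<Rightarrow> real mpol" and G :: "'i \<Rightarrow> nat \<Rightarrow> real mpol"
  assumes n: "n \<ge> 2" and p: "p \<in> mpolys n" and S: "S \<subseteq> zero_set n (\<lambda>x. meval x p)"
    and H: "\<And>x. x \<in> S \<Longrightarrow> \<exists>y\<in>coord_space (n - 1). \<forall>i<n. x i = meval y (H i)"
    and I: "finite I"
    and G: "\<And>x. x \<in> zero_set n (\<lambda>x. meval x p) \<Longrightarrow> x \<notin> S \<Longrightarrow>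
       \<exists>j\<in>I. \<exists>y\<in>coord_space (n - 2). \<forall>i<n. x i = meval y (G j i)"
    and J: "J \<subseteq> {..<n}" "card J = n - 1" and ab: "\<And>i. i \<in> J \<Longrightarrow> a i < b i"
    and proj: "\<And>z. (\<And>i. i \<in> J \<Longrightarrow> a i \<le> z i \<and> z i \<le> b i) \<Longrightarrow> \<exists>x\<in>S. \<forall>i\<in>J. x i = z i"
  shows "main_analytic_function n (\<lambda>x. meval x p) S"
proof -
  let ?Z = "zero_set n (\<lambda>x. meval x p)"
  have Z: "?Z \<subseteq> coord_space n" by (auto simp: zero_set_def)
  have S': "S \<subseteq> coord_space n" using S Z by blast
  have nS: "hnull n d S" if "d > real (n - 1)" for d
    using that S' H by (rule hnull_polynomial_image)
  have nR: "hnull n d (?Z - S)" if "d > real (n - 2)" for d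
  proof -
    have "hnull n d (\<Union>j\<in>I. {x\<in>coord_space n. \<exists>y\<in>coord_space (n - 2). \<forall>i<n. x i = meval y (G j i)})"
      by (intro hnull_finite_UN I hnull_polynomial_image[OF that]) auto
    moreover have "?Z - S \<subseteq> (\<Union>j\<in>I. {x\<in>coord_space n. \<exists>y\<in>coord_space (n - 2). \<forall>i<n. x i = meval y (G j i)})"
    proof
      fix x assume x: "x \<in> ?Z - S"
      then obtain j where "j \<in> I" "\<exists>y\<in>coord_space (n - 2). \<forall>i<n. x i = meval y (G j i)"
        using G[of x] by auto
      moreover have "x \<in> coord_space n" using x Z by auto
      ultimately show "x \<in> (\<Union>j\<in>I. {x\<in>coord_space n. \<exists>y\<in>coord_space (n - 2). \<forall>i<n. x i = meval y (G j i)})"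
        by (intro UN_I[of j]) simp_all
    qed
    ultimately show ?thesis by (rule hnull_subset)
  qed
  have "?Z \<subseteq> S \<union> (?Z - S)" by blast
  then have nZ: "hnull n d ?Z" if "d > real (n - 1)" for d
    using that by (intro hnull_subset[OF hnull_Un[OF nS nR]]) auto
  have low: "ereal (real (n - 1)) \<le> hausdorff_dim n T" if "S \<subseteq> T" for T
  proof (rule hausdorff_dim_ge)
    fix d :: real assume "0 < d" "d < real (n - 1)"
    then have "\<not> hnull n d S"
      using J by (intro not_hnull_of_projection[where J = J and a = a and b = b] ab proj) auto
    then show "\<not> hnull n d T" using hnull_subset that by blast
  qed
  have dS: "hausdorff_dim n S = ereal (real (n - 1))"
    by (intro antisym hausdorff_dim_le nS low) auto
  have dZ: "hausdorff_dim n ?Z = ereal (real (n - 1))"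
    by (intro antisym hausdorff_dim_le nZ low S) auto
  have "hausdorff_dim n (?Z - S) \<le> ereal (real (n - 2))"
    by (intro hausdorff_dim_le nR) auto
  also have "\<dots> < ereal (real (n - 1))" using n by simp
  finally show ?thesis
    unfolding main_analytic_function_def dS dZ by (intro conjI S S' refl real_analytic_meval[OF p])
qed

subsection \<open>The standard maps\<close>

text \<open>The standard maps are polynomial with integer coefficients. Applied to evaluation, this
  makes \<open>std_map \<tau> X\<close> the symbolic form of the map; applied to
  \<open>complex_of_real\<close>, it relates the map to its complexification.\<close>

lemma std_map_hom:
  fixes \<phi> :: "'a::comm_ring_1 \<Rightarrow> 'b::comm_ring_1"
  assumes "comm_ring_hom \<phi>"
  shows "\<phi> (std_map \<tau> y i) = std_map \<tau> (\<lambda>j. \<phi> (y j)) i"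
proof -
  interpret comm_ring_hom \<phi> by fact
  show ?thesis
    by (cases \<tau>) (simp_all add: map_A_def map_D_def map_E6_def map_E7_def map_E8_def Let_def target_def hom_distribs)
qed

lemma std_map_meval: "meval y (std_map \<tau> X i) = std_map \<tau> y i"
  using std_map_hom[OF mev.comm_ring_hom_axioms, of y \<tau> X i] by simp

lemma std_map_of_real: "std_map \<tau> (\<lambda>j. complex_of_real (y j)) i = of_real (std_map \<tau> y i)"
proof -
  have "comm_ring_hom complex_of_real" by unfold_locales simp_all
  from std_map_hom[OF this, of \<tau> y i] show ?thesis by simp
qed

lemma std_map_coord_space: "valid_wf \<tau> \<Longrightarrow> std_map \<tau> y \<in> coord_space (wf_dim \<tau>)"
  by (cases \<tau>) (auto simp: coord_space_def map_A_def map_D_def map_E6_def map_E7_def map_E8_def Let_def target_def)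

lemma std_map_cong:
  fixes y y' :: "nat \<Rightarrow> 'a::comm_ring_1"
  assumes "valid_wf \<tau>" and eq: "\<And>i. i < wf_dim \<tau> - 1 \<Longrightarrow> y i = y' i"
  shows "std_map \<tau> y = std_map \<tau> y'"
proof (cases \<tau>)
  case (WF_A k)
  have "y (i - 1) = y' (i - 1)" if "i < k" "i \<ge> 2" for i using that eq WF_A by simp
  moreover have "y 0 = y' 0" "k > 2 \<Longrightarrow> y 1 = y' 1" using eq[of 0] eq[of 1] assms(1) WF_A by simp_all
  ultimately show ?thesis
    unfolding WF_A std_map.simps map_A_def Let_def target_def by (intro ext) (auto intro!: sum.cong)
next
  case (WF_D s k)
  have "y (i - 1) = y' (i - 1)" if "i < k" "i \<ge> 2" for i using that eq WF_D by simp
  moreover have "y 0 = y' 0" "y 1 = y' 1" using eq[of 0] eq[of 1] assms(1) WF_D by (simp_all add: less_diff_conv)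
  ultimately show ?thesis
    unfolding WF_D std_map.simps map_D_def Let_def target_def by (intro ext) (auto intro!: sum.cong)
next
  case WF_E6
  have yi: "y (i - 1) = y' (i - 1)" if "0 < i" "i < 6" for i
    using that eq[of "i - 1"] WF_E6 by simp
  have "y 0 = y' 0" "y 1 = y' 1" "y 2 = y' 2" "y 3 = y' 3" "y 4 = y' 4" using eq WF_E6 by simp_all
  then show ?thesis
    unfolding WF_E6 std_map.simps map_E6_def Let_def target_def
    by (intro ext) (auto simp: yi[simplified])
next
  case WF_E7
  have yi: "y (i - 1) = y' (i - 1)" if "0 < i" "i < 7" for i
    using that eq[of "i - 1"] WF_E7 by simp
  have "y 0 = y' 0" "y 1 = y' 1" "y 2 = y' 2" "y 3 = y' 3" "y 4 = y' 4" "y 5 = y' 5" using eq WF_E7 by simp_all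
  then show ?thesis
    unfolding WF_E7 std_map.simps map_E7_def Let_def target_def
    by (intro ext) (auto simp: yi[simplified])
next
  case WF_E8
  have yi: "y (i - 1) = y' (i - 1)" if "0 < i" "i < 8" for i
    using that eq[of "i - 1"] WF_E8 by simp
  have "y 0 = y' 0" "y 1 = y' 1" "y 2 = y' 2" "y 3 = y' 3" "y 4 = y' 4" "y 5 = y' 5" "y 6 = y' 6" using eq WF_E8 by simp_all
  then show ?thesis
    unfolding WF_E8 std_map.simps map_E8_def Let_def target_def
    by (intro ext) (auto simp: yi[simplified])
qed

lemma wf_dim_ge_2: "valid_wf \<tau> \<Longrightarrow> wf_dim \<tau> \<ge> 2"
  by (cases \<tau>) auto

definition cut :: "nat \<Rightarrow> (nat \<Rightarrow> 'a::zero) \<Rightarrow> nat \<Rightarrow> 'a" where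
  "cut n x = (\<lambda>i. if i < n then x i else 0)"

lemma cut_coord_space [simp]: "cut n x \<in> coord_space n"
  by (simp add: cut_def coord_space_def)

lemma ev_cut: "p \<in> mpolys n \<Longrightarrow> ev (cut n x) p = ev x p"
  by (rule ev_cong_mpolys) (auto simp: cut_def)

lemma meval_cut: "p \<in> mpolys n \<Longrightarrow> meval (cut n x) p = meval x p"
  by (rule meval_cong_mpolys) (auto simp: cut_def)

text \<open>
  The coordinate \<open>x e\<close> plays the role of the main variable; the free parameter \<open>y (k - 1)\<close>, on
  which the standard map does not depend, parametrizes the dummy coordinate left by \<open>uni e\<close>.
\<close>

lemma discriminant_from_data:
  fixes \<Theta> :: "real mpol"
  assumes \<tau>: "valid_wf \<tau>" and k: "k = wf_dim \<tau>" and e: "e < k" and \<Theta>: "\<Theta> \<in> mpolys k"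
    and Z: "\<And>x. x \<in> coord_space k \<Longrightarrow> ev x \<Theta> = 0 \<longleftrightarrow> x \<in> std_map \<tau> ` coord_space (k - 1)"
    and N: "N > 0" and c: "c \<noteq> 0"
    and M: "\<And>x. \<exists>p. degree p = N \<and> coeff p N = c \<and> (\<forall>z. ev (x(e := z)) \<Theta> = poly p z)"
    and D: "finite Zs" "card Zs = N" "\<And>z. z \<in> Zs \<Longrightarrow> ev (x0(e := z)) \<Theta> = 0"
  shows "(\<exists>\<Delta>. discriminant_polynomial k (std_map \<tau>) \<Delta>) \<and>
    (\<forall>\<Delta>. discriminant_polynomial k (std_map \<tau>) \<Delta> \<longrightarrow> (\<exists>c. c \<noteq> 0 \<and> complexify \<Theta> = Const c * \<Delta>))"
proof -
  have k2: "k \<ge> 2" using wf_dim_ge_2 \<tau> k by simp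
  define T where "T = uni e (complexify \<Theta>)"
  have ev: "poly (pev x T) z = ev (x(e := z)) \<Theta>" for x z
    by (simp add: T_def poly_pev_uni meval_complexify)
  have pevT: "degree (pev x T) = N" "coeff (pev x T) N = c" for x
  proof -
    obtain p where "degree p = N" "coeff p N = c" "\<And>z. ev (x(e := z)) \<Theta> = poly p z" using M by blast
    moreover from this have "pev x T = p" by (simp add: poly_eq_poly_eq_iff[symmetric] fun_eq_iff ev)
    ultimately show "degree (pev x T) = N" "coeff (pev x T) N = c" by auto
  qed
  have lead: "coeff T N = Const c"
    using pevT(2) by (intro meval_eqI) simp
  have high: "coeff T i = 0" if "i > N" for i
    using that pevT(1) by (intro meval_zero) (metis coeff_eq_0 coeff_pev)
  have deg: "degree T = N"
    using lead c high by (metis Const_eq_0_iff degree_le le_antisym le_degree)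
  have card: "card {z. poly (pev x0 T) z = 0} = N"
  proof (rule antisym)
    have nz: "pev x0 T \<noteq> 0" using pevT(1)[of x0] N by auto
    show "card {z. poly (pev x0 T) z = 0} \<le> N" using card_poly_roots_bound[OF nz] pevT by simp
    show "N \<le> card {z. poly (pev x0 T) z = 0}"
      unfolding D(2)[symmetric] using D(3) by (intro card_mono poly_roots_finite nz) (auto simp: ev)
  qed
  define G where "G i = (if i = e then X (k - 1) else if i < k then std_map \<tau> X i else (X i :: complex mpol))" for i
  define Gz where "Gz = (std_map \<tau> X e :: complex mpol)"
  have param: "poly (pev x T) z = 0 \<longleftrightarrow> (\<exists>y. x = (\<lambda>i. meval y (G i)) \<and> z = meval y Gz)" for x z
  proof -
    have "poly (pev x T) z = 0 \<longleftrightarrow> cut k (x(e := z)) \<in> std_map \<tau> ` coord_space (k - 1)"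
      unfolding ev by (subst Z[symmetric]) (simp_all add: ev_cut \<Theta>)
    also have "\<dots> \<longleftrightarrow> (\<exists>y. x = (\<lambda>i. meval y (G i)) \<and> z = meval y Gz)"
    proof
      assume "cut k (x(e := z)) \<in> std_map \<tau> ` coord_space (k - 1)"
      then obtain y0 where y0: "cut k (x(e := z)) = std_map \<tau> y0" by auto
      \<comment> \<open>Parameter \<open>k - 1\<close> receives the dummy coordinate
        \<open>x e\<close>; coordinates from \<open>k\<close> on are passed through, as
        \<open>G\<close> copies them.\<close>
      define y where "y i = (if i < k - 1 then y0 i else if i = k - 1 then x e else x i)" for i
      have y: "std_map \<tau> y = cut k (x(e := z))"
        unfolding y0 using \<tau> k by (intro std_map_cong) (auto simp: y_def)
      have "x i = meval y (G i)" for i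
        using y k2 by (auto simp: G_def std_map_meval cut_def) (auto simp: y_def)
      moreover have "z = meval y Gz" using e by (simp add: Gz_def std_map_meval y cut_def)
      ultimately show "\<exists>y. x = (\<lambda>i. meval y (G i)) \<and> z = meval y Gz" by blast
    next
      assume "\<exists>y. x = (\<lambda>i. meval y (G i)) \<and> z = meval y Gz"
      then obtain y where x: "x = (\<lambda>i. meval y (G i))" and z: "z = meval y Gz" by blast
      have "std_map \<tau> (cut (k - 1) y) = std_map \<tau> y"
        using \<tau> k by (intro std_map_cong) (auto simp: cut_def)
      also have "\<dots> = cut k (x(e := z))"
      proof
        fix i
        show "std_map \<tau> y i = cut k (x(e := z)) i"
        proof (cases "i < k")
          case True
          then show ?thesis by (simp add: cut_def x z G_def Gz_def std_map_meval)
        next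
          case False
          then show ?thesis using std_map_coord_space[OF \<tau>, of y] k by (simp add: cut_def coord_space_def)
        qed
      qed
      finally show "cut k (x(e := z)) \<in> std_map \<tau> ` coord_space (k - 1)"
        by (metis cut_coord_space imageI)
    qed
    finally show ?thesis .
  qed
  interpret parametrized_hypersurface T N c G Gz
    using deg lead c N card param by unfold_locales auto
  have zs: "zero_set k (\<lambda>x. meval x (complexify \<Theta>)) = std_map \<tau> ` coord_space (k - 1)"
    using Z std_map_coord_space[OF \<tau>] by (auto simp: zero_set_def meval_complexify k)
  have sq: "squarefree (complexify \<Theta>)" by (rule squarefree_uni[OF T_def])
  show ?thesis
  proof (intro conjI exI[of _ "complexify \<Theta>"] allI impI)
    show "discriminant_polynomial k (std_map \<tau>) (complexify \<Theta>)"
      unfolding discriminant_polynomial_def using zs sq \<Theta> mpolys_complexify by blast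
  next
    fix \<Delta> assume \<Delta>: "discriminant_polynomial k (std_map \<tau>) \<Delta>"
    have \<Delta>k: "\<Delta> \<in> mpolys k" using \<Delta> by (simp add: discriminant_polynomial_def)
    have "meval x \<Delta> = 0 \<longleftrightarrow> meval x (complexify \<Theta>) = 0" for x
    proof -
      have "meval x \<Delta> = 0 \<longleftrightarrow> cut k x \<in> zero_set k (\<lambda>x. meval x \<Delta>)"
        by (simp add: zero_set_def meval_cut \<Delta>k)
      also have "\<dots> \<longleftrightarrow> cut k x \<in> zero_set k (\<lambda>x. meval x (complexify \<Theta>))"
        using \<Delta> zs by (simp add: discriminant_polynomial_def)
      also have "\<dots> \<longleftrightarrow> meval x (complexify \<Theta>) = 0"
        by (simp add: zero_set_def meval_cut \<Theta> mpolys_complexify)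
      finally show ?thesis .
    qed
    then show "\<exists>c. c \<noteq> 0 \<and> complexify \<Theta> = Const c * \<Delta>"
      using \<Delta> by (intro unique_uni[OF T_def]) (auto simp: discriminant_polynomial_def)
  qed
qed

subsection \<open>Specialization of the coefficients\<close>

definition cpev :: "(nat \<Rightarrow> complex) \<Rightarrow> real mpol poly \<Rightarrow> complex poly" where
  "cpev x f = map_poly (ev x) f"

interpretation mapcev: map_poly_comm_ring_hom "ev x" for x ..

interpretation cpevh: comm_ring_hom "cpev x" for x
  unfolding cpev_def[abs_def] by unfold_locales (auto simp: mapcev.hom_add mapcev.hom_mult)

lemma coeff_cpev [simp]: "coeff (cpev x f) i = ev x (coeff f i)"
  by (simp add: cpev_def)

lemma cpev_pCons [simp]: "cpev x (pCons a f) = pCons (ev x a) (cpev x f)"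
  by (rule poly_eqI) (simp add: coeff_pCons split: nat.split)

lemma cpev_monom [simp]: "cpev x (monom a i) = monom (ev x a) i"
  by (rule poly_eqI) simp

lemma cpev_pderiv: "cpev x (pderiv f) = pderiv (cpev x f)"
  by (rule poly_eqI) (simp add: coeff_pderiv evh.hom_mult evh.hom_add evh.hom_of_nat)

lemma ev_resultant:
  "ev x (resultant f g) = resultant_sub (degree f) (degree g) (cpev x f) (cpev x g)"
  unfolding resultant_def sylvester_mat_def resultant_sub_def evh.hom_det[symmetric] cpev_def
  by (subst sylvester_mat_sub_map) simp_all

lemma degree_cpev_le: "degree (cpev x f) \<le> degree f"
  unfolding cpev_def by (rule degree_map_poly_le)

text \<open>The expansion over the roots of the second argument; exchanging the arguments
  contributes the sign. It is used when the second argument is free of the main variable.\<close>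

lemma resultant_prod_right:
  fixes f :: "complex poly"
  assumes "degree f = m" "g = Polynomial.smult c (\<Prod>a\<leftarrow>as. [:-a, 1:])" "c \<noteq> 0"
  shows "resultant f g = (-1) ^ (m * length as) * c ^ m * (\<Prod>a\<leftarrow>as. poly f a)"
proof -
  have deg: "degree g = length as"
    using assms degree_linear_factors[of uminus as] by simp
  have "resultant f g = (-1) ^ (m * length as) * resultant_sub (length as) m g f"
    by (subst resultant_swap) (simp add: resultant_sub deg assms(1))
  also have "resultant_sub (length as) m g f = c ^ m * (\<Prod>a\<leftarrow>as. poly f a)"
    unfolding assms(2) using assms(1) by (intro resultant_sub_prod) simp
  finally show ?thesis by (simp add: mult.assoc)
qed

text \<open>The remainder modulo the real minimal polynomial of \<open>v\<close> has real
  coefficients, degree at most 1 and the non-real root \<open>v\<close>, so it is 0.\<close>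

lemma quadratic_dvd:
  fixes f :: "real poly" and v :: complex
  assumes "poly (map_poly of_real f) v = 0" "Im v \<noteq> 0"
  shows "[:(Re v)\<^sup>2 + (Im v)\<^sup>2, - 2 * Re v, 1:] dvd f"
proof -
  interpret mr: map_poly_comm_ring_hom complex_of_real
    by unfold_locales simp_all
  define m where "m = [:(Re v)\<^sup>2 + (Im v)\<^sup>2, - 2 * Re v, 1:]"
  define r where "r = f mod m"
  have m0: "poly (map_poly of_real m) v = 0"
    by (simp add: m_def complex_eq_iff power2_eq_square algebra_simps)
  have "degree r < 2" unfolding r_def using degree_mod_less'[of m f]
    by (cases "f mod m = 0") (auto simp: m_def)
  then have r: "r = [:coeff r 0, coeff r 1:]"
    by (intro poly_eqI) (auto simp: coeff_pCons coeff_eq_0 split: nat.split)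
  have "f = f div m * m + r" unfolding r_def by simp
  then have "map_poly complex_of_real f = map_poly of_real (f div m) * map_poly of_real m + map_poly of_real r"
    by (metis mr.hom_add mr.hom_mult)
  then have "poly (map_poly complex_of_real r) v = 0"
    using assms(1) m0 by simp
  moreover have "map_poly complex_of_real [:a, b:] = [:of_real a, of_real b:]" for a b
    by (rule poly_eqI) (simp add: coeff_map_poly coeff_pCons split: nat.split)
  ultimately have "of_real (coeff r 0) + v * of_real (coeff r 1) = 0"
    by (subst (asm) r) simp
  then have "coeff r 1 = 0" "coeff r 0 = 0"
    using assms(2) by (auto simp: complex_eq_iff)
  then have "r = 0" using r by simp
  then show ?thesis unfolding r_def m_def by (simp add: mod_eq_0_iff_dvd)
qed

text \<open>A non-real double root of a real polynomial comes with its conjugate.\<close>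

lemma quadratic_square_dvd:
  fixes f :: "real poly" and v :: complex
  assumes "poly (map_poly of_real f) v = 0" "poly (pderiv (map_poly of_real f)) v = 0" "Im v \<noteq> 0"
  shows "[:(Re v)\<^sup>2 + (Im v)\<^sup>2, - 2 * Re v, 1:]\<^sup>2 dvd f"
proof -
  interpret mr: map_poly_comm_ring_hom complex_of_real
    by unfold_locales simp_all
  define m where "m = [:(Re v)\<^sup>2 + (Im v)\<^sup>2, - 2 * Re v, 1:]"
  obtain g where g: "f = m * g" using quadratic_dvd[OF assms(1,3)] unfolding m_def by auto
  have m0: "poly (map_poly of_real m) v = 0"
    by (simp add: m_def complex_eq_iff power2_eq_square algebra_simps)
  have m1: "poly (pderiv (map_poly of_real m)) v \<noteq> 0"
    using assms(3) by (simp add: m_def pderiv_pCons complex_eq_iff)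
  have "poly (map_poly of_real g) v = 0"
    using assms(2) m0 m1 by (simp add: g mr.hom_mult pderiv_mult)
  then have "m dvd g" unfolding m_def using assms(3) by (rule quadratic_dvd)
  then have "m * m dvd m * g" by (rule mult_dvd_mono[OF dvd_refl])
  then have "m\<^sup>2 dvd f" by (simp only: g power2_eq_square[of m])
  then show ?thesis unfolding m_def .
qed

subsection \<open>Type A\<close>

lemma poly_A_WF_A:
  "poly (cpev x (poly_A (WF_A k))) v = v ^ (k + 1) + (\<Sum>i<k. x i * v ^ i)"
  by (simp add: cpevh.hom_add cpevh.hom_sum poly_monom poly_sum)

lemma pderiv_A_WF_A:
  "poly (pderiv (cpev x (poly_A (WF_A k)))) v = of_nat (k + 1) * v ^ k + (\<Sum>i=1..<k. of_nat i * x i * v ^ (i - 1))"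
proof -
  have "poly (pderiv (cpev x (poly_A (WF_A k)))) v = of_nat (k + 1) * v ^ k + (\<Sum>i<k. of_nat i * x i * v ^ (i - 1))"
    by (simp add: cpevh.hom_add cpevh.hom_sum poly_monom poly_sum pderiv_add pderiv_monom pderiv_sum)
  also have "(\<Sum>i<k. of_nat i * x i * v ^ (i - 1)) = (\<Sum>i=1..<k. of_nat i * x i * v ^ (i - 1))"
    by (rule sum.mono_neutral_right) auto
  finally show ?thesis .
qed

lemma degree_A_WF_A: "degree (poly_A (WF_A k)) = Suc k" "coeff (poly_A (WF_A k)) (Suc k) = 1"
  and coeff_A_WF_A: "i < k \<Longrightarrow> coeff (poly_A (WF_A k)) i = X i" "coeff (poly_A (WF_A k)) k = 0"
proof -
  have c: "coeff (poly_A (WF_A k)) i = (if i = k + 1 then 1 else if i < k then X i else 0)" for i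
    by (auto simp: coeff_sum sum.delta)
  then show "coeff (poly_A (WF_A k)) (Suc k) = 1" "i < k \<Longrightarrow> coeff (poly_A (WF_A k)) i = X i" "coeff (poly_A (WF_A k)) k = 0"
    by (simp_all del: poly_A.simps)
  show "degree (poly_A (WF_A k)) = Suc k"
    by (intro antisym degree_le le_degree) (auto simp: c simp del: poly_A.simps)
qed

text \<open>At a double root \<open>v\<close> the equation \<open>A' = 0\<close> determines
  \<open>x 1\<close>, and then \<open>A = 0\<close> determines \<open>x 0\<close>, both linearly.
  The solutions are the first two components of the standard map.\<close>

lemma map_A_image_iff:
  fixes x :: "nat \<Rightarrow> 'a::comm_ring_1"
  assumes x: "x \<in> coord_space k" and k: "k \<ge> 2"
  shows "x \<in> map_A k ` coord_space (k - 1) \<longleftrightarrow>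
    (\<exists>v. v ^ (k + 1) + (\<Sum>i<k. x i * v ^ i) = 0 \<and> of_nat (k + 1) * v ^ k + (\<Sum>i=1..<k. of_nat i * x i * v ^ (i - 1)) = 0)"
proof -
  have split0: "(\<Sum>i<k. g i) = g 0 + g 1 + (\<Sum>i=2..<k. g i)" for g :: "nat \<Rightarrow> 'a"
  proof -
    have "(\<Sum>i<k. g i) = (\<Sum>i=0..<k. g i)" by (simp add: atLeast0LessThan)
    also have "\<dots> = g 0 + (g 1 + (\<Sum>i=2..<k. g i))"
      using k by (simp add: sum.atLeast_Suc_lessThan numeral_2_eq_2)
    finally show ?thesis by (simp add: add.assoc)
  qed
  have split1: "(\<Sum>i=1..<k. g i) = g 1 + (\<Sum>i=2..<k. g i)" for g :: "nat \<Rightarrow> 'a"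
    using k by (simp add: sum.atLeast_Suc_lessThan numeral_2_eq_2)
  have weight: "(\<Sum>i=2..<k. of_nat i * x i * v ^ (i - 1)) * v = (\<Sum>i=2..<k. of_nat (i - 1) * x i * v ^ i) + (\<Sum>i=2..<k. x i * v ^ i)" for v
    unfolding sum_distrib_right sum.distrib[symmetric]
  proof (rule sum.cong)
    fix i assume i: "i \<in> {2..<k}"
    then have "v ^ (i - 1) * v = v ^ i" by (metis Suc_1 Suc_le_lessD atLeastLessThan_iff bot_nat_0.extremum_strict not_gr_zero power_minus_mult)
    moreover have "of_nat i = of_nat (i - 1) + (1 :: 'a)" using i by (cases i) auto
    ultimately have "of_nat i * x i * (v ^ (i - 1) * v) = (of_nat (i - 1) + 1) * x i * v ^ i" by (simp only:)
    then show "of_nat i * x i * v ^ (i - 1) * v = of_nat (i - 1) * x i * v ^ i + x i * v ^ i"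
      by (simp only: mult.assoc distrib_right mult_1)
  qed simp
  show ?thesis
  proof
    assume "x \<in> map_A k ` coord_space (k - 1)"
    then obtain y where y: "x = map_A k y" by auto
    define v where "v = y 0"
    have xi: "x i = y (i - 1)" if "i \<ge> 2" "i < k" for i
      unfolding y map_A_def Let_def target_def using that by auto
    have x0: "x 0 = of_nat k * v ^ (k + 1) + (\<Sum>i=2..<k. of_nat (i - 1) * x i * v ^ i)"
      by (subst y) (auto simp: map_A_def Let_def target_def v_def xi intro!: sum.cong)
    have x1: "x 1 = - of_nat (k + 1) * v ^ k - (\<Sum>i=2..<k. of_nat i * x i * v ^ (i - 1))"
      by (subst y) (auto simp: map_A_def Let_def target_def v_def xi intro!: sum.cong)
    have "v ^ (k + 1) + (\<Sum>i<k. x i * v ^ i) = 0"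
      unfolding split0 using weight[of v] by (simp add: x0 x1[simplified] algebra_simps)
    moreover have "of_nat (k + 1) * v ^ k + (\<Sum>i=1..<k. of_nat i * x i * v ^ (i - 1)) = 0"
      unfolding split1 by (simp add: x1[simplified] algebra_simps)
    ultimately show "\<exists>v. v ^ (k + 1) + (\<Sum>i<k. x i * v ^ i) = 0 \<and> of_nat (k + 1) * v ^ k + (\<Sum>i=1..<k. of_nat i * x i * v ^ (i - 1)) = 0"
      by blast
  next
    assume "\<exists>v. v ^ (k + 1) + (\<Sum>i<k. x i * v ^ i) = 0 \<and> of_nat (k + 1) * v ^ k + (\<Sum>i=1..<k. of_nat i * x i * v ^ (i - 1)) = 0"
    then obtain v where v: "v ^ (k + 1) + (\<Sum>i<k. x i * v ^ i) = 0"
      "of_nat (k + 1) * v ^ k + (\<Sum>i=1..<k. of_nat i * x i * v ^ (i - 1)) = 0" by blast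
    define y where "y i = (if i = 0 then v else if i < k - 1 then x (i + 1) else 0)" for i
    have yi: "y (i - 1) = x i" if "i \<ge> 2" "i < k" for i using that by (auto simp: y_def)
    have x1: "x 1 = - of_nat (k + 1) * v ^ k - (\<Sum>i=2..<k. of_nat i * x i * v ^ (i - 1))"
      using v(2) unfolding split1 by (simp add: algebra_simps eq_neg_iff_add_eq_0)
    have x0: "x 0 = of_nat k * v ^ (k + 1) + (\<Sum>i=2..<k. of_nat (i - 1) * x i * v ^ i)"
    proof -
      have "x 0 = - (v ^ (k + 1)) - x 1 * v - (\<Sum>i=2..<k. x i * v ^ i)"
        using v(1) unfolding split0 by (simp add: algebra_simps eq_neg_iff_add_eq_0)
      then show ?thesis using weight[of v] by (simp add: x1[simplified] algebra_simps)
    qed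
    have "map_A k y = x"
    proof
      fix i
      have sums: "(\<Sum>i=2..<k. of_nat (i - 1) * y (i - 1) * v ^ i) = (\<Sum>i=2..<k. of_nat (i - 1) * x i * v ^ i)"
        "(\<Sum>i=2..<k. of_nat i * y (i - 1) * v ^ (i - 1)) = (\<Sum>i=2..<k. of_nat i * x i * v ^ (i - 1))"
        by (auto intro!: sum.cong simp: yi[unfolded One_nat_def])
      have "y 0 = v" by (simp add: y_def)
      have m: "map_A k y i = (if i = 0 then of_nat k * v ^ (k + 1) + (\<Sum>i=2..<k. of_nat (i - 1) * x i * v ^ i)
          else if i = 1 then - of_nat (k + 1) * v ^ k - (\<Sum>i=2..<k. of_nat i * x i * v ^ (i - 1))
          else if i \<ge> k then 0 else if i = 2 then y (2 - 1) else y (i - 1))"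
        unfolding map_A_def Let_def target_def \<open>y 0 = v\<close> sums by (rule refl)
      show "map_A k y i = x i"
        unfolding m x0[symmetric] x1[symmetric] using x yi[of 2] yi[of i] by (auto simp: coord_space_def)
    qed
    moreover have "y \<in> coord_space (k - 1)" using k by (auto simp: y_def coord_space_def)
    ultimately show "x \<in> map_A k ` coord_space (k - 1)" by blast
  qed
qed

lemma map_poly_of_real_pev: "map_poly complex_of_real (pev x f) = cpev (\<lambda>i. of_real (x i)) f"
  by (rule poly_eqI) (simp add: coeff_map_poly ev_of_real)

lemma pev_monom [simp]: "pev x (monom a i) = monom (meval x a) i"
  by (rule poly_eqI) simp

lemma poly_pev_A_WF_A:
  "poly (pev x (poly_A (WF_A k))) v = v ^ (k + 1) + (\<Sum>i<k. x i * v ^ i)"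
  by (simp add: pevh.hom_add pevh.hom_sum poly_monom poly_sum)

lemma ev_resultant_A_eq_0_iff:
  "ev x (resultant (poly_A (WF_A k)) (poly_B (WF_A k))) = 0 \<longleftrightarrow>
    (\<exists>v. poly (cpev x (poly_A (WF_A k))) v = 0 \<and> poly (pderiv (cpev x (poly_A (WF_A k)))) v = 0)"
proof -
  let ?A = "poly_A (WF_A k)"
  have d: "degree (cpev x ?A) = degree ?A"
    by (intro antisym degree_cpev_le le_degree) (simp add: degree_A_WF_A del: poly_A.simps)
  have nz: "cpev x ?A \<noteq> 0" using d degree_A_WF_A(1)[of k] by (auto simp del: poly_A.simps)
  have "degree (pderiv (cpev x ?A)) \<le> degree (pderiv ?A)"
    by (simp add: degree_pderiv d del: poly_A.simps)
  from resultant_sub_eq_0_iff[OF nz this] show ?thesis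
    by (simp add: ev_resultant d cpev_pderiv del: poly_A.simps)
qed

lemma prod_monic:
  fixes f :: "'b \<Rightarrow> complex poly"
  assumes "\<And>a. degree (f a) = n" "\<And>a. coeff (f a) n = c" "c \<noteq> 0"
  shows "degree (\<Prod>a\<leftarrow>as. f a) = n * length as \<and> coeff (\<Prod>a\<leftarrow>as. f a) (n * length as) = c ^ length as"
proof (induction as)
  case (Cons a as)
  let ?p = "\<Prod>a\<leftarrow>as. f a"
  have "coeff ?p (n * length as) \<noteq> 0" "coeff (f a) n \<noteq> 0" using Cons assms(2)[of a] assms(3) by simp_all
  then have nz: "?p \<noteq> 0" "f a \<noteq> 0" by (metis coeff_0)+
  then have "degree (f a * ?p) = n + n * length as"
    using Cons assms(1) by (simp add: degree_mult_eq)
  moreover from this have "coeff (f a * ?p) (n + n * length as) = c * c ^ length as"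
    using lead_coeff_mult[of "f a" ?p] Cons assms by simp
  ultimately show ?case by simp
qed simp

text \<open>\<open>A'\<close> does not contain \<open>x 0\<close>. So the resultant is a constant
  times the product of \<open>A(a)\<close> over the roots \<open>a\<close> of \<open>A'\<close>, and
  each factor is \<open>x 0\<close> plus a term free of \<open>x 0\<close>.\<close>

lemma ev_resultant_A_main_variable:
  assumes k: "k \<ge> 2"
  shows "\<exists>p. degree p = k \<and> coeff p k = (-1) ^ ((k + 1) * k) * of_nat (k + 1) ^ (k + 1) \<and>
    (\<forall>z. ev (x(0 := z)) (resultant (poly_A (WF_A k)) (poly_B (WF_A k))) = poly p z)"
proof -
  let ?A = "poly_A (WF_A k)"
  let ?a = "\<lambda>z. cpev (x(0 := z)) ?A"
  have deg: "degree (?a z) = k + 1" "coeff (?a z) (k + 1) = 1" for z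
  proof -
    show c: "coeff (?a z) (k + 1) = 1" by (simp add: degree_A_WF_A del: poly_A.simps)
    show "degree (?a z) = k + 1"
      using degree_cpev_le[of "x(0 := z)" ?A] degree_A_WF_A(1)[of k] le_degree[of "?a z" "k + 1"] c by simp
  qed
  have pd: "pderiv (?a z) = pderiv (?a 0)" for z
    by (intro poly_eqI) (simp add: coeff_pderiv coeff_A_WF_A coeff_sum sum.delta)
  have dp: "degree (pderiv (?a 0)) = k" "lead_coeff (pderiv (?a 0)) = of_nat (k + 1)"
    by (simp_all add: degree_pderiv deg coeff_pderiv del: poly_A.simps)
      (use deg(2)[of 0] in \<open>simp del: poly_A.simps\<close>)
  obtain as where as: "length as = k" "pderiv (?a 0) = Polynomial.smult (of_nat (k + 1)) (\<Prod>a\<leftarrow>as. [:-a, 1:])"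
    using complex_poly_roots[of "pderiv (?a 0)"] dp by auto
  define p where "p = Polynomial.smult ((-1) ^ ((k + 1) * k) * of_nat (k + 1) ^ (k + 1)) (\<Prod>a\<leftarrow>as. [:poly (?a 0) a, 1:])"
  have lin: "poly (?a z) v = poly (?a 0) v + z" for z v
  proof -
    have "(\<Sum>i<k. (x(0 := t)) i * v ^ i) = t + (\<Sum>i\<in>{..<k} - {0}. x i * v ^ i)" for t
      using k by (subst sum.remove[of _ 0]) (auto intro!: sum.cong)
    then show ?thesis unfolding poly_A_WF_A by simp
  qed
  have "ev (x(0 := z)) (resultant ?A (poly_B (WF_A k))) = poly p z" for z
  proof -
    have "ev (x(0 := z)) (resultant ?A (poly_B (WF_A k))) = resultant_sub (Suc k) k (?a z) (pderiv (?a z))"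
      by (simp add: ev_resultant cpev_pderiv degree_pderiv degree_A_WF_A del: poly_A.simps)
    also have "\<dots> = resultant (?a z) (pderiv (?a z))"
      using deg[of z] by (simp add: resultant_sub degree_pderiv del: poly_A.simps)
    also have "\<dots> = (-1) ^ ((k + 1) * k) * of_nat (k + 1) ^ (k + 1) * (\<Prod>a\<leftarrow>as. poly (?a z) a)"
    proof -
      have nz: "of_nat (k + 1) \<noteq> (0 :: complex)" by (metis add_is_0 of_nat_eq_0_iff one_neq_zero)
      show ?thesis
        unfolding pd[of z] using resultant_prod_right[OF deg(1)[of z] as(2) nz] as(1) by (simp del: poly_A.simps)
    qed
    also have "\<dots> = poly p z"
      by (simp add: p_def lin[of z] poly_prod_list o_def del: poly_A.simps)
    finally show ?thesis .
  qed
  moreover have "degree p = k" "coeff p k = (-1) ^ ((k + 1) * k) * of_nat (k + 1) ^ (k + 1)"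
  proof -
    have "degree (\<Prod>a\<leftarrow>as. [:poly (?a 0) a, 1:]) = k \<and> coeff (\<Prod>a\<leftarrow>as. [:poly (?a 0) a, 1:]) k = 1"
      using prod_monic[of "\<lambda>a. [:poly (?a 0) a, 1:]" 1 1 as] as(1) by (simp del: poly_A.simps)
    moreover have "of_nat (k + 1) \<noteq> (0 :: complex)" by (metis add_is_0 of_nat_eq_0_iff one_neq_zero)
    ultimately show "degree p = k" "coeff p k = (-1) ^ ((k + 1) * k) * of_nat (k + 1) ^ (k + 1)"
      unfolding p_def by (auto simp del: poly_A.simps of_nat_Suc of_nat_add)
  qed
  ultimately show ?thesis by blast
qed

lemma wf_A_conclusion:
  assumes k: "k \<ge> 2"
  defines "\<Theta> \<equiv> resultant (poly_A (WF_A k)) (poly_B (WF_A k))"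
  shows "\<Theta> \<in> mpolys k \<and>
    main_analytic_function k (\<lambda>x. meval x \<Theta>) (std_map (WF_A k) ` coord_space (k - 1)) \<and>
    (\<exists>\<Delta>. discriminant_polynomial k (std_map (WF_A k)) \<Delta>) \<and>
    (\<forall>\<Delta>. discriminant_polynomial k (std_map (WF_A k)) \<Delta> \<longrightarrow> (\<exists>c. c \<noteq> 0 \<and> complexify \<Theta> = Const c * \<Delta>))"
proof -
  let ?A = "poly_A (WF_A k)"
  have Am: "coeff ?A i \<in> mpolys k" for i
    by (auto simp: coeff_sum sum.delta intro!: mpolys_intros)
  have \<Theta>: "\<Theta> \<in> mpolys k"
    unfolding \<Theta>_def poly_B.simps
    by (intro mpolys_resultant Am) (auto simp: coeff_pderiv simp del: poly_A.simps of_nat_Suc intro!: mpolys_intros Am)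
  have Z: "ev x \<Theta> = 0 \<longleftrightarrow> x \<in> std_map (WF_A k) ` coord_space (k - 1)" if "x \<in> coord_space k" for x
    unfolding \<Theta>_def ev_resultant_A_eq_0_iff poly_A_WF_A pderiv_A_WF_A
    using map_A_image_iff[OF that k] by simp
  have k1: "1 + complex_of_nat k \<noteq> 0" by (metis of_nat_Suc of_nat_neq_0)
  have disc: "(\<exists>\<Delta>. discriminant_polynomial k (std_map (WF_A k)) \<Delta>) \<and>
    (\<forall>\<Delta>. discriminant_polynomial k (std_map (WF_A k)) \<Delta> \<longrightarrow> (\<exists>c. c \<noteq> 0 \<and> complexify \<Theta> = Const c * \<Delta>))"
  \<comment> \<open>At this point \<open>A = v^(k+1) - (k+1) v + z\<close> and
    \<open>A' = (k+1) (v^k - 1)\<close>. The critical points are the \<open>k\<close>-th roots of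
    unity, and \<open>v\<close> is a double root for \<open>z = k v\<close>; these are
    \<open>k\<close> distinct values.\<close>
  proof (rule discriminant_from_data[where e = 0 and N = k and c = "(-1) ^ ((k + 1) * k) * of_nat (k + 1) ^ (k + 1)"
        and Zs = "{z. z ^ k = of_nat k ^ k}" and ?x0.0 = "(\<lambda>_. 0)(1 := - of_nat (k + 1))"])
    show "\<exists>p. degree p = k \<and> coeff p k = (-1) ^ ((k + 1) * k) * of_nat (k + 1) ^ (k + 1) \<and> (\<forall>z. ev (x(0 := z)) \<Theta> = poly p z)" for x
      unfolding \<Theta>_def by (rule ev_resultant_A_main_variable[OF k])
    show "finite {z :: complex. z ^ k = of_nat k ^ k}" "card {z :: complex. z ^ k = of_nat k ^ k} = k"
      using k by (auto intro!: finite_nth_roots card_nth_roots)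
    fix z :: complex assume "z \<in> {z. z ^ k = of_nat k ^ k}"
    then have zk: "z ^ k = of_nat k ^ k" by simp
    define v where "v = z / of_nat k"
    have vk: "v ^ k = 1" using zk k by (simp add: v_def power_divide)
    have z: "z = of_nat k * v" using k by (simp add: v_def)
    let ?x = "((\<lambda>_. 0)(1 := - of_nat (k + 1)))(0 := z)"
    have "(\<Sum>i<k. ?x i * v ^ i) = (\<Sum>i\<in>{0, 1}. ?x i * v ^ i)"
      using k by (intro sum.mono_neutral_right) auto
    then have "v ^ (k + 1) + (\<Sum>i<k. ?x i * v ^ i) = 0"
      using vk by (simp add: z algebra_simps)
    moreover have "(\<Sum>i=1..<k. of_nat i * ?x i * v ^ (i - 1)) = (\<Sum>i\<in>{1}. of_nat i * ?x i * v ^ (i - 1))"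
      using k by (intro sum.mono_neutral_right) auto
    then have "of_nat (k + 1) * v ^ k + (\<Sum>i=1..<k. of_nat i * ?x i * v ^ (i - 1)) = 0"
      using vk by simp
    ultimately show "ev ?x \<Theta> = 0"
      unfolding \<Theta>_def ev_resultant_A_eq_0_iff poly_A_WF_A pderiv_A_WF_A by blast
  qed (use k k1 \<Theta> Z in auto)
  \<comment> \<open>A conjugate pair of double roots gives \<open>A = Q^2 C\<close> with
    \<open>C\<close> monic of degree \<open>k - 3\<close>. Since \<open>A\<close> has no term of
    degree \<open>k\<close>, the coefficient of \<open>C\<close> in degree \<open>k - 4\<close> is
    \<open>- 2 p\<close>. For \<open>k \<ge> 4\<close> the parameters are \<open>q\<close>,
    \<open>p\<close> and the lower \<open>k - 4\<close> coefficients of \<open>C\<close>, in all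
    \<open>k - 2\<close>.\<close>
  define Q :: "real mpol poly" where "Q = [:X 0, X 1, 1:]"
  define C :: "real mpol poly" where "C = monom 1 (k - 3) + monom (-2 * X 1) (k - 4) + (\<Sum>i<k-4. monom (X (i + 2)) i)"
  have real_mem: "x \<in> std_map (WF_A k) ` coord_space (k - 1)"
    if "x \<in> coord_space k" "poly (pev x ?A) t = 0" "poly (pderiv (pev x ?A)) t = 0" for x :: "nat \<Rightarrow> real" and t
  proof -
    have "poly (pderiv (pev x ?A)) t = of_nat (k + 1) * t ^ k + (\<Sum>i=1..<k. of_nat i * x i * t ^ (i - 1))"
    proof -
      have "complex_of_real (poly (pderiv (pev x ?A)) t) = poly (pderiv (cpev (\<lambda>i. of_real (x i)) ?A)) (of_real t)"
        unfolding map_poly_of_real_pev[symmetric] of_real_hom.map_poly_pderiv[symmetric] by (rule of_real_hom.poly_map_poly[symmetric])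
      also have "\<dots> = complex_of_real (of_nat (k + 1) * t ^ k + (\<Sum>i=1..<k. of_nat i * x i * t ^ (i - 1)))"
        unfolding pderiv_A_WF_A by simp
      finally show ?thesis by (simp only: of_real_eq_iff)
    qed
    then show ?thesis
      using map_A_image_iff[OF that(1) k] that(2,3) poly_pev_A_WF_A[of x k t] by auto
  qed
  have "main_analytic_function k (\<lambda>x. meval x \<Theta>) (std_map (WF_A k) ` coord_space (k - 1))"
  proof (rule main_analytic_functionI[where I = "{()}" and J = "{1..<k}" and a = "\<lambda>i. if i = 1 then - 2 else 0"
        and b = "\<lambda>i. if i = 1 then - 1 else 1" and H = "std_map (WF_A k) X" and G = "\<lambda>_ i. coeff (Q\<^sup>2 * C) i"])
    show "std_map (WF_A k) ` coord_space (k - 1) \<subseteq> zero_set k (\<lambda>x. meval x \<Theta>)"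
    proof
      fix x :: "nat \<Rightarrow> real" assume "x \<in> std_map (WF_A k) ` coord_space (k - 1)"
      then obtain y where y: "y \<in> coord_space (k - 1)" "x = std_map (WF_A k) y" by auto
      have xk: "x \<in> coord_space k" using std_map_coord_space[of "WF_A k" y] k y(2) by simp
      have "(\<lambda>i. complex_of_real (x i)) = std_map (WF_A k) (\<lambda>j. of_real (y j))"
        by (simp add: fun_eq_iff y(2) std_map_of_real del: std_map.simps)
      moreover have "(\<lambda>j. complex_of_real (y j)) \<in> coord_space (k - 1)" using y(1) by (simp add: coord_space_def)
      moreover have "(\<lambda>i. complex_of_real (x i)) \<in> coord_space k" using xk by (simp add: coord_space_def)
      ultimately have "ev (\<lambda>i. of_real (x i)) \<Theta> = 0" using Z by blast
      then show "x \<in> zero_set k (\<lambda>x. meval x \<Theta>)" using xk by (simp add: zero_set_def ev_of_real)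
    qed
  next
    fix x assume "x \<in> std_map (WF_A k) ` coord_space (k - 1)"
    then show "\<exists>y\<in>coord_space (k - 1). \<forall>i<k. x i = meval y (std_map (WF_A k) X i)"
      by (auto simp: std_map_meval simp del: std_map.simps)
  next
    fix x :: "nat \<Rightarrow> real" assume "x \<in> zero_set k (\<lambda>x. meval x \<Theta>)" and xS: "x \<notin> std_map (WF_A k) ` coord_space (k - 1)"
    then have xk: "x \<in> coord_space k" and "meval x \<Theta> = 0" by (auto simp: zero_set_def)
    then have "ev (\<lambda>i. of_real (x i)) \<Theta> = 0" by (simp add: ev_of_real)
    then obtain v where v: "poly (map_poly complex_of_real (pev x ?A)) v = 0" "poly (pderiv (map_poly complex_of_real (pev x ?A))) v = 0"
      unfolding \<Theta>_def ev_resultant_A_eq_0_iff map_poly_of_real_pev by blast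
    have Im: "Im v \<noteq> 0"
    proof
      assume "Im v = 0"
      then have "v = of_real (Re v)" by (simp add: complex_eq_iff)
      with v have "poly (pev x ?A) (Re v) = 0" "poly (pderiv (pev x ?A)) (Re v) = 0"
        by (metis of_real_eq_0_iff of_real_hom.poly_map_poly of_real_hom.map_poly_pderiv)+
      with xS real_mem[OF xk] show False by blast
    qed
    define p where "p = - 2 * Re v"
    define q where "q = (Re v)\<^sup>2 + (Im v)\<^sup>2"
    define m where "m = [:q, p, 1:]"
    obtain c where c: "pev x ?A = m\<^sup>2 * c"
      using quadratic_square_dvd[OF v Im] unfolding m_def p_def q_def by (auto simp del: poly_A.simps)
    have dA: "degree (pev x ?A) = Suc k" "coeff (pev x ?A) (Suc k) = 1"
    proof -
      show "coeff (pev x ?A) (Suc k) = 1" by (simp add: degree_A_WF_A del: poly_A.simps)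
      then show "degree (pev x ?A) = Suc k"
        using degree_map_poly_le[of "meval x" ?A] le_degree[of "pev x ?A" "Suc k"] degree_A_WF_A(1)[of k]
        by (simp add: pev_def del: poly_A.simps)
    qed
    have m2: "m\<^sup>2 = [:q\<^sup>2, 2 * p * q, p\<^sup>2 + 2 * q, 2 * p, 1:]"
      by (simp add: m_def power2_eq_square algebra_simps)
    have c0: "c \<noteq> 0" using c dA by auto
    have dm: "degree (m\<^sup>2) = 4" "coeff (m\<^sup>2) 4 = 1" unfolding m2 by (simp_all add: numeral_eq_Suc)
    have "m\<^sup>2 \<noteq> 0" using dm(1) by (metis degree_0 zero_neq_numeral)
    then have dc: "degree c + 4 = Suc k" using dA(1) c0 dm(1) degree_mult_eq[of "m\<^sup>2" c] unfolding c by simp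
    have lc: "coeff c (degree c) = 1"
      using dA lead_coeff_mult[of "m\<^sup>2" c] dm unfolding c by (simp only: mult_1)
    have k3: "degree c + 3 = k" using dc by simp
    have sub: "coeff c (degree c - 1) = - 2 * p" if "degree c > 0"
    proof -
      have "0 = coeff (pev x ?A) k" by (simp add: coeff_A_WF_A del: poly_A.simps)
      also have "\<dots> = coeff (m\<^sup>2 * c) (degree c + 3)" by (simp only: c k3)
      also have "\<dots> = coeff c (degree c - 1) + 2 * p * coeff c (degree c)"
        using that unfolding m2
        by (cases "degree c") (simp_all add: coeff_pCons coeff_eq_0 numeral_eq_Suc split: nat.split)
      finally show ?thesis using lc by simp
    qed
    \<comment> \<open>This is the case \<open>k = 3\<close>: \<open>C\<close> is constant and the
      missing term of degree \<open>k\<close> gives \<open>p = 0\<close>. Hence \<open>y\<close>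
      stays within one parameter, and the truncated \<open>k - 4\<close> in \<open>C\<close> does no
      harm.\<close>
    have p0: "p = 0" if "degree c = 0"
    proof -
      have "0 = coeff (pev x ?A) k" by (simp add: coeff_A_WF_A del: poly_A.simps)
      also have "\<dots> = coeff (m\<^sup>2 * c) (degree c + 3)" by (simp only: c k3)
      also have "\<dots> = 2 * p"
        using that lc unfolding m2
        by (simp add: coeff_pCons coeff_eq_0 numeral_eq_Suc split: nat.split)
      finally show ?thesis by simp
    qed
    define y where "y i = (if i = 0 then q else if i = 1 then p else if i < k - 2 then coeff c (i - 2) else 0)" for i
    have y01: "y 0 = q" "y 1 = p" by (simp_all add: y_def)
    have yk: "y \<in> coord_space (k - 2)"
      using p0 dc by (auto simp: coord_space_def y_def)
    have "pev y C = c"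
    proof (rule poly_eqI)
      fix i
      have "coeff (pev y C) i = (if i = k - 3 then 1 else 0) + (if i = k - 4 then - 2 * p else 0) + (if i < k - 4 then y (i + 2) else 0)"
        by (simp add: C_def coeff_sum sum.delta mev.hom_add mev.hom_mult mev.hom_uminus mev.hom_numeral y01[simplified])
      also have "\<dots> = coeff c i"
      proof (cases "degree c = 0")
        case True
        then have "k = 3" using dc by simp
        then show ?thesis using lc True p0 by (cases "i = 0") (auto simp: coeff_eq_0)
      next
        case False
        have d: "k - 3 = degree c" "k - 4 = degree c - 1" using dc by linarith+
        consider "i > degree c" | "i = degree c" | "i = degree c - 1" | "i < degree c - 1" by linarith
        then show ?thesis
        proof cases
          case 4
          then have "i + 2 < k - 2" using d dc by linarith
          with 4 show ?thesis unfolding d by (simp add: y_def)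
        qed (use False lc sub in \<open>auto simp: d coeff_eq_0\<close>)
      qed
      finally show "coeff (pev y C) i = coeff c i" .
    qed
    moreover have "pev y Q = m" by (simp add: Q_def m_def y01[simplified])
    ultimately have "pev y (Q\<^sup>2 * C) = pev x ?A"
      by (simp add: pevh.hom_mult pevh.hom_power c del: poly_A.simps)
    then have "meval y (coeff (Q\<^sup>2 * C) i) = x i" if "i < k" for i
      using coeff_pev[of y "Q\<^sup>2 * C" i] that by (simp add: coeff_A_WF_A del: poly_A.simps coeff_pev) (simp add: coeff_A_WF_A del: poly_A.simps)
    then show "\<exists>j\<in>{()}. \<exists>y\<in>coord_space (k - 2). \<forall>i<k. x i = meval y (coeff (Q\<^sup>2 * C) i)"
      using yk by (intro bexI[of _ "()"] bexI[of _ y]) simp_all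
  next
    fix z :: "nat \<Rightarrow> real"
    assume z: "\<And>i. i \<in> {1..<k} \<Longrightarrow> (if i = 1 then - 2 else 0) \<le> z i \<and> z i \<le> (if i = 1 then - 1 else 1)"
    \<comment> \<open>\<open>\<phi>\<close> is \<open>A'\<close>. As \<open>z 1\<close> lies in
      \<open>[-2, -1]\<close> and the other coordinates are nonnegative, it is negative at 0 and
      nonnegative at 2. Its zero \<open>v\<close> then determines \<open>x 0\<close> through
      \<open>A(v) = 0\<close>.\<close>
    define \<phi> where "\<phi> v = of_nat (k + 1) * v ^ k + (\<Sum>i=1..<k. of_nat i * z i * v ^ (i - 1))" for v
    have s1: "(\<Sum>i=1..<k. g i) = g 1 + (\<Sum>i=2..<k. g i)" for g :: "nat \<Rightarrow> real"
      using k by (simp add: sum.atLeast_Suc_lessThan numeral_2_eq_2)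
    have z2: "0 \<le> z i" if "i \<in> {2..<k}" for i using z[of i] that by auto
    have z1: "- 2 \<le> z 1" "z 1 \<le> - 1" using z[of 1] k by auto
    have "\<exists>v\<ge>0. v \<le> 2 \<and> \<phi> v = 0"
    proof (rule IVT')
      have "(\<Sum>i=2..<k. of_nat i * z i * 0 ^ (i - 1)) = 0" by (intro sum.neutral) auto
      then show "\<phi> 0 \<le> 0" unfolding \<phi>_def s1 using k z1 by (simp add: power_0_left)
      have "0 \<le> (\<Sum>i=2..<k. of_nat i * z i * 2 ^ (i - 1))"
        by (intro sum_nonneg mult_nonneg_nonneg) (use z2 in auto)
      moreover have "2 \<le> of_nat (k + 1) * (2 :: real) ^ k"
      proof -
        have "2 * 1 \<le> of_nat (k + 1) * (2 :: real) ^ k" by (rule mult_mono) (use k in auto)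
        then show ?thesis by simp
      qed
      ultimately show "0 \<le> \<phi> 2" unfolding \<phi>_def s1 using z1 by simp
      show "continuous_on {0..2} \<phi>" unfolding \<phi>_def by (intro continuous_intros)
    qed simp
    then obtain v where v: "\<phi> v = 0" by blast
    define x where "x i = (if i = 0 then - (v ^ (k + 1)) - (\<Sum>i=1..<k. z i * v ^ i) else if i < k then z i else 0)" for i
    have xk: "x \<in> coord_space k" using k by (auto simp: x_def coord_space_def)
    have "(\<Sum>i<k. x i * v ^ i) = x 0 + (\<Sum>i=1..<k. x i * v ^ i)"
      using k by (simp add: atLeast0LessThan[symmetric] sum.atLeast_Suc_lessThan)
    moreover have "(\<Sum>i=1..<k. x i * v ^ i) = (\<Sum>i=1..<k. z i * v ^ i)"
      "(\<Sum>i=1..<k. of_nat i * x i * v ^ (i - 1)) = (\<Sum>i=1..<k. of_nat i * z i * v ^ (i - 1))"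
      by (auto simp: x_def intro!: sum.cong)
    ultimately have "x \<in> map_A k ` coord_space (k - 1)"
      using v unfolding map_A_image_iff[OF xk k] by (intro exI[of _ v]) (simp add: x_def[of 0] \<phi>_def)
    then show "\<exists>x\<in>std_map (WF_A k) ` coord_space (k - 1). \<forall>i\<in>{1..<k}. x i = z i"
      by (intro bexI[of _ x]) (auto simp: x_def)
  qed (use k \<Theta> in \<open>auto split: if_splits\<close>)
  with \<Theta> disc show ?thesis by blast
qed

text \<open>The description \<open>Z\<close> of the complex zeros suffices for the real inclusion,
  because a point of the real image lies in the complex image. The box always uses the coordinates
  from 1 on and leaves \<open>x 0\<close> to be solved for.\<close>

lemma main_analytic_std_mapI:
  fixes \<Theta> :: "real mpol" and G :: "'i \<Rightarrow> nat \<Rightarrow> real mpol" and a b :: "nat \<Rightarrow> real"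
  assumes \<tau>: "valid_wf \<tau>" and k: "k = wf_dim \<tau>" and \<Theta>: "\<Theta> \<in> mpolys k"
    and Z: "\<And>x. x \<in> coord_space k \<Longrightarrow> ev x \<Theta> = 0 \<longleftrightarrow> x \<in> std_map \<tau> ` coord_space (k - 1)"
    and I: "finite I"
    and G: "\<And>x. x \<in> coord_space k \<Longrightarrow> ev (\<lambda>i. of_real (x i)) \<Theta> = 0 \<Longrightarrow> x \<notin> std_map \<tau> ` coord_space (k - 1) \<Longrightarrow>
       \<exists>j\<in>I. \<exists>y\<in>coord_space (k - 2). \<forall>i<k. x i = meval y (G j i)"
    and ab: "\<And>i. i \<in> {1..<k} \<Longrightarrow> a i < b i"
    and proj: "\<And>z. (\<And>i. i \<in> {1..<k} \<Longrightarrow> a i \<le> z i \<and> z i \<le> b i) \<Longrightarrow>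
       \<exists>x\<in>std_map \<tau> ` coord_space (k - 1). \<forall>i\<in>{1..<k}. x i = z i"
  shows "main_analytic_function k (\<lambda>x. meval x \<Theta>) (std_map \<tau> ` coord_space (k - 1))"
proof (rule main_analytic_functionI[where I = I and J = "{1..<k}" and a = a and b = b and H = "std_map \<tau> X" and G = G])
  show "std_map \<tau> ` coord_space (k - 1) \<subseteq> zero_set k (\<lambda>x. meval x \<Theta>)"
  proof
    fix x :: "nat \<Rightarrow> real" assume "x \<in> std_map \<tau> ` coord_space (k - 1)"
    then obtain y where y: "y \<in> coord_space (k - 1)" "x = std_map \<tau> y" by auto
    have xk: "x \<in> coord_space k" using std_map_coord_space[OF \<tau>, of y] k y(2) by simp
    have "(\<lambda>i. complex_of_real (x i)) = std_map \<tau> (\<lambda>j. of_real (y j))"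
      by (simp add: fun_eq_iff y(2) std_map_of_real)
    moreover have "(\<lambda>j. complex_of_real (y j)) \<in> coord_space (k - 1)" using y(1) by (simp add: coord_space_def)
    moreover have "(\<lambda>i. complex_of_real (x i)) \<in> coord_space k" using xk by (simp add: coord_space_def)
    ultimately have "ev (\<lambda>i. of_real (x i)) \<Theta> = 0" using Z by blast
    then show "x \<in> zero_set k (\<lambda>x. meval x \<Theta>)" using xk by (simp add: zero_set_def ev_of_real)
  qed
next
  fix x :: "nat \<Rightarrow> real" assume "x \<in> std_map \<tau> ` coord_space (k - 1)"
  then show "\<exists>y\<in>coord_space (k - 1). \<forall>i<k. x i = meval y (std_map \<tau> X i)"
    by (auto simp: std_map_meval)
next
  fix x :: "nat \<Rightarrow> real" assume "x \<in> zero_set k (\<lambda>x. meval x \<Theta>)" "x \<notin> std_map \<tau> ` coord_space (k - 1)"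
  then show "\<exists>j\<in>I. \<exists>y\<in>coord_space (k - 2). \<forall>i<k. x i = meval y (G j i)"
    by (intro G) (auto simp: zero_set_def ev_of_real)
qed (use \<Theta> I ab proj wf_dim_ge_2[OF \<tau>] k in auto)

subsection \<open>Type D\<close>

definition double_root_D :: "int \<Rightarrow> nat \<Rightarrow> (nat \<Rightarrow> 'a::field) \<Rightarrow> 'a \<Rightarrow> bool" where
  "double_root_D s k x v \<longleftrightarrow>
    v ^ k + (\<Sum>i=2..<k. x i * v ^ i) + x 0 * v - of_int s / 4 * (x 1)\<^sup>2 = 0 \<and>
    of_nat k * v ^ (k - 1) + (\<Sum>i=2..<k. of_nat i * x i * v ^ (i - 1)) + x 0 = 0"

definition sing_D :: "int \<Rightarrow> nat \<Rightarrow> (nat \<Rightarrow> 'a::comm_ring_1) \<Rightarrow> 'a \<Rightarrow> 'a \<Rightarrow> bool" where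
  "sing_D s k x u v \<longleftrightarrow>
    x 0 = of_int s * 2 * u\<^sup>2 * v + of_nat (k - 2) * v ^ (k - 1) + (\<Sum>i=3..<k. of_nat (i - 2) * x i * v ^ (i - 1)) \<and>
    x 1 = - of_int s * 2 * u * v \<and>
    x 2 = - of_int s * u\<^sup>2 - of_nat (k - 1) * v ^ (k - 2) - (\<Sum>i=3..<k. of_nat (i - 1) * x i * v ^ (i - 2))"

lemma map_D_image_iff:
  fixes x :: "nat \<Rightarrow> 'a::comm_ring_1"
  assumes x: "x \<in> coord_space k" and k: "k \<ge> 4"
  shows "x \<in> map_D s k ` coord_space (k - 1) \<longleftrightarrow> (\<exists>u v. sing_D s k x u v)"
proof
  assume "x \<in> map_D s k ` coord_space (k - 1)"
  then obtain y where y: "x = map_D s k y" by auto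
  have xi: "x i = y (i - 1)" if "i \<ge> 3" "i < k" for i
    unfolding y map_D_def Let_def target_def using that by auto
  have "(\<Sum>i=3..<k. of_nat (i - 2) * y (i - 1) * y 1 ^ (i - 1)) = (\<Sum>i=3..<k. of_nat (i - 2) * x i * y 1 ^ (i - 1))"
    "(\<Sum>i=3..<k. of_nat (i - 1) * y (i - 1) * y 1 ^ (i - 2)) = (\<Sum>i=3..<k. of_nat (i - 1) * x i * y 1 ^ (i - 2))"
    using xi by (auto intro!: sum.cong)
  then have "sing_D s k x (y 0) (y 1)"
    unfolding sing_D_def using k by (subst (1 3 4) y) (simp add: map_D_def Let_def target_def)
  then show "\<exists>u v. sing_D s k x u v" by blast
next
  assume "\<exists>u v. sing_D s k x u v"
  then obtain u v where uv: "sing_D s k x u v" by blast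
  define y where "y i = (if i = 0 then u else if i = 1 then v else if i < k - 1 then x (i + 1) else 0)" for i
  have y01: "y 0 = u" "y 1 = v" by (simp_all add: y_def)
  have xi: "y (i - 1) = x i" if "i \<ge> 3" "i < k" for i
    using that by (auto simp: y_def)
  have sums: "(\<Sum>i=3..<k. of_nat (i - 2) * y (i - 1) * v ^ (i - 1)) = (\<Sum>i=3..<k. of_nat (i - 2) * x i * v ^ (i - 1))"
    "(\<Sum>i=3..<k. of_nat (i - 1) * y (i - 1) * v ^ (i - 2)) = (\<Sum>i=3..<k. of_nat (i - 1) * x i * v ^ (i - 2))"
    using xi by (auto intro!: sum.cong)
  have "map_D s k y = x"
  proof
    fix i
    have m: "map_D s k y i = (if i = 0 then x 0 else if i = 1 then x 1 else if i \<ge> k then 0 else if i = 2 then x 2 else y (i - 1))"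
      unfolding map_D_def Let_def target_def y01 sums using uv unfolding sing_D_def by (simp only:)
    have "i \<ge> 3" if "i \<noteq> 0" "i \<noteq> 1" "i \<noteq> 2" using that by simp
    then show "map_D s k y i = x i" unfolding m using x xi[of i] by (auto simp: coord_space_def)
  qed
  moreover have "y \<in> coord_space (k - 1)" using k by (auto simp: y_def coord_space_def)
  ultimately show "x \<in> map_D s k ` coord_space (k - 1)" by blast
qed

text \<open>The \<open>A\<close> of type D arises by eliminating \<open>u\<close> through
  \<open>x 1 = - 2 s u v\<close>, which is reversible for \<open>v\<close> nonzero. At
  \<open>v = 0\<close> a double root only says \<open>x 0 = x 1 = 0\<close>, whereas a singular
  point also needs \<open>x 2 = - s u^2\<close>: solvable over the complex numbers, but over the
  reals only if \<open>- s x 2\<close> is nonnegative. This is the source of extra real zeros with a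
  real double root.\<close>

lemma sing_D_double_root_D:
  fixes x :: "nat \<Rightarrow> 'a::field_char_0"
  assumes k: "k \<ge> 4" and s: "s = 1 \<or> s = -1"
  shows "sing_D s k x u v \<Longrightarrow> double_root_D s k x v"
    and "double_root_D s k x v \<Longrightarrow> v \<noteq> 0 \<Longrightarrow> sing_D s k x (- of_int s * x 1 / (2 * v)) v"
    and "double_root_D s k x 0 \<longleftrightarrow> x 0 = 0 \<and> x 1 = 0"
    and "sing_D s k x u 0 \<longleftrightarrow> x 0 = 0 \<and> x 1 = 0 \<and> x 2 = - of_int s * u\<^sup>2"
proof -
  \<comment> \<open>These are the sums in the components with index 2 and 0. By
    \<open>i = 2 (i - 1) - (i - 2)\<close> and \<open>1 = (i - 1) - (i - 2)\<close> the tails of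
    \<open>A'\<close> and \<open>A\<close> are combinations of them, so the rest is free of
    sums.\<close>
  define a where "a v = (\<Sum>i=3..<k. of_nat (i - 1) * x i * v ^ (i - 2))" for v
  define b where "b v = (\<Sum>i=3..<k. of_nat (i - 2) * x i * v ^ (i - 1))" for v
  define K :: 'a where "K = of_nat k"
  define \<sigma> :: 'a where "\<sigma> = of_int s"
  have \<sigma>: "\<sigma> * \<sigma> = 1" using s by (auto simp: \<sigma>_def)
  have K: "of_nat (k - 1) = K - 1" "of_nat (k - 2) = K - 2" using k by (simp_all add: K_def of_nat_diff)
  have pow: "v ^ (k - 1) = v * v ^ (k - 2)" "v ^ k = v\<^sup>2 * v ^ (k - 2)" for v :: 'a
  proof -
    obtain j where "k = j + 4" using k by (metis le_add_diff_inverse2)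
    then show "v ^ (k - 1) = v * v ^ (k - 2)" "v ^ k = v\<^sup>2 * v ^ (k - 2)"
      by (simp_all add: numeral_eq_Suc)
  qed
  have split: "(\<Sum>i=2..<k. g i) = g 2 + (\<Sum>i=3..<k. g i)" for g :: "nat \<Rightarrow> 'a"
    using k by (simp add: sum.atLeast_Suc_lessThan numeral_3_eq_3 numeral_2_eq_2)
  have c: "(\<Sum>i=3..<k. of_nat i * x i * v ^ (i - 1)) = 2 * v * a v - b v" for v
    unfolding a_def b_def sum_distrib_left sum_subtractf[symmetric]
  proof (rule sum.cong)
    fix i assume "i \<in> {3..<k}"
    then obtain j where "i = j + 3" by (metis atLeastLessThan_iff le_add_diff_inverse2)
    then show "of_nat i * x i * v ^ (i - 1) = 2 * v * (of_nat (i - 1) * x i * v ^ (i - 2)) - of_nat (i - 2) * x i * v ^ (i - 1)"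
      by (simp add: algebra_simps numeral_eq_Suc)
  qed simp
  have d: "(\<Sum>i=3..<k. x i * v ^ i) = v\<^sup>2 * a v - v * b v" for v
    unfolding a_def b_def sum_distrib_left sum_subtractf[symmetric]
  proof (rule sum.cong)
    fix i assume "i \<in> {3..<k}"
    then obtain j where "i = j + 3" by (metis atLeastLessThan_iff le_add_diff_inverse2)
    then show "x i * v ^ i = v\<^sup>2 * (of_nat (i - 1) * x i * v ^ (i - 2)) - v * (of_nat (i - 2) * x i * v ^ (i - 1))"
      by (simp add: algebra_simps numeral_eq_Suc)
  qed simp
  have sing: "sing_D s k x u v \<longleftrightarrow> x 0 = \<sigma> * 2 * u\<^sup>2 * v + (K - 2) * (v * v ^ (k - 2)) + b v \<and>
      x 1 = - \<sigma> * 2 * u * v \<and> x 2 = - \<sigma> * u\<^sup>2 - (K - 1) * v ^ (k - 2) - a v" for u v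
    unfolding sing_D_def K pow(1) \<sigma>_def a_def b_def ..
  have dbl: "double_root_D s k x v \<longleftrightarrow>
      v\<^sup>2 * v ^ (k - 2) + (x 2 * v\<^sup>2 + (v\<^sup>2 * a v - v * b v)) + x 0 * v - \<sigma> / 4 * (x 1)\<^sup>2 = 0 \<and>
      K * (v * v ^ (k - 2)) + (2 * x 2 * v + (2 * v * a v - b v)) + x 0 = 0" for v
    unfolding double_root_D_def split c d pow \<sigma>_def K_def by simp
  have a0: "a 0 = 0" "b 0 = 0" unfolding a_def b_def by (auto intro!: sum.neutral simp: power_0_left)
  show "double_root_D s k x v" if "sing_D s k x u v"
  proof -
    have "\<sigma> / 4 * (x 1)\<^sup>2 = (\<sigma> * \<sigma>) * \<sigma> * u\<^sup>2 * v\<^sup>2"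
      using that unfolding sing by (simp add: power2_eq_square)
    then have x1: "\<sigma> / 4 * (x 1)\<^sup>2 = \<sigma> * u\<^sup>2 * v\<^sup>2" by (simp add: \<sigma>)
    from that have x0: "x 0 = \<sigma> * 2 * u\<^sup>2 * v + (K - 2) * (v * v ^ (k - 2)) + b v"
      and x2: "x 2 = - \<sigma> * u\<^sup>2 - (K - 1) * v ^ (k - 2) - a v" unfolding sing by auto
    show ?thesis unfolding dbl x1 unfolding x0 x2 by (simp add: algebra_simps power2_eq_square)
  qed
  show "sing_D s k x (- of_int s * x 1 / (2 * v)) v" if "double_root_D s k x v" and v: "v \<noteq> 0"
  proof -
    define u where "u = - \<sigma> * x 1 / (2 * v)"
    have "- \<sigma> * 2 * u * v = (\<sigma> * \<sigma>) * x 1" using v by (simp add: u_def)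
    then have x1: "x 1 = - \<sigma> * 2 * u * v" by (simp add: \<sigma>)
    then have "\<sigma> / 4 * (x 1)\<^sup>2 = (\<sigma> * \<sigma>) * \<sigma> * u\<^sup>2 * v\<^sup>2" by (simp add: power2_eq_square)
    then have x1': "\<sigma> / 4 * (x 1)\<^sup>2 = \<sigma> * u\<^sup>2 * v\<^sup>2" by (simp add: \<sigma>)
    let ?w = "v ^ (k - 2)"
    have e1: "v\<^sup>2 * ?w + (x 2 * v\<^sup>2 + (v\<^sup>2 * a v - v * b v)) + x 0 * v - \<sigma> * u\<^sup>2 * v\<^sup>2 = 0"
      and e2: "K * (v * ?w) + (2 * x 2 * v + (2 * v * a v - b v)) + x 0 = 0"
      using that(1) unfolding dbl x1' by auto
    have "v * (v * ?w + x 2 * v + v * a v - b v + x 0 - \<sigma> * u\<^sup>2 * v) = 0"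
      using e1 by (simp add: algebra_simps power2_eq_square)
    then have e3: "v * ?w + x 2 * v + v * a v - b v + x 0 - \<sigma> * u\<^sup>2 * v = 0" using v by simp
    have "v * (x 2 - (- \<sigma> * u\<^sup>2 - (K - 1) * ?w - a v)) =
        (K * (v * ?w) + (2 * x 2 * v + (2 * v * a v - b v)) + x 0) - (v * ?w + x 2 * v + v * a v - b v + x 0 - \<sigma> * u\<^sup>2 * v)"
      by (simp add: algebra_simps)
    then have x2: "x 2 = - \<sigma> * u\<^sup>2 - (K - 1) * ?w - a v" using e2 e3 v by simp
    have "x 0 = - (K * (v * ?w) + (2 * x 2 * v + (2 * v * a v - b v)))"
      using e2 by (simp only: eq_neg_iff_add_eq_0 add.commute)
    then have x0: "x 0 = \<sigma> * 2 * u\<^sup>2 * v + (K - 2) * (v * ?w) + b v"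
      unfolding x2 by (simp add: algebra_simps)
    show ?thesis using x0 x1 x2 unfolding sing u_def \<sigma>_def by blast
  qed
  show "double_root_D s k x 0 \<longleftrightarrow> x 0 = 0 \<and> x 1 = 0"
    unfolding dbl using s k by (auto simp: a0 \<sigma>_def power_0_left)
  show "sing_D s k x u 0 \<longleftrightarrow> x 0 = 0 \<and> x 1 = 0 \<and> x 2 = - of_int s * u\<^sup>2"
    unfolding sing using k by (auto simp: a0 \<sigma>_def power_0_left)
qed

lemma coeff_A_WF_D:
  assumes "k \<ge> 4"
  shows "coeff (poly_A (WF_D s k)) i = (if i = k then 1 else if i = 0 then - (Const (of_int s / 4) * (X 1)\<^sup>2)
    else if i = 1 then X 0 else if i < k then X i else 0)"
  using assms by (cases "i = 0") (auto simp: coeff_sum sum.delta coeff_pCons split: nat.split)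

lemma degree_A_WF_D: "k \<ge> 4 \<Longrightarrow> degree (poly_A (WF_D s k)) = k"
  by (intro antisym degree_le le_degree) (auto simp: coeff_A_WF_D simp del: poly_A.simps)

lemma degree_cpev_A_WF_D: "k \<ge> 4 \<Longrightarrow> degree (cpev x (poly_A (WF_D s k))) = k"
  by (intro antisym degree_le le_degree) (auto simp: coeff_A_WF_D simp del: poly_A.simps)

lemma double_root_D_poly:
  "poly (cpev x (poly_A (WF_D s k))) v = 0 \<and> poly (pderiv (cpev x (poly_A (WF_D s k)))) v = 0 \<longleftrightarrow> double_root_D s k x v"
proof -
  have "poly (cpev x (poly_A (WF_D s k))) v = v ^ k + (\<Sum>i=2..<k. x i * v ^ i) + x 0 * v - of_int s / 4 * (x 1)\<^sup>2"
    by (simp add: cpevh.hom_add cpevh.hom_minus cpevh.hom_sum poly_monom poly_sum evh.hom_mult evh.hom_power)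
  moreover have "poly (pderiv (cpev x (poly_A (WF_D s k)))) v = of_nat k * v ^ (k - 1) + (\<Sum>i=2..<k. of_nat i * x i * v ^ (i - 1)) + x 0"
    by (simp add: cpevh.hom_add cpevh.hom_minus cpevh.hom_sum poly_monom poly_sum pderiv_add pderiv_diff pderiv_monom pderiv_sum pderiv_pCons)
  ultimately show ?thesis unfolding double_root_D_def by simp
qed

lemma double_root_D_real: "double_root_D s k (\<lambda>i. complex_of_real (x i)) (of_real t) \<longleftrightarrow> double_root_D s k x t"
proof -
  have e: "complex_of_real (t ^ k + (\<Sum>i=2..<k. x i * t ^ i) + x 0 * t - of_int s / 4 * (x 1)\<^sup>2) =
    of_real t ^ k + (\<Sum>i=2..<k. of_real (x i) * of_real t ^ i) + of_real (x 0) * of_real t - of_int s / 4 * (of_real (x 1))\<^sup>2"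
    "complex_of_real (of_nat k * t ^ (k - 1) + (\<Sum>i=2..<k. of_nat i * x i * t ^ (i - 1)) + x 0) =
     of_nat k * of_real t ^ (k - 1) + (\<Sum>i=2..<k. of_nat i * of_real (x i) * of_real t ^ (i - 1)) + of_real (x 0)"
    by simp_all
  show ?thesis unfolding double_root_D_def e[symmetric] of_real_eq_0_iff ..
qed

lemma ev_resultant_D_eq_0_iff:
  assumes k: "k \<ge> 4"
  shows "ev x (resultant (poly_A (WF_D s k)) (poly_B (WF_D s k))) = 0 \<longleftrightarrow> (\<exists>v. double_root_D s k x v)"
proof -
  let ?A = "poly_A (WF_D s k)"
  have d: "degree (cpev x ?A) = degree ?A" using k by (simp add: degree_cpev_A_WF_D degree_A_WF_D del: poly_A.simps)
  have nz: "cpev x ?A \<noteq> 0" using degree_cpev_A_WF_D[OF k, of x s] k by (auto simp del: poly_A.simps)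
  have "degree (pderiv (cpev x ?A)) \<le> degree (pderiv ?A)"
    by (simp add: degree_pderiv d del: poly_A.simps)
  from resultant_sub_eq_0_iff[OF nz this] show ?thesis
    by (simp add: ev_resultant d cpev_pderiv double_root_D_poly del: poly_A.simps)
qed

text \<open>\<open>A\<close> contains \<open>x 1\<close> only in its constant term, through
  \<open>x 1\<close> squared, and \<open>A'\<close> not at all. Each of the \<open>k - 1\<close>
  roots of \<open>A'\<close> therefore contributes a factor quadratic in \<open>x 1\<close>.\<close>

lemma ev_resultant_D_main_variable:
  assumes k: "k \<ge> 4" and s: "s = 1 \<or> s = -1"
  shows "\<exists>p. degree p = 2 * (k - 1) \<and> coeff p (2 * (k - 1)) = (-1) ^ (k * (k - 1)) * of_nat k ^ k * (- of_int s / 4) ^ (k - 1) \<and>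
    (\<forall>z. ev (x(1 := z)) (resultant (poly_A (WF_D s k)) (poly_B (WF_D s k))) = poly p z)"
proof -
  let ?A = "poly_A (WF_D s k)"
  let ?a = "\<lambda>z. cpev (x(1 := z)) ?A"
  have deg: "degree (?a z) = k" for z by (rule degree_cpev_A_WF_D[OF k])
  have pd: "pderiv (?a z) = pderiv (?a 0)" for z
    using k by (intro poly_eqI) (simp add: coeff_pderiv coeff_A_WF_D del: poly_A.simps)
  have dp: "degree (pderiv (?a 0)) = k - 1" "lead_coeff (pderiv (?a 0)) = of_nat k"
  proof -
    show d: "degree (pderiv (?a 0)) = k - 1" by (simp add: degree_pderiv degree_cpev_A_WF_D k del: poly_A.simps)
    show "lead_coeff (pderiv (?a 0)) = of_nat k"
      unfolding d using k by (simp add: coeff_pderiv coeff_A_WF_D del: poly_A.simps)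
  qed
  obtain as where as: "length as = k - 1" "pderiv (?a 0) = Polynomial.smult (of_nat k) (\<Prod>a\<leftarrow>as. [:-a, 1:])"
    using complex_poly_roots[of "pderiv (?a 0)"] dp by auto
  define p where "p = Polynomial.smult ((-1) ^ (k * (k - 1)) * of_nat k ^ k) (\<Prod>a\<leftarrow>as. [:poly (?a 0) a, 0, - of_int s / 4:])"
  have lin: "?a z = ?a 0 + [:- of_int s / 4 * z\<^sup>2:]" for z
    using k by (intro poly_eqI) (auto simp: coeff_A_WF_D coeff_pCons evh.hom_mult evh.hom_power evh.hom_uminus simp del: poly_A.simps split: nat.split)
  have "ev (x(1 := z)) (resultant ?A (poly_B (WF_D s k))) = poly p z" for z
  proof -
    have "ev (x(1 := z)) (resultant ?A (poly_B (WF_D s k))) = resultant_sub k (k - 1) (?a z) (pderiv (?a z))"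
      using k by (simp add: ev_resultant cpev_pderiv degree_pderiv degree_A_WF_D del: poly_A.simps)
    also have "\<dots> = resultant (?a z) (pderiv (?a z))"
      by (simp add: resultant_sub degree_pderiv degree_cpev_A_WF_D k del: poly_A.simps)
    also have "\<dots> = (-1) ^ (k * (k - 1)) * of_nat k ^ k * (\<Prod>a\<leftarrow>as. poly (?a z) a)"
    proof -
      have nz: "of_nat k \<noteq> (0 :: complex)" using k by simp
      show ?thesis
        unfolding pd[of z] using resultant_prod_right[OF deg[of z] as(2) nz] as(1) by (simp del: poly_A.simps)
    qed
    also have "(\<Prod>a\<leftarrow>as. poly (?a z) a) = (\<Prod>a\<leftarrow>as. poly [:poly (?a 0) a, 0, - of_int s / 4:] z)"
      unfolding lin[of z] by (intro arg_cong[of _ _ prod_list] map_cong refl) (simp add: power2_eq_square del: poly_A.simps)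
    also have "(-1) ^ (k * (k - 1)) * of_nat k ^ k * \<dots> = poly p z"
      by (simp add: p_def poly_prod_list o_def del: poly_A.simps)
    finally show ?thesis .
  qed
  moreover have "degree p = 2 * (k - 1)" "coeff p (2 * (k - 1)) = (-1) ^ (k * (k - 1)) * of_nat k ^ k * (- of_int s / 4) ^ (k - 1)"
  proof -
    have "degree (\<Prod>a\<leftarrow>as. [:poly (?a 0) a, 0, - of_int s / 4:]) = 2 * (k - 1) \<and>
      coeff (\<Prod>a\<leftarrow>as. [:poly (?a 0) a, 0, - of_int s / 4:]) (2 * (k - 1)) = (- of_int s / 4) ^ (k - 1)"
      using prod_monic[of "\<lambda>a. [:poly (?a 0) a, 0, - of_int s / 4:]" 2 "- of_int s / 4" as] as(1) s
      by (auto simp: numeral_2_eq_2 simp del: poly_A.simps)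
    then show "degree p = 2 * (k - 1)" "coeff p (2 * (k - 1)) = (-1) ^ (k * (k - 1)) * of_nat k ^ k * (- of_int s / 4) ^ (k - 1)"
      unfolding p_def using k by (auto simp del: poly_A.simps)
  qed
  ultimately show ?thesis by blast
qed

lemma wf_D_conclusion:
  assumes k: "k \<ge> 4" and s: "s = 1 \<or> s = -1"
  defines "\<Theta> \<equiv> resultant (poly_A (WF_D s k)) (poly_B (WF_D s k))"
  shows "\<Theta> \<in> mpolys k \<and>
    main_analytic_function k (\<lambda>x. meval x \<Theta>) (std_map (WF_D s k) ` coord_space (k - 1)) \<and>
    (\<exists>\<Delta>. discriminant_polynomial k (std_map (WF_D s k)) \<Delta>) \<and>
    (\<forall>\<Delta>. discriminant_polynomial k (std_map (WF_D s k)) \<Delta> \<longrightarrow> (\<exists>c. c \<noteq> 0 \<and> complexify \<Theta> = Const c * \<Delta>))"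
proof -
  let ?A = "poly_A (WF_D s k)"
  have Am: "coeff ?A i \<in> mpolys k" for i
    using k by (auto simp: coeff_A_WF_D simp del: poly_A.simps intro!: mpolys_intros)
  have \<Theta>: "\<Theta> \<in> mpolys k"
    unfolding \<Theta>_def poly_B.simps
    by (intro mpolys_resultant Am) (auto simp: coeff_pderiv simp del: poly_A.simps of_nat_Suc intro!: mpolys_intros Am)
  have mem: "x \<in> std_map (WF_D s k) ` coord_space (k - 1) \<longleftrightarrow> (\<exists>u v. sing_D s k x u v)" if "x \<in> coord_space k" for x :: "nat \<Rightarrow> 'a::comm_ring_1"
    using map_D_image_iff[OF that k] by simp
  have s2: "of_int s * (of_int s :: complex) = 1" using s by auto
  have Z: "ev x \<Theta> = 0 \<longleftrightarrow> x \<in> std_map (WF_D s k) ` coord_space (k - 1)" if x: "x \<in> coord_space k" for x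
    unfolding mem[OF x] \<Theta>_def ev_resultant_D_eq_0_iff[OF k]
  proof
    assume "\<exists>v. double_root_D s k x v"
    then obtain v where v: "double_root_D s k x v" by blast
    show "\<exists>u v. sing_D s k x u v"
    proof (cases "v = 0")
      case True
      have "x 2 = - of_int s * (csqrt (- of_int s * x 2))\<^sup>2" using s2 by (simp flip: mult.assoc)
      then have "sing_D s k x (csqrt (- of_int s * x 2)) 0"
        using v True sing_D_double_root_D(3,4)[OF k s, of x] by auto
      then show ?thesis by blast
    next
      case False
      then show ?thesis using sing_D_double_root_D(2)[OF k s v] by blast
    qed
  qed (use sing_D_double_root_D(1)[OF k s] in blast)
  have disc: "(\<exists>\<Delta>. discriminant_polynomial k (std_map (WF_D s k)) \<Delta>) \<and>
    (\<forall>\<Delta>. discriminant_polynomial k (std_map (WF_D s k)) \<Delta> \<longrightarrow> (\<exists>c. c \<noteq> 0 \<and> complexify \<Theta> = Const c * \<Delta>))"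
  \<comment> \<open>With \<open>x 0 = - k\<close>, \<open>x 1 = z\<close> and the rest 0,
    \<open>A = v^k - k v - s z^2 / 4\<close>. Take a critical point with \<open>w^(k-1) = 1\<close>;
    then \<open>A(w) = 0\<close> reads \<open>s z^2 / 4 = w (1 - k)\<close>. Altogether this gives
    \<open>2 (k - 1)\<close> distinct \<open>z\<close>.\<close>
  proof (rule discriminant_from_data[where e = 1 and N = "2 * (k - 1)"
        and c = "(-1) ^ (k * (k - 1)) * of_nat k ^ k * (- of_int s / 4) ^ (k - 1)"
        and Zs = "{z. z ^ (2 * (k - 1)) = (4 * of_int s * (1 - of_nat k)) ^ (k - 1)}" and ?x0.0 = "(\<lambda>_. 0)(0 := - of_nat k)"])
    show "\<exists>p. degree p = 2 * (k - 1) \<and> coeff p (2 * (k - 1)) = (-1) ^ (k * (k - 1)) * of_nat k ^ k * (- of_int s / 4) ^ (k - 1) \<and>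
        (\<forall>z. ev (x(1 := z)) \<Theta> = poly p z)" for x
      unfolding \<Theta>_def by (rule ev_resultant_D_main_variable[OF k s])
    have k1: "1 - of_nat k \<noteq> (0 :: complex)"
      using k by (metis eq_iff_diff_eq_0 of_nat_1 of_nat_eq_iff one_le_numeral order_antisym_conv numeral_eq_one_iff semiring_norm(85))
    have "(4 * of_int s * (1 - of_nat k)) ^ (k - 1) \<noteq> (0 :: complex)" using k1 s by auto
    then show "finite {z :: complex. z ^ (2 * (k - 1)) = (4 * of_int s * (1 - of_nat k)) ^ (k - 1)}"
      "card {z :: complex. z ^ (2 * (k - 1)) = (4 * of_int s * (1 - of_nat k)) ^ (k - 1)} = 2 * (k - 1)"
      using k by (auto intro!: finite_nth_roots card_nth_roots)
    fix z :: complex assume "z \<in> {z. z ^ (2 * (k - 1)) = (4 * of_int s * (1 - of_nat k)) ^ (k - 1)}"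
    then have zk: "(z\<^sup>2) ^ (k - 1) = (4 * of_int s * (1 - of_nat k)) ^ (k - 1)" by (simp add: power_mult)
    define w where "w = of_int s * z\<^sup>2 / (4 * (1 - of_nat k))"
    have "w ^ (k - 1) * (4 * (1 - of_nat k)) ^ (k - 1) = (of_int s) ^ (k - 1) * (z\<^sup>2) ^ (k - 1)"
      using k1 by (simp add: w_def flip: power_mult_distrib)
    also have "\<dots> = (of_int s * of_int s * (4 * (1 - of_nat k))) ^ (k - 1)"
      unfolding zk by (simp only: power_mult_distrib[symmetric] mult_ac)
    also have "\<dots> = (4 * (1 - of_nat k)) ^ (k - 1)" by (simp add: s2)
    finally have wk: "w ^ (k - 1) = 1" using k1 by simp
    then have wk': "w ^ k = w" using k by (metis One_nat_def Suc_le_D mult_1 numeral_eq_Suc power_Suc2 diff_Suc_1)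
    have "of_int s / 4 * z\<^sup>2 = of_int s * z\<^sup>2 / (4 * r) * r" if "r \<noteq> 0" for r :: complex
      using that by simp
    from this[OF k1] have sz: "of_int s / 4 * z\<^sup>2 = w * (1 - of_nat k)" unfolding w_def .
    let ?x = "((\<lambda>_. 0)(0 := - of_nat k))(1 := z)"
    have "double_root_D s k ?x w"
      unfolding double_root_D_def using wk wk' sz by (simp add: algebra_simps)
    then show "ev ?x \<Theta> = 0"
      unfolding \<Theta>_def ev_resultant_D_eq_0_iff[OF k] by blast
  qed (use k s \<Theta> Z in auto)
  define Q :: "real mpol poly" where "Q = [:X 0, X 1, 1:]"
  \<comment> \<open>In \<open>A = Q^2 C\<close> the constant terms give
    \<open>- s (x 1)^2 / 4 = q^2 C(0)\<close>. With \<open>e = x 1 / (2 q)\<close> this says that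
    \<open>C(0) = - s e^2\<close>, while \<open>x 1 = 2 q e\<close>; taking \<open>e\<close> as a
    parameter avoids a square root. For \<open>k \<ge> 5\<close> the parameters are
    \<open>q\<close>, \<open>p\<close>, \<open>e\<close> and the coefficients of \<open>C\<close> in
    degrees 1 to \<open>k - 5\<close>.\<close>
  define C :: "real mpol poly" where "C = monom 1 (k - 4) + (\<Sum>i=1..<k-4. monom (X (i + 2)) i) + [:Const (- of_int s) * (X 2)\<^sup>2:]"
  \<comment> \<open>Index 0 is a real double root at 0, where \<open>x 0 = x 1 = 0\<close>. Indices
    1 and 2 belong to \<open>k = 4\<close>, where \<open>C = 1\<close> leaves only the sign in
    \<open>x 1 = 2 q\<close> or \<open>x 1 = - 2 q\<close>. Index 3 is \<open>k \<ge> 5\<close>. The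
    coordinate \<open>x 0\<close> is the coefficient of \<open>A\<close> in degree 1.\<close>
  define G :: "nat \<Rightarrow> nat \<Rightarrow> real mpol" where
    "G j i = (if j = 0 then (if i < 2 then 0 else X (i - 2))
      else if j = 1 then (if i = 0 then coeff (Q\<^sup>2) 1 else if i = 1 then 2 * X 0 else coeff (Q\<^sup>2) i)
      else if j = 2 then (if i = 0 then coeff (Q\<^sup>2) 1 else if i = 1 then - 2 * X 0 else coeff (Q\<^sup>2) i)
      else (if i = 0 then coeff (Q\<^sup>2 * C) 1 else if i = 1 then 2 * X 0 * X 2 else coeff (Q\<^sup>2 * C) i))" for j i
  define B where "B = 1 + real k + real k * real k"
  have "main_analytic_function k (\<lambda>x. meval x \<Theta>) (std_map (WF_D s k) ` coord_space (k - 1))"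
  proof (rule main_analytic_std_mapI[where I = "{0, 1, 2, 3}" and a = "\<lambda>i. if i = 1 then 1 else if i = 2 then - B - 2 else 0"
        and b = "\<lambda>i. if i = 1 then 2 else if i = 2 then - B - 1 else 1" and G = G])
    fix x :: "nat \<Rightarrow> real" assume xk: "x \<in> coord_space k" and "ev (\<lambda>i. of_real (x i)) \<Theta> = 0"
      and xS: "x \<notin> std_map (WF_D s k) ` coord_space (k - 1)"
    then obtain v where v: "double_root_D s k (\<lambda>i. complex_of_real (x i)) v"
      unfolding \<Theta>_def ev_resultant_D_eq_0_iff[OF k] by blast
    show "\<exists>j\<in>{0, 1, 2, 3}. \<exists>y\<in>coord_space (k - 2). \<forall>i<k. x i = meval y (G j i)"
    proof (cases "Im v = 0")
      case True
      then have "v = of_real (Re v)" by (simp add: complex_eq_iff)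
      with v have t: "double_root_D s k x (Re v)" using double_root_D_real by metis
      have "Re v = 0"
      proof (rule ccontr)
        assume "Re v \<noteq> 0"
        then have "\<exists>u v. sing_D s k x u v" using sing_D_double_root_D(2)[OF k s t] by blast
        then show False using mem[OF xk] xS by blast
      qed
      then have x01: "x 0 = 0" "x 1 = 0" using t sing_D_double_root_D(3)[OF k s, of x] by auto
      define y where "y i = x (i + 2)" for i
      have "y \<in> coord_space (k - 2)" using xk by (auto simp: y_def coord_space_def)
      moreover have "x i = meval y (G 0 i)" for i
      proof (cases "i < 2")
        case False
        then have "i - 2 + 2 = i" by simp
        then show ?thesis using False by (simp only: G_def y_def meval_X if_False if_True simp_thms)
      qed (use x01 in \<open>auto simp: G_def less_2_cases_iff\<close>)
      ultimately show ?thesis by (intro bexI[of _ 0] bexI[of _ y]) auto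
    next
      case False
      let ?f = "pev x ?A"
      have v': "poly (map_poly complex_of_real ?f) v = 0" "poly (pderiv (map_poly complex_of_real ?f)) v = 0"
        using v unfolding map_poly_of_real_pev double_root_D_poly[symmetric] by auto
      define p where "p = - 2 * Re v"
      define q where "q = (Re v)\<^sup>2 + (Im v)\<^sup>2"
      have q: "q > 0" unfolding q_def using False by (simp add: sum_power2_gt_zero_iff)
      define m where "m = [:q, p, 1:]"
      obtain c where c: "?f = m\<^sup>2 * c"
        using quadratic_square_dvd[OF v' False] unfolding m_def p_def q_def by (auto simp del: poly_A.simps)
      have cf: "coeff ?f i = (if i = k then 1 else if i = 0 then - (of_int s / 4 * (x 1)\<^sup>2)
          else if i = 1 then x 0 else if i < k then x i else 0)" for i
        using k by (simp add: coeff_A_WF_D mev.hom_mult mev.hom_power mev.hom_uminus del: poly_A.simps)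
      have dA: "degree ?f = k" "coeff ?f k = 1"
      proof -
        show "degree ?f = k" using k by (intro antisym degree_le le_degree) (auto simp: cf simp del: poly_A.simps coeff_pev)
      qed (simp add: cf del: poly_A.simps coeff_pev)
      have m2: "m\<^sup>2 = [:q\<^sup>2, 2 * p * q, p\<^sup>2 + 2 * q, 2 * p, 1:]"
        by (simp add: m_def power2_eq_square algebra_simps)
      have c0: "c \<noteq> 0" using c dA k by auto
      have dm: "degree (m\<^sup>2) = 4" "coeff (m\<^sup>2) 4 = 1" unfolding m2 by (simp_all add: numeral_eq_Suc)
      have "m\<^sup>2 \<noteq> 0" using dm(1) by (metis degree_0 zero_neq_numeral)
      then have dc: "degree c + 4 = k" using dA(1) c0 dm(1) degree_mult_eq[of "m\<^sup>2" c] unfolding c by simp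
      have lc: "coeff c (degree c) = 1"
        using dA lead_coeff_mult[of "m\<^sup>2" c] dm unfolding c by (simp only: mult_1)
      have const: "- (of_int s / 4 * (x 1)\<^sup>2) = q\<^sup>2 * coeff c 0"
      proof -
        have "- (of_int s / 4 * (x 1)\<^sup>2) = coeff ?f 0" unfolding cf using k by simp
        also have "\<dots> = q\<^sup>2 * coeff c 0" unfolding c m2 coeff_mult_0 by simp
        finally show ?thesis .
      qed
      show ?thesis
      proof (cases "k = 4")
        case True
        then have "degree c = 0" using dc by simp
        then have c1: "c = 1" using lc by (metis degree_eq_zeroE coeff_pCons_0 one_pCons)
        define y where "y i = (if i = 0 then q else if i = 1 then p else 0)" for i :: nat
        have yk: "y \<in> coord_space (k - 2)" using k by (auto simp: coord_space_def y_def)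
        have "pev y Q = m" by (simp add: Q_def m_def y_def)
        then have "pev y (Q\<^sup>2) = ?f" by (simp add: pevh.hom_power c c1 del: poly_A.simps)
        then have mc: "meval y (coeff (Q\<^sup>2) i) = coeff ?f i" for i by (metis coeff_pev)
        have "s = -1"
        proof (rule ccontr)
          assume "s \<noteq> -1"
          then have "s = 1" using s by simp
          then have "- ((x 1)\<^sup>2 / 4) = q\<^sup>2" using const c1 by simp
          moreover have "0 \<le> (x 1)\<^sup>2" "0 < q\<^sup>2" using q by simp_all
          ultimately show False by linarith
        qed
        then have "(x 1 - 2 * q) * (x 1 + 2 * q) = 0"
          using const c1 by (simp add: algebra_simps power2_eq_square)
        then consider "x 1 = 2 * q" | "x 1 = - 2 * q" by auto
        then show ?thesis
        proof cases
          case 1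
          have "x i = meval y (G 1 i)" if "i < k" for i
            using that 1 k by (auto simp: G_def mc cf mev.hom_mult mev.hom_numeral simp del: poly_A.simps coeff_pev) (auto simp: y_def)
          then show ?thesis using yk by (intro bexI[of _ 1] bexI[of _ y]) auto
        next
          case 2
          have "x i = meval y (G 2 i)" if "i < k" for i
            using that 2 k by (auto simp: G_def mc cf mev.hom_mult mev.hom_numeral mev.hom_uminus simp del: poly_A.simps coeff_pev) (auto simp: y_def)
          then show ?thesis using yk by (intro bexI[of _ 2] bexI[of _ y]) auto
        qed
      next
        case False
        then have k5: "k \<ge> 5" "degree c > 0" using k dc by auto
        define e where "e = x 1 / (2 * q)"
        have x1: "x 1 = 2 * q * e" using q by (simp add: e_def)
        have "q\<^sup>2 * coeff c 0 = q\<^sup>2 * (- of_int s * e\<^sup>2)"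
          unfolding const[symmetric] x1 by (simp add: power2_eq_square)
        moreover have "q\<^sup>2 \<noteq> 0" using q by simp
        ultimately have ce: "coeff c 0 = - of_int s * e\<^sup>2" using mult_left_cancel by blast
        define y where "y i = (if i = 0 then q else if i = 1 then p else if i = 2 then e else if i < k - 2 then coeff c (i - 2) else 0)" for i
        have y012: "y 0 = q" "y 1 = p" "y 2 = e" by (simp_all add: y_def)
        have yk: "y \<in> coord_space (k - 2)" using k5 by (auto simp: coord_space_def y_def)
        have "pev y C = c"
        proof (rule poly_eqI)
          fix i
          have "coeff (pev y C) i = (if i = k - 4 then 1 else 0) + (if 1 \<le> i \<and> i < k - 4 then y (i + 2) else 0) + (if i = 0 then - of_int s * (y 2)\<^sup>2 else 0)"
            by (cases i) (auto simp: C_def coeff_sum sum.delta mev.hom_add mev.hom_mult mev.hom_power coeff_pCons mev.hom_sum)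
          also have "\<dots> = coeff c i"
          proof -
            have d: "k - 4 = degree c" using dc by linarith
            consider "i = 0" | "i > degree c" | "i = degree c" | "1 \<le> i" "i < degree c" by linarith
            then show ?thesis
            proof cases
              case 4
              then have "i + 2 < k - 2" using dc by linarith
              with 4 show ?thesis unfolding d by (simp add: y_def)
            qed (use k5 lc ce y012 in \<open>auto simp: d coeff_eq_0\<close>)
          qed
          finally show "coeff (pev y C) i = coeff c i" .
        qed
        moreover have "pev y Q = m" by (simp add: Q_def m_def y012[simplified])
        ultimately have "pev y (Q\<^sup>2 * C) = ?f"
          by (simp add: pevh.hom_mult pevh.hom_power c del: poly_A.simps)
        then have mc: "meval y (coeff (Q\<^sup>2 * C) i) = coeff ?f i" for i by (metis coeff_pev)
        have "x i = meval y (G 3 i)" if "i < k" for i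
          using that k x1 y012 by (auto simp: G_def mc cf mev.hom_mult mev.hom_numeral simp del: poly_A.simps coeff_pev)
        then show ?thesis using yk by (intro bexI[of _ 3] bexI[of _ y]) auto
      qed
    qed
  next
    fix z :: "nat \<Rightarrow> real"
    assume z: "\<And>i. i \<in> {1..<k} \<Longrightarrow> (if i = 1 then 1 else if i = 2 then - B - 2 else 0) \<le> z i \<and>
      z i \<le> (if i = 1 then 2 else if i = 2 then - B - 1 else 1)"
    \<comment> \<open>\<open>\<phi> v\<close> is the value of \<open>x 2\<close> forced by a
      singular point with coordinate \<open>v\<close> once \<open>u = - s x 1 / (2 v)\<close> is
      inserted; the interval starts at 1 to avoid the pole. \<open>\<phi> 1\<close> is at least
      \<open>- B\<close>, and at \<open>B + 3\<close> the leading term brings \<open>\<phi>\<close>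
      down to at most \<open>- B - 2\<close>, so the range covers the box for
      \<open>x 2\<close>.\<close>
    define \<phi> where "\<phi> v = - of_int s * (z 1 / (2 * v))\<^sup>2 - of_nat (k - 1) * v ^ (k - 2) - (\<Sum>i=3..<k. of_nat (i - 1) * z i * v ^ (i - 2))" for v
    have z1: "1 \<le> z 1" "z 1 \<le> 2" and z2: "- B - 2 \<le> z 2" "z 2 \<le> - B - 1" using z[of 1] z[of 2] k by auto
    have z3: "0 \<le> z i" "z i \<le> 1" if "i \<in> {3..<k}" for i using z[of i] that by auto
    have B: "B \<ge> 1" by (simp add: B_def)
    have sq: "(z 1 / (2 * v))\<^sup>2 \<le> 1" if "v \<ge> 1" for v
    proof -
      have "0 \<le> z 1 / (2 * v)" "z 1 / (2 * v) \<le> 1" using that z1 by (auto simp: field_simps)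
      then show ?thesis by (simp add: power_le_one)
    qed
    have sb: "- 1 \<le> - of_int s * t \<and> - of_int s * t \<le> 1" if "0 \<le> t" "t \<le> 1" for t :: real
      using s that by auto
    have "\<exists>v\<ge>1. v \<le> B + 3 \<and> \<phi> v = z 2"
    proof (rule IVT2')
      have "(\<Sum>i=3..<k. of_nat (i - 1) * z i * 1 ^ (i - 2)) \<le> (\<Sum>i=3..<k. real k)"
      proof (rule sum_mono)
        fix i assume i: "i \<in> {3..<k}"
        then have "of_nat (i - 1) * z i \<le> real k * 1" using z3[OF i] by (intro mult_mono) auto
        then show "of_nat (i - 1) * z i * 1 ^ (i - 2) \<le> real k" by simp
      qed
      also have "\<dots> \<le> real k * real k" by (simp add: mult_mono)
      finally have "(\<Sum>i=3..<k. of_nat (i - 1) * z i * 1 ^ (i - 2)) \<le> real k * real k" .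
      moreover have "- 1 \<le> - of_int s * (z 1 / (2 * 1))\<^sup>2" using sb[OF zero_le_power2 sq[of 1]] by blast
      moreover have "of_nat (k - 1) * (1 :: real) ^ (k - 2) \<le> real k" by simp
      ultimately have "- B \<le> \<phi> 1" unfolding \<phi>_def B_def by linarith
      then show "z 2 \<le> \<phi> 1" using z2 by linarith
      have "0 \<le> (\<Sum>i=3..<k. of_nat (i - 1) * z i * (B + 3) ^ (i - 2))"
        using B z3 by (intro sum_nonneg mult_nonneg_nonneg) auto
      moreover have "- of_int s * (z 1 / (2 * (B + 3)))\<^sup>2 \<le> 1"
        using sb[OF zero_le_power2 sq[of "B + 3"]] B by simp
      moreover have "B + 3 \<le> of_nat (k - 1) * (B + 3) ^ (k - 2)"
      proof -
        have "(B + 3) ^ 1 \<le> (B + 3) ^ (k - 2)" using B k by (intro power_increasing) auto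
        moreover have "1 * (B + 3) ^ (k - 2) \<le> of_nat (k - 1) * (B + 3) ^ (k - 2)"
          using B k by (intro mult_right_mono) auto
        ultimately show ?thesis by simp
      qed
      ultimately show "\<phi> (B + 3) \<le> z 2" unfolding \<phi>_def using z2 by linarith
      show "continuous_on {1..B + 3} \<phi>" unfolding \<phi>_def by (intro continuous_intros) auto
    qed (use B in simp)
    then obtain v where v: "v \<ge> 1" "\<phi> v = z 2" by blast
    define u where "u = - of_int s * (z 1 / (2 * v))"
    define x where "x i = (if i = 0 then of_int s * 2 * u\<^sup>2 * v + of_nat (k - 2) * v ^ (k - 1) + (\<Sum>i=3..<k. of_nat (i - 2) * z i * v ^ (i - 1))
       else if i < k then z i else 0)" for i
    have xk: "x \<in> coord_space k" using k by (auto simp: x_def coord_space_def)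
    have u2: "u\<^sup>2 = (z 1 / (2 * v))\<^sup>2" unfolding u_def using s by (auto simp: power_mult_distrib)
    have "- of_int s * 2 * u * v = (of_int s * of_int s) * z 1" using v by (simp add: u_def)
    then have "z 1 = - of_int s * 2 * u * v" using s by auto
    moreover have "(\<Sum>i=3..<k. of_nat (i - 2) * x i * v ^ (i - 1)) = (\<Sum>i=3..<k. of_nat (i - 2) * z i * v ^ (i - 1))"
      "(\<Sum>i=3..<k. of_nat (i - 1) * x i * v ^ (i - 2)) = (\<Sum>i=3..<k. of_nat (i - 1) * z i * v ^ (i - 2))"
      by (auto simp: x_def intro!: sum.cong)
    moreover have "x 0 = of_int s * 2 * u\<^sup>2 * v + of_nat (k - 2) * v ^ (k - 1) + (\<Sum>i=3..<k. of_nat (i - 2) * z i * v ^ (i - 1))"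
      "x 1 = z 1" "x 2 = z 2" using k by (simp_all add: x_def)
    ultimately have "sing_D s k x u v"
      using v(2) unfolding sing_D_def \<phi>_def u2 by simp
    then have "x \<in> std_map (WF_D s k) ` coord_space (k - 1)" using mem[OF xk] by blast
    then show "\<exists>x\<in>std_map (WF_D s k) ` coord_space (k - 1). \<forall>i\<in>{1..<k}. x i = z i"
      by (intro bexI[of _ x]) (auto simp: x_def)
  qed (use k s \<Theta> Z in \<open>auto split: if_splits\<close>)
  with \<Theta> disc show ?thesis by blast
qed

subsection \<open>Types E: the algebra of the critical locus\<close>

text \<open>
  \<open>module_span\<close> consists of the functions that restrict on the critical locus to combinations of
  the \<open>b j\<close>, with coefficients polynomial in the unfolding parameters.
\<close>

locale module_span =
  fixes k :: nat and crit :: "(nat \<Rightarrow> complex) \<Rightarrow> complex \<Rightarrow> complex \<Rightarrow> bool"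
    and b :: "nat \<Rightarrow> complex \<Rightarrow> complex \<Rightarrow> complex"
begin

definition SP :: "((nat \<Rightarrow> complex) \<Rightarrow> complex \<Rightarrow> complex \<Rightarrow> complex) \<Rightarrow> bool" where
  "SP g \<longleftrightarrow> (\<exists>c. \<forall>x u v. crit x u v \<longrightarrow> g x u v = (\<Sum>j<k. ev x (c j) * b j u v))"

text \<open>Multipliers that preserve the span. They are closed under products, which is not evident
  for the span itself, so only \<open>u\<close> and \<open>v\<close> have to be tested, on each
  basis element.\<close>

definition MC :: "((nat \<Rightarrow> complex) \<Rightarrow> complex \<Rightarrow> complex \<Rightarrow> complex) \<Rightarrow> bool" where
  "MC m \<longleftrightarrow> (\<forall>g. SP g \<longrightarrow> SP (\<lambda>x u v. m x u v * g x u v))"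

lemma SP_cong: "SP g' \<Longrightarrow> (\<And>x u v. crit x u v \<Longrightarrow> g x u v = g' x u v) \<Longrightarrow> SP g"
  unfolding SP_def by metis

lemma SP_basis: assumes "i < k" shows "SP (\<lambda>x u v. b i u v)"
  unfolding SP_def
proof (intro exI[of _ "\<lambda>j. if j = i then 1 else 0"] allI impI)
  fix x u v
  have "(\<Sum>j<k. ev x (if j = i then 1 else 0) * b j u v) = (\<Sum>j<k. if j = i then b j u v else 0)"
    by (intro sum.cong) auto
  then show "b i u v = (\<Sum>j<k. ev x (if j = i then 1 else 0) * b j u v)"
    using assms by simp
qed

lemma SP_add: assumes "SP g" "SP h" shows "SP (\<lambda>x u v. g x u v + h x u v)"
proof -
  obtain c where "\<And>x u v. crit x u v \<Longrightarrow> g x u v = (\<Sum>j<k. ev x (c j) * b j u v)"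
    using assms(1) unfolding SP_def by blast
  moreover obtain d where "\<And>x u v. crit x u v \<Longrightarrow> h x u v = (\<Sum>j<k. ev x (d j) * b j u v)"
    using assms(2) unfolding SP_def by blast
  ultimately show ?thesis
    unfolding SP_def
    by (intro exI[of _ "\<lambda>j. c j + d j"]) (simp add: evh.hom_add distrib_right sum.distrib)
qed

lemma SP_scale: assumes "SP g" shows "SP (\<lambda>x u v. ev x p * g x u v)"
proof -
  obtain c where "\<And>x u v. crit x u v \<Longrightarrow> g x u v = (\<Sum>j<k. ev x (c j) * b j u v)"
    using assms unfolding SP_def by blast
  then show ?thesis
    unfolding SP_def
    by (intro exI[of _ "\<lambda>j. p * c j"]) (simp add: evh.hom_mult sum_distrib_left mult.assoc)
qed

lemma SP_sum: "(\<And>i. i < n \<Longrightarrow> SP (g i)) \<Longrightarrow> SP (\<lambda>x u v. \<Sum>i<n. g i x u v)" for n :: nat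
proof (induction n)
  case 0
  have "SP (\<lambda>x u v. 0)" unfolding SP_def by (intro exI[of _ "\<lambda>_. 0"]) simp
  then show ?case by simp
next
  case (Suc n)
  then show ?case by (simp add: SP_add)
qed

lemma MC_I: assumes "\<And>i. i < k \<Longrightarrow> SP (\<lambda>x u v. m x u v * b i u v)" shows "MC m"
  unfolding MC_def
proof (intro allI impI)
  fix g assume "SP g"
  then obtain c where c: "\<And>x u v. crit x u v \<Longrightarrow> g x u v = (\<Sum>j<k. ev x (c j) * b j u v)"
    unfolding SP_def by blast
  have "SP (\<lambda>x u v. \<Sum>j<k. ev x (c j) * (m x u v * b j u v))"
    by (intro SP_sum SP_scale assms)
  then show "SP (\<lambda>x u v. m x u v * g x u v)"
    by (rule SP_cong) (simp add: c sum_distrib_left mult_ac)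
qed

lemma MC_ev: "MC (\<lambda>x u v. ev x p)"
  unfolding MC_def using SP_scale by blast

lemma MC_const: "MC (\<lambda>x u v. of_real c)"
  using MC_ev[of "Const c"] by simp

lemma MC_coord: "MC (\<lambda>x u v. x i)"
  using MC_ev[of "X i"] by simp

lemma SP_mult: "MC m \<Longrightarrow> SP g \<Longrightarrow> SP (\<lambda>x u v. m x u v * g x u v)"
  by (simp add: MC_def)

lemma MC_add: assumes "MC m" "MC n" shows "MC (\<lambda>x u v. m x u v + n x u v)"
  unfolding MC_def
proof (intro allI impI)
  fix g assume g: "SP g"
  from SP_add[OF SP_mult[OF assms(1) g] SP_mult[OF assms(2) g]]
  show "SP (\<lambda>x u v. (m x u v + n x u v) * g x u v)" by (simp add: distrib_right)
qed

lemma MC_mult: assumes "MC m" "MC n" shows "MC (\<lambda>x u v. m x u v * n x u v)"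
  unfolding MC_def
proof (intro allI impI)
  fix g assume g: "SP g"
  from SP_mult[OF assms(1) SP_mult[OF assms(2) g]]
  show "SP (\<lambda>x u v. (m x u v * n x u v) * g x u v)" by (simp add: mult.assoc)
qed

lemma MC_numeral: "MC (\<lambda>x u v. numeral w)"
  using MC_const[of "numeral w"] by simp

lemma MC_minus: "MC m \<Longrightarrow> MC (\<lambda>x u v. - m x u v)"
  using MC_mult[OF MC_const[of "-1"], of m] by simp

lemma MC_diff: "MC m \<Longrightarrow> MC n \<Longrightarrow> MC (\<lambda>x u v. m x u v - n x u v)"
  using MC_add[of m "\<lambda>x u v. - n x u v"] MC_minus[of n] by simp

lemma MC_power: "MC m \<Longrightarrow> MC (\<lambda>x u v. m x u v ^ n)"
proof (induction n)
  case 0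
  show ?case using MC_const[of 1] by simp
qed (auto intro: MC_mult)

lemmas MC_intros = MC_const MC_coord MC_add MC_mult MC_numeral MC_minus MC_diff MC_power

text \<open>Cayley-Hamilton: \<open>m\<close> is an eigenvalue of the matrix of multiplication by \<open>m\<close>.\<close>

lemma integral_equation:
  assumes k: "k > 0" and b0: "\<And>u v. b 0 u v = 1" and m: "MC m"
    and crit0: "\<And>x u v. crit x u v \<Longrightarrow> crit (\<lambda>i. if 0 < i \<and> i < k then x i else 0) u v"
    and m0: "\<And>x u v. m (\<lambda>i. if 0 < i \<and> i < k then x i else 0) u v = m x u v"
  shows "\<exists>T :: real mpol poly. degree T = k \<and> coeff T k = 1 \<and> (\<forall>i. coeff T i \<in> mpolys k) \<and>
    (\<forall>x z. cpev (x(0 := z)) T = cpev x T) \<and> (\<forall>x u v. crit x u v \<longrightarrow> poly (cpev x T) (m x u v) = 0)"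
proof -
  have "\<exists>c. \<forall>x u v. crit x u v \<longrightarrow> m x u v * b i u v = (\<Sum>j<k. ev x (c j) * b j u v)" if "i < k" for i
    using SP_mult[OF m SP_basis[OF that]] unfolding SP_def by blast
  then have "\<forall>i. \<exists>c. i < k \<longrightarrow> (\<forall>x u v. crit x u v \<longrightarrow> m x u v * b i u v = (\<Sum>j<k. ev x (c j) * b j u v))"
    by blast
  from choice[OF this] obtain c where
    "\<forall>i. i < k \<longrightarrow> (\<forall>x u v. crit x u v \<longrightarrow> m x u v * b i u v = (\<Sum>j<k. ev x (c i j) * b j u v))"
    by blast
  then have c: "m x u v * b i u v = (\<Sum>j<k. ev x (c i j) * b j u v)" if "i < k" "crit x u v" for i x u v
    using that by blast
  \<comment> \<open>By \<open>crit0\<close> and \<open>m0\<close> the relations survive setting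
    \<open>x 0\<close> and the variables from \<open>k\<close> on to 0. Doing so in the structure
    constants makes the characteristic polynomial free of \<open>x 0\<close> and puts its
    coefficients into \<open>mpolys k\<close>.\<close>
  define \<sigma> :: "real mpol \<Rightarrow> real mpol" where "\<sigma> = mhom Const (\<lambda>i. if 0 < i \<and> i < k then X i else 0)"
  have ev\<sigma>: "ev x (\<sigma> p) = ev (\<lambda>i. if 0 < i \<and> i < k then x i else 0) p" for x p
    unfolding \<sigma>_def ev_subst by (rule arg_cong[of _ _ "\<lambda>x. ev x p"]) auto
  define M where "M = mat k k (\<lambda>(i, j). \<sigma> (c i j))"
  have M: "M \<in> carrier_mat k k" by (simp add: M_def)
  define T where "T = char_poly M"
  have coeffs: "coeff T i \<in> mpolys k" for i
  proof -
    define N where "N = mat k k (\<lambda>(i, j). c i j)"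
    have "M = map_mat \<sigma> N" by (rule eq_matI) (auto simp: M_def N_def)
    moreover have "N \<in> carrier_mat k k" by (simp add: N_def)
    ultimately have "T = map_poly \<sigma> (char_poly N)"
      unfolding T_def \<sigma>_def by (simp add: msubst.char_poly_hom)
    then have "coeff T i = \<sigma> (coeff (char_poly N) i)" by (simp add: \<sigma>_def)
    then show ?thesis unfolding \<sigma>_def by (simp only:) (rule mhom_mpolys, simp)
  qed
  have cp: "cpev x T = char_poly (map_mat (ev x) M)" for x
    unfolding cpev_def T_def by (rule evh.char_poly_hom[OF M, symmetric])
  have "cpev (x(0 := z)) T = cpev x T" for x z
  proof -
    have "map_mat (ev (x(0 := z))) M = map_mat (ev x) M"
      by (rule eq_matI) (auto simp: M_def ev\<sigma> intro!: arg_cong2[of _ _ _ _ ev])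
    then show ?thesis by (simp add: cp)
  qed
  moreover have "poly (cpev x T) (m x u v) = 0" if cr: "crit x u v" for x u v
  proof -
    let ?x = "\<lambda>i. if 0 < i \<and> i < k then x i else 0"
    \<comment> \<open>The values of the basis at the critical point form the eigenvector; it is
      nonzero because the basis contains 1.\<close>
    define w where "w = vec k (\<lambda>j. b j u v)"
    have "map_mat (ev x) M *\<^sub>v w = m x u v \<cdot>\<^sub>v w"
    proof (rule eq_vecI)
      fix i assume "i < dim_vec (m x u v \<cdot>\<^sub>v w)"
      then have i: "i < k" by (simp add: w_def)
      then have "(map_mat (ev x) M *\<^sub>v w) $ i = (\<Sum>j<k. ev ?x (c i j) * b j u v)"
        by (auto simp: M_def w_def scalar_prod_def ev\<sigma> atLeast0LessThan intro!: sum.cong)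
      also have "\<dots> = m ?x u v * b i u v" using c[OF i crit0[OF cr]] by simp
      finally show "(map_mat (ev x) M *\<^sub>v w) $ i = (m x u v \<cdot>\<^sub>v w) $ i"
        using i by (simp add: m0 w_def)
    qed (simp add: M_def w_def)
    moreover have "w \<noteq> 0\<^sub>v k"
    proof
      assume "w = 0\<^sub>v k"
      then have "w $ 0 = 0" using k by simp
      then show False using k by (simp add: w_def b0)
    qed
    ultimately have "eigenvalue (map_mat (ev x) M) (m x u v)"
      unfolding eigenvalue_def eigenvector_def by (intro exI[of _ w]) (simp add: M_def, simp add: w_def)
    then show ?thesis
      unfolding cp by (subst (asm) eigenvalue_root_char_poly[of _ k]) (simp_all add: M_def)
  qed
  moreover have "degree T = k" "coeff T k = 1"
    using degree_monic_char_poly[OF M] unfolding T_def by auto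
  ultimately show ?thesis using coeffs by blast
qed

end

subsection \<open>Types E: general argument\<close>

fun PE :: "wf_type \<Rightarrow> (nat \<Rightarrow> 'a) \<Rightarrow> 'a::comm_ring_1 poly" where
  "PE WF_E6 x = [:x 1, x 4, x 5:]"
| "PE WF_E7 x = [:x 1, x 5, x 6, 1:]"
| "PE WF_E8 x = [:x 1, x 5, x 6, x 7:]"
| "PE _ x = 0"

fun QE :: "wf_type \<Rightarrow> (nat \<Rightarrow> 'a) \<Rightarrow> 'a::comm_ring_1 poly" where
  "QE WF_E6 x = [:x 0, x 2, x 3, 0, 1:]"
| "QE WF_E7 x = [:x 0, x 2, x 3, x 4:]"
| "QE WF_E8 x = [:x 0, x 2, x 3, x 4, 0, 1:]"
| "QE _ x = 0"

text \<open>The gradient equations of \<open>u^3 + P(v) u + Q(v)\<close> in \<open>u\<close> and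
  \<open>v\<close>. On their solutions the function itself equals \<open>Q - 2 u^3\<close>, whence
  the third equation in \<open>sing_E\<close>.\<close>

definition crit_E :: "wf_type \<Rightarrow> (nat \<Rightarrow> 'a::{comm_ring_1,ring_no_zero_divisors}) \<Rightarrow> 'a \<Rightarrow> 'a \<Rightarrow> bool" where
  "crit_E \<tau> x u v \<longleftrightarrow> poly (PE \<tau> x) v = - 3 * u\<^sup>2 \<and> poly (pderiv (QE \<tau> x)) v = - u * poly (pderiv (PE \<tau> x)) v"

definition sing_E :: "wf_type \<Rightarrow> (nat \<Rightarrow> 'a::{comm_ring_1,ring_no_zero_divisors}) \<Rightarrow> 'a \<Rightarrow> 'a \<Rightarrow> bool" where
  "sing_E \<tau> x u v \<longleftrightarrow> crit_E \<tau> x u v \<and> poly (QE \<tau> x) v = 2 * u ^ 3"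

lemma cpev_PE: "cpev x (poly_P \<tau>) = PE \<tau> x" and cpev_QE: "cpev x (poly_Q \<tau>) = QE \<tau> x"
  by (cases \<tau>; simp)+

lemma QE_upd: "\<tau> \<in> {WF_E6, WF_E7, WF_E8} \<Longrightarrow> QE \<tau> (x(0 := z)) = QE \<tau> x + [:z - x 0:]"
  and PE_upd: "\<tau> \<in> {WF_E6, WF_E7, WF_E8} \<Longrightarrow> PE \<tau> (x(0 := z)) = PE \<tau> x"
  by auto

lemma pderiv_QE_upd: "\<tau> \<in> {WF_E6, WF_E7, WF_E8} \<Longrightarrow> pderiv (QE \<tau> (x(0 := z))) = pderiv (QE \<tau> x)"
  for x :: "nat \<Rightarrow> 'a::idom"
  by (simp only: QE_upd pderiv_add) (simp add: pderiv_pCons)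

lemma cpev_poly_A_E:
  assumes "\<tau> \<in> {WF_E6, WF_E7, WF_E8}"
  shows "cpev x (poly_A \<tau>) = 3 * (pderiv (QE \<tau> x))\<^sup>2 + (pderiv (PE \<tau> x))\<^sup>2 * PE \<tau> x"
    "cpev x (poly_B \<tau>) = 2 * pderiv (QE \<tau> x) * PE \<tau> x - 3 * pderiv (PE \<tau> x) * QE \<tau> x"
proof -
  have A: "poly_A \<tau> = 3 * (pderiv (poly_Q \<tau>))\<^sup>2 + (pderiv (poly_P \<tau>))\<^sup>2 * poly_P \<tau>"
    and B: "poly_B \<tau> = 2 * pderiv (poly_Q \<tau>) * poly_P \<tau> - 3 * pderiv (poly_P \<tau>) * poly_Q \<tau>"
    using assms by auto
  show "cpev x (poly_A \<tau>) = 3 * (pderiv (QE \<tau> x))\<^sup>2 + (pderiv (PE \<tau> x))\<^sup>2 * PE \<tau> x"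
    "cpev x (poly_B \<tau>) = 2 * pderiv (QE \<tau> x) * PE \<tau> x - 3 * pderiv (PE \<tau> x) * QE \<tau> x"
    unfolding A B
    by (simp_all only: cpevh.hom_add cpevh.hom_mult cpevh.hom_minus cpevh.hom_power cpevh.hom_numeral cpev_pderiv cpev_PE cpev_QE)
qed

text \<open>
  On the critical locus \<open>P = -3 u\<^sup>2\<close>, \<open>Q' = -u P'\<close> one has \<open>A = 0\<close>, and \<open>B = -3 P' (Q - 2 u\<^sup>3)\<close>;
  conversely, a common root with \<open>P' \<noteq> 0\<close> comes from \<open>u = - Q' / P'\<close>.
\<close>

lemma common_root_of_sing_E:
  fixes x :: "nat \<Rightarrow> complex"
  assumes "\<tau> \<in> {WF_E6, WF_E7, WF_E8}" "sing_E \<tau> x u v"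
  shows "poly (cpev x (poly_A \<tau>)) v = 0" "poly (cpev x (poly_B \<tau>)) v = 0"
  using assms(2) unfolding sing_E_def crit_E_def cpev_poly_A_E[OF assms(1)]
  by (auto simp: power2_eq_square power3_eq_cube)

lemma sing_E_of_common_root:
  fixes x :: "nat \<Rightarrow> complex"
  assumes \<tau>: "\<tau> \<in> {WF_E6, WF_E7, WF_E8}"
    and A: "poly (cpev x (poly_A \<tau>)) v = 0" and B: "poly (cpev x (poly_B \<tau>)) v = 0"
    and nz: "poly (pderiv (PE \<tau> x)) v \<noteq> 0"
  shows "\<exists>u. sing_E \<tau> x u v"
proof -
  define p p' q q' where "p = poly (PE \<tau> x) v" and "p' = poly (pderiv (PE \<tau> x)) v"
    and "q = poly (QE \<tau> x) v" and "q' = poly (pderiv (QE \<tau> x)) v"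
  define u where "u = - q' / p'"
  have p': "p' \<noteq> 0" using nz by (simp add: p'_def)
  have q': "q' = - u * p'" using p' by (simp add: u_def)
  have "3 * q'\<^sup>2 + p'\<^sup>2 * p = 0" using A unfolding cpev_poly_A_E[OF \<tau>] by (simp add: p_def p'_def q'_def)
  then have "p'\<^sup>2 * (3 * u\<^sup>2 + p) = 0" unfolding q' by (simp add: algebra_simps power2_eq_square)
  then have p: "p = - 3 * u\<^sup>2" using p' by (simp add: add_eq_0_iff)
  have "2 * q' * p - 3 * p' * q = 0" using B unfolding cpev_poly_A_E[OF \<tau>] by (simp add: p_def p'_def q_def q'_def)
  then have "3 * p' * (2 * u ^ 3 - q) = 0" unfolding q' p by (simp add: algebra_simps power2_eq_square power3_eq_cube)
  then have "q = 2 * u ^ 3" using p' by simp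
  then show ?thesis
    using p q' unfolding sing_E_def crit_E_def p_def p'_def q_def q'_def by blast
qed

section \<open>Continuity in the parameters and bounds for roots\<close>

lemma tendsto_ev:
  assumes "\<And>i. (\<lambda>n. xs n i) \<longlonglongrightarrow> x i"
  shows "(\<lambda>n. ev (xs n) p) \<longlonglongrightarrow> ev x p"
  by (induction p rule: mpol_induct) (auto simp: evh.hom_add evh.hom_mult assms intro!: tendsto_intros)

lemma tendsto_poly_cpev:
  assumes "\<And>i. (\<lambda>n. xs n i) \<longlonglongrightarrow> x i" "vs \<longlonglongrightarrow> v"
  shows "(\<lambda>n. poly (cpev (xs n) f) (vs n)) \<longlonglongrightarrow> poly (cpev x f) v"
  by (induction f) (auto intro!: tendsto_intros tendsto_ev assms)

lemma cauchy_root_bound: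
  fixes f :: "complex poly"
  assumes f: "degree f = k" "coeff f k = l" "l \<noteq> 0" and v: "poly f v = 0"
  shows "cmod v \<le> 1 + (\<Sum>i<k. cmod (coeff f i)) / cmod l"
proof (cases "cmod v \<le> 1")
  case True
  then show ?thesis by (simp add: add_increasing2 sum_nonneg)
next
  case False
  then have v1: "1 \<le> cmod v" by simp
  show ?thesis
  proof (cases k)
    case 0
    then obtain a where "f = [:a:]" using f(1) degree_eq_zeroE by blast
    then have "a = 0" "a = l" using v f(2) 0 by simp_all
    then show ?thesis using f(3) by simp
  next
    case (Suc m)
    have "poly f v = (\<Sum>i<k. coeff f i * v ^ i) + l * v ^ k"
      unfolding poly_altdef f(1) by (simp add: lessThan_Suc_atMost[symmetric] f)
    then have "l * v ^ k = - (\<Sum>i<k. coeff f i * v ^ i)" using v by (simp add: add_eq_0_iff)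
    then have "cmod l * cmod v ^ k = cmod (\<Sum>i<k. coeff f i * v ^ i)"
      by (metis norm_minus_cancel norm_mult norm_power)
    also have "\<dots> \<le> (\<Sum>i<k. cmod (coeff f i) * cmod v ^ m)"
    proof (rule order_trans[OF norm_sum sum_mono])
      fix i assume "i \<in> {..<k}"
      then have "cmod v ^ i \<le> cmod v ^ m" using v1 Suc by (intro power_increasing) auto
      then show "cmod (coeff f i * v ^ i) \<le> cmod (coeff f i) * cmod v ^ m"
        by (simp add: norm_mult norm_power mult_left_mono)
    qed
    also have "\<dots> = (\<Sum>i<k. cmod (coeff f i)) * cmod v ^ m" by (simp add: sum_distrib_right)
    finally have "(cmod l * cmod v) * cmod v ^ m \<le> (\<Sum>i<k. cmod (coeff f i)) * cmod v ^ m"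
      by (simp add: Suc mult_ac)
    moreover have "cmod v ^ m > 0" using v1 by (intro zero_less_power) linarith
    ultimately have "cmod l * cmod v \<le> (\<Sum>i<k. cmod (coeff f i))" by simp
    then have "cmod v \<le> (\<Sum>i<k. cmod (coeff f i)) / cmod l" using f(3) by (simp add: field_simps)
    then show ?thesis by simp
  qed
qed

text \<open>The modulus of \<open>f\<close> at \<open>z0\<close> is the product of the distances to
  all \<open>k\<close> roots, and each distance is at least the smallest one.\<close>

lemma nearby_root:
  fixes f :: "complex poly"
  assumes "degree f = k" "coeff f k = 1" "k > 0"
  shows "\<exists>z. poly f z = 0 \<and> cmod (z0 - z) ^ k \<le> cmod (poly f z0)"
proof -
  obtain as where as: "length as = k" "f = Polynomial.smult 1 (\<Prod>a\<leftarrow>as. [:-a, 1:])"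
    using complex_poly_roots[of f] assms by auto
  then have "set as \<noteq> {}" using assms(3) by auto
  then obtain a where a: "a \<in> set as" "\<And>b. b \<in> set as \<Longrightarrow> cmod (z0 - a) \<le> cmod (z0 - b)"
    using ex_min_if_finite[of "(\<lambda>a. cmod (z0 - a)) ` set as"] by (auto simp: not_less)
  have "cmod (z0 - a) ^ length bs \<le> cmod (\<Prod>b\<leftarrow>bs. z0 - b)" if "set bs \<subseteq> set as" for bs
    using that
  proof (induction bs)
    case (Cons b bs)
    then show ?case using a(2)[of b] by (auto simp: norm_mult intro!: mult_mono)
  qed simp
  from this[of as] have "cmod (z0 - a) ^ k \<le> cmod (poly f z0)"
    by (simp add: as poly_prod_list o_def)
  moreover have "poly f a = 0" using a(1) by (auto simp: as poly_prod_list prod_list_zero_iff)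
  ultimately show ?thesis by blast
qed

lemma prod_linear_le:
  fixes f h :: "'b \<Rightarrow> complex"
  shows "degree (\<Prod>a\<leftarrow>as. [:f a, h a:]) \<le> length as \<and> coeff (\<Prod>a\<leftarrow>as. [:f a, h a:]) (length as) = (\<Prod>a\<leftarrow>as. h a)"
proof (induction as)
  case (Cons a as)
  let ?p = "\<Prod>a\<leftarrow>as. [:f a, h a:]"
  have "degree ([:f a, h a:] * ?p) \<le> degree [:f a, h a:] + degree ?p" by (rule degree_mult_le)
  also have "\<dots> \<le> 1 + length as" using Cons by (intro add_mono) auto
  finally have "degree ([:f a, h a:] * ?p) \<le> 1 + length as" .
  moreover have "coeff ?p (Suc (length as)) = 0" using Cons by (intro coeff_eq_0) simp
  ultimately show ?case using Cons by simp
qed simp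

lemma poly_eqI_roots:
  fixes f h :: "complex poly"
  assumes "degree f \<le> k" "degree h \<le> k" "coeff f k = coeff h k" "card {z. poly f z = 0} = k" "k > 0"
    and "\<And>z. poly f z = 0 \<Longrightarrow> poly h z = 0"
  shows "f = h"
proof (rule ccontr)
  assume "f \<noteq> h"
  then have nz: "f - h \<noteq> 0" by simp
  have "coeff (f - h) i = 0" if "i \<ge> k" for i
    using that assms(1-3) by (cases "i = k") (auto simp: coeff_eq_0)
  then have "degree (f - h) < k" using nz by (metis leading_coeff_0_iff not_le)
  moreover have "k \<le> card {z. poly (f - h) z = 0}"
    unfolding assms(4)[symmetric] using assms(6) by (intro card_mono poly_roots_finite nz) auto
  ultimately show False using card_poly_roots_bound[OF nz] by simp
qed

text \<open>What the three types share. \<open>lA\<close> is the constant leading coefficient of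
  \<open>A\<close>. \<open>prodP\<close> is the source of the factor \<open>r^2\<close>, required
  only where \<open>g\<close> is nonzero, so that a type may assume that \<open>P'\<close> keeps its
  degree. \<open>xs\<close> and \<open>Zs\<close> give a fibre off \<open>r = 0\<close> with
  \<open>k\<close> distinct singular levels. \<open>T_ex\<close> is the monic equation of the
  critical level.\<close>

locale wf_E =
  fixes \<tau> :: wf_type and k :: nat and lA \<kappa> :: real and g :: "real mpol" and xs :: "nat \<Rightarrow> complex" and Zs :: "complex set"
  assumes \<tau>: "\<tau> \<in> {WF_E6, WF_E7, WF_E8}" and k: "k = wf_dim \<tau>"
    and degA: "degree (poly_A \<tau>) = k" and leadA: "coeff (poly_A \<tau>) k = Const lA" and lA: "lA \<noteq> 0"
    and prodP: "\<And>x as. ev x g \<noteq> 0 \<Longrightarrow> length as = k \<Longrightarrow>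
       cpev x (poly_A \<tau>) = Polynomial.smult (of_real lA) (\<Prod>a\<leftarrow>as. [:-a, 1:]) \<Longrightarrow>
       (\<Prod>a\<leftarrow>as. poly (pderiv (PE \<tau> x)) a) = of_real \<kappa> * (ev x (poly_r \<tau>))\<^sup>2"
    and \<kappa>: "\<kappa> \<noteq> 0" and g: "g \<noteq> 0"
    and common: "\<And>x v. poly (pderiv (PE \<tau> x)) v = 0 \<Longrightarrow> poly (pderiv (QE \<tau> x)) v = 0 \<Longrightarrow> ev x (poly_r \<tau>) = 0"
    and T_ex: "\<exists>T :: real mpol poly. degree T = k \<and> coeff T k = 1 \<and> (\<forall>i. coeff T i \<in> mpolys k) \<and>
       (\<forall>x z. cpev (x(0 := z)) T = cpev x T) \<and> (\<forall>x u v. sing_E \<tau> x u v \<longrightarrow> poly (cpev x T) (x 0) = 0)"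
    and xs: "ev xs (poly_r \<tau>) \<noteq> 0"
    and Zs: "finite Zs" "card Zs = k" "\<And>z. z \<in> Zs \<Longrightarrow> \<exists>u v. sing_E \<tau> (xs(0 := z)) u v"
    and r: "poly_r \<tau> \<in> mpolys k" "\<And>x z. ev (x(0 := z)) (poly_r \<tau>) = ev x (poly_r \<tau>)"
    and image: "\<And>x :: nat \<Rightarrow> complex. x \<in> coord_space k \<Longrightarrow> x \<in> std_map \<tau> ` coord_space (k - 1) \<longleftrightarrow> (\<exists>u v. sing_E \<tau> x u v)"
begin

abbreviation "A \<equiv> poly_A \<tau>"
abbreviation "B \<equiv> poly_B \<tau>"
abbreviation "r \<equiv> poly_r \<tau>"
abbreviation "R \<equiv> resultant A B"

lemma k_pos: "k > 0"
  using k \<tau> by auto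

lemma deg_A: "degree (cpev x A) = k" "coeff (cpev x A) k = of_real lA"
proof -
  show c: "coeff (cpev x A) k = of_real lA" by (simp add: leadA)
  show "degree (cpev x A) = k"
    using degree_cpev_le[of x A] le_degree[of "cpev x A" k] lA unfolding c by (simp add: degA)
qed

lemma roots_A: "\<exists>as. length as = k \<and> cpev x A = Polynomial.smult (of_real lA) (\<Prod>a\<leftarrow>as. [:-a, 1:])"
  using complex_poly_roots[of "cpev x A"] by (simp add: deg_A leadA)

lemma A_upd: "cpev (x(0 := z)) A = cpev x A"
  unfolding cpev_poly_A_E[OF \<tau>] by (simp only: pderiv_QE_upd[OF \<tau>] PE_upd[OF \<tau>])

text \<open>Only \<open>Q\<close> contains \<open>x 0\<close>, and \<open>B\<close> contains
  \<open>Q\<close> undifferentiated with factor \<open>- 3 P'\<close>. Hence the resultant is a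
  product of factors linear in \<open>x 0\<close> with slopes \<open>- 3 P'(a)\<close>.\<close>

lemma B_upd: "poly (cpev (x(0 := z)) B) a = poly (cpev x B) a - 3 * poly (pderiv (PE \<tau> x)) a * (z - x 0)"
  unfolding cpev_poly_A_E[OF \<tau>]
  unfolding pderiv_QE_upd[OF \<tau>] PE_upd[OF \<tau>]
  unfolding QE_upd[OF \<tau>]
  by (simp add: algebra_simps)

lemma ev_R:
  assumes "length as = k" "cpev x A = Polynomial.smult (of_real lA) (\<Prod>a\<leftarrow>as. [:-a, 1:])"
  shows "ev x R = of_real lA ^ degree B * (\<Prod>a\<leftarrow>as. poly (cpev x B) a)"
  unfolding ev_resultant degA assms(2) using resultant_sub_prod[OF degree_cpev_le] assms(1) by blast

lemma ev_R_eq_0_iff: "ev x R = 0 \<longleftrightarrow> (\<exists>v. poly (cpev x A) v = 0 \<and> poly (cpev x B) v = 0)"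
proof -
  have "cpev x A \<noteq> 0" using deg_A(1)[of x] k_pos by auto
  from resultant_sub_eq_0_iff[OF this degree_cpev_le[of x B]] show ?thesis
    by (simp add: ev_resultant degA deg_A)
qed

text \<open>With \<open>r\<close> nonzero a common root cannot have \<open>P' = 0\<close>, because
  \<open>A = 0\<close> would then give \<open>Q' = 0\<close> as well.\<close>

lemma sing_of_ev_R:
  assumes "ev x R = 0" "ev x r \<noteq> 0"
  shows "\<exists>u v. sing_E \<tau> x u v"
proof -
  obtain v where v: "poly (cpev x A) v = 0" "poly (cpev x B) v = 0" using assms(1) ev_R_eq_0_iff by blast
  have "poly (pderiv (PE \<tau> x)) v \<noteq> 0"
  proof
    assume 0: "poly (pderiv (PE \<tau> x)) v = 0"
    then have "poly (pderiv (QE \<tau> x)) v = 0" using v(1) unfolding cpev_poly_A_E[OF \<tau>] by simp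
    with 0 common assms(2) show False by blast
  qed
  then show ?thesis using sing_E_of_common_root[OF \<tau> v] by blast
qed

lemma ev_R_of_sing: "sing_E \<tau> x u v \<Longrightarrow> ev x R = 0"
  using common_root_of_sing_E[OF \<tau>] ev_R_eq_0_iff by blast

definition U :: "complex mpol poly" where "U = uni 0 (complexify R)"
definition c :: real where "c = lA ^ degree B * (- 3) ^ k * \<kappa>"

lemma c_nz: "c \<noteq> 0"
  using lA \<kappa> by (simp add: c_def)

lemma poly_U: "poly (pev x U) z = ev (x(0 := z)) R"
  by (simp add: U_def poly_pev_uni meval_complexify)

lemma pev_U:
  assumes "length as = k" "cpev x A = Polynomial.smult (of_real lA) (\<Prod>a\<leftarrow>as. [:-a, 1:])"
  shows "degree (pev x U) \<le> k"
    "coeff (pev x U) k = of_real lA ^ degree B * (- 3) ^ k * (\<Prod>a\<leftarrow>as. poly (pderiv (PE \<tau> x)) a)"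
proof -
  let ?f = "\<lambda>a. poly (cpev x B) a + 3 * poly (pderiv (PE \<tau> x)) a * x 0"
  let ?h = "\<lambda>a. - 3 * poly (pderiv (PE \<tau> x)) a"
  have eq: "pev x U = Polynomial.smult (of_real lA ^ degree B) (\<Prod>a\<leftarrow>as. [:?f a, ?h a:])"
  proof (rule poly_eq_poly_eq_iff[THEN iffD1], rule ext)
    fix z
    have "poly (pev x U) z = of_real lA ^ degree B * (\<Prod>a\<leftarrow>as. poly (cpev (x(0 := z)) B) a)"
      unfolding poly_U using assms by (intro ev_R) (simp_all only: A_upd)
    also have "(\<Prod>a\<leftarrow>as. poly (cpev (x(0 := z)) B) a) = (\<Prod>a\<leftarrow>as. poly [:?f a, ?h a:] z)"
      unfolding B_upd by (intro arg_cong[of _ _ prod_list] map_cong refl) (simp add: algebra_simps)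
    also have "\<dots> = poly (\<Prod>a\<leftarrow>as. [:?f a, ?h a:]) z" by (simp add: poly_prod_list o_def)
    finally show "poly (pev x U) z = poly (Polynomial.smult (of_real lA ^ degree B) (\<Prod>a\<leftarrow>as. [:?f a, ?h a:])) z" by simp
  qed
  have lin: "degree (\<Prod>a\<leftarrow>as. [:?f a, ?h a:]) \<le> k \<and> coeff (\<Prod>a\<leftarrow>as. [:?f a, ?h a:]) k = (\<Prod>a\<leftarrow>as. ?h a)"
    using prod_linear_le[of ?f ?h as] assms(1) by simp
  show "degree (pev x U) \<le> k" unfolding eq using lin by (intro order_trans[OF degree_smult_le]) simp
  have "(\<Prod>a\<leftarrow>bs. ?h a) = (- 3) ^ length bs * (\<Prod>a\<leftarrow>bs. poly (pderiv (PE \<tau> x)) a)" for bs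
    by (induction bs) auto
  then have "(\<Prod>a\<leftarrow>as. ?h a) = (- 3) ^ k * (\<Prod>a\<leftarrow>as. poly (pderiv (PE \<tau> x)) a)"
    using assms(1) by blast
  then show "coeff (pev x U) k = of_real lA ^ degree B * (- 3) ^ k * (\<Prod>a\<leftarrow>as. poly (pderiv (PE \<tau> x)) a)"
    unfolding eq using lin by (simp add: mult.assoc)
qed

lemma degree_pev_U: "degree (pev x U) \<le> k"
  using roots_A[of x] pev_U(1) by blast

lemma coeff_U: "coeff (pev x U) k = of_real c * (ev x r)\<^sup>2"
proof -
  have "coeff U k - complexify (Const c * r\<^sup>2) = 0"
  proof (rule meval_generic_zero)
    show "complexify g \<noteq> 0"
    proof
      assume "complexify g = 0"
      then have "ev x g = 0" for x using meval_complexify[of x g] by simp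
      then show False using g ev_zero by blast
    qed
    fix x assume "meval x (complexify g) \<noteq> 0"
    then have gx: "ev x g \<noteq> 0" by (simp add: meval_complexify)
    obtain as where as: "length as = k" "cpev x A = Polynomial.smult (of_real lA) (\<Prod>a\<leftarrow>as. [:-a, 1:])"
      using roots_A by blast
    have "coeff (pev x U) k = of_real c * (ev x r)\<^sup>2"
      unfolding pev_U(2)[OF as] prodP[OF gx as] c_def by simp
    then show "meval x (coeff U k - complexify (Const c * r\<^sup>2)) = 0"
      by (simp add: mev.hom_minus meval_complexify evh.hom_mult evh.hom_power)
  qed
  then have "coeff U k = complexify (Const c * r\<^sup>2)" by simp
  then show ?thesis by (simp add: meval_complexify evh.hom_mult evh.hom_power)
qed

lemma degree_U: "degree U = k"
proof (rule antisym)
  show "degree U \<le> k"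
  proof (rule degree_le, intro allI impI)
    fix i assume "k < i"
    then have "coeff (pev x U) i = 0" for x using degree_pev_U[of x] by (intro coeff_eq_0) simp
    then show "coeff U i = 0" by (intro meval_zero) simp
  qed
  have "coeff (pev xs U) k \<noteq> 0" unfolding coeff_U using xs c_nz by simp
  then show "k \<le> degree U" by (intro le_degree) auto
qed

lemma degree_pev_U_eq: "ev x r \<noteq> 0 \<Longrightarrow> degree (pev x U) = k"
  using degree_pev_U[of x] coeff_U[of x] c_nz le_degree[of "pev x U" k] by (intro antisym) auto

text \<open>\<open>U\<close> has leading coefficient \<open>c r^2\<close>, so its fibres keep degree
  \<open>k\<close> only off \<open>r = 0\<close>. \<open>monic_separable\<close> does not apply, and
  the discriminant criterion is established under that restriction.\<close>

lemma disc_U: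
  assumes "ev x r \<noteq> 0"
  shows "meval x (resultant U (pderiv U)) \<noteq> 0 \<longleftrightarrow> card {z. poly (pev x U) z = 0} = k"
proof -
  have nz: "pev x U \<noteq> 0" using degree_pev_U_eq[OF assms] k_pos by auto
  have "degree (pderiv (pev x U)) \<le> degree (pderiv U)"
    by (simp add: degree_pderiv degree_U degree_pev_U_eq[OF assms])
  from resultant_sub_eq_0_iff[OF nz this]
  have "meval x (resultant U (pderiv U)) = 0 \<longleftrightarrow> (\<exists>z. poly (pev x U) z = 0 \<and> poly (pderiv (pev x U)) z = 0)"
    by (simp add: meval_resultant pev_pderiv degree_U degree_pev_U_eq[OF assms])
  then show ?thesis
    using rsquarefree_card_degree[OF nz] rsquarefree_roots[of "pev x U"] degree_pev_U_eq[OF assms] by simp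
qed

lemma disc_U_nz: "resultant U (pderiv U) \<noteq> 0"
proof -
  have nz: "pev xs U \<noteq> 0" using degree_pev_U_eq[OF xs] k_pos by auto
  have "Zs \<subseteq> {z. poly (pev xs U) z = 0}"
    using Zs(3) ev_R_of_sing by (force simp: poly_U)
  then have "k \<le> card {z. poly (pev xs U) z = 0}"
    unfolding Zs(2)[symmetric] by (intro card_mono poly_roots_finite nz)
  then have "card {z. poly (pev xs U) z = 0} = k"
    using card_poly_roots_bound[OF nz] degree_pev_U_eq[OF xs] by simp
  then have "meval xs (resultant U (pderiv U)) \<noteq> 0" by (simp add: disc_U[OF xs])
  then show ?thesis by auto
qed

text \<open>Where \<open>r\<close> and the discriminant of \<open>U\<close> are nonzero, the
  \<open>k\<close> roots of \<open>U\<close> are levels of singular points and so roots of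
  \<open>T\<close>. Equal degrees and the leading coefficient \<open>c r^2\<close> give
  \<open>U = c r^2 T\<close>, so \<open>\<Theta>\<close> is \<open>c\<close> times \<open>T\<close>
  at \<open>x 0\<close>. That its zeros are singular levels follows from the resultant off
  \<open>r = 0\<close> and by approximation elsewhere.\<close>

lemma conclusion:
  "\<exists>\<Theta>\<in>mpolys k. R = \<Theta> * r\<^sup>2 \<and>
    (\<forall>x\<in>coord_space k. ev x \<Theta> = 0 \<longleftrightarrow> x \<in> std_map \<tau> ` coord_space (k - 1)) \<and>
    (\<exists>\<Delta>. discriminant_polynomial k (std_map \<tau>) \<Delta>) \<and>
    (\<forall>\<Delta>. discriminant_polynomial k (std_map \<tau>) \<Delta> \<longrightarrow> (\<exists>c. c \<noteq> 0 \<and> complexify \<Theta> = Const c * \<Delta>))"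
proof -
  obtain T :: "real mpol poly" where T: "degree T = k" "coeff T k = 1" "\<And>i. coeff T i \<in> mpolys k"
    "\<And>x z. cpev (x(0 := z)) T = cpev x T" "\<And>x u v. sing_E \<tau> x u v \<Longrightarrow> poly (cpev x T) (x 0) = 0"
    using T_ex by blast
  have dT: "degree (cpev x T) = k" "coeff (cpev x T) k = 1" for x
  proof -
    show c: "coeff (cpev x T) k = 1" by (simp add: T)
    show "degree (cpev x T) = k"
      using degree_cpev_le[of x T] le_degree[of "cpev x T" k] unfolding c by (simp add: T)
  qed
  define \<Theta> where "\<Theta> = Const c * poly T (X 0)"
  have ev\<Theta>: "ev x \<Theta> = of_real c * poly (cpev x T) (x 0)" for x
    by (simp add: \<Theta>_def evh.hom_mult cpev_def flip: evh.poly_map_poly)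
  have coeff_eq: "coeff U i - complexify (Const c * r\<^sup>2 * coeff T i) = 0" for i
  proof (rule meval_generic_zero)
    have "complexify r \<noteq> 0" using xs meval_complexify[of xs r] by auto
    then show "resultant U (pderiv U) * complexify r \<noteq> 0" using disc_U_nz by simp
    fix x assume "meval x (resultant U (pderiv U) * complexify r) \<noteq> 0"
    then have rx: "ev x r \<noteq> 0" and "meval x (resultant U (pderiv U)) \<noteq> 0"
      by (auto simp: mev.hom_mult meval_complexify)
    then have card: "card {z. poly (pev x U) z = 0} = k" by (simp add: disc_U[OF rx])
    have "pev x U = Polynomial.smult (of_real c * (ev x r)\<^sup>2) (cpev x T)"
    proof (rule poly_eqI_roots[OF degree_pev_U _ _ card k_pos])
      show "degree (Polynomial.smult (of_real c * (ev x r)\<^sup>2) (cpev x T)) \<le> k"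
        using dT(1)[of x] degree_smult_le[of "of_real c * (ev x r)\<^sup>2" "cpev x T"] by simp
      show "coeff (pev x U) k = coeff (Polynomial.smult (of_real c * (ev x r)\<^sup>2) (cpev x T)) k"
        unfolding coeff_U coeff_smult dT by simp
      fix z assume "poly (pev x U) z = 0"
      then obtain u v where "sing_E \<tau> (x(0 := z)) u v"
        using sing_of_ev_R[of "x(0 := z)"] rx by (auto simp: poly_U r)
      then have "poly (cpev x T) z = 0" using T(5)[of "x(0 := z)"] T(4) by simp
      then show "poly (Polynomial.smult (of_real c * (ev x r)\<^sup>2) (cpev x T)) z = 0" by simp
    qed
    then have "coeff (pev x U) i = of_real c * (ev x r)\<^sup>2 * ev x (coeff T i)" by simp
    then show "meval x (coeff U i - complexify (Const c * r\<^sup>2 * coeff T i)) = 0"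
      by (simp add: mev.hom_minus meval_complexify evh.hom_mult evh.hom_power)
  qed
  have pevU: "pev x U = Polynomial.smult (of_real c * (ev x r)\<^sup>2) (cpev x T)" for x
  proof (rule poly_eqI)
    fix i
    have "coeff U i = complexify (Const c * r\<^sup>2 * coeff T i)" using coeff_eq[of i] by simp
    then show "coeff (pev x U) i = coeff (Polynomial.smult (of_real c * (ev x r)\<^sup>2) (cpev x T)) i"
      by (simp add: meval_complexify evh.hom_mult evh.hom_power)
  qed
  have R: "R = \<Theta> * r\<^sup>2"
  proof (rule ev_eqI)
    fix x
    have "ev x R = poly (pev x U) (x 0)" unfolding poly_U by simp
    then show "ev x R = ev x (\<Theta> * r\<^sup>2)"
      by (simp add: pevU ev\<Theta> evh.hom_mult evh.hom_power)
  qed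
  have \<Theta>: "\<Theta> \<in> mpolys k"
    unfolding \<Theta>_def poly_altdef using T(3) k_pos by (intro mpolys_intros) auto
  have \<Theta>_sing: "ev x \<Theta> = 0" if "sing_E \<tau> x u v" for x u v
    using T(5)[OF that] by (simp add: ev\<Theta>)
  have sing_generic: "\<exists>u v. sing_E \<tau> x u v" if "ev x \<Theta> = 0" "ev x r \<noteq> 0" for x
    using that by (intro sing_of_ev_R) (simp_all add: R evh.hom_mult)
  \<comment> \<open>The parameters with a singular point form a closed set: \<open>v\<close> is a
    root of \<open>A\<close>, whose leading coefficient is constant, and
    \<open>3 u^2 = - P(v)\<close>. So \<open>v\<close>, and then \<open>u\<close>, converge along
    subsequences, and the three equations pass to the limit.\<close>
  have closed: "\<exists>u v. sing_E \<tau> x u v"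
    if lim: "\<And>i. (\<lambda>n. ps n i) \<longlonglongrightarrow> x i" and sing: "\<And>n. \<exists>u v. sing_E \<tau> (ps n) u v"
    for ps :: "nat \<Rightarrow> nat \<Rightarrow> complex" and x
  proof -
    obtain us vs where uv: "\<And>n. sing_E \<tau> (ps n) (us n) (vs n)" using sing by metis
    have "(\<lambda>n. 1 + (\<Sum>i<k. cmod (coeff (cpev (ps n) A) i)) / cmod (of_real lA)) \<longlonglongrightarrow>
        1 + (\<Sum>i<k. cmod (coeff (cpev x A) i)) / cmod (of_real lA)"
      unfolding coeff_cpev using lA by (intro tendsto_intros tendsto_ev lim) simp
    then have "Bseq (\<lambda>n. 1 + (\<Sum>i<k. cmod (coeff (cpev (ps n) A) i)) / cmod (of_real lA))"
      by (intro convergent_imp_Bseq convergentI)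
    then obtain K where "\<forall>n. norm (1 + (\<Sum>i<k. cmod (coeff (cpev (ps n) A) i)) / cmod (of_real lA)) \<le> K"
      unfolding Bseq_def by blast
    then have K: "\<And>n. norm (1 + (\<Sum>i<k. cmod (coeff (cpev (ps n) A) i)) / cmod (of_real lA)) \<le> K"
      by blast
    have "cmod (vs n) \<le> K" for n
    proof -
      have "cmod (vs n) \<le> 1 + (\<Sum>i<k. cmod (coeff (cpev (ps n) A) i)) / cmod (of_real lA)"
        using common_root_of_sing_E(1)[OF \<tau> uv] deg_A lA by (intro cauchy_root_bound) auto
      then show ?thesis using K[of n] by (simp only: real_norm_def)
    qed
    then have "bounded (range vs)" by (auto simp: bounded_iff)
    then obtain v s1 where s1: "strict_mono s1" "(vs \<circ> s1) \<longlonglongrightarrow> v"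
      using bounded_imp_convergent_subsequence by blast
    have lim1: "(\<lambda>n. ps (s1 n) i) \<longlonglongrightarrow> x i" for i
      using LIMSEQ_subseq_LIMSEQ[OF lim s1(1)] by (simp add: o_def)
    have lims1: "(\<lambda>n. poly (cpev (ps (s1 n)) f) (vs (s1 n))) \<longlonglongrightarrow> poly (cpev x f) v" for f
      using tendsto_poly_cpev[OF lim1 s1(2)] by (simp add: o_def)
    have "bounded (range (us \<circ> s1))"
    proof -
      have "Bseq (\<lambda>n. poly (cpev (ps (s1 n)) (poly_P \<tau>)) (vs (s1 n)))"
        by (intro convergent_imp_Bseq convergentI[OF lims1])
      then obtain K where "\<forall>n. cmod (poly (cpev (ps (s1 n)) (poly_P \<tau>)) (vs (s1 n))) \<le> K"
        unfolding Bseq_def by blast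
      then have K: "\<And>n. cmod (poly (cpev (ps (s1 n)) (poly_P \<tau>)) (vs (s1 n))) \<le> K" by blast
      have "cmod (us (s1 n)) \<le> 1 + K" for n
      proof -
        have "3 * (cmod (us (s1 n)))\<^sup>2 \<le> K"
          using K[of n] uv[of "s1 n"] by (simp add: sing_E_def crit_E_def cpev_PE norm_mult norm_power)
        moreover have "cmod (us (s1 n)) \<le> 1 + (cmod (us (s1 n)))\<^sup>2"
        proof -
          have "2 * cmod (us (s1 n)) \<le> 1 + (cmod (us (s1 n)))\<^sup>2"
            using zero_le_power2[of "cmod (us (s1 n)) - 1"] by (simp add: power2_diff)
          then show ?thesis using norm_ge_zero[of "us (s1 n)"] by linarith
        qed
        moreover have "0 \<le> (cmod (us (s1 n)))\<^sup>2" by simp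
        ultimately show ?thesis by linarith
      qed
      then show ?thesis by (auto simp: bounded_iff)
    qed
    then obtain u s2 where s2: "strict_mono s2" "(us \<circ> s1 \<circ> s2) \<longlonglongrightarrow> u"
      using bounded_imp_convergent_subsequence by blast
    have lims: "(\<lambda>n. poly (cpev (ps (s1 (s2 n))) f) (vs (s1 (s2 n)))) \<longlonglongrightarrow> poly (cpev x f) v" for f
      using LIMSEQ_subseq_LIMSEQ[OF lims1 s2(1)] by (simp add: o_def)
    have limu: "(\<lambda>n. us (s1 (s2 n))) \<longlonglongrightarrow> u" using s2(2) by (simp add: o_def)
    have e: "poly (cpev (ps n) (poly_P \<tau>)) (vs n) = - 3 * (us n)\<^sup>2"
      "poly (cpev (ps n) (pderiv (poly_Q \<tau>))) (vs n) = - us n * poly (cpev (ps n) (pderiv (poly_P \<tau>))) (vs n)"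
      "poly (cpev (ps n) (poly_Q \<tau>)) (vs n) = 2 * us n ^ 3" for n
      using uv[of n] by (simp_all add: sing_E_def crit_E_def cpev_PE cpev_QE cpev_pderiv)
    have "poly (cpev x (poly_P \<tau>)) v = - 3 * u\<^sup>2"
      using lims[of "poly_P \<tau>"] unfolding e(1) by (rule LIMSEQ_unique) (intro tendsto_intros limu)
    moreover have "poly (cpev x (pderiv (poly_Q \<tau>))) v = - u * poly (cpev x (pderiv (poly_P \<tau>))) v"
      using lims[of "pderiv (poly_Q \<tau>)"] unfolding e(2) by (rule LIMSEQ_unique) (intro tendsto_intros limu lims)
    moreover have "poly (cpev x (poly_Q \<tau>)) v = 2 * u ^ 3"
      using lims[of "poly_Q \<tau>"] unfolding e(3) by (rule LIMSEQ_unique) (intro tendsto_intros limu)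
    ultimately have "sing_E \<tau> x u v"
      by (simp add: sing_E_def crit_E_def cpev_PE cpev_QE cpev_pderiv)
    then show ?thesis by blast
  qed
  have sing_all: "\<exists>u v. sing_E \<tau> x u v" if \<Theta>0: "ev x \<Theta> = 0" for x
  proof -
    \<comment> \<open>The line from \<open>x\<close> towards \<open>xs\<close> with
      \<open>x 0\<close> held fixed. As \<open>r\<close> does not depend on \<open>x 0\<close>, it
      is nonzero at \<open>t = 1\<close>; along the line it is a nonzero polynomial in
      \<open>t\<close>, which does not vanish for small nonzero \<open>t\<close>.\<close>
    define xt where "xt t i = (if i = 0 then x 0 else x i + t * (xs i - x i))" for t i
    interpret L: mpol_hom "\<lambda>c. [:complex_of_real c:]"
      by unfold_locales auto
    define rp where "rp = mhom (\<lambda>c. [:complex_of_real c:]) (\<lambda>i. if i = 0 then [:x 0:] else [:x i, xs i - x i:]) r"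
    have rp: "poly rp t = ev (xt t) r" for t
    proof -
      have "poly (mhom (\<lambda>c. [:complex_of_real c:]) (\<lambda>i. if i = 0 then [:x 0:] else [:x i, xs i - x i:]) p) t = ev (xt t) p" for p
        by (induction p rule: mpol_induct) (auto simp: L.mhom_add L.mhom_mult evh.hom_add evh.hom_mult xt_def)
      then show ?thesis by (simp add: rp_def)
    qed
    have "xt 1 = xs(0 := x 0)" by (auto simp: xt_def)
    then have "poly rp 1 \<noteq> 0" using xs by (simp add: rp r)
    then have "finite {t. poly rp t = 0}" by (intro poly_roots_finite) auto
    then have "\<not> 0 islimpt {t. poly rp t = 0}" by (rule islimpt_finite)
    then have "eventually (\<lambda>t. poly rp t \<noteq> 0) (at 0)" by (simp add: islimpt_iff_eventually)
    then obtain d where d: "d > 0" "\<And>t. t \<noteq> 0 \<Longrightarrow> dist t 0 < d \<Longrightarrow> poly rp t \<noteq> 0"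
      unfolding eventually_at by auto
    \<comment> \<open>The shift by 2 keeps every term strictly inside the radius \<open>d\<close>,
      also at \<open>n = 0\<close>.\<close>
    define ts where "ts n = complex_of_real (d / real (n + 2))" for n
    have ts_nz: "poly rp (ts n) \<noteq> 0" for n
    proof (rule d(2))
      show "ts n \<noteq> 0" using d(1) by (simp add: ts_def del: of_real_divide)
      have "d / real (n + 2) < d" using d(1) by (simp add: field_simps add_pos_nonneg)
      then show "dist (ts n) 0 < d" using d(1) by (simp add: ts_def del: of_real_divide)
    qed
    have "(\<lambda>n. d / real (n + 2)) \<longlonglongrightarrow> 0"
      using LIMSEQ_ignore_initial_segment[OF lim_const_over_n[of d], of 2] by simp
    then have "(\<lambda>n. complex_of_real (d / real (n + 2))) \<longlonglongrightarrow> of_real 0" by (rule tendsto_of_real)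
    then have ts0: "ts \<longlonglongrightarrow> 0" unfolding ts_def[abs_def] by simp
    have limx: "(\<lambda>n. xt (ts n) i) \<longlonglongrightarrow> x i" for i
    proof -
      have "(\<lambda>n. x i + ts n * (xs i - x i)) \<longlonglongrightarrow> x i + 0 * (xs i - x i)" by (intro tendsto_intros ts0)
      then show ?thesis by (cases "i = 0") (auto simp: xt_def)
    qed
    have "(\<lambda>n. poly (cpev (xt (ts n)) T) (x 0)) \<longlonglongrightarrow> poly (cpev x T) (x 0)"
      by (intro tendsto_poly_cpev limx tendsto_const)
    also have "poly (cpev x T) (x 0) = 0" using \<Theta>0 c_nz by (simp add: ev\<Theta>)
    finally have lim0: "(\<lambda>n. cmod (poly (cpev (xt (ts n)) T) (x 0))) \<longlonglongrightarrow> 0"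
      by (rule tendsto_norm_zero)
    \<comment> \<open>At the shifted parameters \<open>x 0\<close> need not be a root of
      \<open>T\<close> any more. A nearby root replaces it, at a distance controlled by the value of
      \<open>T\<close> at \<open>x 0\<close>, which tends to 0.\<close>
    have "\<forall>n. \<exists>z. poly (cpev (xt (ts n)) T) z = 0 \<and> cmod (x 0 - z) ^ k \<le> cmod (poly (cpev (xt (ts n)) T) (x 0))"
      using nearby_root[OF dT k_pos] by blast
    then obtain zs where zs: "\<And>n. poly (cpev (xt (ts n)) T) (zs n) = 0"
      "\<And>n. cmod (x 0 - zs n) ^ k \<le> cmod (poly (cpev (xt (ts n)) T) (x 0))" by metis
    have "(\<lambda>n. cmod (x 0 - zs n) ^ k) \<longlonglongrightarrow> 0"
      by (rule tendsto_sandwich[OF _ _ tendsto_const lim0]) (use zs(2) in auto)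
    then have "(\<lambda>n. root k (cmod (x 0 - zs n) ^ k)) \<longlonglongrightarrow> root k 0" by (rule tendsto_real_root)
    then have "(\<lambda>n. cmod (x 0 - zs n)) \<longlonglongrightarrow> 0" using k_pos by (simp add: real_root_power_cancel)
    then have "(\<lambda>n. x 0 - zs n) \<longlonglongrightarrow> 0" by (rule tendsto_norm_zero_cancel)
    then have "(\<lambda>n. x 0 - (x 0 - zs n)) \<longlonglongrightarrow> x 0 - 0" by (intro tendsto_intros)
    then have zlim: "zs \<longlonglongrightarrow> x 0" by simp
    show ?thesis
    proof (rule closed)
      show "(\<lambda>n. ((xt (ts n))(0 := zs n)) i) \<longlonglongrightarrow> x i" for i
        using limx[of i] zlim by (cases "i = 0") auto
      show "\<exists>u v. sing_E \<tau> ((xt (ts n))(0 := zs n)) u v" for n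
        using zs(1)[of n] ts_nz[of n] by (intro sing_generic) (simp_all add: ev\<Theta> T(4) r rp)
    qed
  qed
  have Z: "ev x \<Theta> = 0 \<longleftrightarrow> x \<in> std_map \<tau> ` coord_space (k - 1)" if "x \<in> coord_space k" for x
    unfolding image[OF that] using sing_all \<Theta>_sing by blast
  have "(\<exists>\<Delta>. discriminant_polynomial k (std_map \<tau>) \<Delta>) \<and>
    (\<forall>\<Delta>. discriminant_polynomial k (std_map \<tau>) \<Delta> \<longrightarrow> (\<exists>c. c \<noteq> 0 \<and> complexify \<Theta> = Const c * \<Delta>))"
  proof (rule discriminant_from_data[where e = 0 and N = k and c = "of_real c" and Zs = Zs and ?x0.0 = xs])
    show "valid_wf \<tau>" using \<tau> by auto
    show "\<exists>p. degree p = k \<and> coeff p k = of_real c \<and> (\<forall>z. ev (x(0 := z)) \<Theta> = poly p z)" for x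
      using dT[of x] c_nz by (intro exI[of _ "Polynomial.smult (of_real c) (cpev x T)"]) (simp add: ev\<Theta> T(4))
    show "ev (xs(0 := z)) \<Theta> = 0" if "z \<in> Zs" for z using Zs(3)[OF that] \<Theta>_sing by blast
  qed (use k k_pos \<Theta> Z c_nz Zs in auto)
  then show ?thesis using \<Theta> R Z by blast
qed

end

lemma (in module_span) MC_divide: "MC m \<Longrightarrow> MC (\<lambda>x u v. m x u v / numeral w)"
  using MC_mult[OF MC_const[of "1 / numeral w"], of m] by simp

text \<open>Both sides are the resultant of \<open>f\<close> and \<open>p\<close>, expanded over the
  roots of the one or of the other.\<close>

lemma prod_poly_swap:
  fixes f p :: "complex poly"
  assumes f: "f = Polynomial.smult l (\<Prod>a\<leftarrow>as. [:-a, 1:])" "l \<noteq> 0"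
    and p: "p = Polynomial.smult c (\<Prod>w\<leftarrow>ws. [:-w, 1:])" "c \<noteq> 0"
  shows "l ^ length ws * (\<Prod>a\<leftarrow>as. poly p a) = (-1) ^ (length as * length ws) * c ^ length as * (\<Prod>w\<leftarrow>ws. poly f w)"
proof -
  have df: "degree f = length as" and dp: "degree p = length ws"
    using assms degree_linear_factors[of uminus as] degree_linear_factors[of uminus ws] by simp_all
  have "resultant f p = l ^ length ws * (\<Prod>a\<leftarrow>as. poly p a)"
    unfolding resultant_sub df dp by (subst f(1)) (rule resultant_sub_prod, simp add: dp)
  then show ?thesis using resultant_prod_right[OF df p] by simp
qed

lemma sing_E_real_iff:
  fixes x :: "nat \<Rightarrow> real"
  shows "sing_E \<tau> (\<lambda>i. complex_of_real (x i)) (of_real a) (of_real b) \<longleftrightarrow> sing_E \<tau> x a b"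
proof -
  interpret mr: map_poly_comm_ring_hom complex_of_real
    by unfold_locales simp_all
  have [simp]: "map_poly complex_of_real (pCons a f) = pCons (of_real a) (map_poly of_real f)" for a f
    by (rule poly_eqI) (simp add: coeff_map_poly coeff_pCons split: nat.split)
  have "PE \<tau> (\<lambda>i. complex_of_real (x i)) = map_poly of_real (PE \<tau> x)"
    "QE \<tau> (\<lambda>i. complex_of_real (x i)) = map_poly of_real (QE \<tau> x)"
    by (cases \<tau>; simp)+
  then have "poly (PE \<tau> (\<lambda>i. complex_of_real (x i))) (of_real b) = of_real (poly (PE \<tau> x) b)"
    "poly (QE \<tau> (\<lambda>i. complex_of_real (x i))) (of_real b) = of_real (poly (QE \<tau> x) b)"
    "poly (pderiv (PE \<tau> (\<lambda>i. complex_of_real (x i)))) (of_real b) = of_real (poly (pderiv (PE \<tau> x)) b)"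
    "poly (pderiv (QE \<tau> (\<lambda>i. complex_of_real (x i)))) (of_real b) = of_real (poly (pderiv (QE \<tau> x)) b)"
    by (simp_all add: of_real_hom.map_poly_pderiv[symmetric] of_real_hom.poly_map_poly)
  then have "sing_E \<tau> (\<lambda>i. complex_of_real (x i)) (of_real a) (of_real b) \<longleftrightarrow>
     complex_of_real (poly (PE \<tau> x) b) = of_real (- 3 * a\<^sup>2) \<and>
     complex_of_real (poly (pderiv (QE \<tau> x)) b) = of_real (- a * poly (pderiv (PE \<tau> x)) b) \<and>
     complex_of_real (poly (QE \<tau> x) b) = of_real (2 * a ^ 3)"
    unfolding sing_E_def crit_E_def by simp
  also have "\<dots> \<longleftrightarrow> sing_E \<tau> x a b"
    unfolding of_real_eq_iff sing_E_def crit_E_def by simp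
  finally show ?thesis .
qed

text \<open>
  A non-real singular point comes with its conjugate. On the real line \<open>u = t v + s\<close> through both,
  \<open>u\<^sup>3 + P u + Q\<close> vanishes doubly at \<open>v\<close> and its conjugate, and \<open>3 u\<^sup>2 + P\<close> vanishes there.
\<close>

lemma real_sing_E_cases:
  fixes x :: "nat \<Rightarrow> real"
  assumes sing: "sing_E \<tau> (\<lambda>i. complex_of_real (x i)) u v" and no: "\<And>a b. \<not> sing_E \<tau> x a b"
  shows "\<exists>s t q p C D. PE \<tau> x + 3 * [:s, t:]\<^sup>2 = [:q, p, 1:] * C \<and>
    [:s, t:] ^ 3 + PE \<tau> x * [:s, t:] + QE \<tau> x = [:q, p, 1:]\<^sup>2 * D"
proof -
  interpret mr: map_poly_comm_ring_hom complex_of_real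
    by unfold_locales simp_all
  have [simp]: "map_poly complex_of_real (pCons a f) = pCons (of_real a) (map_poly of_real f)" for a f
    by (rule poly_eqI) (simp add: coeff_map_poly coeff_pCons split: nat.split)
  have P: "PE \<tau> (\<lambda>i. complex_of_real (x i)) = map_poly of_real (PE \<tau> x)"
    and Q: "QE \<tau> (\<lambda>i. complex_of_real (x i)) = map_poly of_real (QE \<tau> x)"
    by (cases \<tau>; simp)+
  have e: "poly (map_poly of_real (PE \<tau> x)) v = - 3 * u\<^sup>2"
    "poly (pderiv (map_poly of_real (QE \<tau> x))) v = - u * poly (pderiv (map_poly of_real (PE \<tau> x))) v"
    "poly (map_poly of_real (QE \<tau> x)) v = 2 * u ^ 3"
    using sing unfolding sing_E_def crit_E_def P Q by auto
  \<comment> \<open>For real \<open>v\<close> the values of \<open>P\<close> and \<open>Q\<close>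
    are real, so \<open>u^2\<close> and \<open>u^3\<close> are real and hence \<open>u\<close> is.
    The singular point would be real, contrary to \<open>no\<close>.\<close>
  have Im: "Im v \<noteq> 0"
  proof
    assume "Im v = 0"
    then have v: "v = of_real (Re v)" by (simp add: complex_eq_iff)
    have "- 3 * u\<^sup>2 = of_real (poly (PE \<tau> x) (Re v))" "2 * u ^ 3 = of_real (poly (QE \<tau> x) (Re v))"
      using e(1,3) by (subst (asm) (1 2) v, simp add: of_real_hom.poly_map_poly)+
    then have "Im (- 3 * u\<^sup>2) = 0" "Im (2 * u ^ 3) = 0" by (simp_all only: Im_complex_of_real)
    then have i: "Re u * Im u = 0" "Im (u ^ 3) = 0" by (auto simp: power2_eq_square)
    have "Im u = 0"
    proof (rule ccontr)
      assume nz: "Im u \<noteq> 0"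
      then have "Re u = 0" using i(1) by simp
      then have "Im (u ^ 3) = - ((Im u) ^ 3)" by (simp add: power3_eq_cube)
      with i(2) nz show False by simp
    qed
    then have "u = of_real (Re u)" by (simp add: complex_eq_iff)
    then have "sing_E \<tau> x (Re u) (Re v)" using sing v sing_E_real_iff by metis
    with no show False by blast
  qed
  define t where "t = Im u / Im v"
  define s where "s = Re u - t * Re v"
  define L where "L = [:s, t:]"
  have L: "poly (map_poly of_real L) v = u" "poly (pderiv (map_poly of_real L)) v = of_real t"
    using Im by (simp_all add: L_def s_def t_def complex_eq_iff pderiv_pCons)
  define q where "q = (Re v)\<^sup>2 + (Im v)\<^sup>2"
  define p where "p = - 2 * Re v"
  have "poly (map_poly complex_of_real (PE \<tau> x + 3 * L\<^sup>2)) v = 0"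
    by (simp add: mr.hom_add mr.hom_mult mr.hom_power mr.hom_numeral e L)
  from quadratic_dvd[OF this Im] obtain C where C: "PE \<tau> x + 3 * L\<^sup>2 = [:q, p, 1:] * C"
    unfolding q_def p_def by auto
  let ?F = "L ^ 3 + PE \<tau> x * L + QE \<tau> x"
  have "poly (map_poly complex_of_real ?F) v = 0"
    by (simp add: mr.hom_add mr.hom_mult mr.hom_power e L power3_eq_cube power2_eq_square)
  moreover have "poly (pderiv (map_poly complex_of_real ?F)) v = 0"
  proof -
    have "map_poly complex_of_real ?F = map_poly of_real L * map_poly of_real L * map_poly of_real L +
        map_poly of_real (PE \<tau> x) * map_poly of_real L + map_poly of_real (QE \<tau> x)"
      by (simp add: mr.hom_add mr.hom_mult power3_eq_cube)
    moreover have "poly (pderiv (l * l * l + f * l + g)) v = 0"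
      if "poly l v = u" "poly (pderiv l) v = d" "poly f v = - 3 * u\<^sup>2" "poly (pderiv g) v = - u * poly (pderiv f) v"
      for l f g :: "complex poly" and d
    proof -
      have "poly (pderiv (l * l * l + f * l + g)) v = 3 * u * u * d + poly (pderiv f) v * u + poly f v * d + poly (pderiv g) v"
        by (simp only: pderiv_add pderiv_mult poly_add poly_mult that(1,2)) (simp add: algebra_simps)
      also have "\<dots> = 0" unfolding that(3,4) by (simp add: power2_eq_square)
      finally show ?thesis .
    qed
    ultimately show ?thesis using e L by simp
  qed
  ultimately have "[:q, p, 1:]\<^sup>2 dvd ?F"
    unfolding q_def p_def by (rule quadratic_square_dvd[OF _ _ Im])
  then obtain D where D: "?F = [:q, p, 1:]\<^sup>2 * D" unfolding dvd_def by (elim exE)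
  show ?thesis
    by (rule exI[of _ s], rule exI[of _ t], rule exI[of _ q], rule exI[of _ p], rule exI[of _ C], rule exI[of _ D])
      (rule conjI[OF C[unfolded L_def] D[unfolded L_def]])
qed

lemma degree_le_of_mult_monic:
  fixes m C :: "real poly"
  assumes "degree (m * C) \<le> n + d" "degree m = n" "m \<noteq> 0"
  shows "degree C \<le> d"
  using assms by (cases "C = 0") (auto simp: degree_mult_eq)

lemma poly_eq_const: "degree C \<le> 0 \<Longrightarrow> C = [:coeff C 0:]"
  by (rule poly_eqI) (auto simp: coeff_pCons coeff_eq_0 split: nat.split)

lemma poly_eq_linear: "degree C \<le> 1 \<Longrightarrow> C = [:coeff C 0, coeff C 1:]"
  by (rule poly_eqI) (auto simp: coeff_pCons coeff_eq_0 split: nat.split)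

lemma square_eq_of_sum_eq_0:
  fixes u p :: complex
  assumes "3 * u\<^sup>2 + p = 0"
  shows "u * u = - p / 3"
proof -
  have "u * u = (3 * u\<^sup>2 + p) / 3 - p / 3" by (simp add: power2_eq_square add_divide_distrib)
  then show ?thesis unfolding assms by simp
qed

lemma power5_eq: "a ^ 5 = a * a * a * a * (a :: 'a::monoid_mult)"
  by (simp add: eval_nat_numeral mult.assoc)

lemmas power_expand = power2_eq_square power3_eq_cube power4_eq_xxxx power5_eq

lemma degree_F_le:
  fixes P Q :: "real poly"
  assumes "degree P \<le> 3" "degree Q \<le> n" "n \<ge> 4"
  shows "degree ([:s, t:] ^ 3 + P * [:s, t:] + Q) \<le> n"
proof -
  have L: "degree [:s, t:] \<le> 1" by simp
  have "degree ([:s, t:] ^ 3) \<le> 3"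
    using order_trans[OF degree_power_le mult_right_mono[OF L, of 3]] by simp
  moreover have "degree (P * [:s, t:]) \<le> 4"
    using degree_mult_le[of P "[:s, t:]"] L assms(1) by linarith
  ultimately show ?thesis using assms by (intro degree_add_le) auto
qed

lemma degree_P_le:
  fixes P :: "real poly"
  assumes "degree P \<le> n" "n \<ge> 2"
  shows "degree (P + 3 * [:s, t:]\<^sup>2) \<le> n"
proof -
  have L: "degree [:s, t:] \<le> 1" by simp
  have "degree ([:s, t:]\<^sup>2) \<le> 2"
    using order_trans[OF degree_power_le mult_right_mono[OF L, of 2]] by simp
  moreover have "degree (3 * [:s, t:]\<^sup>2) \<le> degree (3 :: real poly) + degree ([:s, t:]\<^sup>2)"
    by (rule degree_mult_le)
  ultimately show ?thesis using assms by (intro degree_add_le) auto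
qed

text \<open>What remains for each type: solve the two factorizations for \<open>x\<close> by one
  polynomial map \<open>G\<close> in \<open>k - 2\<close> parameters, and find a box of values of
  the coordinates other than \<open>x 0\<close> over each point of which a real singular point
  exists.\<close>

lemma (in wf_E) conclusion_main:
  fixes G :: "nat \<Rightarrow> real mpol" and a b :: "nat \<Rightarrow> real"
  assumes image_real: "\<And>x :: nat \<Rightarrow> real. x \<in> coord_space k \<Longrightarrow> x \<in> std_map \<tau> ` coord_space (k - 1) \<longleftrightarrow> (\<exists>u v. sing_E \<tau> x u v)"
    and G: "\<And>(x :: nat \<Rightarrow> real) s t q p C D. PE \<tau> x + 3 * [:s, t:]\<^sup>2 = [:q, p, 1:] * C \<Longrightarrow>
      [:s, t:] ^ 3 + PE \<tau> x * [:s, t:] + QE \<tau> x = [:q, p, 1:]\<^sup>2 * D \<Longrightarrow>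
      \<exists>y\<in>coord_space (k - 2). \<forall>i<k. x i = meval y (G i)"
    and ab: "\<And>i. i \<in> {1..<k} \<Longrightarrow> a i < b i"
    and proj: "\<And>z. (\<And>i. i \<in> {1..<k} \<Longrightarrow> a i \<le> z i \<and> z i \<le> b i) \<Longrightarrow>
      \<exists>u v x0. sing_E \<tau> (\<lambda>i. if i = 0 then x0 else if i < k then z i else 0) u v"
  shows "\<exists>\<Theta>\<in>mpolys k. R = \<Theta> * r\<^sup>2 \<and>
    main_analytic_function k (\<lambda>x. meval x \<Theta>) (std_map \<tau> ` coord_space (k - 1)) \<and>
    (\<exists>\<Delta>. discriminant_polynomial k (std_map \<tau>) \<Delta>) \<and>
    (\<forall>\<Delta>. discriminant_polynomial k (std_map \<tau>) \<Delta> \<longrightarrow> (\<exists>c. c \<noteq> 0 \<and> complexify \<Theta> = Const c * \<Delta>))"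
proof -
  obtain \<Theta> where \<Theta>: "\<Theta> \<in> mpolys k" "R = \<Theta> * r\<^sup>2"
    and Z: "\<And>x. x \<in> coord_space k \<Longrightarrow> ev x \<Theta> = 0 \<longleftrightarrow> x \<in> std_map \<tau> ` coord_space (k - 1)"
    and disc: "(\<exists>\<Delta>. discriminant_polynomial k (std_map \<tau>) \<Delta>) \<and>
      (\<forall>\<Delta>. discriminant_polynomial k (std_map \<tau>) \<Delta> \<longrightarrow> (\<exists>c. c \<noteq> 0 \<and> complexify \<Theta> = Const c * \<Delta>))"
    using conclusion by blast
  have "main_analytic_function k (\<lambda>x. meval x \<Theta>) (std_map \<tau> ` coord_space (k - 1))"
  proof (rule main_analytic_std_mapI[where I = "{()}" and G = "\<lambda>_. G" and a = a and b = b])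
    show "valid_wf \<tau>" using \<tau> by auto
    show "k = wf_dim \<tau>" by (rule k)
    show "ev x \<Theta> = 0 \<longleftrightarrow> x \<in> std_map \<tau> ` coord_space (k - 1)" if "x \<in> coord_space k" for x
      using that by (rule Z)
    fix x :: "nat \<Rightarrow> real"
    assume x: "x \<in> coord_space k" and "ev (\<lambda>i. of_real (x i)) \<Theta> = 0" and no: "x \<notin> std_map \<tau> ` coord_space (k - 1)"
    moreover have xc: "(\<lambda>i. complex_of_real (x i)) \<in> coord_space k" using x by (simp add: coord_space_def)
    ultimately have "(\<lambda>i. complex_of_real (x i)) \<in> std_map \<tau> ` coord_space (k - 1)" using Z by blast
    then obtain u v where "sing_E \<tau> (\<lambda>i. complex_of_real (x i)) u v" using image[OF xc] by blast
    moreover have "\<And>a b. \<not> sing_E \<tau> x a b" using no image_real[OF x] by blast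
    ultimately have "\<exists>s t q p C D. PE \<tau> x + 3 * [:s, t:]\<^sup>2 = [:q, p, 1:] * C \<and>
      [:s, t:] ^ 3 + PE \<tau> x * [:s, t:] + QE \<tau> x = [:q, p, 1:]\<^sup>2 * D"
      by (rule real_sing_E_cases)
    then have "\<exists>y\<in>coord_space (k - 2). \<forall>i<k. x i = meval y (G i)" using G by blast
    then show "\<exists>j\<in>{()}. \<exists>y\<in>coord_space (k - 2). \<forall>i<k. x i = meval y (G i)" by blast
  next
    fix z :: "nat \<Rightarrow> real" assume "\<And>i. i \<in> {1..<k} \<Longrightarrow> a i \<le> z i \<and> z i \<le> b i"
    then obtain u v x0 where s: "sing_E \<tau> (\<lambda>i. if i = 0 then x0 else if i < k then z i else 0) u v"
      using proj by blast
    let ?x = "\<lambda>i. if i = 0 then x0 else if i < k then z i else 0"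
    have "?x \<in> coord_space k" using k_pos by (auto simp: coord_space_def)
    then have "?x \<in> std_map \<tau> ` coord_space (k - 1)" using image_real s by blast
    then show "\<exists>x\<in>std_map \<tau> ` coord_space (k - 1). \<forall>i\<in>{1..<k}. x i = z i"
      by (rule bexI[rotated]) auto
  qed (use \<Theta> ab in auto)
  then show ?thesis using \<Theta> disc by blast
qed

lemma coeff_mult_top:
  fixes p q :: "'a::idom poly"
  assumes "degree p \<le> m" "degree q \<le> n"
  shows "coeff (p * q) (m + n) = coeff p m * coeff q n"
proof (cases "degree p = m \<and> degree q = n")
  case True
  then show ?thesis using coeff_mult_degree_sum[of p q] by auto
next
  case False
  then have "degree p + degree q < m + n" "coeff p m = 0 \<or> coeff q n = 0"
    using assms coeff_eq_0[of p m] coeff_eq_0[of q n] by linarith+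
  moreover from this(1) have "coeff (p * q) (m + n) = 0"
    using degree_mult_le[of p q] by (intro coeff_eq_0) linarith
  ultimately show ?thesis by auto
qed

lemma numeral_eq_Const: "(numeral w :: real mpol) = Const (numeral w)"
  by (rule meval_eqI) (simp add: mev.hom_numeral)

text \<open>The top coefficient of \<open>A = 3 Q'^2 + P'^2 P\<close>. The conditionals record which
  summand reaches degree \<open>n\<close>: the first for E6 and E8, with \<open>48 = 3 * 4^2\<close>
  and \<open>75 = 3 * 5^2\<close>, the second for E7, with \<open>9 = 3^2\<close>.\<close>

lemma degree_square_sum:
  fixes f g h :: "real mpol poly"
  assumes f: "degree f \<le> a" and g: "degree g \<le> b" and h: "degree h \<le> c"
    and n: "2 * a \<le> n" "2 * b + c \<le> n"
    and top: "3 * (if n = 2 * a then coeff f a * coeff f a else 0) +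
      (if n = 2 * b + c then coeff g b * coeff g b * coeff h c else 0) = Const l"
    and l: "l \<noteq> 0"
  shows "degree (3 * f\<^sup>2 + g\<^sup>2 * h) = n" "coeff (3 * f\<^sup>2 + g\<^sup>2 * h) n = Const l"
proof -
  have ff: "degree (f * f) \<le> a + a" using degree_mult_le[of f f] f by linarith
  have gg: "degree (g * g) \<le> b + b" using degree_mult_le[of g g] g by linarith
  have ggh: "degree (g * g * h) \<le> b + b + c" using degree_mult_le[of "g * g" h] gg h by linarith
  have c3: "coeff (3 * p) i = 3 * coeff p i" for p :: "real mpol poly" and i
    by (simp add: numeral_poly)
  have "coeff (f * f) n = (if n = 2 * a then coeff f a * coeff f a else 0)"
    using coeff_mult_top[OF f f] ff n by (auto simp: mult_2 intro!: coeff_eq_0)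
  moreover have "coeff (g * g * h) n = (if n = 2 * b + c then coeff g b * coeff g b * coeff h c else 0)"
    using coeff_mult_top[OF gg h] coeff_mult_top[OF g g] ggh n by (auto simp: mult_2 intro!: coeff_eq_0)
  ultimately show 1: "coeff (3 * f\<^sup>2 + g\<^sup>2 * h) n = Const l"
    using top by (simp add: power2_eq_square c3)
  show "degree (3 * f\<^sup>2 + g\<^sup>2 * h) = n"
  proof (rule antisym)
    show "degree (3 * f\<^sup>2 + g\<^sup>2 * h) \<le> n"
      unfolding power2_eq_square using ff ggh n degree_mult_le[of "3 :: real mpol poly" "f * f"]
      by (intro degree_add_le) (simp_all add: mult_2)
    show "n \<le> degree (3 * f\<^sup>2 + g\<^sup>2 * h)" using 1 l by (intro le_degree) simp
  qed
qed

subsection \<open>Type E6\<close>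

lemma poly_PE6: "poly (PE WF_E6 x) v = x 1 + x 4 * v + x 5 * v\<^sup>2" "poly (pderiv (PE WF_E6 x)) v = x 4 + 2 * x 5 * v"
  and poly_QE6: "poly (QE WF_E6 x) v = x 0 + (x 2 * v + x 3 * v\<^sup>2 + v ^ 4)" "poly (pderiv (QE WF_E6 x)) v = x 2 + 2 * x 3 * v + 4 * v ^ 3"
  for x :: "nat \<Rightarrow> 'a::idom"
  by (simp_all add: pderiv_pCons algebra_simps power_expand)

text \<open>The equations are linear in \<open>x 1\<close>, \<open>x 2\<close> and
  \<open>x 0\<close> respectively, and solving them gives the first three components of the standard
  map, whose \<open>\<delta>\<close> is \<open>P'\<close>. The value of \<open>x 2\<close> has to be
  inserted before \<open>x 0\<close> can be read off.\<close>

lemma sing_E6: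
  "sing_E WF_E6 x u v \<longleftrightarrow> x 1 = - 3 * u\<^sup>2 - x 4 * v - x 5 * v\<^sup>2 \<and>
    x 2 = - 4 * v ^ 3 - 2 * x 3 * v - u * (2 * x 5 * v + x 4) \<and>
    x 0 = 2 * u ^ 3 + 3 * v ^ 4 + x 3 * v\<^sup>2 + u * v * (2 * x 5 * v + x 4)"
  for x :: "nat \<Rightarrow> 'a::idom"
proof -
  have 1: "x 1 + x 4 * v + x 5 * v\<^sup>2 = - 3 * u\<^sup>2 \<longleftrightarrow> x 1 = - 3 * u\<^sup>2 - x 4 * v - x 5 * v\<^sup>2"
    by (rule diff_eq_diff_eq) (simp add: algebra_simps)
  have 2: "x 2 + 2 * x 3 * v + 4 * v ^ 3 = - u * (x 4 + 2 * x 5 * v) \<longleftrightarrow> x 2 = - 4 * v ^ 3 - 2 * x 3 * v - u * (2 * x 5 * v + x 4)"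
    by (rule diff_eq_diff_eq) (simp add: algebra_simps)
  have 3: "x 0 + (x 2 * v + x 3 * v\<^sup>2 + v ^ 4) = 2 * u ^ 3 \<longleftrightarrow> x 0 = 2 * u ^ 3 + 3 * v ^ 4 + x 3 * v\<^sup>2 + u * v * (2 * x 5 * v + x 4)" if "x 2 = - 4 * v ^ 3 - 2 * x 3 * v - u * (2 * x 5 * v + x 4)"
    by (rule diff_eq_diff_eq) (subst that, simp add: algebra_simps power_expand)
  show ?thesis unfolding sing_E_def crit_E_def poly_PE6 poly_QE6 using 1 2 3 by blast
qed

lemma map_E6_image_iff:
  fixes x :: "nat \<Rightarrow> 'a::idom"
  assumes x: "x \<in> coord_space 6"
  shows "x \<in> std_map WF_E6 ` coord_space (6 - 1) \<longleftrightarrow> (\<exists>u v. sing_E WF_E6 x u v)"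
proof
  assume "x \<in> std_map WF_E6 ` coord_space (6 - 1)"
  then obtain y where y: "x = map_E6 y" by auto
  have "sing_E WF_E6 x (y 0) (y 1)"
    unfolding sing_E6 y by (simp add: map_E6_def Let_def target_def)
  then show "\<exists>u v. sing_E WF_E6 x u v" by blast
next
  assume "\<exists>u v. sing_E WF_E6 x u v"
  then obtain u v where s: "x 1 = - 3 * u\<^sup>2 - x 4 * v - x 5 * v\<^sup>2" "x 2 = - 4 * v ^ 3 - 2 * x 3 * v - u * (2 * x 5 * v + x 4)" "x 0 = 2 * u ^ 3 + 3 * v ^ 4 + x 3 * v\<^sup>2 + u * v * (2 * x 5 * v + x 4)"
    unfolding sing_E6 by blast
  define y where "y i = (if i = 0 then u else if i = 1 then v else if i < 5 then x (i + 1) else 0)" for i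
  have y: "y 0 = u" "y 1 = v" "y 2 = x 3" "y 3 = x 4" "y 4 = x 5" by (simp_all add: y_def eval_nat_numeral)
  have "map_E6 y i = x i" for i
  proof -
    have m: "map_E6 y i = (if i = 0 then x 0 else if i = 1 then x 1 else if i \<ge> 6 then 0 else if i = 2 then x 2 else y (i - 1))"
      unfolding s by (simp add: map_E6_def Let_def target_def y[simplified])
    have "y (i - 1) = x i" if "i \<noteq> 0" "i \<noteq> 1" "i \<noteq> 2" "\<not> i \<ge> 6"
    proof -
      have "3 \<le> i" using that by linarith
      then obtain j where "i = 3 + j" using le_Suc_ex by blast
      then show ?thesis using that by (simp add: y_def eval_nat_numeral)
    qed
    then show ?thesis unfolding m using x by (simp add: coord_space_def)
  qed
  then have "map_E6 y = x" by blast
  moreover have "y \<in> coord_space (6 - 1)" by (auto simp: y_def coord_space_def)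
  ultimately show "x \<in> std_map WF_E6 ` coord_space (6 - 1)" by auto
qed

lemma crit_E6: "crit_E WF_E6 x u v \<longleftrightarrow> 3 * u\<^sup>2 + (x 1 + x 4 * v + x 5 * v\<^sup>2) = 0 \<and> x 2 + 2 * x 3 * v + 4 * v ^ 3 + u * (x 4 + 2 * x 5 * v) = 0"
  for x :: "nat \<Rightarrow> complex"
proof -
  have "x 1 + x 4 * v + x 5 * v\<^sup>2 = - 3 * u\<^sup>2 \<longleftrightarrow> 3 * u\<^sup>2 + (x 1 + x 4 * v + x 5 * v\<^sup>2) = 0"
    by (rule diff_eq_diff_eq) (simp add: algebra_simps)
  moreover have "x 2 + 2 * x 3 * v + 4 * v ^ 3 = - u * (x 4 + 2 * x 5 * v) \<longleftrightarrow> x 2 + 2 * x 3 * v + 4 * v ^ 3 + u * (x 4 + 2 * x 5 * v) = 0"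
    by (rule diff_eq_diff_eq) (simp add: algebra_simps)
  ultimately show ?thesis unfolding crit_E_def poly_PE6 poly_QE6 by blast
qed

text \<open>The basis is the monomial basis of the local algebra of \<open>u^3 + v^4\<close>, which
  persists under the unfolding: \<open>u^2\<close> reduces by \<open>3 u^2 = - P\<close>, and
  \<open>v^3\<close> by \<open>Q' = - u P'\<close>.\<close>

lemma integral_E6:
  "\<exists>T :: real mpol poly. degree T = 6 \<and> coeff T 6 = 1 \<and> (\<forall>i. coeff T i \<in> mpolys 6) \<and>
    (\<forall>x z. cpev (x(0 := z)) T = cpev x T) \<and> (\<forall>x u v. sing_E WF_E6 x u v \<longrightarrow> poly (cpev x T) (x 0) = 0)"
proof -
  interpret M: module_span 6 "crit_E WF_E6" "\<lambda>j u v. [1, v, v\<^sup>2, u, u * v, u * v\<^sup>2] ! j" .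
  have e: "3 * u\<^sup>2 + (x 1 + x 4 * v + x 5 * v\<^sup>2) = 0" "x 2 + 2 * x 3 * v + 4 * v ^ 3 + u * (x 4 + 2 * x 5 * v) = 0" if "crit_E WF_E6 x u v" for x :: "nat \<Rightarrow> complex" and u v
    using that unfolding crit_E6 by auto
  have B: "M.SP (\<lambda>x u v. 1)" "M.SP (\<lambda>x u v. v)" "M.SP (\<lambda>x u v. v\<^sup>2)" "M.SP (\<lambda>x u v. u)" "M.SP (\<lambda>x u v. u * v)" "M.SP (\<lambda>x u v. u * v\<^sup>2)"
    using M.SP_basis[of 0] M.SP_basis[of 1] M.SP_basis[of 2] M.SP_basis[of 3] M.SP_basis[of 4] M.SP_basis[of 5] by (simp_all add: eval_nat_numeral)
  have R1: "M.SP (\<lambda>x u v. v ^ 3)"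
  proof (rule M.SP_cong)
    show "M.SP (\<lambda>x u v. (- x 2 / 4) * 1 + (- x 3 / 2) * v + (- x 4 / 4) * u + (- x 5 / 2) * (u * v))"
      by (intro M.SP_add M.SP_mult M.MC_divide M.MC_minus M.MC_add M.MC_mult M.MC_coord M.MC_numeral B)
    fix x :: "nat \<Rightarrow> complex" and u v assume c: "crit_E WF_E6 x u v"
    have "v ^ 3 - ((- x 2 / 4) * 1 + (- x 3 / 2) * v + (- x 4 / 4) * u + (- x 5 / 2) * (u * v)) = (x 2 + 2 * x 3 * v + 4 * v ^ 3 + u * (x 4 + 2 * x 5 * v)) / 4"
      by (simp add: field_simps power_expand)
    also have "\<dots> = 0" unfolding e[OF c] by simp
    finally show "v ^ 3 = (- x 2 / 4) * 1 + (- x 3 / 2) * v + (- x 4 / 4) * u + (- x 5 / 2) * (u * v)" by (rule eq_iff_diff_eq_0[THEN iffD2])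
  qed
  have R2: "M.SP (\<lambda>x u v. u * v ^ 3)"
  proof (rule M.SP_cong)
    show "M.SP (\<lambda>x u v. (- x 2 / 4) * u + (- x 3 / 2) * (u * v) + (x 4 * x 1 / 12) * 1 + (x 4 * x 4 / 12) * v + (x 4 * x 5 / 12) * v\<^sup>2 + (x 5 * x 1 / 6) * v + (x 5 * x 4 / 6) * v\<^sup>2 + (x 5 * x 5 / 6) * v ^ 3)"
      by (intro M.SP_add M.SP_mult M.MC_divide M.MC_minus M.MC_add M.MC_mult M.MC_coord M.MC_numeral B R1)
    fix x :: "nat \<Rightarrow> complex" and u v assume c: "crit_E WF_E6 x u v"
    \<comment> \<open>Multiplying the second critical equation by \<open>u / 4\<close> creates the
      term \<open>u^2 P' / 4\<close>, which \<open>P' / 12\<close> times the first equation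
      removes.\<close>
    have "u * v ^ 3 - ((- x 2 / 4) * u + (- x 3 / 2) * (u * v) + (x 4 * x 1 / 12) * 1 + (x 4 * x 4 / 12) * v + (x 4 * x 5 / 12) * v\<^sup>2 + (x 5 * x 1 / 6) * v + (x 5 * x 4 / 6) * v\<^sup>2 + (x 5 * x 5 / 6) * v ^ 3) = u * (x 2 + 2 * x 3 * v + 4 * v ^ 3 + u * (x 4 + 2 * x 5 * v)) / 4 - (x 4 / 12 + x 5 * v / 6) * (3 * u\<^sup>2 + (x 1 + x 4 * v + x 5 * v\<^sup>2))"
      by (simp add: field_simps power_expand)
    also have "\<dots> = 0" unfolding e[OF c] by simp
    finally show "u * v ^ 3 = (- x 2 / 4) * u + (- x 3 / 2) * (u * v) + (x 4 * x 1 / 12) * 1 + (x 4 * x 4 / 12) * v + (x 4 * x 5 / 12) * v\<^sup>2 + (x 5 * x 1 / 6) * v + (x 5 * x 4 / 6) * v\<^sup>2 + (x 5 * x 5 / 6) * v ^ 3" by (rule eq_iff_diff_eq_0[THEN iffD2])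
  qed
  have MCv: "M.MC (\<lambda>x u v. v)"
  proof (rule M.MC_I)
    fix i :: nat assume "i < 6"
    then consider "i = 0" | "i = 1" | "i = 2" | "i = 3" | "i = 4" | "i = 5" by linarith
    then show "M.SP (\<lambda>x u v. v * [1, v, v\<^sup>2, u, u * v, u * v\<^sup>2] ! i)"
    proof cases
      case 1
      show ?thesis
        by (rule M.SP_cong[OF B(2)]) (simp add: 1 eval_nat_numeral mult_ac)
    next
      case 2
      show ?thesis
        by (rule M.SP_cong[OF B(3)]) (simp add: 2 eval_nat_numeral mult_ac)
    next
      case 3
      show ?thesis
        by (rule M.SP_cong[OF R1]) (simp add: 3 eval_nat_numeral mult_ac)
    next
      case 4
      show ?thesis
        by (rule M.SP_cong[OF B(5)]) (simp add: 4 eval_nat_numeral mult_ac)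
    next
      case 5
      show ?thesis
        by (rule M.SP_cong[OF B(6)]) (simp add: 5 eval_nat_numeral mult_ac)
    next
      case 6
      show ?thesis
        by (rule M.SP_cong[OF R2]) (simp add: 6 eval_nat_numeral mult_ac)
    qed
  qed
  have MCp: "M.MC (\<lambda>x u v. - (x 1 + x 4 * v + x 5 * v\<^sup>2) / 3)"
    by (intro M.MC_intros M.MC_divide MCv)
  have uu: "u * u = - (x 1 + x 4 * v + x 5 * v\<^sup>2) / 3" if "crit_E WF_E6 x u v" for x :: "nat \<Rightarrow> complex" and u v
    using e(1)[OF that] by (rule square_eq_of_sum_eq_0)
  have MCu: "M.MC (\<lambda>x u v. u)"
  proof (rule M.MC_I)
    fix i :: nat assume "i < 6"
    then consider "i = 0" | "i = 1" | "i = 2" | "i = 3" | "i = 4" | "i = 5" by linarith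
    then show "M.SP (\<lambda>x u v. u * [1, v, v\<^sup>2, u, u * v, u * v\<^sup>2] ! i)"
    proof cases
      case 1
      show ?thesis
        by (rule M.SP_cong[OF B(4)]) (simp add: 1 eval_nat_numeral mult_ac)
    next
      case 2
      show ?thesis
        by (rule M.SP_cong[OF B(5)]) (simp add: 2 eval_nat_numeral mult_ac)
    next
      case 3
      show ?thesis
        by (rule M.SP_cong[OF B(6)]) (simp add: 3 eval_nat_numeral mult_ac)
    next
      case 4
      show ?thesis
        by (rule M.SP_cong[OF M.SP_mult[OF MCp B(1)]]) (use uu in \<open>simp add: 4 eval_nat_numeral mult.assoc[symmetric]\<close>)
    next
      case 5
      show ?thesis
        by (rule M.SP_cong[OF M.SP_mult[OF MCp B(2)]]) (use uu in \<open>simp add: 5 eval_nat_numeral mult.assoc[symmetric]\<close>)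
    next
      case 6
      show ?thesis
        by (rule M.SP_cong[OF M.SP_mult[OF MCp B(3)]]) (use uu in \<open>simp add: 6 eval_nat_numeral mult.assoc[symmetric]\<close>)
    qed
  qed
  have "\<exists>T :: real mpol poly. degree T = 6 \<and> coeff T 6 = 1 \<and> (\<forall>i. coeff T i \<in> mpolys 6) \<and>
    (\<forall>x z. cpev (x(0 := z)) T = cpev x T) \<and> (\<forall>x u v. crit_E WF_E6 x u v \<longrightarrow> poly (cpev x T) (2 * u ^ 3 - (x 2 * v + x 3 * v\<^sup>2 + v ^ 4)) = 0)"
    by (rule M.integral_equation[where m = "\<lambda>x u v. 2 * u ^ 3 - (x 2 * v + x 3 * v\<^sup>2 + v ^ 4)"])
      (intro M.MC_intros MCu MCv | simp add: crit_E6)+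
  moreover have "crit_E WF_E6 x u v \<and> x 0 = 2 * u ^ 3 - (x 2 * v + x 3 * v\<^sup>2 + v ^ 4)" if "sing_E WF_E6 x u v" for x :: "nat \<Rightarrow> complex" and u v
    using that unfolding sing_E_def poly_QE6 by (simp add: eq_diff_eq)
  ultimately show ?thesis by metis
qed

lemma degree_A_E6: "degree (poly_A WF_E6) = 6" "coeff (poly_A WF_E6) 6 = Const 48"
proof -
  have A: "poly_A WF_E6 = 3 * (pderiv (poly_Q WF_E6))\<^sup>2 + (pderiv (poly_P WF_E6))\<^sup>2 * poly_P WF_E6" by simp
  have d: "degree (poly_Q WF_E6) \<le> 3 + 1" "degree (poly_P WF_E6) \<le> 2" by simp_all
  have dd: "degree (pderiv (poly_Q WF_E6)) \<le> 3" "degree (pderiv (poly_P WF_E6)) \<le> 1"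
    using d unfolding degree_pderiv by linarith+
  have top: "coeff (pderiv (poly_Q WF_E6)) 3 = 4" "coeff (poly_P WF_E7) 3 = 1" by (simp_all add: coeff_pderiv eval_nat_numeral)
  show "degree (poly_A WF_E6) = 6"
    unfolding A by (rule degree_square_sum(1)[where l = 48 and n = 6, OF dd d(2)]; simp del: poly_P.simps poly_Q.simps add: top flip: numeral_eq_Const)
  show "coeff (poly_A WF_E6) 6 = Const 48"
    unfolding A by (rule degree_square_sum(2)[where l = 48 and n = 6, OF dd d(2)]; simp del: poly_P.simps poly_Q.simps add: top flip: numeral_eq_Const)
qed

subsection \<open>Type E7\<close>

lemma poly_PE7: "poly (PE WF_E7 x) v = x 1 + x 5 * v + x 6 * v\<^sup>2 + v ^ 3" "poly (pderiv (PE WF_E7 x)) v = x 5 + 2 * x 6 * v + 3 * v\<^sup>2"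
  and poly_QE7: "poly (QE WF_E7 x) v = x 0 + (x 2 * v + x 3 * v\<^sup>2 + x 4 * v ^ 3)" "poly (pderiv (QE WF_E7 x)) v = x 2 + 2 * x 3 * v + 3 * x 4 * v\<^sup>2"
  for x :: "nat \<Rightarrow> 'a::idom"
  by (simp_all add: pderiv_pCons algebra_simps power_expand)

lemma sing_E7:
  "sing_E WF_E7 x u v \<longleftrightarrow> x 1 = - 3 * u\<^sup>2 - v ^ 3 - x 5 * v - x 6 * v\<^sup>2 \<and>
    x 2 = - 2 * x 3 * v - 3 * x 4 * v\<^sup>2 - u * (3 * v\<^sup>2 + 2 * x 6 * v + x 5) \<and>
    x 0 = 2 * u ^ 3 + x 3 * v\<^sup>2 + 2 * x 4 * v ^ 3 + u * v * (3 * v\<^sup>2 + 2 * x 6 * v + x 5)"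
  for x :: "nat \<Rightarrow> 'a::idom"
proof -
  have 1: "x 1 + x 5 * v + x 6 * v\<^sup>2 + v ^ 3 = - 3 * u\<^sup>2 \<longleftrightarrow> x 1 = - 3 * u\<^sup>2 - v ^ 3 - x 5 * v - x 6 * v\<^sup>2"
    by (rule diff_eq_diff_eq) (simp add: algebra_simps)
  have 2: "x 2 + 2 * x 3 * v + 3 * x 4 * v\<^sup>2 = - u * (x 5 + 2 * x 6 * v + 3 * v\<^sup>2) \<longleftrightarrow> x 2 = - 2 * x 3 * v - 3 * x 4 * v\<^sup>2 - u * (3 * v\<^sup>2 + 2 * x 6 * v + x 5)"
    by (rule diff_eq_diff_eq) (simp add: algebra_simps)
  have 3: "x 0 + (x 2 * v + x 3 * v\<^sup>2 + x 4 * v ^ 3) = 2 * u ^ 3 \<longleftrightarrow> x 0 = 2 * u ^ 3 + x 3 * v\<^sup>2 + 2 * x 4 * v ^ 3 + u * v * (3 * v\<^sup>2 + 2 * x 6 * v + x 5)" if "x 2 = - 2 * x 3 * v - 3 * x 4 * v\<^sup>2 - u * (3 * v\<^sup>2 + 2 * x 6 * v + x 5)"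
    by (rule diff_eq_diff_eq) (subst that, simp add: algebra_simps power_expand)
  show ?thesis unfolding sing_E_def crit_E_def poly_PE7 poly_QE7 using 1 2 3 by blast
qed

lemma map_E7_image_iff:
  fixes x :: "nat \<Rightarrow> 'a::idom"
  assumes x: "x \<in> coord_space 7"
  shows "x \<in> std_map WF_E7 ` coord_space (7 - 1) \<longleftrightarrow> (\<exists>u v. sing_E WF_E7 x u v)"
proof
  assume "x \<in> std_map WF_E7 ` coord_space (7 - 1)"
  then obtain y where y: "x = map_E7 y" by auto
  have "sing_E WF_E7 x (y 0) (y 1)"
    unfolding sing_E7 y by (simp add: map_E7_def Let_def target_def)
  then show "\<exists>u v. sing_E WF_E7 x u v" by blast
next
  assume "\<exists>u v. sing_E WF_E7 x u v"
  then obtain u v where s: "x 1 = - 3 * u\<^sup>2 - v ^ 3 - x 5 * v - x 6 * v\<^sup>2" "x 2 = - 2 * x 3 * v - 3 * x 4 * v\<^sup>2 - u * (3 * v\<^sup>2 + 2 * x 6 * v + x 5)" "x 0 = 2 * u ^ 3 + x 3 * v\<^sup>2 + 2 * x 4 * v ^ 3 + u * v * (3 * v\<^sup>2 + 2 * x 6 * v + x 5)"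
    unfolding sing_E7 by blast
  define y where "y i = (if i = 0 then u else if i = 1 then v else if i < 6 then x (i + 1) else 0)" for i
  have y: "y 0 = u" "y 1 = v" "y 2 = x 3" "y 3 = x 4" "y 4 = x 5" "y 5 = x 6" by (simp_all add: y_def eval_nat_numeral)
  have "map_E7 y i = x i" for i
  proof -
    have m: "map_E7 y i = (if i = 0 then x 0 else if i = 1 then x 1 else if i \<ge> 7 then 0 else if i = 2 then x 2 else y (i - 1))"
      unfolding s by (simp add: map_E7_def Let_def target_def y[simplified])
    have "y (i - 1) = x i" if "i \<noteq> 0" "i \<noteq> 1" "i \<noteq> 2" "\<not> i \<ge> 7"
    proof -
      have "3 \<le> i" using that by linarith
      then obtain j where "i = 3 + j" using le_Suc_ex by blast
      then show ?thesis using that by (simp add: y_def eval_nat_numeral)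
    qed
    then show ?thesis unfolding m using x by (simp add: coord_space_def)
  qed
  then have "map_E7 y = x" by blast
  moreover have "y \<in> coord_space (7 - 1)" by (auto simp: y_def coord_space_def)
  ultimately show "x \<in> std_map WF_E7 ` coord_space (7 - 1)" by auto
qed

lemma crit_E7: "crit_E WF_E7 x u v \<longleftrightarrow> 3 * u\<^sup>2 + (x 1 + x 5 * v + x 6 * v\<^sup>2 + v ^ 3) = 0 \<and> x 2 + 2 * x 3 * v + 3 * x 4 * v\<^sup>2 + u * (x 5 + 2 * x 6 * v + 3 * v\<^sup>2) = 0"
  for x :: "nat \<Rightarrow> complex"
proof -
  have "x 1 + x 5 * v + x 6 * v\<^sup>2 + v ^ 3 = - 3 * u\<^sup>2 \<longleftrightarrow> 3 * u\<^sup>2 + (x 1 + x 5 * v + x 6 * v\<^sup>2 + v ^ 3) = 0"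
    by (rule diff_eq_diff_eq) (simp add: algebra_simps)
  moreover have "x 2 + 2 * x 3 * v + 3 * x 4 * v\<^sup>2 = - u * (x 5 + 2 * x 6 * v + 3 * v\<^sup>2) \<longleftrightarrow> x 2 + 2 * x 3 * v + 3 * x 4 * v\<^sup>2 + u * (x 5 + 2 * x 6 * v + 3 * v\<^sup>2) = 0"
    by (rule diff_eq_diff_eq) (simp add: algebra_simps)
  ultimately show ?thesis unfolding crit_E_def poly_PE7 poly_QE7 by blast
qed

text \<open>The monomial basis of the local algebra of \<open>u^3 + u v^3\<close>. The second
  critical equation reduces \<open>u v^2\<close>; eliminating \<open>u^2\<close> between the two
  equations leaves \<open>P P' / 3 = u Q'\<close>, whose leading term reduces
  \<open>v^5\<close>.\<close>

lemma integral_E7: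
  "\<exists>T :: real mpol poly. degree T = 7 \<and> coeff T 7 = 1 \<and> (\<forall>i. coeff T i \<in> mpolys 7) \<and>
    (\<forall>x z. cpev (x(0 := z)) T = cpev x T) \<and> (\<forall>x u v. sing_E WF_E7 x u v \<longrightarrow> poly (cpev x T) (x 0) = 0)"
proof -
  interpret M: module_span 7 "crit_E WF_E7" "\<lambda>j u v. [1, v, v\<^sup>2, v ^ 3, v ^ 4, u, u * v] ! j" .
  have e: "3 * u\<^sup>2 + (x 1 + x 5 * v + x 6 * v\<^sup>2 + v ^ 3) = 0" "x 2 + 2 * x 3 * v + 3 * x 4 * v\<^sup>2 + u * (x 5 + 2 * x 6 * v + 3 * v\<^sup>2) = 0" if "crit_E WF_E7 x u v" for x :: "nat \<Rightarrow> complex" and u v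
    using that unfolding crit_E7 by auto
  have B: "M.SP (\<lambda>x u v. 1)" "M.SP (\<lambda>x u v. v)" "M.SP (\<lambda>x u v. v\<^sup>2)" "M.SP (\<lambda>x u v. v ^ 3)" "M.SP (\<lambda>x u v. v ^ 4)" "M.SP (\<lambda>x u v. u)" "M.SP (\<lambda>x u v. u * v)"
    using M.SP_basis[of 0] M.SP_basis[of 1] M.SP_basis[of 2] M.SP_basis[of 3] M.SP_basis[of 4] M.SP_basis[of 5] M.SP_basis[of 6] by (simp_all add: eval_nat_numeral)
  have R1: "M.SP (\<lambda>x u v. u * v\<^sup>2)"
  proof (rule M.SP_cong)
    show "M.SP (\<lambda>x u v. (- x 4) * v\<^sup>2 + (- (2 * x 3) / 3) * v + (- x 2 / 3) * 1 + (- (2 * x 6) / 3) * (u * v) + (- x 5 / 3) * u)"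
      by (intro M.SP_add M.SP_mult M.MC_divide M.MC_minus M.MC_add M.MC_mult M.MC_coord M.MC_numeral B)
    fix x :: "nat \<Rightarrow> complex" and u v assume c: "crit_E WF_E7 x u v"
    have "u * v\<^sup>2 - ((- x 4) * v\<^sup>2 + (- (2 * x 3) / 3) * v + (- x 2 / 3) * 1 + (- (2 * x 6) / 3) * (u * v) + (- x 5 / 3) * u) = (x 2 + 2 * x 3 * v + 3 * x 4 * v\<^sup>2 + u * (x 5 + 2 * x 6 * v + 3 * v\<^sup>2)) / 3"
      by (simp add: field_simps power_expand)
    also have "\<dots> = 0" unfolding e[OF c] by simp
    finally show "u * v\<^sup>2 = (- x 4) * v\<^sup>2 + (- (2 * x 3) / 3) * v + (- x 2 / 3) * 1 + (- (2 * x 6) / 3) * (u * v) + (- x 5 / 3) * u" by (rule eq_iff_diff_eq_0[THEN iffD2])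
  qed
  have R2: "M.SP (\<lambda>x u v. v ^ 5)"
  proof (rule M.SP_cong)
    show "M.SP (\<lambda>x u v. (3 * x 4) * (u * v\<^sup>2) + (2 * x 3) * (u * v) + x 2 * u + (- (5 * x 6) / 3) * v ^ 4 + (- (4 * x 5 + 2 * x 6 * x 6) / 3) * v ^ 3 + (- (x 1 + x 5 * x 6)) * v\<^sup>2 + (- (2 * x 1 * x 6 + x 5 * x 5) / 3) * v + (- (x 1 * x 5) / 3) * 1)"
      by (intro M.SP_add M.SP_mult M.MC_divide M.MC_minus M.MC_add M.MC_mult M.MC_coord M.MC_numeral B R1)
    fix x :: "nat \<Rightarrow> complex" and u v assume c: "crit_E WF_E7 x u v"
    have "v ^ 5 - ((3 * x 4) * (u * v\<^sup>2) + (2 * x 3) * (u * v) + x 2 * u + (- (5 * x 6) / 3) * v ^ 4 + (- (4 * x 5 + 2 * x 6 * x 6) / 3) * v ^ 3 + (- (x 1 + x 5 * x 6)) * v\<^sup>2 + (- (2 * x 1 * x 6 + x 5 * x 5) / 3) * v + (- (x 1 * x 5) / 3) * 1) = (3 * u\<^sup>2 + (x 1 + x 5 * v + x 6 * v\<^sup>2 + v ^ 3)) * (x 5 + 2 * x 6 * v + 3 * v\<^sup>2) / 3 - u * (x 2 + 2 * x 3 * v + 3 * x 4 * v\<^sup>2 + u * (x 5 + 2 * x 6 * v + 3 * v\<^sup>2))"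
      by (simp add: field_simps power_expand)
    also have "\<dots> = 0" unfolding e[OF c] by simp
    finally show "v ^ 5 = (3 * x 4) * (u * v\<^sup>2) + (2 * x 3) * (u * v) + x 2 * u + (- (5 * x 6) / 3) * v ^ 4 + (- (4 * x 5 + 2 * x 6 * x 6) / 3) * v ^ 3 + (- (x 1 + x 5 * x 6)) * v\<^sup>2 + (- (2 * x 1 * x 6 + x 5 * x 5) / 3) * v + (- (x 1 * x 5) / 3) * 1" by (rule eq_iff_diff_eq_0[THEN iffD2])
  qed
  have MCv: "M.MC (\<lambda>x u v. v)"
  proof (rule M.MC_I)
    fix i :: nat assume "i < 7"
    then consider "i = 0" | "i = 1" | "i = 2" | "i = 3" | "i = 4" | "i = 5" | "i = 6" by linarith
    then show "M.SP (\<lambda>x u v. v * [1, v, v\<^sup>2, v ^ 3, v ^ 4, u, u * v] ! i)"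
    proof cases
      case 1
      show ?thesis
        by (rule M.SP_cong[OF B(2)]) (simp add: 1 eval_nat_numeral mult_ac)
    next
      case 2
      show ?thesis
        by (rule M.SP_cong[OF B(3)]) (simp add: 2 eval_nat_numeral mult_ac)
    next
      case 3
      show ?thesis
        by (rule M.SP_cong[OF B(4)]) (simp add: 3 eval_nat_numeral mult_ac)
    next
      case 4
      show ?thesis
        by (rule M.SP_cong[OF B(5)]) (simp add: 4 eval_nat_numeral mult_ac)
    next
      case 5
      show ?thesis
        by (rule M.SP_cong[OF R2]) (simp add: 5 eval_nat_numeral mult_ac)
    next
      case 6
      show ?thesis
        by (rule M.SP_cong[OF B(7)]) (simp add: 6 eval_nat_numeral mult_ac)
    next
      case 7
      show ?thesis
        by (rule M.SP_cong[OF R1]) (simp add: 7 eval_nat_numeral mult_ac)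
    qed
  qed
  have MCp: "M.MC (\<lambda>x u v. - (x 1 + x 5 * v + x 6 * v\<^sup>2 + v ^ 3) / 3)"
    by (intro M.MC_intros M.MC_divide MCv)
  have uu: "u * u = - (x 1 + x 5 * v + x 6 * v\<^sup>2 + v ^ 3) / 3" if "crit_E WF_E7 x u v" for x :: "nat \<Rightarrow> complex" and u v
    using e(1)[OF that] by (rule square_eq_of_sum_eq_0)
  \<comment> \<open>The products are read as the multiplier \<open>v^i\<close> applied to
    \<open>u\<close>, so that \<open>u v^3\<close> and \<open>u v^4\<close> require no reduction of
    their own.\<close>
  have MCu: "M.MC (\<lambda>x u v. u)"
  proof (rule M.MC_I)
    fix i :: nat assume "i < 7"
    then consider "i = 0" | "i = 1" | "i = 2" | "i = 3" | "i = 4" | "i = 5" | "i = 6" by linarith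
    then show "M.SP (\<lambda>x u v. u * [1, v, v\<^sup>2, v ^ 3, v ^ 4, u, u * v] ! i)"
    proof cases
      case 1
      show ?thesis
        by (rule M.SP_cong[OF M.SP_mult[OF M.MC_power[OF MCv, of 0] B(6)]]) (simp add: 1 eval_nat_numeral mult_ac)
    next
      case 2
      show ?thesis
        by (rule M.SP_cong[OF M.SP_mult[OF M.MC_power[OF MCv, of 1] B(6)]]) (simp add: 2 eval_nat_numeral mult_ac)
    next
      case 3
      show ?thesis
        by (rule M.SP_cong[OF M.SP_mult[OF M.MC_power[OF MCv, of 2] B(6)]]) (simp add: 3 eval_nat_numeral mult_ac)
    next
      case 4
      show ?thesis
        by (rule M.SP_cong[OF M.SP_mult[OF M.MC_power[OF MCv, of 3] B(6)]]) (simp add: 4 eval_nat_numeral mult_ac)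
    next
      case 5
      show ?thesis
        by (rule M.SP_cong[OF M.SP_mult[OF M.MC_power[OF MCv, of 4] B(6)]]) (simp add: 5 eval_nat_numeral mult_ac)
    next
      case 6
      show ?thesis
        by (rule M.SP_cong[OF M.SP_mult[OF MCp B(1)]]) (use uu in \<open>simp add: 6 eval_nat_numeral mult.assoc[symmetric]\<close>)
    next
      case 7
      show ?thesis
        by (rule M.SP_cong[OF M.SP_mult[OF MCp B(2)]]) (use uu in \<open>simp add: 7 eval_nat_numeral mult.assoc[symmetric]\<close>)
    qed
  qed
  have "\<exists>T :: real mpol poly. degree T = 7 \<and> coeff T 7 = 1 \<and> (\<forall>i. coeff T i \<in> mpolys 7) \<and>
    (\<forall>x z. cpev (x(0 := z)) T = cpev x T) \<and> (\<forall>x u v. crit_E WF_E7 x u v \<longrightarrow> poly (cpev x T) (2 * u ^ 3 - (x 2 * v + x 3 * v\<^sup>2 + x 4 * v ^ 3)) = 0)"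
    by (rule M.integral_equation[where m = "\<lambda>x u v. 2 * u ^ 3 - (x 2 * v + x 3 * v\<^sup>2 + x 4 * v ^ 3)"])
      (intro M.MC_intros MCu MCv | simp add: crit_E7)+
  moreover have "crit_E WF_E7 x u v \<and> x 0 = 2 * u ^ 3 - (x 2 * v + x 3 * v\<^sup>2 + x 4 * v ^ 3)" if "sing_E WF_E7 x u v" for x :: "nat \<Rightarrow> complex" and u v
    using that unfolding sing_E_def poly_QE7 by (simp add: eq_diff_eq)
  ultimately show ?thesis by metis
qed

lemma degree_A_E7: "degree (poly_A WF_E7) = 7" "coeff (poly_A WF_E7) 7 = Const 9"
proof -
  have A: "poly_A WF_E7 = 3 * (pderiv (poly_Q WF_E7))\<^sup>2 + (pderiv (poly_P WF_E7))\<^sup>2 * poly_P WF_E7" by simp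
  have d: "degree (poly_Q WF_E7) \<le> 2 + 1" "degree (poly_P WF_E7) \<le> 3" by simp_all
  have dd: "degree (pderiv (poly_Q WF_E7)) \<le> 2" "degree (pderiv (poly_P WF_E7)) \<le> 2"
    using d unfolding degree_pderiv by linarith+
  have top: "coeff (pderiv (poly_P WF_E7)) 2 = 3" "coeff (poly_P WF_E7) 3 = 1" by (simp_all add: coeff_pderiv eval_nat_numeral)
  show "degree (poly_A WF_E7) = 7"
    unfolding A by (rule degree_square_sum(1)[where l = 9 and n = 7, OF dd d(2)]; simp del: poly_P.simps poly_Q.simps add: top flip: numeral_eq_Const)
  show "coeff (poly_A WF_E7) 7 = Const 9"
    unfolding A by (rule degree_square_sum(2)[where l = 9 and n = 7, OF dd d(2)]; simp del: poly_P.simps poly_Q.simps add: top flip: numeral_eq_Const)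
qed

subsection \<open>Type E8\<close>

lemma poly_PE8: "poly (PE WF_E8 x) v = x 1 + x 5 * v + x 6 * v\<^sup>2 + x 7 * v ^ 3" "poly (pderiv (PE WF_E8 x)) v = x 5 + 2 * x 6 * v + 3 * x 7 * v\<^sup>2"
  and poly_QE8: "poly (QE WF_E8 x) v = x 0 + (x 2 * v + x 3 * v\<^sup>2 + x 4 * v ^ 3 + v ^ 5)" "poly (pderiv (QE WF_E8 x)) v = x 2 + 2 * x 3 * v + 3 * x 4 * v\<^sup>2 + 5 * v ^ 4"
  for x :: "nat \<Rightarrow> 'a::idom"
  by (simp_all add: pderiv_pCons algebra_simps power_expand)

lemma sing_E8:
  "sing_E WF_E8 x u v \<longleftrightarrow> x 1 = - 3 * u\<^sup>2 - x 5 * v - x 6 * v\<^sup>2 - x 7 * v ^ 3 \<and>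
    x 2 = - 5 * v ^ 4 - 2 * x 3 * v - 3 * x 4 * v\<^sup>2 - u * (3 * x 7 * v\<^sup>2 + 2 * x 6 * v + x 5) \<and>
    x 0 = 2 * u ^ 3 + 4 * v ^ 5 + x 3 * v\<^sup>2 + 2 * x 4 * v ^ 3 + u * v * (3 * x 7 * v\<^sup>2 + 2 * x 6 * v + x 5)"
  for x :: "nat \<Rightarrow> 'a::idom"
proof -
  have 1: "x 1 + x 5 * v + x 6 * v\<^sup>2 + x 7 * v ^ 3 = - 3 * u\<^sup>2 \<longleftrightarrow> x 1 = - 3 * u\<^sup>2 - x 5 * v - x 6 * v\<^sup>2 - x 7 * v ^ 3"
    by (rule diff_eq_diff_eq) (simp add: algebra_simps)
  have 2: "x 2 + 2 * x 3 * v + 3 * x 4 * v\<^sup>2 + 5 * v ^ 4 = - u * (x 5 + 2 * x 6 * v + 3 * x 7 * v\<^sup>2) \<longleftrightarrow> x 2 = - 5 * v ^ 4 - 2 * x 3 * v - 3 * x 4 * v\<^sup>2 - u * (3 * x 7 * v\<^sup>2 + 2 * x 6 * v + x 5)"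
    by (rule diff_eq_diff_eq) (simp add: algebra_simps)
  have 3: "x 0 + (x 2 * v + x 3 * v\<^sup>2 + x 4 * v ^ 3 + v ^ 5) = 2 * u ^ 3 \<longleftrightarrow> x 0 = 2 * u ^ 3 + 4 * v ^ 5 + x 3 * v\<^sup>2 + 2 * x 4 * v ^ 3 + u * v * (3 * x 7 * v\<^sup>2 + 2 * x 6 * v + x 5)" if "x 2 = - 5 * v ^ 4 - 2 * x 3 * v - 3 * x 4 * v\<^sup>2 - u * (3 * x 7 * v\<^sup>2 + 2 * x 6 * v + x 5)"
    by (rule diff_eq_diff_eq) (subst that, simp add: algebra_simps power_expand)
  show ?thesis unfolding sing_E_def crit_E_def poly_PE8 poly_QE8 using 1 2 3 by blast
qed

lemma map_E8_image_iff:
  fixes x :: "nat \<Rightarrow> 'a::idom"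
  assumes x: "x \<in> coord_space 8"
  shows "x \<in> std_map WF_E8 ` coord_space (8 - 1) \<longleftrightarrow> (\<exists>u v. sing_E WF_E8 x u v)"
proof
  assume "x \<in> std_map WF_E8 ` coord_space (8 - 1)"
  then obtain y where y: "x = map_E8 y" by auto
  have "sing_E WF_E8 x (y 0) (y 1)"
    unfolding sing_E8 y by (simp add: map_E8_def Let_def target_def)
  then show "\<exists>u v. sing_E WF_E8 x u v" by blast
next
  assume "\<exists>u v. sing_E WF_E8 x u v"
  then obtain u v where s: "x 1 = - 3 * u\<^sup>2 - x 5 * v - x 6 * v\<^sup>2 - x 7 * v ^ 3" "x 2 = - 5 * v ^ 4 - 2 * x 3 * v - 3 * x 4 * v\<^sup>2 - u * (3 * x 7 * v\<^sup>2 + 2 * x 6 * v + x 5)" "x 0 = 2 * u ^ 3 + 4 * v ^ 5 + x 3 * v\<^sup>2 + 2 * x 4 * v ^ 3 + u * v * (3 * x 7 * v\<^sup>2 + 2 * x 6 * v + x 5)"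
    unfolding sing_E8 by blast
  define y where "y i = (if i = 0 then u else if i = 1 then v else if i < 7 then x (i + 1) else 0)" for i
  have y: "y 0 = u" "y 1 = v" "y 2 = x 3" "y 3 = x 4" "y 4 = x 5" "y 5 = x 6" "y 6 = x 7" by (simp_all add: y_def eval_nat_numeral)
  have "map_E8 y i = x i" for i
  proof -
    have m: "map_E8 y i = (if i = 0 then x 0 else if i = 1 then x 1 else if i \<ge> 8 then 0 else if i = 2 then x 2 else y (i - 1))"
      unfolding s by (simp add: map_E8_def Let_def target_def y[simplified])
    have "y (i - 1) = x i" if "i \<noteq> 0" "i \<noteq> 1" "i \<noteq> 2" "\<not> i \<ge> 8"
    proof -
      have "3 \<le> i" using that by linarith
      then obtain j where "i = 3 + j" using le_Suc_ex by blast
      then show ?thesis using that by (simp add: y_def eval_nat_numeral)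
    qed
    then show ?thesis unfolding m using x by (simp add: coord_space_def)
  qed
  then have "map_E8 y = x" by blast
  moreover have "y \<in> coord_space (8 - 1)" by (auto simp: y_def coord_space_def)
  ultimately show "x \<in> std_map WF_E8 ` coord_space (8 - 1)" by auto
qed

lemma crit_E8: "crit_E WF_E8 x u v \<longleftrightarrow> 3 * u\<^sup>2 + (x 1 + x 5 * v + x 6 * v\<^sup>2 + x 7 * v ^ 3) = 0 \<and> x 2 + 2 * x 3 * v + 3 * x 4 * v\<^sup>2 + 5 * v ^ 4 + u * (x 5 + 2 * x 6 * v + 3 * x 7 * v\<^sup>2) = 0"
  for x :: "nat \<Rightarrow> complex"
proof -
  have "x 1 + x 5 * v + x 6 * v\<^sup>2 + x 7 * v ^ 3 = - 3 * u\<^sup>2 \<longleftrightarrow> 3 * u\<^sup>2 + (x 1 + x 5 * v + x 6 * v\<^sup>2 + x 7 * v ^ 3) = 0"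
    by (rule diff_eq_diff_eq) (simp add: algebra_simps)
  moreover have "x 2 + 2 * x 3 * v + 3 * x 4 * v\<^sup>2 + 5 * v ^ 4 = - u * (x 5 + 2 * x 6 * v + 3 * x 7 * v\<^sup>2) \<longleftrightarrow> x 2 + 2 * x 3 * v + 3 * x 4 * v\<^sup>2 + 5 * v ^ 4 + u * (x 5 + 2 * x 6 * v + 3 * x 7 * v\<^sup>2) = 0"
    by (rule diff_eq_diff_eq) (simp add: algebra_simps)
  ultimately show ?thesis unfolding crit_E_def poly_PE8 poly_QE8 by blast
qed

text \<open>The monomial basis of the local algebra of \<open>u^3 + v^5\<close>. \<open>v^4\<close>
  reduces by the second critical equation and \<open>u^2\<close> by the first; \<open>v^5\<close> is
  treated separately because the reduction of \<open>u v^4\<close> produces it.\<close>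

lemma integral_E8:
  "\<exists>T :: real mpol poly. degree T = 8 \<and> coeff T 8 = 1 \<and> (\<forall>i. coeff T i \<in> mpolys 8) \<and>
    (\<forall>x z. cpev (x(0 := z)) T = cpev x T) \<and> (\<forall>x u v. sing_E WF_E8 x u v \<longrightarrow> poly (cpev x T) (x 0) = 0)"
proof -
  interpret M: module_span 8 "crit_E WF_E8" "\<lambda>j u v. [1, v, v\<^sup>2, v ^ 3, u, u * v, u * v\<^sup>2, u * v ^ 3] ! j" .
  have e: "3 * u\<^sup>2 + (x 1 + x 5 * v + x 6 * v\<^sup>2 + x 7 * v ^ 3) = 0" "x 2 + 2 * x 3 * v + 3 * x 4 * v\<^sup>2 + 5 * v ^ 4 + u * (x 5 + 2 * x 6 * v + 3 * x 7 * v\<^sup>2) = 0" if "crit_E WF_E8 x u v" for x :: "nat \<Rightarrow> complex" and u v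
    using that unfolding crit_E8 by auto
  have B: "M.SP (\<lambda>x u v. 1)" "M.SP (\<lambda>x u v. v)" "M.SP (\<lambda>x u v. v\<^sup>2)" "M.SP (\<lambda>x u v. v ^ 3)" "M.SP (\<lambda>x u v. u)" "M.SP (\<lambda>x u v. u * v)" "M.SP (\<lambda>x u v. u * v\<^sup>2)" "M.SP (\<lambda>x u v. u * v ^ 3)"
    using M.SP_basis[of 0] M.SP_basis[of 1] M.SP_basis[of 2] M.SP_basis[of 3] M.SP_basis[of 4] M.SP_basis[of 5] M.SP_basis[of 6] M.SP_basis[of 7] by (simp_all add: eval_nat_numeral)
  have R1: "M.SP (\<lambda>x u v. v ^ 4)"
  proof (rule M.SP_cong)
    show "M.SP (\<lambda>x u v. (- (3 * x 4) / 5) * v\<^sup>2 + (- (2 * x 3) / 5) * v + (- x 2 / 5) * 1 + (- (3 * x 7) / 5) * (u * v\<^sup>2) + (- (2 * x 6) / 5) * (u * v) + (- x 5 / 5) * u)"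
      by (intro M.SP_add M.SP_mult M.MC_divide M.MC_minus M.MC_add M.MC_mult M.MC_coord M.MC_numeral B)
    fix x :: "nat \<Rightarrow> complex" and u v assume c: "crit_E WF_E8 x u v"
    have "v ^ 4 - ((- (3 * x 4) / 5) * v\<^sup>2 + (- (2 * x 3) / 5) * v + (- x 2 / 5) * 1 + (- (3 * x 7) / 5) * (u * v\<^sup>2) + (- (2 * x 6) / 5) * (u * v) + (- x 5 / 5) * u) = (x 2 + 2 * x 3 * v + 3 * x 4 * v\<^sup>2 + 5 * v ^ 4 + u * (x 5 + 2 * x 6 * v + 3 * x 7 * v\<^sup>2)) / 5"
      by (simp add: field_simps power_expand)
    also have "\<dots> = 0" unfolding e[OF c] by simp
    finally show "v ^ 4 = (- (3 * x 4) / 5) * v\<^sup>2 + (- (2 * x 3) / 5) * v + (- x 2 / 5) * 1 + (- (3 * x 7) / 5) * (u * v\<^sup>2) + (- (2 * x 6) / 5) * (u * v) + (- x 5 / 5) * u" by (rule eq_iff_diff_eq_0[THEN iffD2])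
  qed
  have R2: "M.SP (\<lambda>x u v. v ^ 5)"
  proof (rule M.SP_cong)
    show "M.SP (\<lambda>x u v. (- (3 * x 4) / 5) * v ^ 3 + (- (2 * x 3) / 5) * v\<^sup>2 + (- x 2 / 5) * v + (- (3 * x 7) / 5) * (u * v ^ 3) + (- (2 * x 6) / 5) * (u * v\<^sup>2) + (- x 5 / 5) * (u * v))"
      by (intro M.SP_add M.SP_mult M.MC_divide M.MC_minus M.MC_add M.MC_mult M.MC_coord M.MC_numeral B R1)
    fix x :: "nat \<Rightarrow> complex" and u v assume c: "crit_E WF_E8 x u v"
    have "v ^ 5 - ((- (3 * x 4) / 5) * v ^ 3 + (- (2 * x 3) / 5) * v\<^sup>2 + (- x 2 / 5) * v + (- (3 * x 7) / 5) * (u * v ^ 3) + (- (2 * x 6) / 5) * (u * v\<^sup>2) + (- x 5 / 5) * (u * v)) = v * (x 2 + 2 * x 3 * v + 3 * x 4 * v\<^sup>2 + 5 * v ^ 4 + u * (x 5 + 2 * x 6 * v + 3 * x 7 * v\<^sup>2)) / 5"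
      by (simp add: field_simps power_expand)
    also have "\<dots> = 0" unfolding e[OF c] by simp
    finally show "v ^ 5 = (- (3 * x 4) / 5) * v ^ 3 + (- (2 * x 3) / 5) * v\<^sup>2 + (- x 2 / 5) * v + (- (3 * x 7) / 5) * (u * v ^ 3) + (- (2 * x 6) / 5) * (u * v\<^sup>2) + (- x 5 / 5) * (u * v)" by (rule eq_iff_diff_eq_0[THEN iffD2])
  qed
  have R3: "M.SP (\<lambda>x u v. u * v ^ 4)"
  proof (rule M.SP_cong)
    show "M.SP (\<lambda>x u v. (- (3 * x 4) / 5) * (u * v\<^sup>2) + (- (2 * x 3) / 5) * (u * v) + (- x 2 / 5) * u + (3 * x 7 * x 7 / 15) * v ^ 5 + (5 * x 6 * x 7 / 15) * v ^ 4 + ((4 * x 5 * x 7 + 2 * x 6 * x 6) / 15) * v ^ 3 + ((3 * x 5 * x 6 + 3 * x 1 * x 7) / 15) * v\<^sup>2 + ((x 5 * x 5 + 2 * x 1 * x 6) / 15) * v + (x 1 * x 5 / 15) * 1)"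
      by (intro M.SP_add M.SP_mult M.MC_divide M.MC_minus M.MC_add M.MC_mult M.MC_coord M.MC_numeral B R1 R2)
    fix x :: "nat \<Rightarrow> complex" and u v assume c: "crit_E WF_E8 x u v"
    \<comment> \<open>As for E6: the term \<open>u^2 P' / 5\<close> is removed by
      \<open>P' / 15\<close> times the first equation.\<close>
    have "u * v ^ 4 - ((- (3 * x 4) / 5) * (u * v\<^sup>2) + (- (2 * x 3) / 5) * (u * v) + (- x 2 / 5) * u + (3 * x 7 * x 7 / 15) * v ^ 5 + (5 * x 6 * x 7 / 15) * v ^ 4 + ((4 * x 5 * x 7 + 2 * x 6 * x 6) / 15) * v ^ 3 + ((3 * x 5 * x 6 + 3 * x 1 * x 7) / 15) * v\<^sup>2 + ((x 5 * x 5 + 2 * x 1 * x 6) / 15) * v + (x 1 * x 5 / 15) * 1) = u * (x 2 + 2 * x 3 * v + 3 * x 4 * v\<^sup>2 + 5 * v ^ 4 + u * (x 5 + 2 * x 6 * v + 3 * x 7 * v\<^sup>2)) / 5 - (3 * u\<^sup>2 + (x 1 + x 5 * v + x 6 * v\<^sup>2 + x 7 * v ^ 3)) * (x 5 + 2 * x 6 * v + 3 * x 7 * v\<^sup>2) / 15"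
      by (simp add: field_simps power_expand)
    also have "\<dots> = 0" unfolding e[OF c] by simp
    finally show "u * v ^ 4 = (- (3 * x 4) / 5) * (u * v\<^sup>2) + (- (2 * x 3) / 5) * (u * v) + (- x 2 / 5) * u + (3 * x 7 * x 7 / 15) * v ^ 5 + (5 * x 6 * x 7 / 15) * v ^ 4 + ((4 * x 5 * x 7 + 2 * x 6 * x 6) / 15) * v ^ 3 + ((3 * x 5 * x 6 + 3 * x 1 * x 7) / 15) * v\<^sup>2 + ((x 5 * x 5 + 2 * x 1 * x 6) / 15) * v + (x 1 * x 5 / 15) * 1" by (rule eq_iff_diff_eq_0[THEN iffD2])
  qed
  have MCv: "M.MC (\<lambda>x u v. v)"
  proof (rule M.MC_I)
    fix i :: nat assume "i < 8"
    then consider "i = 0" | "i = 1" | "i = 2" | "i = 3" | "i = 4" | "i = 5" | "i = 6" | "i = 7" by linarith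
    then show "M.SP (\<lambda>x u v. v * [1, v, v\<^sup>2, v ^ 3, u, u * v, u * v\<^sup>2, u * v ^ 3] ! i)"
    proof cases
      case 1
      show ?thesis
        by (rule M.SP_cong[OF B(2)]) (simp add: 1 eval_nat_numeral mult_ac)
    next
      case 2
      show ?thesis
        by (rule M.SP_cong[OF B(3)]) (simp add: 2 eval_nat_numeral mult_ac)
    next
      case 3
      show ?thesis
        by (rule M.SP_cong[OF B(4)]) (simp add: 3 eval_nat_numeral mult_ac)
    next
      case 4
      show ?thesis
        by (rule M.SP_cong[OF R1]) (simp add: 4 eval_nat_numeral mult_ac)
    next
      case 5
      show ?thesis
        by (rule M.SP_cong[OF B(6)]) (simp add: 5 eval_nat_numeral mult_ac)
    next
      case 6
      show ?thesis
        by (rule M.SP_cong[OF B(7)]) (simp add: 6 eval_nat_numeral mult_ac)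
    next
      case 7
      show ?thesis
        by (rule M.SP_cong[OF B(8)]) (simp add: 7 eval_nat_numeral mult_ac)
    next
      case 8
      show ?thesis
        by (rule M.SP_cong[OF R3]) (simp add: 8 eval_nat_numeral mult_ac)
    qed
  qed
  have MCp: "M.MC (\<lambda>x u v. - (x 1 + x 5 * v + x 6 * v\<^sup>2 + x 7 * v ^ 3) / 3)"
    by (intro M.MC_intros M.MC_divide MCv)
  have uu: "u * u = - (x 1 + x 5 * v + x 6 * v\<^sup>2 + x 7 * v ^ 3) / 3" if "crit_E WF_E8 x u v" for x :: "nat \<Rightarrow> complex" and u v
    using e(1)[OF that] by (rule square_eq_of_sum_eq_0)
  have MCu: "M.MC (\<lambda>x u v. u)"
  proof (rule M.MC_I)
    fix i :: nat assume "i < 8"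
    then consider "i = 0" | "i = 1" | "i = 2" | "i = 3" | "i = 4" | "i = 5" | "i = 6" | "i = 7" by linarith
    then show "M.SP (\<lambda>x u v. u * [1, v, v\<^sup>2, v ^ 3, u, u * v, u * v\<^sup>2, u * v ^ 3] ! i)"
    proof cases
      case 1
      show ?thesis
        by (rule M.SP_cong[OF B(5)]) (simp add: 1 eval_nat_numeral mult_ac)
    next
      case 2
      show ?thesis
        by (rule M.SP_cong[OF B(6)]) (simp add: 2 eval_nat_numeral mult_ac)
    next
      case 3
      show ?thesis
        by (rule M.SP_cong[OF B(7)]) (simp add: 3 eval_nat_numeral mult_ac)
    next
      case 4
      show ?thesis
        by (rule M.SP_cong[OF B(8)]) (simp add: 4 eval_nat_numeral mult_ac)
    next
      case 5
      show ?thesis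
        by (rule M.SP_cong[OF M.SP_mult[OF MCp B(1)]]) (use uu in \<open>simp add: 5 eval_nat_numeral mult.assoc[symmetric]\<close>)
    next
      case 6
      show ?thesis
        by (rule M.SP_cong[OF M.SP_mult[OF MCp B(2)]]) (use uu in \<open>simp add: 6 eval_nat_numeral mult.assoc[symmetric]\<close>)
    next
      case 7
      show ?thesis
        by (rule M.SP_cong[OF M.SP_mult[OF MCp B(3)]]) (use uu in \<open>simp add: 7 eval_nat_numeral mult.assoc[symmetric]\<close>)
    next
      case 8
      show ?thesis
        by (rule M.SP_cong[OF M.SP_mult[OF MCp B(4)]]) (use uu in \<open>simp add: 8 eval_nat_numeral mult.assoc[symmetric]\<close>)
    qed
  qed
  have "\<exists>T :: real mpol poly. degree T = 8 \<and> coeff T 8 = 1 \<and> (\<forall>i. coeff T i \<in> mpolys 8) \<and>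
    (\<forall>x z. cpev (x(0 := z)) T = cpev x T) \<and> (\<forall>x u v. crit_E WF_E8 x u v \<longrightarrow> poly (cpev x T) (2 * u ^ 3 - (x 2 * v + x 3 * v\<^sup>2 + x 4 * v ^ 3 + v ^ 5)) = 0)"
    by (rule M.integral_equation[where m = "\<lambda>x u v. 2 * u ^ 3 - (x 2 * v + x 3 * v\<^sup>2 + x 4 * v ^ 3 + v ^ 5)"])
      (intro M.MC_intros MCu MCv | simp add: crit_E8)+
  moreover have "crit_E WF_E8 x u v \<and> x 0 = 2 * u ^ 3 - (x 2 * v + x 3 * v\<^sup>2 + x 4 * v ^ 3 + v ^ 5)" if "sing_E WF_E8 x u v" for x :: "nat \<Rightarrow> complex" and u v
    using that unfolding sing_E_def poly_QE8 by (simp add: eq_diff_eq)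
  ultimately show ?thesis by metis
qed

lemma degree_A_E8: "degree (poly_A WF_E8) = 8" "coeff (poly_A WF_E8) 8 = Const 75"
proof -
  have A: "poly_A WF_E8 = 3 * (pderiv (poly_Q WF_E8))\<^sup>2 + (pderiv (poly_P WF_E8))\<^sup>2 * poly_P WF_E8" by simp
  have d: "degree (poly_Q WF_E8) \<le> 4 + 1" "degree (poly_P WF_E8) \<le> 3" by simp_all
  have dd: "degree (pderiv (poly_Q WF_E8)) \<le> 4" "degree (pderiv (poly_P WF_E8)) \<le> 2"
    using d unfolding degree_pderiv by linarith+
  have top: "coeff (pderiv (poly_Q WF_E8)) 4 = 5" "coeff (poly_P WF_E7) 3 = 1" by (simp_all add: coeff_pderiv eval_nat_numeral)
  show "degree (poly_A WF_E8) = 8"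
    unfolding A by (rule degree_square_sum(1)[where l = 75 and n = 8, OF dd d(2)]; simp del: poly_P.simps poly_Q.simps add: top flip: numeral_eq_Const)
  show "coeff (poly_A WF_E8) 8 = Const 75"
    unfolding A by (rule degree_square_sum(2)[where l = 75 and n = 8, OF dd d(2)]; simp del: poly_P.simps poly_Q.simps add: top flip: numeral_eq_Const)
qed

subsection \<open>The exceptional types\<close>

lemma coeff_mult_mpolys:
  fixes f g :: "real mpol poly"
  assumes "\<And>i. coeff f i \<in> mpolys n" "\<And>i. coeff g i \<in> mpolys n"
  shows "coeff (f * g) i \<in> mpolys n"
  unfolding coeff_mult using assms by (intro mpolys_sum mpolys_mult)

lemma coeff_pderiv_mpolys:
  fixes f :: "real mpol poly"
  shows "(\<And>i. coeff f i \<in> mpolys n) \<Longrightarrow> coeff (pderiv f) i \<in> mpolys n"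
  unfolding coeff_pderiv by (intro mpolys_mult mpolys_of_nat)

lemma coeff_numeral_mpolys: "coeff (numeral w :: real mpol poly) i \<in> mpolys n"
  unfolding numeral_poly by (auto simp: coeff_pCons mpolys_numeral split: nat.split)

lemma coeff_E_mpolys:
  assumes "\<tau> \<in> {WF_E6, WF_E7, WF_E8}"
  shows "coeff (poly_A \<tau>) i \<in> mpolys (wf_dim \<tau>)" "coeff (poly_B \<tau>) i \<in> mpolys (wf_dim \<tau>)"
proof -
  have A: "poly_A \<tau> = 3 * (pderiv (poly_Q \<tau>) * pderiv (poly_Q \<tau>)) + pderiv (poly_P \<tau>) * pderiv (poly_P \<tau>) * poly_P \<tau>"
    and B: "poly_B \<tau> = 2 * pderiv (poly_Q \<tau>) * poly_P \<tau> - 3 * pderiv (poly_P \<tau>) * poly_Q \<tau>"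
    using assms by (auto simp: power2_eq_square)
  have P: "coeff (poly_P \<tau>) i \<in> mpolys (wf_dim \<tau>)" and Q: "coeff (poly_Q \<tau>) i \<in> mpolys (wf_dim \<tau>)" for i
    using assms by (auto simp: coeff_pCons split: nat.split)
  show "coeff (poly_A \<tau>) i \<in> mpolys (wf_dim \<tau>)" "coeff (poly_B \<tau>) i \<in> mpolys (wf_dim \<tau>)"
    unfolding A B coeff_add coeff_diff
    by (intro mpolys_add mpolys_diff coeff_mult_mpolys coeff_pderiv_mpolys coeff_numeral_mpolys P Q)+
qed

text \<open>At a zero \<open>w\<close> of \<open>P'\<close> the polynomial \<open>A\<close> reduces
  to \<open>3 Q'(w)^2\<close>. Exchanging the roots of \<open>A\<close> with those of
  \<open>P'\<close> thus turns the product of the values of \<open>P'\<close> into a square up to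
  constants and powers of \<open>c\<close>; this is why \<open>r\<close> enters squared.\<close>

lemma prod_pderiv_PE:
  assumes "\<tau> \<in> {WF_E6, WF_E7, WF_E8}" "length as = k"
    and "cpev x (poly_A \<tau>) = Polynomial.smult l (\<Prod>a\<leftarrow>as. [:-a, 1:])" "l \<noteq> 0"
    and p: "pderiv (PE \<tau> x) = Polynomial.smult c (\<Prod>w\<leftarrow>ws. [:-w, 1:])" "c \<noteq> 0"
  shows "l ^ length ws * (\<Prod>a\<leftarrow>as. poly (pderiv (PE \<tau> x)) a) =
    (-1) ^ (k * length ws) * c ^ k * (\<Prod>w\<leftarrow>ws. 3 * (poly (pderiv (QE \<tau> x)) w)\<^sup>2)"
proof -
  have "poly (cpev x (poly_A \<tau>)) w = 3 * (poly (pderiv (QE \<tau> x)) w)\<^sup>2" if "w \<in> set ws" for w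
  proof -
    have "poly (pderiv (PE \<tau> x)) w = 0"
      using that unfolding p(1) by (induction ws) auto
    then show ?thesis unfolding cpev_poly_A_E[OF assms(1)] by simp
  qed
  then have "map (poly (cpev x (poly_A \<tau>))) ws = map (\<lambda>w. 3 * (poly (pderiv (QE \<tau> x)) w)\<^sup>2) ws"
    by simp
  then have "(\<Prod>w\<leftarrow>ws. poly (cpev x (poly_A \<tau>)) w) = (\<Prod>w\<leftarrow>ws. 3 * (poly (pderiv (QE \<tau> x)) w)\<^sup>2)"
    by (rule arg_cong)
  then show ?thesis using prod_poly_swap[OF assms(3,4) p] unfolding assms(2) by (simp only:)
qed

lemma quadratic_roots:
  fixes p :: "complex poly"
  assumes "degree p = 2"
  obtains w1 w2 where "p = Polynomial.smult (lead_coeff p) (\<Prod>w\<leftarrow>[w1, w2]. [:-w, 1:])"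
proof -
  obtain as where "length as = 2" "p = Polynomial.smult (lead_coeff p) (\<Prod>a\<leftarrow>as. [:-a, 1:])"
    using complex_poly_roots[of p] assms by auto
  moreover from this(1) obtain w1 w2 where "as = [w1, w2]"
    by (auto simp: numeral_eq_Suc length_Suc_conv)
  ultimately show ?thesis using that by blast
qed

lemma quotient_degrees:
  fixes P Q C D :: "real poly"
  assumes "P + 3 * [:s, t:]\<^sup>2 = [:q, p, 1:] * C" "[:s, t:] ^ 3 + P * [:s, t:] + Q = [:q, p, 1:]\<^sup>2 * D"
    and "degree P \<le> 2 + m" "m \<le> 1" "degree Q \<le> 4 + n"
  shows "degree C \<le> m" "degree D \<le> n"
proof -
  have "degree ([:q, p, 1:] * C) \<le> 2 + m"
    unfolding assms(1)[symmetric] by (rule degree_P_le) (use assms in auto)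
  then show "degree C \<le> m" by (rule degree_le_of_mult_monic) auto
  have "degree ([:q, p, 1:]\<^sup>2 * D) \<le> 4 + n"
    unfolding assms(2)[symmetric] by (rule degree_F_le) (use assms in auto)
  then show "degree D \<le> n" by (rule degree_le_of_mult_monic) (auto simp: degree_power_eq)
qed

text \<open>A zero \<open>u\<close> of \<open>u\<^sup>5 N - 1\<close> or \<open>u\<^sup>7 N + 1\<close> is recovered from its cube.\<close>

lemma cube_inverse_5:
  fixes t N :: complex
  assumes "t ^ 5 * N ^ 3 = 1"
  shows "(N * t\<^sup>2) ^ 5 * N = 1" "(N * t\<^sup>2) ^ 3 = t"
proof -
  have "(N * t\<^sup>2) ^ 5 * N = (t ^ 5 * N ^ 3) ^ 2" "(N * t\<^sup>2) ^ 3 = (t ^ 5 * N ^ 3) * t"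
    using power_Suc2[of N 5] power_Suc2[of t 5] by (simp_all add: power_mult_distrib mult_ac flip: power_mult)
  then show "(N * t\<^sup>2) ^ 5 * N = 1" "(N * t\<^sup>2) ^ 3 = t" using assms by simp_all
qed

lemma cube_inverse_7:
  fixes t N :: complex
  assumes "t ^ 7 * N ^ 3 = -1"
  shows "(N\<^sup>2 * t ^ 5) ^ 7 * N = -1" "(N\<^sup>2 * t ^ 5) ^ 3 = t"
proof -
  have "(N\<^sup>2 * t ^ 5) ^ 7 * N = (t ^ 7 * N ^ 3) ^ 5" "(N\<^sup>2 * t ^ 5) ^ 3 = (t ^ 7 * N ^ 3) ^ 2 * t"
    using power_Suc2[of N 14] power_Suc2[of t 14] by (simp_all add: power_mult_distrib mult_ac flip: power_mult)
  then show "(N\<^sup>2 * t ^ 5) ^ 7 * N = -1" "(N\<^sup>2 * t ^ 5) ^ 3 = t" using assms by simp_all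
qed

lemma card_insert_0_nth_roots:
  fixes c :: complex
  assumes "c \<noteq> 0" "n > 0"
  shows "finite (insert 0 {z. z ^ n = c})" "card (insert 0 {z. z ^ n = c}) = Suc n"
proof -
  have f: "finite {z. z ^ n = c}" using assms finite_nth_roots by blast
  then show "finite (insert 0 {z. z ^ n = c})" by simp
  show "card (insert 0 {z. z ^ n = c}) = Suc n"
    using f assms card_nth_roots[of c n] by (subst card_insert_disjoint) auto
qed

lemma X_nonzero: "(X i :: real mpol) \<noteq> 0"
proof
  assume "(X i :: real mpol) = 0"
  then have "meval (\<lambda>_. 1) (X i :: real mpol) = 0" by simp
  then show False by simp
qed

lemma less_6_iff: "(\<forall>i<6. R i) \<longleftrightarrow> R 0 \<and> R 1 \<and> R 2 \<and> R 3 \<and> R 4 \<and> R (5 :: nat)"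
  by (simp add: eval_nat_numeral All_less_Suc conj_ac)

lemma less_7_iff: "(\<forall>i<7. R i) \<longleftrightarrow> R 0 \<and> R 1 \<and> R 2 \<and> R 3 \<and> R 4 \<and> R 5 \<and> R (6 :: nat)"
  by (simp add: eval_nat_numeral All_less_Suc conj_ac)

lemma less_8_iff: "(\<forall>i<8. R i) \<longleftrightarrow> R 0 \<and> R 1 \<and> R 2 \<and> R 3 \<and> R 4 \<and> R 5 \<and> R 6 \<and> R (7 :: nat)"
  by (simp add: eval_nat_numeral All_less_Suc conj_ac)

section \<open>Type E6: product formula, separable fibre and real points\<close>

lemma poly_r_E6:
  "poly_r WF_E6 \<in> mpolys 6"
  "ev x (poly_r WF_E6) = x 4 ^ 3 + 2 * x 3 * x 4 * x 5 ^ 2 - 2 * x 2 * x 5 ^ 3"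
proof -
  show "poly_r WF_E6 \<in> mpolys 6" unfolding poly_r.simps by (intro mpolys_intros) simp_all
  show "ev x (poly_r WF_E6) = x 4 ^ 3 + 2 * x 3 * x 4 * x 5 ^ 2 - 2 * x 2 * x 5 ^ 3"
    by (simp add: evh.hom_add evh.hom_minus evh.hom_mult evh.hom_power evh.hom_numeral)
qed

text \<open>\<open>P'\<close> has the single root \<open>w = - x 4 / (2 x 5)\<close>, and
  \<open>c^3 Q'(w) = - 4 r\<close> with \<open>c = 2 x 5\<close>. So 48 times the product is
  \<open>3 (4 r)^2\<close>, and the constant is 1. The condition on \<open>X 5\<close> excludes
  fibres with constant \<open>P'\<close>.\<close>

lemma prod_E6:
  assumes "ev x (X 5) \<noteq> 0" "length as = 6"
    and "cpev x (poly_A WF_E6) = Polynomial.smult (of_real 48) (\<Prod>a\<leftarrow>as. [:-a, 1:])"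
  shows "(\<Prod>a\<leftarrow>as. poly (pderiv (PE WF_E6 x)) a) = of_real 1 * (ev x (poly_r WF_E6))\<^sup>2"
proof -
  define c where "c = 2 * x 5"
  define w where "w = - (x 4 / c)"
  have c: "c \<noteq> 0" using assms(1) by (simp add: c_def)
  have x: "x 4 = - (c * w)" "2 * x 5 = c" using c by (simp_all add: w_def c_def)
  have p: "pderiv (PE WF_E6 x) = Polynomial.smult c (\<Prod>w\<leftarrow>[w]. [:-w, 1:])"
    by (simp add: pderiv_pCons x)
  have "48 * (\<Prod>a\<leftarrow>as. poly (pderiv (PE WF_E6 x)) a) = 3 * (c ^ 3 * poly (pderiv (QE WF_E6 x)) w)\<^sup>2"
    using prod_pderiv_PE[OF _ assms(2,3) _ p c] by (simp add: power_mult_distrib flip: power_mult)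
  also have "c ^ 3 * poly (pderiv (QE WF_E6 x)) w = - 4 * ev x (poly_r WF_E6)"
    unfolding poly_QE6 poly_r_E6 x(1) x(2)[symmetric] by (simp add: power_expand algebra_simps)
  finally show ?thesis by (simp add: power_mult_distrib)
qed

lemma common_E6:
  assumes "poly (pderiv (PE WF_E6 x)) v = 0" "poly (pderiv (QE WF_E6 x)) v = 0"
  shows "ev x (poly_r WF_E6) = 0"
proof -
  have "x 4 = - (2 * x 5 * v)" "x 2 = - (2 * x 3 * v + 4 * v ^ 3)"
    using assms unfolding poly_PE6 poly_QE6 add.assoc by (simp_all only: add_eq_0_iff2)
  note x = this
  show ?thesis unfolding poly_r_E6 x by (simp add: power_expand algebra_simps)
qed

lemma axis_r_E6: "ev ((\<lambda>_. 0)(4 := 1)) (poly_r WF_E6) \<noteq> 0"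
  by (simp add: poly_r_E6 del: poly_r.simps)

text \<open>With \<open>x 4 = 1\<close>, \<open>x 0 = z\<close> and the rest 0, \<open>P = v\<close>
  and \<open>Q = v^4 + z\<close>, so \<open>v = - 3 u^2\<close> and
  \<open>u (108 u^5 - 1) = 0\<close>. The level is 0 for \<open>u = 0\<close> and
  \<open>u^3 (243 u^5 - 1) = 5/4 u^3\<close> otherwise; since \<open>u^15 = 1 / 108^3\<close>, the
  nonzero levels are the fifth roots of \<open>(5/4)^5 / 108^3\<close>.\<close>

lemma axis_E6:
  fixes z :: complex
  assumes "z \<in> insert 0 {z. z ^ 5 = (5 / 4) ^ 5 / 108 ^ 3}"
  shows "\<exists>u v. sing_E WF_E6 (((\<lambda>_. 0)(4 := 1))(0 := z)) u v"
proof (cases "z = 0")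
  case True
  then show ?thesis by (intro exI[of _ 0]) (simp add: sing_E6)
next
  case False
  define t where "t = 4 * z / 5"
  define u where "u = 108 * t\<^sup>2"
  define v where "v = - (3 * u\<^sup>2)"
  have z: "z = 5 / 4 * t" by (simp add: t_def)
  have "(5 / 4) ^ 5 * t ^ 5 = (5 / 4) ^ 5 / 108 ^ 3"
    using assms False unfolding z by (simp add: power_mult_distrib power_divide)
  then have "t ^ 5 * 108 ^ 3 = 1" by (simp add: field_simps)
  from cube_inverse_5[OF this] have u: "u ^ 5 * 108 = 1" "u ^ 3 = t" unfolding u_def by blast+
  have "- 4 * v ^ 3 - u = u * (u ^ 5 * 108 - 1)" "2 * u ^ 3 + 3 * v ^ 4 + u * v = u ^ 3 * (9 / 4 * (u ^ 5 * 108) - 1)"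
    by (simp_all add: v_def power_mult_distrib algebra_simps eval_nat_numeral)
  then have "0 = - 4 * v ^ 3 - u" "z = 2 * u ^ 3 + 3 * v ^ 4 + u * v"
    unfolding u z by simp_all
  moreover have "0 = - 3 * u\<^sup>2 - v" by (simp add: v_def)
  ultimately have "sing_E WF_E6 (((\<lambda>_. 0)(4 := 1))(0 := z)) u v"
    unfolding sing_E6 by simp
  then show ?thesis by blast
qed

lemma wf_E_E6: "wf_E WF_E6 6 48 1 (X 5) ((\<lambda>_. 0)(4 := 1)) (insert 0 {z. z ^ 5 = (5 / 4) ^ 5 / 108 ^ 3})"
proof unfold_locales
  show "WF_E6 \<in> {WF_E6, WF_E7, WF_E8}" "6 = wf_dim WF_E6" "(48 :: real) \<noteq> 0" "(1 :: real) \<noteq> 0" by simp_all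
  show "degree (poly_A WF_E6) = 6" "coeff (poly_A WF_E6) 6 = Const 48" by (rule degree_A_E6)+
  show "(X 5 :: real mpol) \<noteq> 0" by (simp add: X_nonzero)
  show "\<exists>T :: real mpol poly. degree T = 6 \<and> coeff T 6 = 1 \<and> (\<forall>i. coeff T i \<in> mpolys 6) \<and>
    (\<forall>x z. cpev (x(0 := z)) T = cpev x T) \<and> (\<forall>x u v. sing_E WF_E6 x u v \<longrightarrow> poly (cpev x T) (x 0) = 0)"
    by (rule integral_E6)
  show "poly_r WF_E6 \<in> mpolys 6" by (rule poly_r_E6)
  show "ev ((\<lambda>_. 0)(4 := 1)) (poly_r WF_E6) \<noteq> 0" by (rule axis_r_E6)
  show "finite (insert 0 {z. z ^ 5 = (5 / 4) ^ 5 / 108 ^ 3} :: complex set)" "card (insert 0 {z. z ^ 5 = (5 / 4) ^ 5 / 108 ^ 3} :: complex set) = 6"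
    using card_insert_0_nth_roots[of "(5 / 4) ^ 5 / 108 ^ 3" 5] by simp_all
  fix x :: "nat \<Rightarrow> complex" and z
  show "ev (x(0 := z)) (poly_r WF_E6) = ev x (poly_r WF_E6)" by (simp add: poly_r_E6 del: poly_r.simps)
  show "\<exists>u v. sing_E WF_E6 (((\<lambda>_. 0)(4 := 1))(0 := z)) u v" if "z \<in> insert 0 {z. z ^ 5 = (5 / 4) ^ 5 / 108 ^ 3}" using that by (rule axis_E6)
  show "ev x (poly_r WF_E6) = 0" if "poly (pderiv (PE WF_E6 x)) v = 0" "poly (pderiv (QE WF_E6 x)) v = 0" for v
    using that by (rule common_E6)
  show "x \<in> std_map WF_E6 ` coord_space (6 - 1) \<longleftrightarrow> (\<exists>u v. sing_E WF_E6 x u v)" if "x \<in> coord_space 6"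
    using that by (rule map_E6_image_iff)
  show "(\<Prod>a\<leftarrow>as. poly (pderiv (PE WF_E6 x)) a) = of_real 1 * (ev x (poly_r WF_E6))\<^sup>2"
    if "ev x (X 5) \<noteq> 0" "length as = 6" "cpev x (poly_A WF_E6) = Polynomial.smult (of_real 48) (\<Prod>a\<leftarrow>as. [:-a, 1:])" for as
    using that by (rule prod_E6)
qed

text \<open>The degrees leave only a constant \<open>C = c\<close> and \<open>D = 1\<close>.
  Comparing coefficients expresses the coordinates through \<open>t\<close>, \<open>s\<close>,
  \<open>q\<close>, \<open>c\<close> and \<open>p\<close>, and the coefficient of
  \<open>v^3\<close>, absent from \<open>Q\<close>, determines \<open>p\<close>.\<close>

lemma real_quotients_E6:
  fixes x :: "nat \<Rightarrow> real"
  assumes C: "PE WF_E6 x + 3 * [:s, t:]\<^sup>2 = [:q, p, 1:] * C"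
    and D: "[:s, t:] ^ 3 + PE WF_E6 x * [:s, t:] + QE WF_E6 x = [:q, p, 1:]\<^sup>2 * D"
  shows "\<exists>c. p = (c * t - 2 * t ^ 3) / 2 \<and> x 1 = q * c - 3 * s\<^sup>2 \<and> x 4 = p * c - 6 * s * t \<and> x 5 = c - 3 * t\<^sup>2 \<and> x 0 = q\<^sup>2 - c * q * s + 2 * s ^ 3 \<and> x 2 = 2 * p * q - c * (p * s + q * t) + 6 * s\<^sup>2 * t \<and> x 3 = p\<^sup>2 + 2 * q - c * (s + p * t) + 6 * s * t\<^sup>2"
proof -
  have "degree C \<le> 0" "degree D \<le> 0" by (rule quotient_degrees[OF C D, where m = 0 and n = 0]; simp)+
  then obtain c d where cd: "C = [:c:]" "D = [:d:]"
    using poly_eq_const[of C] poly_eq_const[of D] by blast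
  have "[:x 1 + 3 * (s * s), x 4 + 6 * s * t, x 5 + 3 * (t * t):] = PE WF_E6 x + 3 * [:s, t:]\<^sup>2"
    by (rule poly_eq_poly_eq_iff[THEN iffD1], rule ext) (simp add: algebra_simps power_expand)
  also have "\<dots> = [:q * c, p * c, c:]"
    unfolding C cd by (rule poly_eq_poly_eq_iff[THEN iffD1], rule ext) (simp add: algebra_simps power_expand)
  finally have 1: "x 1 + 3 * (s * s) = q * c" "x 4 + 6 * s * t = p * c" "x 5 + 3 * (t * t) = c"
    by (simp_all only: pCons_eq_iff)
  have "[:x 0 + x 1 * s + s * s * s, x 2 + x 4 * s + x 1 * t + 3 * s * s * t, x 3 + x 5 * s + x 4 * t + 3 * s * t * t, x 5 * t + t * t * t, 1:] = [:s, t:] ^ 3 + PE WF_E6 x * [:s, t:] + QE WF_E6 x"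
    by (rule poly_eq_poly_eq_iff[THEN iffD1], rule ext) (simp add: algebra_simps power_expand)
  also have "\<dots> = [:q * q * d, 2 * p * q * d, (p * p + 2 * q) * d, 2 * p * d, d:]"
    unfolding D cd by (rule poly_eq_poly_eq_iff[THEN iffD1], rule ext) (simp add: algebra_simps power_expand)
  finally have 2: "x 0 + x 1 * s + s * s * s = q * q * d" "x 2 + x 4 * s + x 1 * t + 3 * s * s * t = 2 * p * q * d" "x 3 + x 5 * s + x 4 * t + 3 * s * t * t = (p * p + 2 * q) * d" "x 5 * t + t * t * t = 2 * p * d" "1 = d"
    by (simp_all only: pCons_eq_iff)
  have x: "x 1 = q * c - 3 * s\<^sup>2" "x 4 = p * c - 6 * s * t" "x 5 = c - 3 * t\<^sup>2"
    using 1 by (simp_all add: algebra_simps power_expand)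
  have "p = (c * t - 2 * t ^ 3) / 2" "x 0 = q\<^sup>2 - c * q * s + 2 * s ^ 3" "x 2 = 2 * p * q - c * (p * s + q * t) + 6 * s\<^sup>2 * t" "x 3 = p\<^sup>2 + 2 * q - c * (s + p * t) + 6 * s * t\<^sup>2"
    using 2(1-4)[folded 2(5)] unfolding x by (simp_all add: algebra_simps power_expand)
  then show ?thesis using x by (intro exI[of _ c]) simp
qed

text \<open>\<open>X 0\<close> to \<open>X 3\<close> stand for \<open>t\<close>, \<open>s\<close>,
  \<open>q\<close>, \<open>c\<close>, and \<open>H\<close> is the polynomial for
  \<open>p\<close>.\<close>

lemma real_image_E6:
  fixes x :: "nat \<Rightarrow> real"
  defines "H \<equiv> Const (1 / 2) * (X 3 * X 0 - 2 * X 0 ^ 3) :: real mpol"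
  assumes C: "PE WF_E6 x + 3 * [:s, t:]\<^sup>2 = [:q, p, 1:] * C"
    and D: "[:s, t:] ^ 3 + PE WF_E6 x * [:s, t:] + QE WF_E6 x = [:q, p, 1:]\<^sup>2 * D"
  shows "\<exists>y\<in>coord_space (6 - 2). \<forall>i<6. x i = meval y
    (if i = 0 then X 2 ^ 2 - X 3 * X 2 * X 1 + 2 * X 1 ^ 3 else
     if i = 1 then X 2 * X 3 - 3 * X 1 ^ 2 else
     if i = 2 then 2 * H * X 2 - X 3 * (H * X 1 + X 2 * X 0) + 6 * X 1 ^ 2 * X 0 else
     if i = 3 then H ^ 2 + 2 * X 2 - X 3 * (X 1 + H * X 0) + 6 * X 1 * X 0 ^ 2 else
     if i = 4 then H * X 3 - 6 * X 1 * X 0 else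
     X 3 - 3 * X 0 ^ 2)"
proof -
  from real_quotients_E6[OF C D] obtain c where x: "p = (c * t - 2 * t ^ 3) / 2" "x 1 = q * c - 3 * s\<^sup>2" "x 4 = p * c - 6 * s * t" "x 5 = c - 3 * t\<^sup>2" "x 0 = q\<^sup>2 - c * q * s + 2 * s ^ 3" "x 2 = 2 * p * q - c * (p * s + q * t) + 6 * s\<^sup>2 * t" "x 3 = p\<^sup>2 + 2 * q - c * (s + p * t) + 6 * s * t\<^sup>2"
    by blast
  define y where "y i = (if i = 0 then t else if i = 1 then s else if i = 2 then q else if i = 3 then c else 0)" for i :: nat
  have y: "y 0 = t" "y 1 = s" "y 2 = q" "y 3 = c" by (simp_all add: y_def)
  have H: "meval y H = p" unfolding H_def x(1)
    by (simp add: mev.hom_add mev.hom_minus mev.hom_mult mev.hom_power mev.hom_numeral y[simplified])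
  have "y \<in> coord_space (6 - 2)" by (auto simp: y_def coord_space_def)
  then show ?thesis
    by (rule bexI[rotated])
      (unfold less_6_iff, simp add: x(2-7)[simplified] y[simplified] H mev.hom_add mev.hom_minus mev.hom_mult mev.hom_power mev.hom_numeral)
qed

text \<open>\<open>u = sqrt (S v)\<close> solves the first equation, and \<open>f v\<close> is the
  value of \<open>x 2\<close> demanded by the second. The signs in the box keep \<open>S\<close>
  nonnegative on \<open>[-2, 0]\<close>; \<open>f\<close> is at least \<open>32 - 10\<close> at -2
  and at most 0 at 0, so it takes the value \<open>z 2\<close>.\<close>

lemma projection_E6:
  fixes z :: "nat \<Rightarrow> real"
  assumes "z 1 \<in> {-2..-1}" "z 4 \<in> {0..1}" "z 5 \<in> {-1..0}" "z 3 \<in> {0..1}" "z 2 \<in> {0..1}"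
  shows "\<exists>u v x0. sing_E WF_E6 (\<lambda>i. if i = 0 then x0 else if i < 6 then z i else 0) u v"
proof -
  define S where "S v = (- z 1 - z 4 * v - z 5 * v\<^sup>2) / 3" for v
  define f where "f v = - 4 * v ^ 3 - 2 * z 3 * v - sqrt (S v) * (2 * z 5 * v + z 4)" for v
  have "f 0 \<le> z 2" using assms by (auto simp: f_def S_def intro: order_trans[of _ 0])
  moreover have "z 2 \<le> f (- 2)"
  proof -
    have "sqrt (S (- 2)) \<le> 2" using assms by (intro real_le_lsqrt) (auto simp: S_def)
    moreover have "0 \<le> sqrt (S (- 2))" using assms by (auto simp: S_def)
    ultimately have "sqrt (S (- 2)) * (2 * z 5 * (- 2) + z 4) \<le> 2 * 5" using assms by (intro mult_mono) auto
    then show ?thesis using assms by (simp add: f_def)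
  qed
  moreover have "continuous_on {-2..0} f" unfolding f_def S_def by (intro continuous_intros) auto
  ultimately obtain v where v: "- 2 \<le> v" "v \<le> 0" "f v = z 2" using IVT2'[of f 0 "z 2" "-2"] by auto
  have "0 \<le> - (z 4 * v)" using assms v by (simp add: mult_nonneg_nonpos)
  moreover have "0 \<le> - (z 5 * v\<^sup>2)" using assms by (simp add: mult_nonpos_nonneg)
  ultimately have "0 \<le> S v" using assms by (simp add: S_def)
  then have "3 * (sqrt (S v))\<^sup>2 = - z 1 - z 4 * v - z 5 * v\<^sup>2" by (simp add: S_def)
  then have "sing_E WF_E6 (\<lambda>i. if i = 0 then 2 * sqrt (S v) ^ 3 + 3 * v ^ 4 + z 3 * v\<^sup>2 + sqrt (S v) * v * (2 * z 5 * v + z 4)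
      else if i < 6 then z i else 0) (sqrt (S v)) v"
    unfolding sing_E6 using v(3)[unfolded f_def] by simp
  then show ?thesis by blast
qed

lemma wf_E6_conclusion:
  "\<exists>\<Theta>\<in>mpolys 6. resultant (poly_A WF_E6) (poly_B WF_E6) = \<Theta> * (poly_r WF_E6)\<^sup>2 \<and>
    main_analytic_function 6 (\<lambda>x. meval x \<Theta>) (std_map WF_E6 ` coord_space (6 - 1)) \<and>
    (\<exists>\<Delta>. discriminant_polynomial 6 (std_map WF_E6) \<Delta>) \<and>
    (\<forall>\<Delta>. discriminant_polynomial 6 (std_map WF_E6) \<Delta> \<longrightarrow> (\<exists>c. c \<noteq> 0 \<and> complexify \<Theta> = Const c * \<Delta>))"
proof (rule wf_E.conclusion_main[OF wf_E_E6 map_E6_image_iff real_image_E6, where a = "(\<lambda>_. 0)(1 := - 2, 5 := - 1)" and b = "(\<lambda>_. 1)(1 := - 1, 5 := 0)"])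
  show "((\<lambda>_. 0)(1 := - 2, 5 := - 1)) i < (((\<lambda>_. 1)(1 := - 1, 5 := 0)) i :: real)" for i :: nat by simp
next
  fix z :: "nat \<Rightarrow> real"
  assume z: "\<And>i. i \<in> {1..<6} \<Longrightarrow> ((\<lambda>_. 0)(1 := - 2, 5 := - 1)) i \<le> z i \<and> z i \<le> ((\<lambda>_. 1)(1 := - 1, 5 := 0)) i"
  show "\<exists>u v x0. sing_E WF_E6 (\<lambda>i. if i = 0 then x0 else if i < 6 then z i else 0) u v"
    by (rule projection_E6) (use z[of 1] z[of 2] z[of 3] z[of 4] z[of 5] in simp_all)
qed

section \<open>Type E7: product formula, separable fibre and real points\<close>

lemma poly_r_E7:
  "poly_r WF_E7 \<in> mpolys 7"
  "ev x (poly_r WF_E7) = 3 * x 2 ^ 2 + (- 6 * x 4 * x 5 - 4 * x 3 * x 6 + 4 * x 4 * x 6 ^ 2) * x 2 + x 5 * (4 * x 3 ^ 2 + 3 * x 4 ^ 2 * x 5 - 4 * x 3 * x 4 * x 6)"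
proof -
  show "poly_r WF_E7 \<in> mpolys 7" unfolding poly_r.simps by (intro mpolys_intros) simp_all
  show "ev x (poly_r WF_E7) = 3 * x 2 ^ 2 + (- 6 * x 4 * x 5 - 4 * x 3 * x 6 + 4 * x 4 * x 6 ^ 2) * x 2 + x 5 * (4 * x 3 ^ 2 + 3 * x 4 ^ 2 * x 5 - 4 * x 3 * x 4 * x 6)"
    by (simp add: evh.hom_add evh.hom_minus evh.hom_mult evh.hom_power evh.hom_numeral evh.hom_uminus)
qed

text \<open>\<open>P'\<close> has leading coefficient 3 everywhere, so the generic condition is the
  constant 1. Here \<open>r = 3 Q'(w1) Q'(w2)\<close>, and 81 times the product equals
  \<open>3^7 r^2\<close>, which gives 27.\<close>

lemma prod_E7:
  assumes "ev x 1 \<noteq> 0" "length as = 7"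
    and "cpev x (poly_A WF_E7) = Polynomial.smult (of_real 9) (\<Prod>a\<leftarrow>as. [:-a, 1:])"
  shows "(\<Prod>a\<leftarrow>as. poly (pderiv (PE WF_E7 x)) a) = of_real 27 * (ev x (poly_r WF_E7))\<^sup>2"
proof -
  let ?p = "pderiv (PE WF_E7 x)" and ?q = "poly (pderiv (QE WF_E7 x))"
  have p: "?p = [:x 5, 2 * x 6, 3:]"
    by (rule poly_eq_poly_eq_iff[THEN iffD1], rule ext) (unfold poly_PE7, simp add: algebra_simps power_expand)
  then have "degree ?p = 2" "lead_coeff ?p = 3" by simp_all
  then obtain w1 w2 where w: "?p = Polynomial.smult 3 (\<Prod>w\<leftarrow>[w1, w2]. [:-w, 1:])" using quadratic_roots by metis
  have "[:x 5, 2 * x 6, 3:] = [:3 * w1 * w2, - 3 * (w1 + w2), 3:]"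
    using w unfolding p by (simp add: algebra_simps)
  then have x5: "x 5 = 3 * w1 * w2" and x6: "2 * x 6 = - 3 * (w1 + w2)" by (simp_all only: pCons_eq_iff)
  have "x 6 = 2 * x 6 / 2" by simp
  also have "\<dots> = - 3 * (w1 + w2) / 2" by (simp only: x6)
  also have "\<dots> = - 3 / 2 * (w1 + w2)" by (rule times_divide_eq_left[symmetric])
  finally have "x 6 = - 3 / 2 * (w1 + w2)" .
  note x = x5 this
  have r: "ev x (poly_r WF_E7) = 3 * (?q w1 * ?q w2)"
    unfolding poly_r_E7 poly_QE7 x by (simp add: power_expand field_simps)
  have "81 * (\<Prod>a\<leftarrow>as. poly ?p a) = 2187 * (3 * (?q w1 * ?q w2))\<^sup>2"
    using prod_pderiv_PE[OF _ assms(2,3) _ w] by (simp add: power_mult_distrib)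
  then show ?thesis unfolding r by simp
qed

lemma common_E7:
  assumes "poly (pderiv (PE WF_E7 x)) v = 0" "poly (pderiv (QE WF_E7 x)) v = 0"
  shows "ev x (poly_r WF_E7) = 0"
proof -
  have "x 5 = - (2 * x 6 * v + 3 * v\<^sup>2)" "x 2 = - (2 * x 3 * v + 3 * x 4 * v\<^sup>2)"
    using assms unfolding poly_PE7 poly_QE7 add.assoc by (simp_all only: add_eq_0_iff2)
  note x = this
  show ?thesis unfolding poly_r_E7 x by (simp add: power_expand algebra_simps)
qed

lemma axis_r_E7: "ev ((\<lambda>_. 0)(2 := 1)) (poly_r WF_E7) \<noteq> 0"
  by (simp add: poly_r_E7 del: poly_r.simps)

text \<open>With \<open>x 2 = 1\<close>, \<open>x 0 = z\<close> and the rest 0,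
  \<open>P = v^3\<close> and \<open>Q = v + z\<close>. The equations \<open>v^3 = - 3 u^2\<close>
  and \<open>3 u v^2 = - 1\<close> give \<open>3 v^7 = - 1\<close>, and the critical level is
  \<open>- 7/9 v\<close>.\<close>

lemma axis_E7:
  fixes z :: complex
  assumes "z \<in> {z. z ^ 7 = (7 / 9) ^ 7 / 3}"
  shows "\<exists>u v. sing_E WF_E7 (((\<lambda>_. 0)(2 := 1))(0 := z)) u v"
proof -
  define v where "v = - (9 / 7 * z)"
  define u where "u = - 1 / (3 * v\<^sup>2)"
  have z: "z = - (7 / 9 * v)" by (simp add: v_def)
  have "(7 / 9) ^ 7 * (- (v ^ 7)) = (7 / 9) ^ 7 / 3"
    using assms unfolding z by (simp add: power_mult_distrib power_divide)
  moreover have "3 * w = - 1" if "c * (- w) = c / 3" "c \<noteq> 0" for c w :: complex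
  proof -
    have "- w = c * (- w) / c" using that(2) by simp
    also have "\<dots> = 1 / 3" unfolding that(1) using that(2) by simp
    finally have e: "- w = 1 / 3" .
    have "3 * w = - 3 * (- w)" by simp
    also have "\<dots> = - 1" unfolding e by simp
    finally show ?thesis .
  qed
  ultimately have v7: "3 * v ^ 7 = - 1" by (metis divide_eq_0_iff power_eq_0_iff zero_neq_numeral)
  then have "v \<noteq> 0" by auto
  then have uv: "3 * (u * v\<^sup>2) = - 1" by (simp add: u_def)
  have "3 * v ^ 4 * (- 3 * u\<^sup>2 - v ^ 3) = - ((3 * (u * v\<^sup>2))\<^sup>2 + 3 * v ^ 7)"
    by (simp add: algebra_simps eval_nat_numeral)
  also have "\<dots> = 0" unfolding uv v7 by simp
  finally have e: "- 3 * u\<^sup>2 - v ^ 3 = 0" using \<open>v \<noteq> 0\<close> by simp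
  have "9 * (2 * u ^ 3 + u * v * (3 * v\<^sup>2)) = - 6 * u * (- 3 * u\<^sup>2 - v ^ 3) + 7 * v * (3 * (u * v\<^sup>2))"
    by (simp add: power_expand algebra_simps)
  also have "\<dots> = 9 * z" unfolding uv e z by simp
  finally have "2 * u ^ 3 + u * v * (3 * v\<^sup>2) = z"
    by (rule mult_left_cancel[THEN iffD1, rotated]) simp
  then have "z = 2 * u ^ 3 + u * v * (3 * v\<^sup>2)" by (rule sym)
  moreover have "0 = - 3 * u\<^sup>2 - v ^ 3" "1 = - u * (3 * v\<^sup>2)" using e uv by (simp_all add: mult_ac)
  ultimately have "sing_E WF_E7 (((\<lambda>_. 0)(2 := 1))(0 := z)) u v"
    unfolding sing_E7 by simp
  then show ?thesis by blast
qed

lemma wf_E_E7: "wf_E WF_E7 7 9 27 (1) ((\<lambda>_. 0)(2 := 1)) ({z. z ^ 7 = (7 / 9) ^ 7 / 3})"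
proof unfold_locales
  show "WF_E7 \<in> {WF_E6, WF_E7, WF_E8}" "7 = wf_dim WF_E7" "(9 :: real) \<noteq> 0" "(27 :: real) \<noteq> 0" by simp_all
  show "degree (poly_A WF_E7) = 7" "coeff (poly_A WF_E7) 7 = Const 9" by (rule degree_A_E7)+
  show "(1 :: real mpol) \<noteq> 0" by simp
  show "\<exists>T :: real mpol poly. degree T = 7 \<and> coeff T 7 = 1 \<and> (\<forall>i. coeff T i \<in> mpolys 7) \<and>
    (\<forall>x z. cpev (x(0 := z)) T = cpev x T) \<and> (\<forall>x u v. sing_E WF_E7 x u v \<longrightarrow> poly (cpev x T) (x 0) = 0)"
    by (rule integral_E7)
  show "poly_r WF_E7 \<in> mpolys 7" by (rule poly_r_E7)
  show "ev ((\<lambda>_. 0)(2 := 1)) (poly_r WF_E7) \<noteq> 0" by (rule axis_r_E7)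
  show "finite ({z. z ^ 7 = (7 / 9) ^ 7 / 3} :: complex set)" "card ({z. z ^ 7 = (7 / 9) ^ 7 / 3} :: complex set) = 7"
    using card_nth_roots[of "(7 / 9) ^ 7 / 3" 7] finite_nth_roots[of 7 "(7 / 9) ^ 7 / 3"] by simp_all
  fix x :: "nat \<Rightarrow> complex" and z
  show "ev (x(0 := z)) (poly_r WF_E7) = ev x (poly_r WF_E7)" by (simp add: poly_r_E7 del: poly_r.simps)
  show "\<exists>u v. sing_E WF_E7 (((\<lambda>_. 0)(2 := 1))(0 := z)) u v" if "z \<in> {z. z ^ 7 = (7 / 9) ^ 7 / 3}" using that by (rule axis_E7)
  show "ev x (poly_r WF_E7) = 0" if "poly (pderiv (PE WF_E7 x)) v = 0" "poly (pderiv (QE WF_E7 x)) v = 0" for v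
    using that by (rule common_E7)
  show "x \<in> std_map WF_E7 ` coord_space (7 - 1) \<longleftrightarrow> (\<exists>u v. sing_E WF_E7 x u v)" if "x \<in> coord_space 7"
    using that by (rule map_E7_image_iff)
  show "(\<Prod>a\<leftarrow>as. poly (pderiv (PE WF_E7 x)) a) = of_real 27 * (ev x (poly_r WF_E7))\<^sup>2"
    if "ev x (1) \<noteq> 0" "length as = 7" "cpev x (poly_A WF_E7) = Polynomial.smult (of_real 9) (\<Prod>a\<leftarrow>as. [:-a, 1:])" for as
    using that by (rule prod_E7)
qed

text \<open>Now \<open>C = v + c\<close>, and \<open>D\<close> is the constant \<open>t\<close>,
  since the top term of the cubic expression comes from \<open>P\<close> times the line. The
  parameters are \<open>t\<close>, \<open>s\<close>, \<open>q\<close>, \<open>p\<close>,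
  \<open>c\<close>.\<close>

lemma real_quotients_E7:
  fixes x :: "nat \<Rightarrow> real"
  assumes C: "PE WF_E7 x + 3 * [:s, t:]\<^sup>2 = [:q, p, 1:] * C"
    and D: "[:s, t:] ^ 3 + PE WF_E7 x * [:s, t:] + QE WF_E7 x = [:q, p, 1:]\<^sup>2 * D"
  shows "\<exists>c. x 1 = q * c - 3 * s\<^sup>2 \<and> x 5 = p * c + q - 6 * s * t \<and> x 6 = c + p - 3 * t\<^sup>2 \<and> x 0 = t * q\<^sup>2 - q * c * s + 2 * s ^ 3 \<and> x 2 = 2 * t * p * q - q * c * t - (p * c + q) * s + 6 * s\<^sup>2 * t \<and> x 3 = t * (p\<^sup>2 + 2 * q) - (p * c + q) * t - (c + p) * s + 6 * s * t\<^sup>2 \<and> x 4 = 2 * t * p - (c + p) * t - s + 2 * t ^ 3"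
proof -
  have "degree C \<le> 1" "degree D \<le> 0" by (rule quotient_degrees[OF C D, where m = 1 and n = 0]; simp)+
  then obtain c e d where cd: "C = [:c, e:]" "D = [:d:]"
    using poly_eq_linear[of C] poly_eq_const[of D] by blast
  have "[:x 1 + 3 * (s * s), x 5 + 6 * s * t, x 6 + 3 * (t * t), 1:] = PE WF_E7 x + 3 * [:s, t:]\<^sup>2"
    by (rule poly_eq_poly_eq_iff[THEN iffD1], rule ext) (simp add: algebra_simps power_expand)
  also have "\<dots> = [:q * c, p * c + q * e, c + p * e, e:]"
    unfolding C cd by (rule poly_eq_poly_eq_iff[THEN iffD1], rule ext) (simp add: algebra_simps power_expand)
  finally have 1: "x 1 + 3 * (s * s) = q * c" "x 5 + 6 * s * t = p * c + q * e" "x 6 + 3 * (t * t) = c + p * e" "1 = e"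
    by (simp_all only: pCons_eq_iff)
  have "[:x 0 + x 1 * s + s * s * s, x 2 + x 5 * s + x 1 * t + 3 * s * s * t, x 3 + x 6 * s + x 5 * t + 3 * s * t * t, x 4 + s + x 6 * t + t * t * t, t:] = [:s, t:] ^ 3 + PE WF_E7 x * [:s, t:] + QE WF_E7 x"
    by (rule poly_eq_poly_eq_iff[THEN iffD1], rule ext) (simp add: algebra_simps power_expand)
  also have "\<dots> = [:q * q * d, 2 * p * q * d, (p * p + 2 * q) * d, 2 * p * d, d:]"
    unfolding D cd by (rule poly_eq_poly_eq_iff[THEN iffD1], rule ext) (simp add: algebra_simps power_expand)
  finally have 2: "x 0 + x 1 * s + s * s * s = q * q * d" "x 2 + x 5 * s + x 1 * t + 3 * s * s * t = 2 * p * q * d" "x 3 + x 6 * s + x 5 * t + 3 * s * t * t = (p * p + 2 * q) * d" "x 4 + s + x 6 * t + t * t * t = 2 * p * d" "t = d"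
    unfolding pCons_eq_iff by (iprover | blast)+
  have x: "x 1 = q * c - 3 * s\<^sup>2" "x 5 = p * c + q - 6 * s * t" "x 6 = c + p - 3 * t\<^sup>2"
    using 1(1-3)[folded 1(4)] by (simp_all add: algebra_simps power_expand)
  have "x 0 = t * q\<^sup>2 - q * c * s + 2 * s ^ 3" "x 2 = 2 * t * p * q - q * c * t - (p * c + q) * s + 6 * s\<^sup>2 * t" "x 3 = t * (p\<^sup>2 + 2 * q) - (p * c + q) * t - (c + p) * s + 6 * s * t\<^sup>2" "x 4 = 2 * t * p - (c + p) * t - s + 2 * t ^ 3"
    using 2(1-4)[folded 2(5)] unfolding x by (simp_all add: algebra_simps power_expand)
  then show ?thesis using x by (intro exI[of _ c]) simp
qed

lemma real_image_E7:
  fixes x :: "nat \<Rightarrow> real"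
  assumes C: "PE WF_E7 x + 3 * [:s, t:]\<^sup>2 = [:q, p, 1:] * C"
    and D: "[:s, t:] ^ 3 + PE WF_E7 x * [:s, t:] + QE WF_E7 x = [:q, p, 1:]\<^sup>2 * D"
  shows "\<exists>y\<in>coord_space (7 - 2). \<forall>i<7. x i = meval y
    (if i = 0 then X 0 * X 2 ^ 2 - X 2 * X 4 * X 1 + 2 * X 1 ^ 3 else
     if i = 1 then X 2 * X 4 - 3 * X 1 ^ 2 else
     if i = 2 then 2 * X 0 * X 3 * X 2 - X 2 * X 4 * X 0 - (X 3 * X 4 + X 2) * X 1 + 6 * X 1 ^ 2 * X 0 else
     if i = 3 then X 0 * (X 3 ^ 2 + 2 * X 2) - (X 3 * X 4 + X 2) * X 0 - (X 4 + X 3) * X 1 + 6 * X 1 * X 0 ^ 2 else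
     if i = 4 then 2 * X 0 * X 3 - (X 4 + X 3) * X 0 - X 1 + 2 * X 0 ^ 3 else
     if i = 5 then X 3 * X 4 + X 2 - 6 * X 1 * X 0 else
     X 4 + X 3 - 3 * X 0 ^ 2)"
proof -
  from real_quotients_E7[OF C D] obtain c where x: "x 1 = q * c - 3 * s\<^sup>2" "x 5 = p * c + q - 6 * s * t" "x 6 = c + p - 3 * t\<^sup>2" "x 0 = t * q\<^sup>2 - q * c * s + 2 * s ^ 3" "x 2 = 2 * t * p * q - q * c * t - (p * c + q) * s + 6 * s\<^sup>2 * t" "x 3 = t * (p\<^sup>2 + 2 * q) - (p * c + q) * t - (c + p) * s + 6 * s * t\<^sup>2" "x 4 = 2 * t * p - (c + p) * t - s + 2 * t ^ 3"
    by blast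
  define y where "y i = (if i = 0 then t else if i = 1 then s else if i = 2 then q else if i = 3 then p else if i = 4 then c else 0)" for i :: nat
  have y: "y 0 = t" "y 1 = s" "y 2 = q" "y 3 = p" "y 4 = c" by (simp_all add: y_def)
  have "y \<in> coord_space (7 - 2)" by (auto simp: y_def coord_space_def)
  then show ?thesis
    by (rule bexI[rotated])
      (unfold less_7_iff, simp add: x[simplified] y[simplified] mev.hom_add mev.hom_minus mev.hom_mult mev.hom_power mev.hom_numeral)
qed

text \<open>As for E6, with \<open>f\<close> increasing past the box:
  \<open>f (- 2) \<le> 4 - 13\<close> and \<open>f 0 \<ge> - 2\<close> enclose
  \<open>[-8, -7]\<close>. The bound \<open>z 5 \<ge> 1\<close> makes the last factor at -2 at least
  13.\<close>

lemma projection_E7: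
  fixes z :: "nat \<Rightarrow> real"
  assumes "z 1 \<in> {-2..-1}" "z 5 \<in> {1..2}" "z 6 \<in> {-1..0}" "z 3 \<in> {0..1}" "z 4 \<in> {0..1}" "z 2 \<in> {-8..-7}"
  shows "\<exists>u v x0. sing_E WF_E7 (\<lambda>i. if i = 0 then x0 else if i < 7 then z i else 0) u v"
proof -
  define S where "S v = (- z 1 - v ^ 3 - z 5 * v - z 6 * v\<^sup>2) / 3" for v
  define f where "f v = - 2 * z 3 * v - 3 * z 4 * v\<^sup>2 - sqrt (S v) * (3 * v\<^sup>2 + 2 * z 6 * v + z 5)" for v
  have "z 2 \<le> f 0"
  proof -
    have "sqrt (S 0) \<le> 1" using assms by (intro real_le_lsqrt) (auto simp: S_def)
    then have "sqrt (S 0) * z 5 \<le> 1 * 2" using assms by (intro mult_mono) auto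
    moreover have "f 0 = - (sqrt (S 0) * z 5)" by (simp add: f_def)
    ultimately show ?thesis using assms by simp
  qed
  moreover have "f (- 2) \<le> z 2"
  proof -
    have "1 \<le> sqrt (S (- 2))" using assms by (intro real_le_rsqrt) (auto simp: S_def)
    then have "1 * 13 \<le> sqrt (S (- 2)) * (12 - 4 * z 6 + z 5)" using assms by (intro mult_mono) auto
    moreover have "f (- 2) = 4 * z 3 - 12 * z 4 - sqrt (S (- 2)) * (12 - 4 * z 6 + z 5)" by (simp add: f_def)
    ultimately show ?thesis using assms by simp
  qed
  moreover have "continuous_on {-2..0} f" unfolding f_def S_def by (intro continuous_intros) auto
  ultimately obtain v where v: "- 2 \<le> v" "v \<le> 0" "f v = z 2" using IVT'[of f "-2" "z 2" 0] by auto
  have "0 \<le> - (z 5 * v)" using assms v by (simp add: mult_nonneg_nonpos)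
  moreover have "0 \<le> - (z 6 * v\<^sup>2)" using assms by (simp add: mult_nonpos_nonneg)
  moreover have "0 \<le> - (v ^ 3)" using v by (simp add: power3_eq_cube mult_nonneg_nonpos zero_le_mult_iff)
  ultimately have "0 \<le> - z 1 - v ^ 3 - z 5 * v - z 6 * v\<^sup>2"
    using assms unfolding atLeastAtMost_iff by linarith
  then have "0 \<le> S v" unfolding S_def by (rule divide_nonneg_pos) simp
  then have "3 * (sqrt (S v))\<^sup>2 = - z 1 - v ^ 3 - z 5 * v - z 6 * v\<^sup>2" by (simp add: S_def)
  then have "sing_E WF_E7 (\<lambda>i. if i = 0 then 2 * sqrt (S v) ^ 3 + z 3 * v\<^sup>2 + 2 * z 4 * v ^ 3 + sqrt (S v) * v * (3 * v\<^sup>2 + 2 * z 6 * v + z 5)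
      else if i < 7 then z i else 0) (sqrt (S v)) v"
    unfolding sing_E7 using v(3)[unfolded f_def] by simp
  then show ?thesis by blast
qed

lemma wf_E7_conclusion:
  "\<exists>\<Theta>\<in>mpolys 7. resultant (poly_A WF_E7) (poly_B WF_E7) = \<Theta> * (poly_r WF_E7)\<^sup>2 \<and>
    main_analytic_function 7 (\<lambda>x. meval x \<Theta>) (std_map WF_E7 ` coord_space (7 - 1)) \<and>
    (\<exists>\<Delta>. discriminant_polynomial 7 (std_map WF_E7) \<Delta>) \<and>
    (\<forall>\<Delta>. discriminant_polynomial 7 (std_map WF_E7) \<Delta> \<longrightarrow> (\<exists>c. c \<noteq> 0 \<and> complexify \<Theta> = Const c * \<Delta>))"
proof (rule wf_E.conclusion_main[OF wf_E_E7 map_E7_image_iff real_image_E7, where a = "(\<lambda>_. 0)(1 := - 2, 2 := - 8, 5 := 1, 6 := - 1)" and b = "(\<lambda>_. 1)(1 := - 1, 2 := - 7, 5 := 2, 6 := 0)"])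
  show "((\<lambda>_. 0)(1 := - 2, 2 := - 8, 5 := 1, 6 := - 1)) i < (((\<lambda>_. 1)(1 := - 1, 2 := - 7, 5 := 2, 6 := 0)) i :: real)" for i :: nat by simp
next
  fix z :: "nat \<Rightarrow> real"
  assume z: "\<And>i. i \<in> {1..<7} \<Longrightarrow> ((\<lambda>_. 0)(1 := - 2, 2 := - 8, 5 := 1, 6 := - 1)) i \<le> z i \<and> z i \<le> ((\<lambda>_. 1)(1 := - 1, 2 := - 7, 5 := 2, 6 := 0)) i"
  show "\<exists>u v x0. sing_E WF_E7 (\<lambda>i. if i = 0 then x0 else if i < 7 then z i else 0) u v"
    by (rule projection_E7) (use z[of 1] z[of 2] z[of 3] z[of 4] z[of 5] z[of 6] in simp_all)
qed

section \<open>Type E8: product formula, separable fibre and real points\<close>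

lemma poly_r_E8:
  "poly_r WF_E8 \<in> mpolys 8"
  "ev x (poly_r WF_E8) = resultant_sub 4 2 (pderiv (QE WF_E8 x)) (pderiv (PE WF_E8 x))"
proof -
  show "poly_r WF_E8 \<in> mpolys 8"
    unfolding poly_r.simps by (intro mpolys_resultant) (auto simp: coeff_pCons intro!: mpolys_intros split: nat.split)
  have c1: "cpev x [:X 2, 2 * X 3, 3 * X 4, 0, 5:] = pderiv (QE WF_E8 x)"
    by (rule poly_eq_poly_eq_iff[THEN iffD1], rule ext)
      (unfold poly_QE8, simp add: algebra_simps power_expand evh.hom_mult evh.hom_numeral)
  have c2: "cpev x [:X 5, 2 * X 6, 3 * X 7:] = pderiv (PE WF_E8 x)"
    by (rule poly_eq_poly_eq_iff[THEN iffD1], rule ext)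
      (unfold poly_PE8, simp add: algebra_simps power_expand evh.hom_mult evh.hom_numeral)
  have nz: "(3 * X 7 :: real mpol) \<noteq> 0" "(5 :: real mpol) \<noteq> 0" by (simp_all add: X_nonzero numeral_eq_Const)
  have dg: "degree [:X 2, 2 * X 3, 3 * X 4, 0, 5 :: real mpol:] = 4" "degree [:X 5, 2 * X 6, 3 * X 7 :: real mpol:] = 2"
    using nz by simp_all
  show "ev x (poly_r WF_E8) = resultant_sub 4 2 (pderiv (QE WF_E8 x)) (pderiv (PE WF_E8 x))"
    unfolding poly_r.simps ev_resultant dg c1 c2 ..
qed

lemma pderiv_E8:
  fixes x :: "nat \<Rightarrow> complex"
  shows "pderiv (PE WF_E8 x) = [:x 5, 2 * x 6, 3 * x 7:]" "pderiv (QE WF_E8 x) = [:x 2, 2 * x 3, 3 * x 4, 0, 5:]"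
proof -
  show "pderiv (PE WF_E8 x) = [:x 5, 2 * x 6, 3 * x 7:]"
    by (rule poly_eq_poly_eq_iff[THEN iffD1], rule ext) (unfold poly_PE8, simp add: algebra_simps power_expand)
  show "pderiv (QE WF_E8 x) = [:x 2, 2 * x 3, 3 * x 4, 0, 5:]"
    by (rule poly_eq_poly_eq_iff[THEN iffD1], rule ext) (unfold poly_QE8, simp add: algebra_simps power_expand)
qed

lemma degree_pderiv_QE8: "degree (pderiv (QE WF_E8 x)) = 4" for x :: "nat \<Rightarrow> complex"
  unfolding pderiv_E8 by simp

text \<open>For \<open>x 7\<close> nonzero the formal degrees 4 and 2 are the true ones, so
  \<open>r = c^4 Q'(w1) Q'(w2)\<close> with \<open>c = 3 x 7\<close>. Then \<open>75^2\<close> times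
  the product is \<open>9 r^2\<close>, which gives \<open>1/625\<close>.\<close>

lemma prod_E8:
  assumes "ev x (X 7) \<noteq> 0" "length as = 8"
    and "cpev x (poly_A WF_E8) = Polynomial.smult (of_real 75) (\<Prod>a\<leftarrow>as. [:-a, 1:])"
  shows "(\<Prod>a\<leftarrow>as. poly (pderiv (PE WF_E8 x)) a) = of_real (1 / 625) * (ev x (poly_r WF_E8))\<^sup>2"
proof -
  let ?p = "pderiv (PE WF_E8 x)" and ?q = "poly (pderiv (QE WF_E8 x))"
  define c where "c = 3 * x 7"
  have c: "c \<noteq> 0" using assms(1) by (simp add: c_def)
  have d: "degree ?p = 2" and "lead_coeff ?p = c" using c by (simp_all add: pderiv_E8 c_def del: PE.simps)
  then obtain w1 w2 where w: "?p = Polynomial.smult c (\<Prod>w\<leftarrow>[w1, w2]. [:-w, 1:])" using quadratic_roots by metis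
  have "ev x (poly_r WF_E8) = resultant (pderiv (QE WF_E8 x)) ?p"
    unfolding poly_r_E8 resultant_sub d degree_pderiv_QE8 ..
  also have "\<dots> = c ^ 4 * (?q w1 * ?q w2)"
    using resultant_prod_right[OF degree_pderiv_QE8 w c] by simp
  finally have r: "ev x (poly_r WF_E8) = c ^ 4 * (?q w1 * ?q w2)" .
  have "5625 * (\<Prod>a\<leftarrow>as. poly ?p a) = 9 * (c ^ 4 * (?q w1 * ?q w2))\<^sup>2"
    using prod_pderiv_PE[OF _ assms(2,3) _ w c] by (simp add: power_mult_distrib flip: power_mult)
  then show ?thesis unfolding r by (simp add: field_simps)
qed

text \<open>\<open>Q'\<close> has the constant leading coefficient 5, so the resultant detects
  common roots also where \<open>P'\<close> drops in degree or vanishes.\<close>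

lemma poly_r_E8_eq_0_iff:
  "ev x (poly_r WF_E8) = 0 \<longleftrightarrow> (\<exists>v. poly (pderiv (QE WF_E8 x)) v = 0 \<and> poly (pderiv (PE WF_E8 x)) v = 0)"
proof -
  have "pderiv (QE WF_E8 x) \<noteq> 0" unfolding pderiv_E8 by simp
  moreover have "degree (pderiv (PE WF_E8 x)) \<le> 2" unfolding pderiv_E8 by simp
  ultimately show ?thesis
    unfolding poly_r_E8 using resultant_sub_eq_0_iff degree_pderiv_QE8 by metis
qed

lemma common_E8:
  assumes "poly (pderiv (PE WF_E8 x)) v = 0" "poly (pderiv (QE WF_E8 x)) v = 0"
  shows "ev x (poly_r WF_E8) = 0"
  using assms poly_r_E8_eq_0_iff by blast

lemma axis_r_E8: "ev ((\<lambda>_. 0)(5 := 1)) (poly_r WF_E8) \<noteq> 0"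
  unfolding poly_r_E8_eq_0_iff poly_PE8 by simp

text \<open>With \<open>x 5 = 1\<close>, \<open>x 0 = z\<close> and the rest 0, \<open>P = v\<close>
  and \<open>Q = v^5 + z\<close>, so \<open>v = - 3 u^2\<close> and
  \<open>u (405 u^7 + 1) = 0\<close>. The nonzero levels are
  \<open>u^3 (- 972 u^7 - 1) = 7/5 u^3\<close>, where \<open>u^21 = - 1 / 405^3\<close>.\<close>

lemma axis_E8:
  fixes z :: complex
  assumes "z \<in> insert 0 {z. z ^ 7 = - ((7 / 5) ^ 7) / 405 ^ 3}"
  shows "\<exists>u v. sing_E WF_E8 (((\<lambda>_. 0)(5 := 1))(0 := z)) u v"
proof (cases "z = 0")
  case True
  then show ?thesis by (intro exI[of _ 0]) (simp add: sing_E8)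
next
  case False
  define t where "t = 5 * z / 7"
  define u where "u = 405\<^sup>2 * t ^ 5"
  define v where "v = - (3 * u\<^sup>2)"
  have z: "z = 7 / 5 * t" by (simp add: t_def)
  have "(7 / 5) ^ 7 * t ^ 7 = - ((7 / 5) ^ 7) / 405 ^ 3"
    using assms False unfolding z by (simp add: power_mult_distrib power_divide)
  then have "t ^ 7 * 405 ^ 3 = - 1" by (simp add: field_simps)
  from cube_inverse_7[OF this] have u: "u ^ 7 * 405 = - 1" "u ^ 3 = t" unfolding u_def by blast+
  have "- 5 * v ^ 4 - u = - u * (u ^ 7 * 405 + 1)" "2 * u ^ 3 + 4 * v ^ 5 + u * v = u ^ 3 * (- (12 / 5) * (u ^ 7 * 405) - 1)"
    by (simp_all add: v_def power_mult_distrib algebra_simps eval_nat_numeral)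
  then have "0 = - 5 * v ^ 4 - u" "z = 2 * u ^ 3 + 4 * v ^ 5 + u * v"
    unfolding u z by simp_all
  moreover have "0 = - 3 * u\<^sup>2 - v" by (simp add: v_def)
  ultimately have "sing_E WF_E8 (((\<lambda>_. 0)(5 := 1))(0 := z)) u v"
    unfolding sing_E8 by simp
  then show ?thesis by blast
qed

lemma wf_E_E8: "wf_E WF_E8 8 75 (1 / 625) (X 7) ((\<lambda>_. 0)(5 := 1)) (insert 0 {z. z ^ 7 = - ((7 / 5) ^ 7) / 405 ^ 3})"
proof unfold_locales
  show "WF_E8 \<in> {WF_E6, WF_E7, WF_E8}" "8 = wf_dim WF_E8" "(75 :: real) \<noteq> 0" "((1 / 625) :: real) \<noteq> 0" by simp_all
  show "degree (poly_A WF_E8) = 8" "coeff (poly_A WF_E8) 8 = Const 75" by (rule degree_A_E8)+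
  show "(X 7 :: real mpol) \<noteq> 0" by (simp add: X_nonzero)
  show "\<exists>T :: real mpol poly. degree T = 8 \<and> coeff T 8 = 1 \<and> (\<forall>i. coeff T i \<in> mpolys 8) \<and>
    (\<forall>x z. cpev (x(0 := z)) T = cpev x T) \<and> (\<forall>x u v. sing_E WF_E8 x u v \<longrightarrow> poly (cpev x T) (x 0) = 0)"
    by (rule integral_E8)
  show "poly_r WF_E8 \<in> mpolys 8" by (rule poly_r_E8)
  show "ev ((\<lambda>_. 0)(5 := 1)) (poly_r WF_E8) \<noteq> 0" by (rule axis_r_E8)
  show "finite (insert 0 {z. z ^ 7 = - ((7 / 5) ^ 7) / 405 ^ 3} :: complex set)" "card (insert 0 {z. z ^ 7 = - ((7 / 5) ^ 7) / 405 ^ 3} :: complex set) = 8"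
    using card_insert_0_nth_roots[of "- ((7 / 5) ^ 7) / 405 ^ 3" 7] by simp_all
  fix x :: "nat \<Rightarrow> complex" and z
  show "ev (x(0 := z)) (poly_r WF_E8) = ev x (poly_r WF_E8)"
    unfolding poly_r_E8 by (simp add: pderiv_QE_upd PE_upd del: PE.simps QE.simps)
  show "\<exists>u v. sing_E WF_E8 (((\<lambda>_. 0)(5 := 1))(0 := z)) u v" if "z \<in> insert 0 {z. z ^ 7 = - ((7 / 5) ^ 7) / 405 ^ 3}" using that by (rule axis_E8)
  show "ev x (poly_r WF_E8) = 0" if "poly (pderiv (PE WF_E8 x)) v = 0" "poly (pderiv (QE WF_E8 x)) v = 0" for v
    using that by (rule common_E8)
  show "x \<in> std_map WF_E8 ` coord_space (8 - 1) \<longleftrightarrow> (\<exists>u v. sing_E WF_E8 x u v)" if "x \<in> coord_space 8"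
    using that by (rule map_E8_image_iff)
  show "(\<Prod>a\<leftarrow>as. poly (pderiv (PE WF_E8 x)) a) = of_real (1 / 625) * (ev x (poly_r WF_E8))\<^sup>2"
    if "ev x (X 7) \<noteq> 0" "length as = 8" "cpev x (poly_A WF_E8) = Polynomial.smult (of_real 75) (\<Prod>a\<leftarrow>as. [:-a, 1:])" for as
    using that by (rule prod_E8)
qed

text \<open>\<open>C = e v + c\<close> with \<open>e = x 7\<close>, and \<open>D = v + d\<close> is
  monic because \<open>Q\<close> is. The coefficient of \<open>v^4\<close>, absent from
  \<open>Q\<close>, fixes \<open>d = e t - 2 p\<close>; the parameters are \<open>t\<close>,
  \<open>s\<close>, \<open>q\<close>, \<open>p\<close>, \<open>c\<close>, \<open>e\<close>, and
  \<open>H\<close> below is the polynomial for \<open>d\<close>.\<close>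

lemma real_quotients_E8:
  fixes x :: "nat \<Rightarrow> real"
  assumes C: "PE WF_E8 x + 3 * [:s, t:]\<^sup>2 = [:q, p, 1:] * C"
    and D: "[:s, t:] ^ 3 + PE WF_E8 x * [:s, t:] + QE WF_E8 x = [:q, p, 1:]\<^sup>2 * D"
  shows "\<exists>c e d. d = e * t - 2 * p \<and> x 1 = q * c - 3 * s\<^sup>2 \<and> x 5 = p * c + q * e - 6 * s * t \<and> x 6 = c + p * e - 3 * t\<^sup>2 \<and> x 7 = e \<and> x 0 = d * q\<^sup>2 - q * c * s + 2 * s ^ 3 \<and> x 2 = q\<^sup>2 + 2 * d * p * q - q * c * t - (p * c + q * e) * s + 6 * s\<^sup>2 * t \<and> x 3 = 2 * p * q + d * (p\<^sup>2 + 2 * q) - (p * c + q * e) * t - (c + p * e) * s + 6 * s * t\<^sup>2 \<and> x 4 = p\<^sup>2 + 2 * q + 2 * d * p - (c + p * e) * t - e * s + 2 * t ^ 3"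
proof -
  have "degree C \<le> 1" "degree D \<le> 1" by (rule quotient_degrees[OF C D, where m = 1 and n = 1]; simp)+
  then obtain c e d f where cd: "C = [:c, e:]" "D = [:d, f:]"
    using poly_eq_linear[of C] poly_eq_linear[of D] by blast
  have "[:x 1 + 3 * (s * s), x 5 + 6 * s * t, x 6 + 3 * (t * t), x 7:] = PE WF_E8 x + 3 * [:s, t:]\<^sup>2"
    by (rule poly_eq_poly_eq_iff[THEN iffD1], rule ext) (simp add: algebra_simps power_expand)
  also have "\<dots> = [:q * c, p * c + q * e, c + p * e, e:]"
    unfolding C cd by (rule poly_eq_poly_eq_iff[THEN iffD1], rule ext) (simp add: algebra_simps power_expand)
  finally have 1: "x 1 + 3 * (s * s) = q * c" "x 5 + 6 * s * t = p * c + q * e" "x 6 + 3 * (t * t) = c + p * e" "x 7 = e"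
    by (simp_all only: pCons_eq_iff)
  have "[:x 0 + x 1 * s + s * s * s, x 2 + x 5 * s + x 1 * t + 3 * s * s * t, x 3 + x 6 * s + x 5 * t + 3 * s * t * t, x 4 + x 7 * s + x 6 * t + t * t * t, x 7 * t, 1:] = [:s, t:] ^ 3 + PE WF_E8 x * [:s, t:] + QE WF_E8 x"
    by (rule poly_eq_poly_eq_iff[THEN iffD1], rule ext) (simp add: algebra_simps power_expand)
  also have "\<dots> = [:q * q * d, q * q * f + 2 * p * q * d, 2 * p * q * f + (p * p + 2 * q) * d, (p * p + 2 * q) * f + 2 * p * d, 2 * p * f + d, f:]"
    unfolding D cd by (rule poly_eq_poly_eq_iff[THEN iffD1], rule ext) (simp add: algebra_simps power_expand)
  finally have 2: "x 0 + x 1 * s + s * s * s = q * q * d" "x 2 + x 5 * s + x 1 * t + 3 * s * s * t = q * q * f + 2 * p * q * d" "x 3 + x 6 * s + x 5 * t + 3 * s * t * t = 2 * p * q * f + (p * p + 2 * q) * d" "x 4 + x 7 * s + x 6 * t + t * t * t = (p * p + 2 * q) * f + 2 * p * d" "x 7 * t = 2 * p * f + d" "1 = f"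
    by (simp_all only: pCons_eq_iff)
  have x: "x 1 = q * c - 3 * s\<^sup>2" "x 5 = p * c + q * e - 6 * s * t" "x 6 = c + p * e - 3 * t\<^sup>2" "x 7 = e"
    using 1 by (simp_all add: algebra_simps power_expand)
  have "d = e * t - 2 * p" "x 0 = d * q\<^sup>2 - q * c * s + 2 * s ^ 3" "x 2 = q\<^sup>2 + 2 * d * p * q - q * c * t - (p * c + q * e) * s + 6 * s\<^sup>2 * t" "x 3 = 2 * p * q + d * (p\<^sup>2 + 2 * q) - (p * c + q * e) * t - (c + p * e) * s + 6 * s * t\<^sup>2" "x 4 = p\<^sup>2 + 2 * q + 2 * d * p - (c + p * e) * t - e * s + 2 * t ^ 3"
    using 2(1-5)[folded 2(6)] unfolding x by (simp_all add: algebra_simps power_expand)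
  then show ?thesis using x by (intro exI[of _ c] exI[of _ e] exI[of _ d]) simp
qed

lemma real_image_E8:
  fixes x :: "nat \<Rightarrow> real"
  defines "H \<equiv> X 5 * X 0 - 2 * X 3 :: real mpol"
  assumes C: "PE WF_E8 x + 3 * [:s, t:]\<^sup>2 = [:q, p, 1:] * C"
    and D: "[:s, t:] ^ 3 + PE WF_E8 x * [:s, t:] + QE WF_E8 x = [:q, p, 1:]\<^sup>2 * D"
  shows "\<exists>y\<in>coord_space (8 - 2). \<forall>i<8. x i = meval y
    (if i = 0 then H * X 2 ^ 2 - X 2 * X 4 * X 1 + 2 * X 1 ^ 3 else
     if i = 1 then X 2 * X 4 - 3 * X 1 ^ 2 else
     if i = 2 then X 2 ^ 2 + 2 * H * X 3 * X 2 - X 2 * X 4 * X 0 - (X 3 * X 4 + X 2 * X 5) * X 1 + 6 * X 1 ^ 2 * X 0 else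
     if i = 3 then 2 * X 3 * X 2 + H * (X 3 ^ 2 + 2 * X 2) - (X 3 * X 4 + X 2 * X 5) * X 0 - (X 4 + X 3 * X 5) * X 1 + 6 * X 1 * X 0 ^ 2 else
     if i = 4 then X 3 ^ 2 + 2 * X 2 + 2 * H * X 3 - (X 4 + X 3 * X 5) * X 0 - X 5 * X 1 + 2 * X 0 ^ 3 else
     if i = 5 then X 3 * X 4 + X 2 * X 5 - 6 * X 1 * X 0 else
     if i = 6 then X 4 + X 3 * X 5 - 3 * X 0 ^ 2 else
     X 5)"
proof -
  from real_quotients_E8[OF C D] obtain c e d where x: "d = e * t - 2 * p" "x 1 = q * c - 3 * s\<^sup>2" "x 5 = p * c + q * e - 6 * s * t" "x 6 = c + p * e - 3 * t\<^sup>2" "x 7 = e" "x 0 = d * q\<^sup>2 - q * c * s + 2 * s ^ 3" "x 2 = q\<^sup>2 + 2 * d * p * q - q * c * t - (p * c + q * e) * s + 6 * s\<^sup>2 * t" "x 3 = 2 * p * q + d * (p\<^sup>2 + 2 * q) - (p * c + q * e) * t - (c + p * e) * s + 6 * s * t\<^sup>2" "x 4 = p\<^sup>2 + 2 * q + 2 * d * p - (c + p * e) * t - e * s + 2 * t ^ 3"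
    by blast
  define y where "y i = (if i = 0 then t else if i = 1 then s else if i = 2 then q else if i = 3 then p else if i = 4 then c else if i = 5 then e else 0)" for i :: nat
  have y: "y 0 = t" "y 1 = s" "y 2 = q" "y 3 = p" "y 4 = c" "y 5 = e" by (simp_all add: y_def)
  have H: "meval y H = d" unfolding H_def x(1)
    by (simp add: mev.hom_add mev.hom_minus mev.hom_mult mev.hom_power mev.hom_numeral y[simplified])
  have "y \<in> coord_space (8 - 2)" by (auto simp: y_def coord_space_def)
  then show ?thesis
    by (rule bexI[rotated])
      (unfold less_8_iff, simp add: x(2-9)[simplified] y[simplified] H mev.hom_add mev.hom_minus mev.hom_mult mev.hom_power mev.hom_numeral)
qed

text \<open>As for E7: \<open>f (- 2) \<le> - 80 + 4\<close> and \<open>f 0 \<ge> - 1\<close>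
  enclose the interval \<open>[-8, -7]\<close> for \<open>x 2\<close>.\<close>

lemma projection_E8:
  fixes z :: "nat \<Rightarrow> real"
  assumes "z 1 \<in> {-2..-1}" "z 5 \<in> {0..1}" "z 6 \<in> {-1..0}" "z 7 \<in> {0..1}" "z 3 \<in> {0..1}" "z 4 \<in> {0..1}" "z 2 \<in> {-8..-7}"
  shows "\<exists>u v x0. sing_E WF_E8 (\<lambda>i. if i = 0 then x0 else if i < 8 then z i else 0) u v"
proof -
  define S where "S v = (- z 1 - z 5 * v - z 6 * v\<^sup>2 - z 7 * v ^ 3) / 3" for v
  define f where "f v = - 5 * v ^ 4 - 2 * z 3 * v - 3 * z 4 * v\<^sup>2 - sqrt (S v) * (3 * z 7 * v\<^sup>2 + 2 * z 6 * v + z 5)" for v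
  have "z 2 \<le> f 0"
  proof -
    have "sqrt (S 0) \<le> 1" using assms by (intro real_le_lsqrt) (auto simp: S_def)
    then have "sqrt (S 0) * z 5 \<le> 1 * 1" using assms by (intro mult_mono) auto
    moreover have "f 0 = - (sqrt (S 0) * z 5)" by (simp add: f_def)
    ultimately show ?thesis using assms by simp
  qed
  moreover have "f (- 2) \<le> z 2"
  proof -
    have "0 \<le> sqrt (S (- 2))" using assms by (auto simp: S_def)
    then have "0 \<le> sqrt (S (- 2)) * (12 * z 7 - 4 * z 6 + z 5)" using assms by (intro mult_nonneg_nonneg) auto
    moreover have "f (- 2) = - 80 + 4 * z 3 - 12 * z 4 - sqrt (S (- 2)) * (12 * z 7 - 4 * z 6 + z 5)" by (simp add: f_def)
    ultimately show ?thesis using assms by simp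
  qed
  moreover have "continuous_on {-2..0} f" unfolding f_def S_def by (intro continuous_intros) auto
  ultimately obtain v where v: "- 2 \<le> v" "v \<le> 0" "f v = z 2" using IVT'[of f "-2" "z 2" 0] by auto
  have "v ^ 3 \<le> 0" using v by (simp add: power3_eq_cube mult_nonneg_nonpos zero_le_mult_iff mult_le_0_iff)
  then have "0 \<le> - (z 7 * v ^ 3)" using assms by (simp add: mult_nonneg_nonpos)
  moreover have "0 \<le> - (z 5 * v)" using assms v by (simp add: mult_nonneg_nonpos)
  moreover have "0 \<le> - (z 6 * v\<^sup>2)" using assms by (simp add: mult_nonpos_nonneg)
  ultimately have "0 \<le> S v" using assms by (simp add: S_def)
  then have "3 * (sqrt (S v))\<^sup>2 = - z 1 - z 5 * v - z 6 * v\<^sup>2 - z 7 * v ^ 3" by (simp add: S_def)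
  then have "sing_E WF_E8 (\<lambda>i. if i = 0 then 2 * sqrt (S v) ^ 3 + 4 * v ^ 5 + z 3 * v\<^sup>2 + 2 * z 4 * v ^ 3 + sqrt (S v) * v * (3 * z 7 * v\<^sup>2 + 2 * z 6 * v + z 5)
      else if i < 8 then z i else 0) (sqrt (S v)) v"
    unfolding sing_E8 using v(3)[unfolded f_def] by simp
  then show ?thesis by blast
qed

lemma wf_E8_conclusion:
  "\<exists>\<Theta>\<in>mpolys 8. resultant (poly_A WF_E8) (poly_B WF_E8) = \<Theta> * (poly_r WF_E8)\<^sup>2 \<and>
    main_analytic_function 8 (\<lambda>x. meval x \<Theta>) (std_map WF_E8 ` coord_space (8 - 1)) \<and>
    (\<exists>\<Delta>. discriminant_polynomial 8 (std_map WF_E8) \<Delta>) \<and>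
    (\<forall>\<Delta>. discriminant_polynomial 8 (std_map WF_E8) \<Delta> \<longrightarrow> (\<exists>c. c \<noteq> 0 \<and> complexify \<Theta> = Const c * \<Delta>))"
proof (rule wf_E.conclusion_main[OF wf_E_E8 map_E8_image_iff real_image_E8, where a = "(\<lambda>_. 0)(1 := - 2, 2 := - 8, 6 := - 1)" and b = "(\<lambda>_. 1)(1 := - 1, 2 := - 7, 6 := 0)"])
  show "((\<lambda>_. 0)(1 := - 2, 2 := - 8, 6 := - 1)) i < (((\<lambda>_. 1)(1 := - 1, 2 := - 7, 6 := 0)) i :: real)" for i :: nat by simp
next
  fix z :: "nat \<Rightarrow> real"
  assume z: "\<And>i. i \<in> {1..<8} \<Longrightarrow> ((\<lambda>_. 0)(1 := - 2, 2 := - 8, 6 := - 1)) i \<le> z i \<and> z i \<le> ((\<lambda>_. 1)(1 := - 1, 2 := - 7, 6 := 0)) i"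
  show "\<exists>u v x0. sing_E WF_E8 (\<lambda>i. if i = 0 then x0 else if i < 8 then z i else 0) u v"
    by (rule projection_E8) (use z[of 1] z[of 2] z[of 3] z[of 4] z[of 5] z[of 6] z[of 7] in simp_all)
qed

text \<open>The quotient by \<open>r^2\<close> is expressed as a product identity; as
  \<open>r\<close> is nonzero and the ring has no zero divisors, it determines
  \<open>\<Theta>\<close>. Existence of a discriminant polynomial is asserted separately so that the
  proportionality is not vacuous.\<close>

theorem theorem0p2:
  fixes \<tau> :: wf_type and k :: nat
  assumes "valid_wf \<tau>" and "k = wf_dim \<tau>"
  shows "(\<forall>i. coeff (poly_A \<tau>) i \<in> mpolys k \<and> coeff (poly_B \<tau>) i \<in> mpolys k) \<and>
    poly_r \<tau> \<in> mpolys k \<and> poly_r \<tau> \<noteq> 0 \<and>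
    (\<exists>\<Theta>\<in>mpolys k.
       resultant (poly_A \<tau>) (poly_B \<tau>) = \<Theta> * (poly_r \<tau>)\<^sup>2 \<and>
       main_analytic_function k (\<lambda>x. meval x \<Theta>) (std_map \<tau> ` coord_space (k - 1)) \<and>
       (\<exists>\<Delta>. discriminant_polynomial k (std_map \<tau>) \<Delta>) \<and>
       (\<forall>\<Delta>. discriminant_polynomial k (std_map \<tau>) \<Delta> \<longrightarrow>
          (\<exists>c::complex. c \<noteq> 0 \<and> complexify \<Theta> = Const c * \<Delta>)))"
proof (cases \<tau>)
  case (WF_A n)
  then have n: "n = k" "k \<ge> 2" using assms by auto
  have A: "coeff (poly_A (WF_A k)) i \<in> mpolys k" for i
    by (auto simp: coeff_sum sum.delta intro!: mpolys_intros)
  then have "coeff (poly_B (WF_A k)) i \<in> mpolys k" for i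
    unfolding poly_B.simps by (rule coeff_pderiv_mpolys)
  with A wf_A_conclusion[OF n(2)] show ?thesis
    unfolding WF_A n poly_r.simps by (intro conjI bexI[of _ "resultant (poly_A (WF_A k)) (poly_B (WF_A k))"] allI) (blast | simp)+
next
  case (WF_D s n)
  then have n: "n = k" "k \<ge> 4" "s = 1 \<or> s = -1" using assms by auto
  have A: "coeff (poly_A (WF_D s k)) i \<in> mpolys k" for i
    using n(2) by (auto simp: coeff_A_WF_D simp del: poly_A.simps intro!: mpolys_intros)
  then have "coeff (poly_B (WF_D s k)) i \<in> mpolys k" for i
    unfolding poly_B.simps by (rule coeff_pderiv_mpolys)
  with A wf_D_conclusion[OF n(2,3)] show ?thesis
    unfolding WF_D n poly_r.simps by (intro conjI bexI[of _ "resultant (poly_A (WF_D s k)) (poly_B (WF_D s k))"] allI) (blast | simp)+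
next
  case WF_E6
  have k: "k = 6" using assms WF_E6 by simp
  have "poly_r WF_E6 \<noteq> 0" using axis_r_E6 evh.hom_zero by metis
  then show ?thesis
    unfolding WF_E6 k using coeff_E_mpolys[of WF_E6] poly_r_E6(1) wf_E6_conclusion by (simp del: poly_A.simps poly_B.simps poly_r.simps std_map.simps)
next
  case WF_E7
  have k: "k = 7" using assms WF_E7 by simp
  have "poly_r WF_E7 \<noteq> 0" using axis_r_E7 evh.hom_zero by metis
  then show ?thesis
    unfolding WF_E7 k using coeff_E_mpolys[of WF_E7] poly_r_E7(1) wf_E7_conclusion by (simp del: poly_A.simps poly_B.simps poly_r.simps std_map.simps)
next
  case WF_E8
  have k: "k = 8" using assms WF_E8 by simp
  have "poly_r WF_E8 \<noteq> 0" using axis_r_E8 evh.hom_zero by metis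
  then show ?thesis
    unfolding WF_E8 k using coeff_E_mpolys[of WF_E8] poly_r_E8(1) wf_E8_conclusion by (simp del: poly_A.simps poly_B.simps poly_r.simps std_map.simps)
qed

end
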